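(* Let $n\geq1$, $\alpha\in(0,1)$ and $p>\tilde p$, where $$\tilde p=1+\frac{2}{n-2+2(1+\alpha)^{-1}}.$$ Moreover, let $p<1+\frac2{n-2}$ if $n\geq3$. Then there exists $\varepsilon>0$ such that for any $u_0\in L^1\cap L^p$ satisfying $\|u_0\|_{L^1\cap L^p}\leq\varepsilon$, there exists a unique global solution $u\in\mathcal C([0,\infty),L^1\cap L^p)$ to the Cauchy problem $$\partial_t^{1+\alpha}u-\Delta u=|u|^p\ \ (t>0,\ x\in\mathbb{R}^n),\qquad u(0,x)=u_0(x),\qquad u_t(0,x)=0.$$ Moreover, the solution satisfies the estimate $$\|u(t,\cdot)\|_{L^q}\leq C\,(1+t)^{\alpha-\frac n2(1+\alpha)\left(1-\frac1q\right)}\|u_0\|_{L^1\cap L^p}\qquad\text{for all } q\in[1,p],\ t\geq0,$$ where $C>0$ does not depend on the data.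
   Context: $L^q=L^q(\mathbb{R}^n)$ and $\|g\|_{L^1\cap L^p}=\|g\|_{L^1}+\|g\|_{L^p}$. For $\alpha\in(0,1)$, $\partial_t^{1+\alpha}u=J^{1-\alpha}(\partial_t^2u)$ is the Caputo fractional derivative in time, where $J^{\beta}g(t)=\frac1{\Gamma(\beta)}\int_0^t(t-s)^{\beta-1}g(s)\,ds$. The Mittag-Leffler functions are $E_{1+\alpha,\beta}(z)=\sum_{k=0}^\infty\frac{z^k}{\Gamma(k+\alpha k+\beta)}$. Let $\mathfrak F^{-1}$ be the inverse Fourier transform in $x$, $\mathfrak F^{-1}g(x)=(2\pi)^{-n}\int_{\mathbb{R}^n}e^{ix\cdot\xi}g(\xi)\,d\xi$ (extended to tempered distributions), and for $t>0$ let $G_{1+\alpha,\beta}(t,\cdot)=\mathfrak F^{-1}\bigl(E_{1+\alpha,\beta}(-t^{1+\alpha}|\xi|^2)\bigr)$. A (global) solution $u\in\mathcal C([0,\infty),L^1\cap L^p)$ to the Cauchy problem (with $u_t(0,\cdot)=0$) is a function satisfying $$u(t,\cdot)=G_{1+\alpha,1}(t,\cdot)*u_0+\int_0^t(t-s)^{\alpha}\,G_{1+\alpha,1+\alpha}(t-s,\cdot)*|u(s,\cdot)|^p\,ds$$ for all $t>0$, with $u(0,\cdot)=u_0$, where $*$ denotes convolution in $x$. *)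

theory Defs
  imports "HOL-Analysis.Analysis"
begin

text \<open>Elements of \<open>L\<^sup>q(\<real>\<^sup>n)\<close> are represented by Borel functions, and equality in \<open>L\<^sup>q\<close> is
  equality almost everywhere. The scalar type \<^typ>\<open>'k::{real_normed_field,euclidean_space}\<close>
  used below covers both real-valued and complex-valued functions.\<close>

definition Lq_space :: "real \<Rightarrow> (real^'n \<Rightarrow> 'k::{real_normed_field,euclidean_space}) set" where
  "Lq_space q = {f \<in> borel_measurable borel. integrable lborel (\<lambda>x. norm (f x) powr q)}"

definition Lq_norm :: "real \<Rightarrow> (real^'n \<Rightarrow> 'k::{real_normed_field,euclidean_space}) \<Rightarrow> real" where
  "Lq_norm q f = (\<integral>x. norm (f x) powr q \<partial>lborel) powr (1 / q)"

definition L1_Lp_space :: "real \<Rightarrow> (real^'n \<Rightarrow> 'k::{real_normed_field,euclidean_space}) set" where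
  "L1_Lp_space p = Lq_space 1 \<inter> Lq_space p"

definition L1_Lp_norm :: "real \<Rightarrow> (real^'n \<Rightarrow> 'k::{real_normed_field,euclidean_space}) \<Rightarrow> real" where
  "L1_Lp_norm p f = Lq_norm 1 f + Lq_norm p f"

text \<open>A function is Schwartz iff all its iterated partial derivatives (along lists of basis
  vectors) exist, are differentiable, and decay faster than any power of \<open>norm x\<close>.\<close>

definition iter_partial :: "(real^'n) list \<Rightarrow> (real^'n \<Rightarrow> complex) \<Rightarrow> real^'n \<Rightarrow> complex" where
  "iter_partial bs \<phi> = foldr (\<lambda>b f x. frechet_derivative f (at x) b) bs \<phi>"

definition schwartz :: "(real^'n \<Rightarrow> complex) \<Rightarrow> bool" where
  "schwartz \<phi> \<longleftrightarrow>
     (\<forall>bs. set bs \<subseteq> Basis \<longrightarrow>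
        (\<forall>x. iter_partial bs \<phi> differentiable (at x)) \<and>
        (\<forall>k::nat. bounded (range (\<lambda>x. norm x ^ k *\<^sub>R iter_partial bs \<phi> x))))"

definition inverse_fourier :: "(real^'n \<Rightarrow> complex) \<Rightarrow> real^'n \<Rightarrow> complex" where
  "inverse_fourier g x =
     (\<integral>\<xi>. cis (x \<bullet> \<xi>) * g \<xi> \<partial>lborel) /\<^sub>R (2 * pi) ^ CARD('n)"

text \<open>The inverse Fourier transform of the tempered distribution given by the function \<open>m\<close> is the
  distribution \<open>\<phi> \<mapsto> \<integral> m (inverse_fourier \<phi>)\<close>; the following predicate says that this distribution
  is given by the function \<open>g\<close>, which is then determined almost everywhere.\<close>

definition has_tempered_inverse_fourier ::
    "(real^'n \<Rightarrow> complex) \<Rightarrow> (real^'n \<Rightarrow> complex) \<Rightarrow> bool" where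
  "has_tempered_inverse_fourier m g \<longleftrightarrow>
     m \<in> borel_measurable borel \<and> g \<in> borel_measurable borel \<and>
     (\<forall>\<phi>. schwartz \<phi> \<longrightarrow>
        integrable lborel (\<lambda>\<xi>. m \<xi> * \<phi> \<xi>) \<and>
        integrable lborel (\<lambda>x. g x * \<phi> x) \<and>
        (\<integral>x. g x * \<phi> x \<partial>lborel) = (\<integral>\<xi>. m \<xi> * inverse_fourier \<phi> \<xi> \<partial>lborel))"

definition mittag_leffler :: "real \<Rightarrow> real \<Rightarrow> real \<Rightarrow> real" where
  "mittag_leffler a b z = (\<Sum>k. z ^ k / Gamma (a * real k + b))"

text \<open>\<open>G_kernel \<alpha> \<beta> t\<close> is \<open>G\<^bsub>1+\<alpha>,\<beta>\<^esub>(t,\<cdot>)\<close>, meaningful for \<open>t > 0\<close>. It is real-valued because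
  its Fourier transform is real and even. The choice of the representative has no influence on
  convolutions.\<close>

definition G_kernel :: "real \<Rightarrow> real \<Rightarrow> real \<Rightarrow> real^'n \<Rightarrow> real" where
  "G_kernel \<alpha> \<beta> t = (SOME g.
     has_tempered_inverse_fourier
       (\<lambda>\<xi>. complex_of_real (mittag_leffler (1 + \<alpha>) \<beta> (- (t powr (1 + \<alpha>)) * (norm \<xi>)\<^sup>2)))
       (\<lambda>x. complex_of_real (g x)))"

definition convolves_at ::
    "(real^'n \<Rightarrow> real) \<Rightarrow> (real^'n \<Rightarrow> 'k::{real_normed_field,euclidean_space}) \<Rightarrow> real^'n \<Rightarrow> bool"
  where
  "convolves_at g f x \<longleftrightarrow> integrable lborel (\<lambda>y. g (x - y) *\<^sub>R f y)"

definition conv ::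
    "(real^'n \<Rightarrow> real) \<Rightarrow> (real^'n \<Rightarrow> 'k::{real_normed_field,euclidean_space}) \<Rightarrow> real^'n \<Rightarrow> 'k"
  where
  "conv g f x = (\<integral>y. g (x - y) *\<^sub>R f y \<partial>lborel)"

definition nonlinearity ::
    "real \<Rightarrow> (real^'n \<Rightarrow> 'k::{real_normed_field,euclidean_space}) \<Rightarrow> real^'n \<Rightarrow> 'k" where
  "nonlinearity p f x = of_real (norm (f x) powr p)"

definition duhamel_integrand ::
    "real \<Rightarrow> real \<Rightarrow> (real \<Rightarrow> real^'n \<Rightarrow> 'k::{real_normed_field,euclidean_space}) \<Rightarrow>
     real \<Rightarrow> real^'n \<Rightarrow> real \<Rightarrow> 'k" where
  "duhamel_integrand \<alpha> p u t x s =
     (t - s) powr \<alpha> *\<^sub>R conv (G_kernel \<alpha> (1 + \<alpha>) (t - s)) (nonlinearity p (u s)) x"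

text \<open>The integral equation is an identity between elements of \<open>L\<^sup>1 \<inter> L\<^sup>p\<close>, hence holds for almost
  every \<open>x\<close> at each time; neither side depends on the representatives of \<open>u(s,\<cdot>)\<close>. All integrals
  are required to converge, so that none of them takes the default value \<open>0\<close> of a
  non-integrable function.\<close>

definition global_solution ::
    "real \<Rightarrow> real \<Rightarrow> (real^'n \<Rightarrow> 'k::{real_normed_field,euclidean_space}) \<Rightarrow>
     (real \<Rightarrow> real^'n \<Rightarrow> 'k) \<Rightarrow> bool" where
  "global_solution \<alpha> p u0 u \<longleftrightarrow>
     (\<forall>t\<ge>0. u t \<in> L1_Lp_space p) \<and>
     (\<forall>t\<ge>0. ((\<lambda>s. L1_Lp_norm p (\<lambda>x. u s x - u t x)) \<longlongrightarrow> 0) (at t within {0..})) \<and>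
     (AE x in lborel. u 0 x = u0 x) \<and>
     (\<forall>t>0. AE x in lborel.
        convolves_at (G_kernel \<alpha> 1 t) u0 x \<and>
        (AE s in lborel. 0 < s \<and> s < t \<longrightarrow>
           convolves_at (G_kernel \<alpha> (1 + \<alpha>) (t - s)) (nonlinearity p (u s)) x) \<and>
        set_integrable lborel {0..t} (duhamel_integrand \<alpha> p u t x) \<and>
        u t x = conv (G_kernel \<alpha> 1 t) u0 x + (LINT s:{0..t}|lborel. duhamel_integrand \<alpha> p u t x s))"

end

theory Submission
  imports Defs "HOL-Probability.Probability" "HOL-Complex_Analysis.Complex_Analysis" "HOL-Real_Asymp.Real_Asymp"
begin

text \<open>Both propagators of the linear equation are convolutions with kernels that come from a fixed
  profile by dilation: \<open>G(t, x) = t powr (- n(1+\<alpha>)/2) * g (t powr (- (1+\<alpha>)/2) *\<^sub>R x)\<close>. Once the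
  profile is known to lie in \<open>L\<^sup>1 \<inter> L\<^sup>p\<close>, Young's inequality gives all decay rates of the linear
  problem, and the semilinear problem is a contraction in a space with polynomial weights in time.
  Subcriticality, that is \<open>p < 1 + 2/(n-2)\<close>, says that the profile is in \<open>L\<^sup>p\<close>; supercriticality,
  that is \<open>p > p~\<close>, says that the source \<open>\<bar>u\<bar>\<^sup>p\<close> of a function with the decay of the claim is
  integrable in time with values in \<open>L\<^sup>1\<close>.

  The profile. The Hankel integral for \<open>1 / \<Gamma>\<close>, over a contour made of two conjugate rays at angle \<open>\<theta>\<close>
  with \<open>\<pi>/2 < \<theta> < \<pi>/(1+\<alpha>)\<close>, turns the Mittag-Leffler series into a contour integral of
  \<open>exp z * z powr (a - \<beta>) / (z powr a + l)\<close> (\<open>mittag_leffler_contour\<close>, with \<open>a = 1 + \<alpha>\<close>). Writing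
  the denominator as a Laplace integral along a rotated ray gives a subordination formula: \<open>E(-l)\<close>
  is the imaginary part of \<open>\<integral> V(r) exp (-\<omega> r l) dr\<close> with \<open>Re \<omega> > 0\<close> and \<open>V\<close> of exponential decay
  (\<open>mittag_leffler_subordination\<close>). With \<open>l = \<bar>\<xi>\<bar>\<^sup>2\<close> the inverse Fourier transform can be taken under
  the integral and yields a superposition of heat kernels with complex time, whose \<open>L\<^sup>q\<close> norm at time
  \<open>r\<close> is a multiple of \<open>r powr (- n/2 (1 - 1/q))\<close>; this is integrable at \<open>r = 0\<close> exactly when
  \<open>n/2 (1 - 1/q) < 1\<close> (\<open>mittag_leffler_kernel\<close>). The description of the kernel as a tempered
  distribution determines it almost everywhere (\<open>has_tempered_inverse_fourier_unique\<close>), so the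
  profile may replace the kernel in every convolution.

  Existence. In the norm \<open>sup (1+t) powr (- rate q) * \<parallel>u(t)\<parallel>\<^sub>q\<close>, \<open>q = 1, p\<close>, where \<open>rate q\<close> is the
  exponent of the claim, the free evolution is bounded by the data, and the integral operator is
  controlled by \<open>\<integral> (t-s) powr rate q * (1+s) powr (p * rate p) ds \<le> C (1+t) powr rate q\<close>. The last
  bound holds because \<open>rate q > -1\<close> and \<open>p * rate p < -1\<close>, the latter being the condition \<open>p > p~\<close>
  (\<open>weakly_singular_integral\<close>, \<open>duhamel_weighted\<close>). Together with the Lipschitz bound of \<open>u \<mapsto> \<bar>u\<bar>\<^sup>p\<close>
  from \<open>L\<^sup>p\<close> to \<open>L\<^sup>1\<close>, the Picard iteration contracts for small data (\<open>small_data_fixed_point\<close>), and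
  the exponents between \<open>1\<close> and \<open>p\<close> follow by interpolation.

  Uniqueness holds without smallness: on a bounded time interval two solutions are bounded in \<open>L\<^sup>p\<close>,
  and their difference satisfies a linear Volterra inequality with the weakly singular kernel
  \<open>(t-s) powr rate p\<close>, which an exponential weight in time turns into a contraction (\<open>mild_unique\<close>).
  The integral equation only sees the classes of \<open>u(t)\<close> modulo null sets; a solution that is
  continuous in time has a version that is measurable in \<open>(t, x)\<close> (\<open>L1_curve_measurable_version\<close>),
  and for this version Fubini's theorem and Minkowski's integral inequality apply.\<close>

section \<open>Minkowski's integral inequality\<close>

text \<open>This is the tangent line inequality for the convex function \<open>t \<mapsto> t powr q\<close> at the point \<open>c\<close>.
  It is stated affinely in \<open>t\<close> so that it can be integrated before \<open>c\<close> is chosen.\<close>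

lemma young_affine:
  fixes t c q :: real
  assumes "1 \<le> q" "0 \<le> t" "0 < c"
  shows "t \<le> t powr q * c powr (1 - q) / q + (1 - 1 / q) * c"
proof (cases "t = 0")
  case True
  then show ?thesis using assms by (simp add: field_simps)
next
  case False
  then have "t > 0" using assms by simp
  have "(t powr q * c powr (1 - q)) powr (1/q) * c powr (1 - 1/q) \<le> 1/q * (t powr q * c powr (1 - q)) + (1 - 1/q) * c"
    using assms \<open>t > 0\<close> by (intro Youngs_inequality_0) (auto simp: field_simps)
  also have "(t powr q * c powr (1 - q)) powr (1/q) * c powr (1 - 1/q) = t"
  proof -
    have e: "(1 - q) * (1/q) + (1 - 1/q) = 0" using assms by (simp add: field_simps)
    have "(t powr q * c powr (1 - q)) powr (1/q) * c powr (1 - 1/q)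
       = t powr (q * (1/q)) * (c powr ((1 - q) * (1/q)) * c powr (1 - 1/q))"
      by (simp only: powr_mult powr_powr mult.assoc)
    also have "\<dots> = t"
      unfolding powr_add[symmetric] e using assms \<open>t > 0\<close> by simp
    finally show ?thesis .
  qed
  finally show ?thesis by simp
qed

text \<open>The best \<open>c\<close> satisfies \<open>c powr q = a / W\<close>. Replacing \<open>a\<close> by a slightly larger number avoids
  the degenerate choice \<open>c = 0\<close>.\<close>

lemma young_optimise:
  fixes I a W q :: real
  assumes q: "1 \<le> q" and "0 \<le> I" "0 \<le> a" "0 < W"
    and le: "\<And>c. 0 < c \<Longrightarrow> I \<le> a * c powr (1 - q) / q + (1 - 1 / q) * c * W"
  shows "I powr q \<le> a * W powr (q - 1)"
proof (rule field_le_epsilon)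
  fix e :: real assume "0 < e"
  define b where "b = a + e / W powr (q - 1)"
  have b: "b > 0" "a \<le> b" using \<open>0 < e\<close> assms by (auto simp: b_def add_nonneg_pos)
  define c where "c = (b / W) powr (1/q)"
  have c: "c > 0" using b assms by (simp add: c_def)
  have cq: "c powr q = b / W" using b assms by (simp add: c_def powr_powr)
  have "I \<le> a * c powr (1 - q) / q + (1 - 1 / q) * c * W" by (rule le[OF c])
  also have "\<dots> \<le> b * c powr (1 - q) / q + (1 - 1 / q) * c * W"
    using b q by (intro add_right_mono divide_right_mono mult_right_mono) auto
  also have "b * c powr (1 - q) = W * c"
    using cq c assms by (simp add: powr_diff field_simps)
  finally have "I \<le> c * W" using q by (simp add: field_simps)
  then have "I powr q \<le> (c * W) powr q" using assms by (intro powr_mono2) auto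
  also have "\<dots> = b * (W powr q / W)" using c assms cq by (simp add: powr_mult)
  also have "W powr q / W = W powr (q - 1)" using assms by (simp add: powr_diff)
  also have "b * W powr (q - 1) = a * W powr (q - 1) + e" using assms by (simp add: b_def field_simps)
  finally show "I powr q \<le> a * W powr (q - 1) + e" .
qed

text \<open>The bound \<open>w y\<close> on the norm of \<open>F y\<close> serves as a weight: by Jensen's inequality for the
  measure \<open>w dN\<close>, \<open>\<parallel>\<integral> F y dN\<parallel>\<^sup>q\<close> is at most \<open>(\<integral> w) powr (q-1) * \<integral> w powr (1-q) * \<parallel>F y\<parallel>\<^sup>q dN\<close>, and the
  last integral is computed by Tonelli's theorem. Jensen's inequality is obtained from
  \<open>young_affine\<close> and \<open>young_optimise\<close>.\<close>

lemma minkowski_integral: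
  fixes F :: "'y \<Rightarrow> 'x \<Rightarrow> 'b::{banach, second_countable_topology}"
  assumes N: "sigma_finite_measure N" and M: "sigma_finite_measure M" and q: "1 \<le> q"
    and F[measurable]: "(\<lambda>(y,x). F y x) \<in> borel_measurable (N \<Otimes>\<^sub>M M)"
    and w: "integrable N w" "\<And>y. 0 \<le> w y"
    and bd: "AE y in N. (\<integral>\<^sup>+x. ennreal (norm (F y x) powr q) \<partial>M) \<le> ennreal (w y powr q)"
  shows "AE x in M. integrable N (\<lambda>y. F y x)"
    and "(\<integral>\<^sup>+x. ennreal (norm (\<integral>y. F y x \<partial>N) powr q) \<partial>M) \<le> ennreal ((\<integral>y. w y \<partial>N) powr q)"
proof -
  interpret N: sigma_finite_measure N by fact
  interpret M: sigma_finite_measure M by fact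
  interpret pair_sigma_finite N M ..
  have wm[measurable]: "w \<in> borel_measurable N" using w by simp
  define W where "W = (\<integral>y. w y \<partial>N)"
  have W0: "0 \<le> W" using w by (simp add: W_def)
  \<comment> \<open>where \<open>w\<close> vanishes, so does \<open>F\<close> almost everywhere\<close>
  define H where "H = (\<lambda>y x. if w y = 0 then 0 else w y powr (1 - q) * norm (F y x) powr q)"
  have H0: "0 \<le> H y x" for y x by (simp add: H_def)
  have Hm[measurable]: "(\<lambda>(y,x). H y x) \<in> borel_measurable (N \<Otimes>\<^sub>M M)"
    unfolding H_def split_beta' using F[unfolded split_beta'] by measurable
  have "(\<integral>\<^sup>+x. \<integral>\<^sup>+y. ennreal (H y x) \<partial>N \<partial>M) = (\<integral>\<^sup>+y. \<integral>\<^sup>+x. ennreal (H y x) \<partial>M \<partial>N)"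
    by (rule Fubini') measurable
  also have "\<dots> \<le> (\<integral>\<^sup>+y. ennreal (w y) \<partial>N)"
  proof (rule nn_integral_mono_AE, use bd AE_space in eventually_elim)
    fix y assume y: "(\<integral>\<^sup>+x. ennreal (norm (F y x) powr q) \<partial>M) \<le> ennreal (w y powr q)" "y \<in> space N"
    show "(\<integral>\<^sup>+x. ennreal (H y x) \<partial>M) \<le> ennreal (w y)"
    proof (cases "w y = 0")
      case False
      have [measurable]: "(\<lambda>x. F y x) \<in> borel_measurable M"
        using y by measurable
      have "(\<integral>\<^sup>+x. ennreal (H y x) \<partial>M) = (\<integral>\<^sup>+x. ennreal (w y powr (1 - q)) * ennreal (norm (F y x) powr q) \<partial>M)"
        using False by (simp add: H_def ennreal_mult')
      also have "\<dots> = ennreal (w y powr (1 - q)) * (\<integral>\<^sup>+x. ennreal (norm (F y x) powr q) \<partial>M)"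
        by (rule nn_integral_cmult) simp
      also have "\<dots> \<le> ennreal (w y powr (1 - q)) * ennreal (w y powr q)"
        using y by (intro mult_left_mono) auto
      also have "\<dots> = ennreal (w y)"
        using w(2)[of y] False by (simp flip: ennreal_mult' powr_add)
      finally show ?thesis .
    qed (simp add: H_def)
  qed
  also have "\<dots> = ennreal W"
    unfolding W_def using w by (intro nn_integral_eq_integral) auto
  finally have HW: "(\<integral>\<^sup>+x. \<integral>\<^sup>+y. ennreal (H y x) \<partial>N \<partial>M) \<le> ennreal W" .
  have AEfin: "AE x in M. (\<integral>\<^sup>+y. ennreal (H y x) \<partial>N) \<noteq> \<infinity>"
    using HW by (intro nn_integral_noteq_infinite) (auto simp: top_unique)
  have "AE y in N. AE x in M. w y = 0 \<longrightarrow> F y x = 0"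
    using bd AE_space
  proof eventually_elim
    case (elim y)
    then have [measurable]: "(\<lambda>x. F y x) \<in> borel_measurable M" by measurable
    show ?case
    proof (cases "w y = 0")
      case True
      then have "(\<integral>\<^sup>+x. ennreal (norm (F y x) powr q) \<partial>M) = 0" using elim by simp
      then show ?thesis by (subst (asm) nn_integral_0_iff_AE) (auto elim: eventually_mono)
    qed simp
  qed
  then have AE0: "AE x in M. AE y in N. w y = 0 \<longrightarrow> F y x = 0"
    by (subst (asm) AE_commute) (use F[unfolded split_beta'] in measurable)
  have main: "AE x in M. integrable N (\<lambda>y. F y x) \<and>
      ennreal (norm (\<integral>y. F y x \<partial>N) powr q) \<le> (\<integral>\<^sup>+y. ennreal (H y x) \<partial>N) * ennreal (W powr (q - 1))"
    using AEfin AE0 AE_space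
  proof eventually_elim
    case (elim x)
    have [measurable]: "(\<lambda>y. F y x) \<in> borel_measurable N" "(\<lambda>y. H y x) \<in> borel_measurable N"
      using elim by measurable
    have Hi: "integrable N (\<lambda>y. H y x)"
      using elim H0 by (intro integrableI_nonneg) (auto simp: less_top)
    have pt: "AE y in N. norm (F y x) \<le> H y x * c powr (1 - q) / q + (1 - 1 / q) * c * w y" if c: "c > 0" for c
      using elim(2)
    proof eventually_elim
      case (elim y)
      show ?case
      proof (cases "w y = 0")
        case True
        then show ?thesis using elim by (simp add: H_def)
      next
        case False
        then have wy: "w y > 0" using w(2)[of y] by simp
        have "norm (F y x) / w y \<le> (norm (F y x) / w y) powr q * c powr (1 - q) / q + (1 - 1/q) * c"
          using wy c q by (intro young_affine) auto
        then have "norm (F y x) \<le> w y * ((norm (F y x) / w y) powr q * c powr (1 - q) / q + (1 - 1/q) * c)"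
          using wy by (simp add: field_simps)
        also have "\<dots> = (w y * (norm (F y x) / w y) powr q) * c powr (1 - q) / q + (1 - 1 / q) * c * w y"
          by (simp add: algebra_simps)
        also have "w y * (norm (F y x) / w y) powr q = H y x"
          using wy by (simp add: H_def powr_divide powr_diff)
        finally show ?thesis .
      qed
    qed
    have gi: "integrable N (\<lambda>y. H y x * c powr (1 - q) / q + (1 - 1 / q) * c * w y)" for c
      using Hi w by auto
    have Fi: "integrable N (\<lambda>y. F y x)"
      by (rule Bochner_Integration.integrable_bound[OF gi[of 1]]) (use pt[of 1] q in \<open>auto elim!: eventually_mono\<close>)
    define a where "a = (\<integral>y. H y x \<partial>N)"
    have a0: "0 \<le> a" unfolding a_def using H0 by simp
    have aeq: "(\<integral>\<^sup>+y. ennreal (H y x) \<partial>N) = ennreal a"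
      unfolding a_def using Hi H0 by (intro nn_integral_eq_integral) auto
    define I where "I = (\<integral>y. norm (F y x) \<partial>N)"
    have I: "I \<le> a * c powr (1 - q) / q + (1 - 1 / q) * c * W" if c: "c > 0" for c
    proof -
      have "I \<le> (\<integral>y. H y x * c powr (1 - q) / q + (1 - 1 / q) * c * w y \<partial>N)"
        unfolding I_def using Fi gi pt[OF c] by (intro integral_mono_AE) auto
      also have "\<dots> = a * c powr (1 - q) / q + (1 - 1 / q) * c * W"
        using Hi w by (simp add: a_def W_def)
      finally show ?thesis .
    qed
    have "norm (\<integral>y. F y x \<partial>N) \<le> I" unfolding I_def by (rule integral_norm_bound)
    then have "norm (\<integral>y. F y x \<partial>N) powr q \<le> I powr q" using q by (intro powr_mono2) auto
    also have "\<dots> \<le> a * W powr (q - 1)"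
    proof (cases "W = 0")
      case False
      then show ?thesis using I q a0 W0 by (intro young_optimise) (auto simp: I_def)
    next
      case True
      then have "AE y in N. w y = 0"
        using w by (simp add: W_def integral_nonneg_eq_0_iff_AE)
      then have "a = 0" unfolding a_def H_def by (intro integral_eq_zero_AE) (auto elim: eventually_mono)
      then have "I \<le> 0" using I[of 1] True by simp
      then have "I = 0" by (simp add: I_def order_antisym)
      then show ?thesis using \<open>a = 0\<close> by simp
    qed
    finally have "norm (\<integral>y. F y x \<partial>N) powr q \<le> a * W powr (q - 1)" .
    then show ?case using Fi a0 unfolding aeq by (simp flip: ennreal_mult')
  qed
  show "AE x in M. integrable N (\<lambda>y. F y x)" using main by eventually_elim simp
  have "(\<integral>\<^sup>+x. ennreal (norm (\<integral>y. F y x \<partial>N) powr q) \<partial>M)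
      \<le> (\<integral>\<^sup>+x. (\<integral>\<^sup>+y. ennreal (H y x) \<partial>N) * ennreal (W powr (q - 1)) \<partial>M)"
    by (rule nn_integral_mono_AE) (use main in \<open>auto elim: eventually_mono\<close>)
  also have "\<dots> = (\<integral>\<^sup>+x. (\<integral>\<^sup>+y. ennreal (H y x) \<partial>N) \<partial>M) * ennreal (W powr (q - 1))"
    by (rule nn_integral_multc) measurable
  also have "\<dots> \<le> ennreal W * ennreal (W powr (q - 1))"
    using HW by (rule mult_right_mono) simp
  also have "\<dots> = ennreal (W powr q)"
    using W0 by (cases "W = 0") (auto simp flip: ennreal_mult' simp: powr_diff)
  finally show "(\<integral>\<^sup>+x. ennreal (norm (\<integral>y. F y x \<partial>N) powr q) \<partial>M) \<le> ennreal ((\<integral>y. w y \<partial>N) powr q)"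
    unfolding W_def .
qed

section \<open>The spaces \<open>L\<^sup>q\<close>\<close>

lemma nn_integral_affine:
  fixes f :: "'a::euclidean_space \<Rightarrow> ennreal"
  assumes [measurable]: "f \<in> borel_measurable borel" and c: "c \<noteq> 0"
  shows "(\<integral>\<^sup>+x. f x \<partial>lborel) = ennreal (\<bar>c\<bar> ^ DIM('a)) * (\<integral>\<^sup>+x. f (t + c *\<^sub>R x) \<partial>lborel)"
  by (subst lborel_affine[OF c, of t])
     (simp add: nn_integral_density nn_integral_distr nn_integral_cmult)

lemma integral_affine:
  fixes f :: "'a::euclidean_space \<Rightarrow> 'b::{banach, second_countable_topology}"
  assumes [measurable]: "f \<in> borel_measurable borel" and c: "c \<noteq> 0"
  shows "(LBINT x. f x) = \<bar>c\<bar> ^ DIM('a) *\<^sub>R (LBINT x. f (t + c *\<^sub>R x))"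
  by (subst lborel_affine[OF c, of t])
     (simp add: integral_density integral_distr)

lemma integrable_affine_iff:
  fixes f :: "'a::euclidean_space \<Rightarrow> 'b::{banach, second_countable_topology}"
  assumes [measurable]: "f \<in> borel_measurable borel" and c: "c \<noteq> 0"
  shows "integrable lborel (\<lambda>x. f (t + c *\<^sub>R x)) \<longleftrightarrow> integrable lborel f"
proof -
  have k: "integrable lborel (\<lambda>x. k *\<^sub>R g x) \<longleftrightarrow> integrable lborel g" if "k \<noteq> 0"
    for k :: real and g :: "'a \<Rightarrow> 'b"
    using integrable_scaleR_right[of k lborel g] integrable_scaleR_right[of "inverse k" lborel "\<lambda>x. k *\<^sub>R g x"] that
    by auto
  show ?thesis
    using c by (subst (2) lborel_affine[OF c, of t])
     (simp add: integrable_density integrable_distr_eq k)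
qed

lemma Lq_measurable[measurable_dest]: "f \<in> Lq_space q \<Longrightarrow> f \<in> borel_measurable borel"
  by (simp add: Lq_space_def)

lemma Lq_norm_nonneg[simp]: "0 \<le> Lq_norm q f"
  by (simp add: Lq_norm_def)

lemma Lq_nn_integral:
  assumes "f \<in> Lq_space q" "q > 0"
  shows "(\<integral>\<^sup>+x. ennreal (norm (f x) powr q) \<partial>lborel) = ennreal (Lq_norm q f powr q)"
proof -
  have "integrable lborel (\<lambda>x. norm (f x) powr q)" using assms by (simp add: Lq_space_def)
  then have "(\<integral>\<^sup>+x. ennreal (norm (f x) powr q) \<partial>lborel) = ennreal (LBINT x. norm (f x) powr q)"
    by (intro nn_integral_eq_integral) auto
  then show ?thesis using assms by (simp add: Lq_norm_def powr_powr)
qed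

lemma Lq_norm_powr:
  assumes "f \<in> Lq_space q" "q > 0"
  shows "Lq_norm q f powr q = (LBINT x. norm (f x) powr q)"
  using assms by (simp add: Lq_norm_def powr_powr)

text \<open>Membership in \<open>L\<^sup>q\<close> is usually obtained from a bound on a nonnegative integral, where
  convergence is not an issue; this rule converts such a bound.\<close>

lemma Lq_boundI:
  assumes [measurable]: "f \<in> borel_measurable borel" and q: "q > 0" and B: "0 \<le> B"
    and le: "(\<integral>\<^sup>+x. ennreal (norm (f x) powr q) \<partial>lborel) \<le> ennreal (B powr q)"
  shows "f \<in> Lq_space q" "Lq_norm q f \<le> B"
proof -
  have i: "integrable lborel (\<lambda>x. norm (f x) powr q)"
    using le by (intro integrableI_nonneg) (auto simp: le_less_trans[OF _ ennreal_less_top])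
  then show "f \<in> Lq_space q" by (simp add: Lq_space_def)
  have "ennreal (LBINT x. norm (f x) powr q) \<le> ennreal (B powr q)"
    using le i by (subst (asm) nn_integral_eq_integral) auto
  then have "(LBINT x. norm (f x) powr q) \<le> B powr q" by (subst (asm) ennreal_le_iff) auto
  then have "Lq_norm q f \<le> (B powr q) powr (1/q)"
    unfolding Lq_norm_def using q by (intro powr_mono2) auto
  then show "Lq_norm q f \<le> B" using q B by (simp add: powr_powr)
qed

lemma Lq_mono:
  assumes [measurable]: "f \<in> borel_measurable borel" and q: "q > 0" and g: "g \<in> Lq_space q"
    and le: "AE x in lborel. norm (f x) \<le> norm (g x)"
  shows "f \<in> Lq_space q" "Lq_norm q f \<le> Lq_norm q g"
proof -
  have "(\<integral>\<^sup>+x. ennreal (norm (f x) powr q) \<partial>lborel) \<le> (\<integral>\<^sup>+x. ennreal (norm (g x) powr q) \<partial>lborel)"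
    by (rule nn_integral_mono_AE) (use le q in \<open>auto elim!: eventually_mono intro!: ennreal_leI powr_mono2\<close>)
  then have "(\<integral>\<^sup>+x. ennreal (norm (f x) powr q) \<partial>lborel) \<le> ennreal (Lq_norm q g powr q)"
    using Lq_nn_integral[OF g q] by simp
  from Lq_boundI[OF _ q _ this] show "f \<in> Lq_space q" "Lq_norm q f \<le> Lq_norm q g" by auto
qed

lemma Lq_norm_cong_AE:
  assumes [measurable]: "f \<in> borel_measurable borel" "g \<in> borel_measurable borel"
    and eq: "AE x in lborel. norm (f x) = norm (g x)"
  shows "Lq_norm q f = Lq_norm q g"
proof -
  have "(LBINT x. norm (f x) powr q) = (LBINT x. norm (g x) powr q)"
    by (rule integral_cong_AE) (use eq in auto)
  then show ?thesis by (simp add: Lq_norm_def)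
qed

lemma Lq_cong_AE:
  assumes [measurable]: "f \<in> borel_measurable borel" "g \<in> borel_measurable borel"
    and eq: "AE x in lborel. norm (f x) = norm (g x)"
  shows "f \<in> Lq_space q \<longleftrightarrow> g \<in> Lq_space q"
proof -
  have "integrable lborel (\<lambda>x. norm (f x) powr q) \<longleftrightarrow> integrable lborel (\<lambda>x. norm (g x) powr q)"
    by (rule integrable_cong_AE) (use eq in auto)
  then show ?thesis by (simp add: Lq_space_def)
qed

lemma Lq1_iff:
  shows "f \<in> Lq_space 1 \<longleftrightarrow> integrable lborel f"
proof
  assume "f \<in> Lq_space 1"
  then have "f \<in> borel_measurable borel" "integrable lborel (\<lambda>x. norm (f x))"
    by (auto simp: Lq_space_def)
  then show "integrable lborel f" by (simp add: integrable_norm_iff)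
next
  assume "integrable lborel f"
  then show "f \<in> Lq_space 1" by (auto simp: Lq_space_def)
qed

lemma Lq_norm_1: "Lq_norm 1 f = (LBINT x. norm (f x))"
  by (simp add: Lq_norm_def)

lemma Lq_norm_zero_imp:
  assumes "f \<in> Lq_space q" "q > 0" "Lq_norm q f = 0"
  shows "AE x in lborel. f x = 0"
proof -
  have [measurable]: "f \<in> borel_measurable borel" using assms by measurable
  have "(\<integral>\<^sup>+x. ennreal (norm (f x) powr q) \<partial>lborel) = 0"
    using Lq_nn_integral[OF assms(1,2)] assms by simp
  then show ?thesis by (subst (asm) nn_integral_0_iff_AE) (auto elim: eventually_mono)
qed

lemma Lq_zero[simp]: "(\<lambda>x. 0) \<in> Lq_space q" "Lq_norm q (\<lambda>x. 0) = 0"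
  by (auto simp: Lq_space_def Lq_norm_def)

lemma Lq_scale:
  assumes "f \<in> Lq_space q" "q > 0"
  shows "(\<lambda>x. f x *\<^sub>R c) \<in> Lq_space q" "Lq_norm q (\<lambda>x. f x *\<^sub>R c) = Lq_norm q f * norm c"
  using assms by (auto simp: Lq_space_def Lq_norm_def powr_mult powr_powr)

lemma Lq_scaleR:
  assumes "f \<in> Lq_space q" "q > 0"
  shows "(\<lambda>x. c *\<^sub>R f x) \<in> Lq_space q" "Lq_norm q (\<lambda>x. c *\<^sub>R f x) = \<bar>c\<bar> * Lq_norm q f"
  using assms by (auto simp: Lq_space_def Lq_norm_def powr_mult powr_powr)

lemma Lq_affine:
  fixes f :: "real^'n \<Rightarrow> 'k::{real_normed_field,euclidean_space}"
  assumes f: "f \<in> Lq_space q" and q: "q > 0" and c: "c \<noteq> 0"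
  shows "(\<lambda>x. f (t + c *\<^sub>R x)) \<in> Lq_space q"
    and "Lq_norm q (\<lambda>x. f (t + c *\<^sub>R x)) = \<bar>c\<bar> powr (- real CARD('n) / q) * Lq_norm q f"
proof -
  have [measurable]: "f \<in> borel_measurable borel" using f by measurable
  have i: "integrable lborel (\<lambda>x. norm (f x) powr q)" using f by (simp add: Lq_space_def)
  have "integrable lborel (\<lambda>x. norm (f (t + c *\<^sub>R x)) powr q)"
    using integrable_affine_iff[of "\<lambda>x. norm (f x) powr q" c t] c i by simp
  then show "(\<lambda>x. f (t + c *\<^sub>R x)) \<in> Lq_space q" by (simp add: Lq_space_def)
  have "(LBINT x. norm (f x) powr q) = \<bar>c\<bar> ^ CARD('n) * (LBINT x. norm (f (t + c *\<^sub>R x)) powr q)"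
    using integral_affine[of "\<lambda>x. norm (f x) powr q" c t] c by simp
  then have "(LBINT x. norm (f (t + c *\<^sub>R x)) powr q) = \<bar>c\<bar> powr (- real CARD('n)) * (LBINT x. norm (f x) powr q)"
    using c by (simp add: powr_minus powr_realpow field_simps)
  then show "Lq_norm q (\<lambda>x. f (t + c *\<^sub>R x)) = \<bar>c\<bar> powr (- real CARD('n) / q) * Lq_norm q f"
    by (simp add: Lq_norm_def powr_mult powr_powr)
qed

lemma Lq_translate:
  assumes f: "f \<in> Lq_space q" and q: "q > 0"
  shows "(\<lambda>x. f (x - h)) \<in> Lq_space q" "Lq_norm q (\<lambda>x. f (x - h)) = Lq_norm q f"
  using Lq_affine[OF f q, of 1 "-h"] by (simp_all add: algebra_simps)

lemma Lq_minkowski: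
  assumes N: "sigma_finite_measure N" and q: "1 \<le> q"
    and F: "(\<lambda>(y,x). F y x) \<in> borel_measurable (N \<Otimes>\<^sub>M lborel)"
    and w: "integrable N w" "\<And>y. 0 \<le> w y"
    and bd: "AE y in N. F y \<in> Lq_space q \<and> Lq_norm q (F y) \<le> w y"
  shows "AE x in lborel. integrable N (\<lambda>y. F y x)"
    and "(\<lambda>x. \<integral>y. F y x \<partial>N) \<in> Lq_space q"
    and "Lq_norm q (\<lambda>x. \<integral>y. F y x \<partial>N) \<le> (\<integral>y. w y \<partial>N)"
proof -
  interpret N: sigma_finite_measure N by fact
  have b: "AE y in N. (\<integral>\<^sup>+x. ennreal (norm (F y x) powr q) \<partial>lborel) \<le> ennreal (w y powr q)"
    using bd
  proof eventually_elim
    case (elim y)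
    then have "(\<integral>\<^sup>+x. ennreal (norm (F y x) powr q) \<partial>lborel) = ennreal (Lq_norm q (F y) powr q)"
      using q by (intro Lq_nn_integral) auto
    also have "\<dots> \<le> ennreal (w y powr q)" using elim q by (intro ennreal_leI powr_mono2) auto
    finally show ?case .
  qed
  note M = minkowski_integral[OF N sigma_finite_lborel q F w b]
  show "AE x in lborel. integrable N (\<lambda>y. F y x)" by (rule M)
  have "(\<lambda>(x,y). F y x) \<in> borel_measurable (lborel \<Otimes>\<^sub>M N)"
    using measurable_compose[OF measurable_pair_swap' F] by (simp add: split_beta')
  then have m: "(\<lambda>x. \<integral>y. F y x \<partial>N) \<in> borel_measurable borel"
    using N.borel_measurable_lebesgue_integral[of "\<lambda>x y. F y x" lborel] by simp
  show "(\<lambda>x. \<integral>y. F y x \<partial>N) \<in> Lq_space q" "Lq_norm q (\<lambda>x. \<integral>y. F y x \<partial>N) \<le> (\<integral>y. w y \<partial>N)"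
    using q w by (intro Lq_boundI[OF m _ _ M(2)]; simp)+
qed

text \<open>Minkowski's inequality for two functions is the case of the counting measure on
  \<^typ>\<open>bool\<close>.\<close>

lemma Lq_add:
  assumes f: "f \<in> Lq_space q" and g: "g \<in> Lq_space q" and q: "1 \<le> q"
  shows "(\<lambda>x. f x + g x) \<in> Lq_space q" "Lq_norm q (\<lambda>x. f x + g x) \<le> Lq_norm q f + Lq_norm q g"
proof -
  let ?N = "count_space (UNIV :: bool set)"
  let ?F = "\<lambda>y x. if y then f x else g x"
  have [measurable]: "f \<in> borel_measurable borel" "g \<in> borel_measurable borel" using f g by measurable
  have i: "integral\<^sup>L ?N h = h True + h False" for h :: "bool \<Rightarrow> 'z::{banach, second_countable_topology}"
    by (simp add: lebesgue_integral_count_space_finite UNIV_bool add.commute)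
  have N: "sigma_finite_measure ?N" by (rule sigma_finite_measure_count_space)
  have F: "(\<lambda>(y,x). ?F y x) \<in> borel_measurable (?N \<Otimes>\<^sub>M lborel)"
    by measurable
  have w: "integrable ?N (\<lambda>y. Lq_norm q (?F y))" by (rule integrable_count_space) simp
  note M = Lq_minkowski[OF N q F w]
  have bd: "AE y in ?N. ?F y \<in> Lq_space q \<and> Lq_norm q (?F y) \<le> Lq_norm q (?F y)"
  proof (rule AE_I2)
    fix y show "?F y \<in> Lq_space q \<and> Lq_norm q (?F y) \<le> Lq_norm q (?F y)" using f g by (cases y) auto
  qed
  show "(\<lambda>x. f x + g x) \<in> Lq_space q" "Lq_norm q (\<lambda>x. f x + g x) \<le> Lq_norm q f + Lq_norm q g"
    using M(2)[OF _ bd] M(3)[OF _ bd] by (simp_all add: i)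
qed

lemma Lq_uminus:
  assumes "f \<in> Lq_space q"
  shows "(\<lambda>x. - f x) \<in> Lq_space q" "Lq_norm q (\<lambda>x. - f x) = Lq_norm q f"
  using assms by (auto simp: Lq_space_def Lq_norm_def)

lemma Lq_norm_diff_commute: "Lq_norm q (\<lambda>x. f x - g x) = Lq_norm q (\<lambda>x. g x - f x)"
  by (simp add: Lq_norm_def norm_minus_commute)

lemma Lq_diff:
  assumes f: "f \<in> Lq_space q" and g: "g \<in> Lq_space q" and q: "1 \<le> q"
  shows "(\<lambda>x. f x - g x) \<in> Lq_space q" "Lq_norm q (\<lambda>x. f x - g x) \<le> Lq_norm q f + Lq_norm q g"
  using Lq_add[OF f Lq_uminus(1)[OF g] q] Lq_uminus[OF g] by simp_all

lemma Lq_norm_triangle: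
  assumes f: "f \<in> Lq_space q" and g: "g \<in> Lq_space q" and h: "h \<in> Lq_space q" and q: "1 \<le> q"
  shows "Lq_norm q (\<lambda>x. f x - h x) \<le> Lq_norm q (\<lambda>x. f x - g x) + Lq_norm q (\<lambda>x. g x - h x)"
  using Lq_add(2)[OF Lq_diff(1)[OF f g q] Lq_diff(1)[OF g h q] q] by simp

lemma Lq_norm_le_diff:
  assumes f: "f \<in> Lq_space q" and g: "g \<in> Lq_space q" and q: "1 \<le> q"
  shows "Lq_norm q f \<le> Lq_norm q g + Lq_norm q (\<lambda>x. f x - g x)"
  using Lq_add(2)[OF g Lq_diff(1)[OF f g q] q] by simp

text \<open>Young's inequality is Minkowski's integral inequality for the translates of \<open>g\<close>, weighted by
  \<open>f\<close>.\<close>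

lemma conv_Lq_L1:
  assumes g: "g \<in> Lq_space q" and f: "f \<in> Lq_space 1" and q: "1 \<le> q"
  shows "AE x in lborel. convolves_at g f x"
    and "conv g f \<in> Lq_space q"
    and "Lq_norm q (conv g f) \<le> Lq_norm q g * Lq_norm 1 f"
proof -
  have [measurable]: "f \<in> borel_measurable borel" "g \<in> borel_measurable borel" using f g by measurable
  have w: "integrable lborel (\<lambda>y. Lq_norm q g * norm (f y))" using f by (simp add: Lq1_iff)
  have bd: "AE y in lborel. (\<lambda>x. g (x - y) *\<^sub>R f y) \<in> Lq_space q \<and>
      Lq_norm q (\<lambda>x. g (x - y) *\<^sub>R f y) \<le> Lq_norm q g * norm (f y)"
    using Lq_translate[OF g] q by (auto simp: Lq_scale)
  have F: "(\<lambda>(y,x). g (x - y) *\<^sub>R f y) \<in> borel_measurable (lborel \<Otimes>\<^sub>M lborel)" by measurable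
  note M = Lq_minkowski[OF sigma_finite_lborel q F w _ bd]
  show "AE x in lborel. convolves_at g f x" using M(1) by (simp add: convolves_at_def)
  show "conv g f \<in> Lq_space q" "Lq_norm q (conv g f) \<le> Lq_norm q g * Lq_norm 1 f"
    using M(2,3) by (simp_all add: conv_def[abs_def] Lq_norm_1)
qed

section \<open>Continuity of translations and dilations\<close>

text \<open>For the indicator of an open set \<open>U\<close> of finite measure the overlap of \<open>U\<close> with its translate
  tends to the measure of \<open>U\<close> by dominated convergence, because a point of \<open>U\<close> stays in \<open>U\<close> under
  small translations. Outer regularity passes to measurable sets, and \<open>integrable_induct\<close> to
  integrable functions.\<close>

lemma L1_translation_continuous:
  fixes f :: "real^'n \<Rightarrow> 'k::{real_normed_field,euclidean_space}"
  assumes "integrable lborel f"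
  shows "((\<lambda>h. Lq_norm 1 (\<lambda>x. f (x - h) - f x)) \<longlongrightarrow> 0) (at 0)"
  using assms
proof (induction rule: integrable_induct)
  case (base A c)
  show ?case
  proof (rule tendstoI)
    fix e :: real assume e: "e > 0"
    define e' where "e' = e / 4 / (norm c + 1)"
    have e': "e' > 0" using e by (simp add: e'_def add_nonneg_pos)
    have A[measurable]: "A \<in> sets borel" using base by simp
    obtain U where U: "open U" "A \<subseteq> U" "emeasure lborel (U - A) < ennreal e'"
      using outer_regular_lborel[of A e'] A e' by auto
    have [measurable]: "U \<in> sets borel" using U by simp
    have fU: "emeasure lborel U < \<infinity>"
    proof -
      have "emeasure lborel U \<le> emeasure lborel A + emeasure lborel (U - A)"
        using U(2) by (metis A Un_Diff_cancel Un_absorb1 emeasure_subadditive borel_open U(1) sets.Diff sets_lborel)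
      also have "\<dots> < \<infinity>" using base U(3) by (simp add: ennreal_add_eq_top less_top order.strict_trans)
      finally show ?thesis .
    qed
    define V :: "real^'n \<Rightarrow> real" where "V h = (LBINT x. indicator U x * indicator U (x - h))" for h :: "real^'n"
    have iU: "integrable lborel (indicator U :: _ \<Rightarrow> real)" using fU by simp
    have iU': "integrable lborel (\<lambda>x. indicator U (x - h) :: real)" for h
      using integrable_affine_iff[of "indicator U :: _ \<Rightarrow> real" 1 "-h"] iU by (simp add: algebra_simps)
    have mU': "(LBINT x. indicator U (x - h)) = measure lborel U" for h
      using integral_affine[of "indicator U :: _ \<Rightarrow> real" 1 "-h"] by (simp add: algebra_simps)
    have iV: "integrable lborel (\<lambda>x. indicator U x * indicator U (x - h) :: real)" for h
      by (rule Bochner_Integration.integrable_bound[OF iU]) (auto simp: indicator_def)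
    have Vlim: "(V \<longlongrightarrow> measure lborel U) (at 0)"
    proof (rule tendsto_at_iff_sequentially[THEN iffD2], intro allI impI, goal_cases)
      case (1 h)
      have "(\<lambda>i. V (h i)) \<longlonglongrightarrow> (LBINT x. indicator U x)"
        unfolding V_def
      proof (rule integral_dominated_convergence[where w = "indicator U"])
        show "AE x in lborel. (\<lambda>i. indicator U x * indicator U (x - h i)) \<longlonglongrightarrow> (indicator U x :: real)"
        proof (rule AE_I2)
          fix x :: "real^'n"
          show "(\<lambda>i. indicator U x * indicator U (x - h i)) \<longlonglongrightarrow> (indicator U x :: real)"
          proof (cases "x \<in> U")
            case True
            have "(\<lambda>i. x - h i) \<longlonglongrightarrow> x - 0" by (intro tendsto_intros 1(2))
            then have "\<forall>\<^sub>F i in sequentially. x - h i \<in> U"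
              using True U(1) by (intro topological_tendstoD) auto
            then have "\<forall>\<^sub>F i in sequentially. indicator U x * indicator U (x - h i) = (indicator U x :: real)"
              by eventually_elim (use True in simp)
            then show ?thesis by (rule tendsto_eventually)
          qed simp
        qed
      qed (use iU in \<open>auto simp: indicator_def\<close>)
      then show ?case by (simp add: comp_def)
    qed
    have ev: "\<forall>\<^sub>F h in at 0. measure lborel U - V h < e'"
      using tendstoD[OF Vlim e'] by (auto elim!: eventually_mono simp: dist_real_def)
    then show "\<forall>\<^sub>F h in at 0. dist (Lq_norm 1 (\<lambda>x. indicat_real A (x - h) *\<^sub>R c - indicat_real A x *\<^sub>R c)) 0 < e"
    proof eventually_elim
      case (elim h)
      have iA: "integrable lborel (indicator A :: _ \<Rightarrow> real)" using base by simp
      have iUA: "integrable lborel (\<lambda>x. indicator (U - A) x :: real)"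
        using U(3) by (intro integrable_real_indicator) (auto simp: less_top order.strict_trans)
      have iUA': "integrable lborel (\<lambda>x. indicator (U - A) (x - h) :: real)"
        using integrable_affine_iff[of "indicator (U-A) :: _ \<Rightarrow> real" 1 "-h"] iUA by (simp add: algebra_simps)
      have mUA: "(LBINT x. indicator (U - A) x) \<le> e'" "(LBINT x. indicator (U - A) (x - h)) \<le> e'"
      proof -
        have "measure lborel (U - A) \<le> e'"
          unfolding measure_def using U(3) e' by (intro enn2real_leI) auto
        then show "(LBINT x. indicator (U - A) x) \<le> e'" by simp
        then show "(LBINT x. indicator (U - A) (x - h)) \<le> e'"
          using integral_affine[of "indicator (U-A) :: _ \<Rightarrow> real" 1 "-h"] by (simp add: algebra_simps)
      qed
      have "Lq_norm 1 (\<lambda>x. indicat_real A (x - h) *\<^sub>R c - indicat_real A x *\<^sub>R c)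
        = (LBINT x. \<bar>indicator A (x - h) - indicator A x\<bar> * norm c)"
        by (simp add: Lq_norm_1 flip: scaleR_diff_left)
      also have "\<dots> \<le> (LBINT x. (indicator (U - A) (x - h) + indicator (U - A) x
          + (indicator U x + indicator U (x - h) - 2 * (indicator U x * indicator U (x - h)))) * norm c)"
      proof (rule integral_mono')
        show "integrable lborel (\<lambda>x. (indicator (U - A) (x - h) + indicator (U - A) x
          + (indicator U x + indicator U (x - h) - 2 * (indicator U x * indicator U (x - h)))) * norm c)"
          using iUA iUA' iU iU' iV by auto
        fix x
        have "\<bar>indicator A (x - h) - indicator A x\<bar> \<le> (indicator (U - A) (x - h) + indicator (U - A) x
          + (indicator U x + indicator U (x - h) - 2 * (indicator U x * indicator U (x - h))) :: real)"
          using U(2) by (auto simp: indicator_def)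
        then show "\<bar>indicator A (x - h) - indicator A x\<bar> * norm c \<le> (indicator (U - A) (x - h) + indicator (U - A) x
          + (indicator U x + indicator U (x - h) - 2 * (indicator U x * indicator U (x - h)))) * norm c"
          by (rule mult_right_mono) simp
        show "0 \<le> (indicator (U - A) (x - h) + indicator (U - A) x
          + (indicator U x + indicator U (x - h) - 2 * (indicator U x * indicator U (x - h)))) * norm c"
          by (intro mult_nonneg_nonneg) (auto simp: indicator_def)
      qed
      also have "\<dots> = ((LBINT x. indicator (U - A) (x - h)) + (LBINT x. indicator (U - A) x)
         + (measure lborel U + measure lborel U - 2 * V h)) * norm c"
        using iUA iUA' iU iU' iV by (simp add: mU' V_def)
      also have "\<dots> \<le> (4 * e') * norm c"
        using mUA elim by (intro mult_right_mono) auto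
      also have "\<dots> < 4 * e' * (norm c + 1)" using e' by simp
      also have "\<dots> = e"
      proof -
        have "norm c + 1 \<noteq> 0" using norm_ge_zero[of c] by linarith
        moreover have "4 * (e / 4 / k) * k = e" if "k \<noteq> 0" for k :: real using that by simp
        ultimately show ?thesis unfolding e'_def by blast
      qed
      finally show ?case by simp
    qed
  qed
next
  case (add f g)
  have [measurable]: "f \<in> borel_measurable borel" "g \<in> borel_measurable borel" using add by auto
  have "((\<lambda>h. Lq_norm 1 (\<lambda>x. f (x - h) - f x) + Lq_norm 1 (\<lambda>x. g (x - h) - g x)) \<longlongrightarrow> 0 + 0) (at 0)"
    using add by (intro tendsto_add)
  then have t: "((\<lambda>h. Lq_norm 1 (\<lambda>x. f (x - h) - f x) + Lq_norm 1 (\<lambda>x. g (x - h) - g x)) \<longlongrightarrow> 0) (at 0)" by simp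
  have sub: "(\<lambda>x. k (x - h) - k x) \<in> Lq_space 1" if "integrable lborel k" for k :: "real^'n \<Rightarrow> 'k" and h
    using that Lq_diff(1)[OF Lq_translate(1)[of k 1 h], of k] by (simp add: Lq1_iff)
  have le: "Lq_norm 1 (\<lambda>x. (f (x - h) + g (x - h)) - (f x + g x)) \<le> Lq_norm 1 (\<lambda>x. f (x - h) - f x) + Lq_norm 1 (\<lambda>x. g (x - h) - g x)" for h
    using Lq_add(2)[OF sub[OF add(1)] sub[OF add(2)], of h h] by (simp add: algebra_simps)
  show ?case
    by (rule Lim_null_comparison[OF _ t]) (use le in simp)
next
  case (lim f s)
  show ?case
  proof (rule tendstoI)
    fix e :: real assume e: "e > 0"
    have "(\<lambda>i. LBINT x. norm (s i x - f x)) \<longlonglongrightarrow> (LBINT x. norm (f x - f x))"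
    proof (rule integral_dominated_convergence[where w = "\<lambda>x. 3 * norm (f x)"])
      show "AE x in lborel. (\<lambda>i. norm (s i x - f x)) \<longlonglongrightarrow> norm (f x - f x)"
        using lim by (intro AE_I2 tendsto_intros) auto
      show "AE x in lborel. norm (norm (s i x - f x)) \<le> 3 * norm (f x)" for i
        using lim.hyps(3)[of _ i] by (intro AE_I2) (auto intro!: order_trans[OF norm_triangle_ineq4] simp: add_mono[of "norm _" "2 * norm _" "norm _" "norm _", simplified])
    qed (use lim in auto)
    then have "\<forall>\<^sub>F i in sequentially. (LBINT x. norm (s i x - f x)) < e / 3"
      using e order_tendstoD(2)[of "\<lambda>i. \<integral>x. norm (s i x - f x) \<partial>lborel" 0 sequentially "e/3"] by simp
    then obtain i where i: "Lq_norm 1 (\<lambda>x. s i x - f x) < e / 3"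
      by (auto simp: eventually_sequentially Lq_norm_1)
    have si: "s i \<in> Lq_space 1" "f \<in> Lq_space 1" using lim by (auto simp: Lq1_iff)
    have si': "(\<lambda>x. s i (x - h)) \<in> Lq_space 1" "(\<lambda>x. f (x - h)) \<in> Lq_space 1" for h
      using Lq_translate(1)[OF si(1)] Lq_translate(1)[OF si(2)] by simp_all
    have "\<forall>\<^sub>F h in at 0. Lq_norm 1 (\<lambda>x. s i (x - h) - s i x) < e / 3"
      using tendstoD[OF lim.IH[of i], of "e/3"] e by simp
    then show "\<forall>\<^sub>F h in at 0. dist (Lq_norm 1 (\<lambda>x. f (x - h) - f x)) 0 < e"
    proof eventually_elim
      case (elim h)
      have "Lq_norm 1 (\<lambda>x. f (x - h) - f x) \<le> Lq_norm 1 (\<lambda>x. f (x - h) - s i (x - h)) + Lq_norm 1 (\<lambda>x. s i (x - h) - f x)"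
        using Lq_norm_triangle[OF si'(2) si'(1) si(2)] by simp
      also have "Lq_norm 1 (\<lambda>x. s i (x - h) - f x) \<le> Lq_norm 1 (\<lambda>x. s i (x - h) - s i x) + Lq_norm 1 (\<lambda>x. s i x - f x)"
        using Lq_norm_triangle[OF si'(1) si] by simp
      also have "Lq_norm 1 (\<lambda>x. f (x - h) - s i (x - h)) = Lq_norm 1 (\<lambda>x. s i x - f x)"
        using Lq_translate(2)[OF Lq_diff(1)[OF si], of h] by (simp add: Lq_norm_diff_commute)
      finally show ?case using elim i by simp
    qed
  qed
qed

text \<open>The function is truncated to a bounded function \<open>s\<close> of bounded support; for this one
  \<open>\<bar>s(x-h) - s(x)\<bar>\<^sup>q\<close> is at most a constant times \<open>\<bar>s(x-h) - s(x)\<bar>\<close>, so that the case \<open>q = 1\<close>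
  applies.\<close>

lemma Lq_translation_continuous:
  fixes f :: "real^'n \<Rightarrow> 'k::{real_normed_field,euclidean_space}"
  assumes f: "f \<in> Lq_space q" and q: "1 \<le> q"
  shows "((\<lambda>h. Lq_norm q (\<lambda>x. f (x - h) - f x)) \<longlongrightarrow> 0) (at 0)"
proof (rule tendstoI)
  fix e :: real assume e: "e > 0"
  have [measurable]: "f \<in> borel_measurable borel" using f by measurable
  have fi: "integrable lborel (\<lambda>x. norm (f x) powr q)" using f by (simp add: Lq_space_def)
  define s where "s = (\<lambda>(i::nat) x. if norm (f x) \<le> real i \<and> norm x \<le> real i then f x else 0)"
  have sm[measurable]: "s i \<in> borel_measurable borel" for i unfolding s_def by measurable
  have sL: "s i \<in> Lq_space q" for i
    by (rule Lq_mono(1)[OF _ _ f]) (use q in \<open>auto simp: s_def\<close>)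
  have s1: "s i \<in> Lq_space 1" for i
  proof -
    have "integrable lborel (\<lambda>x. indicator (cball 0 (real i)) x * real i :: real)"
      by (intro integrable_mult_left integrable_real_indicator) (use emeasure_bounded_finite[OF bounded_cball] in \<open>auto simp: less_top\<close>)
    then have "integrable lborel (s i)"
      by (rule Bochner_Integration.integrable_bound) (auto simp: s_def indicator_def)
    then show ?thesis by (simp add: Lq1_iff)
  qed
  have "(\<lambda>i. LBINT x. norm (s i x - f x) powr q) \<longlonglongrightarrow> (\<integral>x. 0 \<partial>(lborel :: (real^'n) measure))"
  proof (rule integral_dominated_convergence[OF _ _ fi])
    show "AE x in lborel. (\<lambda>i. norm (s i x - f x) powr q) \<longlonglongrightarrow> 0"
    proof (rule AE_I2, rule tendsto_eventually)
      fix x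
      show "\<forall>\<^sub>F i in sequentially. norm (s i x - f x) powr q = 0"
        using eventually_ge_at_top[of "nat \<lceil>max (norm (f x)) (norm x)\<rceil>"]
        by eventually_elim (auto simp: s_def nat_ceiling_le_eq)
    qed
    show "AE x in lborel. norm (norm (s i x - f x) powr q) \<le> norm (f x) powr q" for i
      by (auto simp: s_def)
  qed auto
  then have "\<forall>\<^sub>F i in sequentially. (LBINT x. norm (s i x - f x) powr q) < (e / 3) powr q"
    using e order_tendstoD(2)[of _ 0 sequentially "(e/3) powr q"] by simp
  then obtain i where "(LBINT x. norm (s i x - f x) powr q) < (e / 3) powr q"
    by (auto simp: eventually_sequentially)
  then have "Lq_norm q (\<lambda>x. s i x - f x) < ((e / 3) powr q) powr (1/q)"
    unfolding Lq_norm_def using q by (intro powr_less_mono2) auto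
  then have i: "Lq_norm q (\<lambda>x. s i x - f x) < e / 3"
    using q e by (simp add: powr_powr)
  have si': "(\<lambda>x. s i (x - h)) \<in> Lq_space q" "(\<lambda>x. f (x - h)) \<in> Lq_space q" for h
    using sL f q Lq_translate(1)[of _ q] by auto
  define K where "K = (2 * real i) powr (q - 1)"
  have bd: "Lq_norm q (\<lambda>x. s i (x - h) - s i x) \<le> (K * Lq_norm 1 (\<lambda>x. s i (x - h) - s i x)) powr (1/q)" for h
  proof -
    have d: "(\<lambda>x. s i (x - h) - s i x) \<in> Lq_space 1"
      using s1 Lq_translate(1)[OF s1] by (intro Lq_diff) auto
    have "(LBINT x. norm (s i (x - h) - s i x) powr q) \<le> (LBINT x. K * norm (s i (x - h) - s i x))"
    proof (rule integral_mono')
      show "integrable lborel (\<lambda>x. K * norm (s i (x - h) - s i x))"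
        using d by (auto simp: Lq1_iff)
      fix x
      have si: "norm (s i y) \<le> real i" for y by (auto simp: s_def)
      have n: "norm (s i (x - h) - s i x) \<le> 2 * real i"
        using si[of x] si[of "x-h"] norm_triangle_ineq4[of "s i (x - h)" "s i x"] by simp
      have "norm (s i (x - h) - s i x) powr q = norm (s i (x - h) - s i x) powr (q - 1) * norm (s i (x - h) - s i x)"
        using q by (cases "s i (x - h) = s i x") (auto simp: powr_diff)
      also have "\<dots> \<le> K * norm (s i (x - h) - s i x)"
        unfolding K_def using n q by (intro mult_right_mono powr_mono2) auto
      finally show "norm (s i (x - h) - s i x) powr q \<le> K * norm (s i (x - h) - s i x)" .
    qed (auto simp: K_def)
    then show ?thesis unfolding Lq_norm_def[of q] Lq_norm_1 using q by (intro powr_mono2) auto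
  qed
  have "((\<lambda>h. (K * Lq_norm 1 (\<lambda>x. s i (x - h) - s i x)) powr (1/q)) \<longlongrightarrow> (K * 0) powr (1/q)) (at 0)"
    using L1_translation_continuous[of "s i"] s1[of i] q
    by (intro tendsto_powr2 tendsto_mult_left) (auto simp: Lq1_iff K_def intro!: tendsto_eq_intros)
  then have "((\<lambda>h. (K * Lq_norm 1 (\<lambda>x. s i (x - h) - s i x)) powr (1/q)) \<longlongrightarrow> 0) (at 0)" by simp
  then have "((\<lambda>h. Lq_norm q (\<lambda>x. s i (x - h) - s i x)) \<longlongrightarrow> 0) (at 0)"
    by (rule Lim_null_comparison[rotated]) (use bd in simp)
  then have "\<forall>\<^sub>F h in at 0. Lq_norm q (\<lambda>x. s i (x - h) - s i x) < e / 3"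
    using order_tendstoD(2)[of _ 0 _ "e/3"] e by simp
  then show "\<forall>\<^sub>F h in at 0. dist (Lq_norm q (\<lambda>x. f (x - h) - f x)) 0 < e"
  proof eventually_elim
    case (elim h)
    have "Lq_norm q (\<lambda>x. f (x - h) - f x) \<le> Lq_norm q (\<lambda>x. f (x - h) - s i (x - h)) + Lq_norm q (\<lambda>x. s i (x - h) - f x)"
      using Lq_norm_triangle[OF si'(2) si'(1) f q] by simp
    also have "Lq_norm q (\<lambda>x. s i (x - h) - f x) \<le> Lq_norm q (\<lambda>x. s i (x - h) - s i x) + Lq_norm q (\<lambda>x. s i x - f x)"
      using Lq_norm_triangle[OF si'(1) sL f q] by simp
    also have "Lq_norm q (\<lambda>x. f (x - h) - s i (x - h)) = Lq_norm q (\<lambda>x. s i x - f x)"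
      using Lq_translate(2)[OF Lq_diff(1)[OF sL[of i] f q], of h] q by (simp add: Lq_norm_diff_commute)
    finally show ?case using elim i by simp
  qed
qed

text \<open>By translation invariance the modulus is subadditive and even, so that continuity at \<open>0\<close>
  gives continuity everywhere. In particular the modulus is measurable, and can be integrated
  against a kernel.\<close>

lemma continuous_translation_modulus:
  assumes f: "f \<in> Lq_space q" and q: "1 \<le> q"
  shows "continuous_on UNIV (\<lambda>h. Lq_norm q (\<lambda>x. f (x - h) - f x))"
proof -
  let ?m = "\<lambda>h. Lq_norm q (\<lambda>x. f (x - h) - f x)"
  have t: "(\<lambda>x. f (x - h)) \<in> Lq_space q" for h using f q Lq_translate(1)[of f q h] by auto
  have le: "?m h \<le> ?m k + ?m (h - k)" for h k
  proof -
    have "?m h \<le> Lq_norm q (\<lambda>x. f (x - h) - f (x - k)) + ?m k"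
      by (rule Lq_norm_triangle[OF t t f q])
    also have "Lq_norm q (\<lambda>x. f (x - h) - f (x - k)) = ?m (h - k)"
      using Lq_translate(2)[OF Lq_diff(1)[OF t[of "h - k"] f q], of k] q by (simp add: algebra_simps)
    finally show ?thesis by simp
  qed
  have neg: "?m (- h) = ?m h" for h
    using Lq_translate(2)[OF Lq_diff(1)[OF t[of "- h"] f q], of h] q
    by (simp add: Lq_norm_diff_commute)
  have ab: "\<bar>?m h - ?m k\<bar> \<le> ?m (h - k)" for h k
    using le[of h k] le[of k h] neg[of "h - k"] by simp
  have "(?m \<longlongrightarrow> ?m k) (at k)" for k
  proof -
    have "((\<lambda>h. ?m (h - k)) \<longlongrightarrow> 0) (at k)"
      using LIM_offset[OF Lq_translation_continuous[OF f q], of "-k"] by simp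
    then have "((\<lambda>h. ?m h - ?m k) \<longlongrightarrow> 0) (at k)"
      by (rule Lim_null_comparison[rotated]) (use ab in simp)
    then show ?thesis by (simp add: LIM_zero_iff)
  qed
  then show ?thesis by (simp add: continuous_on_def)
qed

text \<open>The difference of two averages is an average of differences of translates, which are bounded
  by the modulus of continuity. The value \<open>r = 0\<close> is included; there the average is a multiple of
  \<open>f\<close>, so that the case \<open>s = 0\<close> is the approximation of \<open>f\<close> by mollifications.\<close>

lemma dilated_average_continuous:
  fixes f :: "real^'n \<Rightarrow> 'k::{real_normed_field,euclidean_space}"
  assumes f: "f \<in> Lq_space q" and q: "1 \<le> q" and g: "g \<in> Lq_space 1"
  shows "((\<lambda>r. Lq_norm q (\<lambda>x. (LBINT y. g y *\<^sub>R f (x - r *\<^sub>R y)) - (LBINT y. g y *\<^sub>R f (x - s *\<^sub>R y)))) \<longlongrightarrow> 0) (at s)"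
    and "AE x in lborel. integrable lborel (\<lambda>y. g y *\<^sub>R f (x - r *\<^sub>R y))"
    and "(\<lambda>x. LBINT y. g y *\<^sub>R f (x - r *\<^sub>R y)) \<in> Lq_space q"
    and "Lq_norm q (\<lambda>x. LBINT y. g y *\<^sub>R f (x - r *\<^sub>R y)) \<le> Lq_norm 1 g * Lq_norm q f"
proof -
  let ?m = "\<lambda>h. Lq_norm q (\<lambda>x. f (x - h) - f x)"
  have [measurable]: "f \<in> borel_measurable borel" "g \<in> borel_measurable borel" using f g by measurable
  have gi: "integrable lborel g" using g by (simp add: Lq1_iff)
  have t: "(\<lambda>x. f (x - h)) \<in> Lq_space q" for h using f q Lq_translate(1)[of f q h] by auto
  have m2: "?m h \<le> 2 * Lq_norm q f" for h
    using Lq_diff(2)[OF t[of h] f q] Lq_translate(2)[OF f, of h] q by simp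
  have mm[measurable]: "?m \<in> borel_measurable borel"
    by (intro borel_measurable_continuous_onI continuous_translation_modulus f q)
  have A: "AE x in lborel. integrable lborel (\<lambda>y. g y *\<^sub>R f (x - r *\<^sub>R y))"
     "(\<lambda>x. LBINT y. g y *\<^sub>R f (x - r *\<^sub>R y)) \<in> Lq_space q"
     "Lq_norm q (\<lambda>x. LBINT y. g y *\<^sub>R f (x - r *\<^sub>R y)) \<le> Lq_norm 1 g * Lq_norm q f" for r
  proof -
    have bd: "AE y in lborel. (\<lambda>x. g y *\<^sub>R f (x - r *\<^sub>R y)) \<in> Lq_space q \<and> Lq_norm q (\<lambda>x. g y *\<^sub>R f (x - r *\<^sub>R y)) \<le> norm (g y) * Lq_norm q f"
      using t Lq_translate(2)[OF f] q by (intro AE_I2) (simp add: Lq_scaleR)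
    have F: "(\<lambda>(y,x). g y *\<^sub>R f (x - r *\<^sub>R y)) \<in> borel_measurable (lborel \<Otimes>\<^sub>M lborel)" by measurable
    note M = Lq_minkowski[OF sigma_finite_lborel q F _ _ bd]
    show "AE x in lborel. integrable lborel (\<lambda>y. g y *\<^sub>R f (x - r *\<^sub>R y))"
     "(\<lambda>x. LBINT y. g y *\<^sub>R f (x - r *\<^sub>R y)) \<in> Lq_space q"
     "Lq_norm q (\<lambda>x. LBINT y. g y *\<^sub>R f (x - r *\<^sub>R y)) \<le> Lq_norm 1 g * Lq_norm q f"
      using M gi by (simp_all add: Lq_norm_1)
  qed
  show "AE x in lborel. integrable lborel (\<lambda>y. g y *\<^sub>R f (x - r *\<^sub>R y))"
     "(\<lambda>x. LBINT y. g y *\<^sub>R f (x - r *\<^sub>R y)) \<in> Lq_space q"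
     "Lq_norm q (\<lambda>x. LBINT y. g y *\<^sub>R f (x - r *\<^sub>R y)) \<le> Lq_norm 1 g * Lq_norm q f" by (rule A)+
  have wi: "integrable lborel (\<lambda>y. norm (g y) * ?m ((r - s) *\<^sub>R y))" for r
    by (rule Bochner_Integration.integrable_bound[OF integrable_mult_left[OF integrable_norm[OF gi], of "2 * Lq_norm q f"]])
       (auto simp: abs_mult m2 intro!: mult_left_mono)
  have le: "Lq_norm q (\<lambda>x. (LBINT y. g y *\<^sub>R f (x - r *\<^sub>R y)) - (LBINT y. g y *\<^sub>R f (x - s *\<^sub>R y)))
     \<le> (LBINT y. norm (g y) * ?m ((r - s) *\<^sub>R y))" for r
  proof -
    have "Lq_norm q (\<lambda>x. f (x - r *\<^sub>R y) - f (x - s *\<^sub>R y)) = ?m ((r - s) *\<^sub>R y)" for y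
      using Lq_translate(2)[OF Lq_diff(1)[OF t[of "(r - s) *\<^sub>R y"] f q], of "s *\<^sub>R y"] q by (simp add: algebra_simps)
    then have bd: "AE y in lborel. (\<lambda>x. g y *\<^sub>R (f (x - r *\<^sub>R y) - f (x - s *\<^sub>R y))) \<in> Lq_space q \<and> Lq_norm q (\<lambda>x. g y *\<^sub>R (f (x - r *\<^sub>R y) - f (x - s *\<^sub>R y))) \<le> norm (g y) * ?m ((r - s) *\<^sub>R y)"
      using t q by (intro AE_I2) (simp add: Lq_scaleR Lq_diff)
    have F: "(\<lambda>(y,x). g y *\<^sub>R (f (x - r *\<^sub>R y) - f (x - s *\<^sub>R y))) \<in> borel_measurable (lborel \<Otimes>\<^sub>M lborel)" by measurable
    have "Lq_norm q (\<lambda>x. LBINT y. g y *\<^sub>R (f (x - r *\<^sub>R y) - f (x - s *\<^sub>R y))) \<le> (LBINT y. norm (g y) * ?m ((r - s) *\<^sub>R y))"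
      by (rule Lq_minkowski(3)[OF sigma_finite_lborel q F wi _ bd]) simp
    also have "Lq_norm q (\<lambda>x. LBINT y. g y *\<^sub>R (f (x - r *\<^sub>R y) - f (x - s *\<^sub>R y)))
      = Lq_norm q (\<lambda>x. (LBINT y. g y *\<^sub>R f (x - r *\<^sub>R y)) - (LBINT y. g y *\<^sub>R f (x - s *\<^sub>R y)))"
    proof (rule Lq_norm_cong_AE)
      show "AE x in lborel. norm (LBINT y. g y *\<^sub>R (f (x - r *\<^sub>R y) - f (x - s *\<^sub>R y))) =
        norm ((LBINT y. g y *\<^sub>R f (x - r *\<^sub>R y)) - (LBINT y. g y *\<^sub>R f (x - s *\<^sub>R y)))"
        using A(1)[of r] A(1)[of s] by eventually_elim (simp add: scaleR_diff_right)
    qed measurable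
    finally show ?thesis .
  qed
  have "((\<lambda>r. LBINT y. norm (g y) * ?m ((r - s) *\<^sub>R y)) \<longlongrightarrow> 0) (at s)"
  proof (rule tendsto_at_iff_sequentially[THEN iffD2], intro allI impI, goal_cases)
    case (1 X)
    have "(\<lambda>i. LBINT y. norm (g y) * ?m ((X i - s) *\<^sub>R y)) \<longlonglongrightarrow> (\<integral>y. 0 \<partial>(lborel :: (real^'n) measure))"
    proof (rule integral_dominated_convergence[where w = "\<lambda>y. norm (g y) * (2 * Lq_norm q f)"])
      show "AE y in lborel. (\<lambda>i. norm (g y) * ?m ((X i - s) *\<^sub>R y)) \<longlonglongrightarrow> 0"
      proof (rule AE_I2)
        fix y :: "real^'n"
        have "(\<lambda>i. (X i - s) *\<^sub>R y) \<longlonglongrightarrow> (s - s) *\<^sub>R y" by (intro tendsto_intros 1(2))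
        then have "(\<lambda>i. ?m ((X i - s) *\<^sub>R y)) \<longlonglongrightarrow> ?m 0"
          using continuous_translation_modulus[OF f q]
          by (intro isCont_tendsto_compose[of _ ?m]) (auto simp: continuous_on_eq_continuous_at)
        then show "(\<lambda>i. norm (g y) * ?m ((X i - s) *\<^sub>R y)) \<longlonglongrightarrow> 0" by (auto intro!: tendsto_eq_intros)
      qed
      show "AE y in lborel. norm (norm (g y) * ?m ((X i - s) *\<^sub>R y)) \<le> norm (g y) * (2 * Lq_norm q f)" for i
        by (auto simp: abs_mult m2 intro!: mult_left_mono)
    qed (use gi in auto)
    then show ?case by (simp add: comp_def)
  qed
  then show "((\<lambda>r. Lq_norm q (\<lambda>x. (LBINT y. g y *\<^sub>R f (x - r *\<^sub>R y)) - (LBINT y. g y *\<^sub>R f (x - s *\<^sub>R y)))) \<longlongrightarrow> 0) (at s)"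
    by (rule Lim_null_comparison[rotated]) (use le in simp)
qed

section \<open>Interpolation and the nonlinearity\<close>

lemma interpolation_weight:
  fixes p q :: real
  assumes p: "1 < p"
  shows "(1 - (p - q) / (p - 1)) * (p - 1) = q - 1" "(p - q) / (p - 1) + p * (1 - (p - q) / (p - 1)) = q"
proof -
  have 1: "(p - q) / (p - 1) * (p - 1) = p - q" using p by simp
  then show 2: "(1 - (p - q) / (p - 1)) * (p - 1) = q - 1" by (simp only: left_diff_distrib) simp
  have "l + p * (1 - l) = 1 + (1 - l) * (p - 1)" for l :: real by (simp add: algebra_simps)
  then show "(p - q) / (p - 1) + p * (1 - (p - q) / (p - 1)) = q" using 2 by simp
qed

text \<open>The bounds \<open>A\<close> and \<open>B\<close> normalize \<open>f\<close> and make the weighted inequality of arithmetic and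
  geometric means integrate to the sharp product.\<close>

lemma Lq_interpolation:
  assumes f: "f \<in> Lq_space 1" "f \<in> Lq_space p" and p: "1 < p" and q: "1 \<le> q" "q \<le> p"
    and A: "0 < A" "Lq_norm 1 f \<le> A" and B: "0 < B" "Lq_norm p f \<le> B"
  defines "l \<equiv> (p - q) / (p - 1)"
  shows "f \<in> Lq_space q" "Lq_norm q f \<le> A powr (l / q) * B powr (p * (1 - l) / q)"
proof -
  have [measurable]: "f \<in> borel_measurable borel" using f by measurable
  have l: "0 \<le> l" "l \<le> 1" using p q by (auto simp: l_def)
  have l3: "l + p * (1 - l) = q" unfolding l_def by (rule interpolation_weight[OF p])
  define E where "E = A powr l * B powr (p * (1 - l))"
  have E: "E > 0" using A B by (simp add: E_def)
  have i1: "integrable lborel (\<lambda>x. norm (f x))" using f(1) by (simp add: Lq1_iff)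
  have ip: "integrable lborel (\<lambda>x. norm (f x) powr p)" using f(2) by (simp add: Lq_space_def)
  have I1: "(LBINT x. norm (f x)) \<le> A" using A by (simp add: Lq_norm_1)
  have Ip: "(LBINT x. norm (f x) powr p) \<le> B powr p"
    using B p Lq_norm_powr[OF f(2)] by (metis Lq_norm_nonneg less_trans order_less_imp_le powr_mono2 zero_less_one)
  let ?g = "\<lambda>x. E * (l * (norm (f x) / A) + (1 - l) * (norm (f x) powr p / B powr p))"
  have pt: "norm (f x) powr q \<le> ?g x" for x
  proof (cases "f x = 0")
    case True
    then show ?thesis by simp
  next
    case False
    then have y: "norm (f x) > 0" by simp
    have "(norm (f x) / A) powr l * (norm (f x) powr p / B powr p) powr (1 - l) \<le> l * (norm (f x) / A) + (1 - l) * (norm (f x) powr p / B powr p)"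
      using l y A B by (intro Youngs_inequality_0) auto
    moreover have "(norm (f x) / A) powr l * (norm (f x) powr p / B powr p) powr (1 - l) = norm (f x) powr q / E"
    proof -
      have "norm (f x) powr l * norm (f x) powr (p * (1 - l)) = norm (f x) powr q"
        unfolding powr_add[symmetric] l3 ..
      then show ?thesis unfolding E_def powr_divide powr_powr by (simp add: field_simps)
    qed
    ultimately show ?thesis using E by (simp add: field_simps)
  qed
  have gi: "integrable lborel ?g" using i1 ip by simp
  have "(\<integral>\<^sup>+x. ennreal (norm (f x) powr q) \<partial>lborel) \<le> (\<integral>\<^sup>+x. ennreal (?g x) \<partial>lborel)"
    by (intro nn_integral_mono ennreal_leI pt)
  also have "\<dots> = ennreal (LBINT x. ?g x)"
    by (rule nn_integral_eq_integral[OF gi]) (use E l A B in \<open>auto intro!: mult_nonneg_nonneg add_nonneg_nonneg\<close>)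
  also have "\<dots> \<le> ennreal E"
  proof (rule ennreal_leI)
    have "(LBINT x. ?g x) = E * (l * ((LBINT x. norm (f x)) / A) + (1 - l) * ((LBINT x. norm (f x) powr p) / B powr p))"
      using i1 ip by simp
    also have "\<dots> \<le> E * (l * 1 + (1 - l) * 1)"
      using I1 Ip A B E l by (intro mult_left_mono add_mono) auto
    finally show "(LBINT x. ?g x) \<le> E" by simp
  qed
  also have "E = (A powr (l / q) * B powr (p * (1 - l) / q)) powr q"
    using q by (simp add: E_def powr_mult powr_powr)
  finally have le: "(\<integral>\<^sup>+x. ennreal (norm (f x) powr q) \<partial>lborel) \<le> ennreal ((A powr (l / q) * B powr (p * (1 - l) / q)) powr q)" .
  show "f \<in> Lq_space q" "Lq_norm q f \<le> A powr (l / q) * B powr (p * (1 - l) / q)"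
    using q by (intro Lq_boundI[OF _ _ _ le]; simp)+
qed

text \<open>The exponent is affine in \<open>1/q\<close>, hence the bounds at the two end points interpolate to the
  same power law in between.\<close>

lemma Lq_interpolation_decay:
  assumes f: "f \<in> Lq_space 1" "f \<in> Lq_space p" and p: "1 < p" and q: "1 \<le> q" "q \<le> p" and T: "0 < T" and M: "0 \<le> M"
    and le: "Lq_norm 1 f \<le> M * T powr a" "Lq_norm p f \<le> M * T powr (a - c * (1 - 1 / p))"
  shows "Lq_norm q f \<le> M * T powr (a - c * (1 - 1 / q))"
proof (rule field_le_epsilon)
  fix e :: real assume e: "0 < e"
  define m where "m = M + e / T powr (a - c * (1 - 1 / q))"
  have m: "0 < m" "M \<le> m" using e T M by (auto simp: m_def add_nonneg_pos)
  define l where "l = (p - q) / (p - 1)"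
  have l: "l + p * (1 - l) = q" "(1 - l) * (p - 1) = q - 1" unfolding l_def by (rule interpolation_weight[OF p])+
  have "Lq_norm q f \<le> (m * T powr a) powr (l / q) * (m * T powr (a - c * (1 - 1 / p))) powr (p * (1 - l) / q)"
    unfolding l_def
  proof (rule Lq_interpolation(2)[OF f p q])
    show "Lq_norm 1 f \<le> m * T powr a" using le(1) mult_right_mono[OF m(2), of "T powr a"] by simp
    show "Lq_norm p f \<le> m * T powr (a - c * (1 - 1 / p))" using le(2) mult_right_mono[OF m(2), of "T powr (a - c * (1 - 1 / p))"] by simp
  qed (use m T in auto)
  also have "\<dots> = (m powr (l / q) * m powr (p * (1 - l) / q)) * (T powr (a * (l / q)) * T powr ((a - c * (1 - 1 / p)) * (p * (1 - l) / q)))"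
    unfolding powr_mult powr_powr by simp
  also have "m powr (l / q) * m powr (p * (1 - l) / q) = m"
  proof -
    have "l / q + p * (1 - l) / q = 1" using l(1) q by (simp add: add_divide_distrib[symmetric])
    then show ?thesis using m by (simp flip: powr_add)
  qed
  also have "T powr (a * (l / q)) * T powr ((a - c * (1 - 1 / p)) * (p * (1 - l) / q)) = T powr (a - c * (1 - 1 / q))"
  proof -
    have "a * (l / q) + (a - c * (1 - 1 / p)) * (p * (1 - l) / q) = (a * (l + p * (1 - l)) - c * ((1 - l) * (p - 1))) / q"
      using p q by (simp add: field_simps)
    also have "\<dots> = a - c * (1 - 1 / q)" unfolding l using q by (simp add: field_simps)
    finally show ?thesis by (simp flip: powr_add)
  qed
  also have "m * T powr (a - c * (1 - 1 / q)) = M * T powr (a - c * (1 - 1 / q)) + e" using T by (simp add: m_def field_simps)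
  finally show "Lq_norm q f \<le> M * T powr (a - c * (1 - 1 / q)) + e" .
qed

text \<open>The mean value theorem, with the derivative estimated at the larger point.\<close>

lemma powr_diff_le:
  fixes x y p :: real
  assumes p: "1 \<le> p" and xy: "0 \<le> y" "y \<le> x"
  shows "x powr p - y powr p \<le> p * (x - y) * x powr (p - 1)"
proof (cases "y = 0 \<or> x = y")
  case True
  show ?thesis
  proof (cases "x = y")
    case False
    then have "y = 0" "x > 0" using True xy by auto
    then have "x powr p = x * x powr (p - 1)" by (simp add: powr_diff)
    moreover have "x * x powr (p - 1) \<le> p * (x * x powr (p - 1))" using p \<open>x > 0\<close> by simp
    ultimately show ?thesis using \<open>y = 0\<close> by (simp add: mult.assoc)
  qed simp
next
  case False
  then have "y < x" "0 < y" using xy by auto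
  then obtain z where z: "y < z" "z < x" "x powr p - y powr p = (x - y) * (p * z powr (p - 1))"
    using MVT2[OF \<open>y < x\<close>, of "\<lambda>t. t powr p" "\<lambda>t. p * t powr (p - 1)"] has_real_derivative_powr[of _ p]
    by (metis less_le_trans)
  have "(x - y) * (p * z powr (p - 1)) \<le> (x - y) * (p * x powr (p - 1))"
    using z p \<open>0 < y\<close> by (intro mult_left_mono powr_mono2) auto
  then show ?thesis using z(3) by (simp add: mult_ac)
qed

lemma powr_abs_diff_le:
  fixes x y p :: real
  assumes "1 \<le> p" "0 \<le> x" "0 \<le> y"
  shows "\<bar>x powr p - y powr p\<bar> \<le> p * \<bar>x - y\<bar> * (x powr (p - 1) + y powr (p - 1))"
proof -
  have main: "\<bar>x powr p - y powr p\<bar> \<le> p * \<bar>x - y\<bar> * (x powr (p - 1) + y powr (p - 1))" if "0 \<le> y" "y \<le> x" for x y :: real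
  proof -
    have "y powr p \<le> x powr p" using that assms by (intro powr_mono2) auto
    then have "\<bar>x powr p - y powr p\<bar> \<le> p * (x - y) * x powr (p - 1)" using powr_diff_le[OF assms(1) that] by simp
    also have "\<dots> \<le> p * (x - y) * (x powr (p - 1) + y powr (p - 1))" using that assms by (intro mult_left_mono) auto
    finally show ?thesis using that by simp
  qed
  show ?thesis
  proof (cases "y \<le> x")
    case True
    then show ?thesis using main assms by simp
  next
    case False
    then show ?thesis using main[of x y] assms by (simp add: abs_minus_commute add.commute)
  qed
qed

text \<open>Hoelder's inequality for the exponents \<open>p/(p-1)\<close> and \<open>p\<close>, in the form needed for \<open>u \<mapsto> \<bar>u\<bar>\<^sup>p\<close>.
  Passing to upper bounds \<open>B, D\<close> of the norms excludes the case of a vanishing norm.\<close>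

lemma holder_powr:
  fixes f g :: "real^'n \<Rightarrow> real"
  assumes f: "f \<in> Lq_space p" and g: "g \<in> Lq_space p" and p: "1 < p"
    and nn: "\<And>x. 0 \<le> f x" "\<And>x. 0 \<le> g x"
    and B: "0 < B" "Lq_norm p f \<le> B" and D: "0 < D" "Lq_norm p g \<le> D"
  shows "integrable lborel (\<lambda>x. f x powr (p - 1) * g x)" "(LBINT x. f x powr (p - 1) * g x) \<le> B powr (p - 1) * D"
proof -
  have [measurable]: "f \<in> borel_measurable borel" "g \<in> borel_measurable borel" using f g by measurable
  have fi: "integrable lborel (\<lambda>x. f x powr p)" "integrable lborel (\<lambda>x. g x powr p)"
    using f g nn by (auto simp: Lq_space_def)
  have I: "(LBINT x. f x powr p) \<le> B powr p" "(LBINT x. g x powr p) \<le> D powr p"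
    using powr_mono2[OF _ Lq_norm_nonneg B(2), of p] powr_mono2[OF _ Lq_norm_nonneg D(2), of p] p
      Lq_norm_powr[OF f] Lq_norm_powr[OF g] nn by auto
  let ?h = "\<lambda>x. B powr (p - 1) * D * ((1 - 1 / p) * (f x powr p / B powr p) + 1 / p * (g x powr p / D powr p))"
  have hi: "integrable lborel ?h" using fi by simp
  have pt: "f x powr (p - 1) * g x \<le> ?h x" for x
  proof (cases "f x = 0 \<or> g x = 0")
    case True
    then show ?thesis using p B D by (auto intro!: mult_nonneg_nonneg add_nonneg_nonneg)
  next
    case False
    then have pos: "f x > 0" "g x > 0" using nn[of x] by (auto simp: less_le)
    have "(f x powr p / B powr p) powr (1 - 1 / p) * (g x powr p / D powr p) powr (1 / p) \<le> (1 - 1 / p) * (f x powr p / B powr p) + 1 / p * (g x powr p / D powr p)"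
      using p pos B D by (intro Youngs_inequality_0) auto
    moreover have "(f x powr p / B powr p) powr (1 - 1 / p) * (g x powr p / D powr p) powr (1 / p) = f x powr (p - 1) * g x / (B powr (p - 1) * D)"
    proof -
      have "p * (1 - 1 / p) = p - 1" "p * (1 / p) = 1" using p by (auto simp: field_simps)
      then show ?thesis unfolding powr_divide powr_powr using pos D by simp
    qed
    ultimately show ?thesis using B D by (simp add: pos_divide_le_eq mult.commute)
  qed
  show i: "integrable lborel (\<lambda>x. f x powr (p - 1) * g x)"
  proof (rule Bochner_Integration.integrable_bound[OF hi])
    show "AE x in lborel. norm (f x powr (p - 1) * g x) \<le> norm (?h x)"
    proof (rule AE_I2)
      fix x
      have "norm (f x powr (p - 1) * g x) = f x powr (p - 1) * g x" using nn(2)[of x] by simp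
      also note pt[of x]
      also have "?h x \<le> norm (?h x)" unfolding real_norm_def by (rule abs_ge_self)
      finally show "norm (f x powr (p - 1) * g x) \<le> norm (?h x)" .
    qed
  qed measurable
  have "(LBINT x. f x powr (p - 1) * g x) \<le> (LBINT x. ?h x)" by (rule integral_mono[OF i hi pt])
  also have "\<dots> = B powr (p - 1) * D * ((1 - 1 / p) * ((LBINT x. f x powr p) / B powr p) + 1 / p * ((LBINT x. g x powr p) / D powr p))"
    using fi by simp
  also have "\<dots> \<le> B powr (p - 1) * D * ((1 - 1 / p) * 1 + 1 / p * 1)"
    using I B D p by (intro mult_left_mono add_mono) auto
  finally show "(LBINT x. f x powr (p - 1) * g x) \<le> B powr (p - 1) * D" by simp
qed

lemma nonlinearity_measurable[measurable (raw)]: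
  assumes [measurable]: "(\<lambda>s. f (a s) (b s)) \<in> borel_measurable M"
  shows "(\<lambda>s. nonlinearity p (f (a s)) (b s)) \<in> borel_measurable M"
  unfolding nonlinearity_def by measurable

text \<open>The source takes \<open>L\<^sup>p\<close> into \<open>L\<^sup>1\<close>; this is why \<open>L\<^sup>1\<close> and \<open>L\<^sup>p\<close> are the two norms in which the
  equation is solved.\<close>

lemma nonlinearity_L1:
  assumes u: "u \<in> Lq_space p" and p: "0 < p"
  shows "nonlinearity p u \<in> Lq_space 1" "Lq_norm 1 (nonlinearity p u) = Lq_norm p u powr p"
proof -
  have [measurable]: "u \<in> borel_measurable borel" using u by measurable
  have i: "integrable lborel (\<lambda>x. norm (u x) powr p)" using u by (simp add: Lq_space_def)
  then show "nonlinearity p u \<in> Lq_space 1" unfolding Lq_space_def nonlinearity_def[abs_def] by simp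
  show "Lq_norm 1 (nonlinearity p u) = Lq_norm p u powr p"
    using Lq_norm_powr[OF u p] by (simp add: Lq_norm_1 nonlinearity_def)
qed

lemma nonlinearity_diff_L1:
  fixes u v :: "real^'n \<Rightarrow> 'k::{real_normed_field,euclidean_space}"
  assumes u: "u \<in> Lq_space p" and v: "v \<in> Lq_space p" and p: "1 < p"
    and B: "Lq_norm p u \<le> B" "Lq_norm p v \<le> B" and D: "Lq_norm p (\<lambda>x. u x - v x) \<le> D"
  shows "Lq_norm 1 (\<lambda>x. nonlinearity p u x - nonlinearity p v x) \<le> 2 * p * B powr (p - 1) * D"
proof -
  have [measurable]: "u \<in> borel_measurable borel" "v \<in> borel_measurable borel" using u v by measurable
  have B0: "0 \<le> B" "0 \<le> D" using order_trans[OF Lq_norm_nonneg B(1)] order_trans[OF Lq_norm_nonneg D] by auto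
  have w: "(\<lambda>x. u x - v x) \<in> Lq_space p" by (rule Lq_diff(1)[OF u v]) (use p in simp)
  have nL: "(\<lambda>x. norm (f x)) \<in> Lq_space p" "Lq_norm p (\<lambda>x. norm (f x)) = Lq_norm p f"
    if "f \<in> Lq_space p" for f :: "real^'n \<Rightarrow> 'k"
    using that by (auto simp: Lq_space_def Lq_norm_def)
  have main: "Lq_norm 1 (\<lambda>x. nonlinearity p u x - nonlinearity p v x) \<le> 2 * p * (B + e) powr (p - 1) * (D + e)" if e: "e > 0" for e
  proof -
    have be: "0 < B + e" "0 < D + e" using B0 e by auto
    note H1 = holder_powr[OF nL(1)[OF u] nL(1)[OF w] p norm_ge_zero norm_ge_zero be(1) _ be(2)]
    note H2 = holder_powr[OF nL(1)[OF v] nL(1)[OF w] p norm_ge_zero norm_ge_zero be(1) _ be(2)]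
    have le: "Lq_norm p (\<lambda>x. norm (u x)) \<le> B + e" "Lq_norm p (\<lambda>x. norm (v x)) \<le> B + e" "Lq_norm p (\<lambda>x. norm (u x - v x)) \<le> D + e"
      using nL(2)[OF u] nL(2)[OF v] nL(2)[OF w] B D e by auto
    let ?g = "\<lambda>x. p * (norm (u x) powr (p - 1) * norm (u x - v x) + norm (v x) powr (p - 1) * norm (u x - v x))"
    have pt: "norm (nonlinearity p u x - nonlinearity p v x) \<le> ?g x" for x
    proof -
      have "norm (nonlinearity p u x - nonlinearity p v x) = \<bar>norm (u x) powr p - norm (v x) powr p\<bar>"
        unfolding nonlinearity_def by (simp flip: of_real_diff)
      also have "\<dots> \<le> p * \<bar>norm (u x) - norm (v x)\<bar> * (norm (u x) powr (p - 1) + norm (v x) powr (p - 1))"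
        using p by (intro powr_abs_diff_le) auto
      also have "\<dots> \<le> p * norm (u x - v x) * (norm (u x) powr (p - 1) + norm (v x) powr (p - 1))"
        using p norm_triangle_ineq3[of "u x" "v x"] by (intro mult_right_mono mult_left_mono) auto
      finally show ?thesis by (simp add: algebra_simps)
    qed
    have "Lq_norm 1 (\<lambda>x. nonlinearity p u x - nonlinearity p v x) \<le> (LBINT x. ?g x)"
      unfolding Lq_norm_1
    proof (rule integral_mono')
      show "integrable lborel ?g" using H1(1) H2(1) le by auto
    qed (use pt p in \<open>auto intro!: mult_nonneg_nonneg add_nonneg_nonneg\<close>)
    also have "\<dots> = p * ((LBINT x. norm (u x) powr (p - 1) * norm (u x - v x)) + (LBINT x. norm (v x) powr (p - 1) * norm (u x - v x)))"
      using H1(1) H2(1) le by simp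
    also have "\<dots> \<le> p * ((B + e) powr (p - 1) * (D + e) + (B + e) powr (p - 1) * (D + e))"
      using H1(2) H2(2) le p by (intro mult_left_mono add_mono) auto
    finally show ?thesis by (simp add: algebra_simps)
  qed
  have "((\<lambda>e. 2 * p * (B + e) powr (p - 1) * (D + e)) \<longlongrightarrow> 2 * p * (B + 0) powr (p - 1) * (D + 0)) (at_right 0)"
    by (intro tendsto_mult tendsto_const tendsto_add tendsto_ident_at tendsto_powr2)
       (use p B0 in \<open>auto intro!: eventually_at_rightI[of 0 1]\<close>)
  moreover have "\<forall>\<^sub>F e in at_right 0. Lq_norm 1 (\<lambda>x. nonlinearity p u x - nonlinearity p v x) \<le> 2 * p * (B + e) powr (p - 1) * (D + e)"
    using eventually_at_right_less[of 0] by eventually_elim (rule main)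
  ultimately have "Lq_norm 1 (\<lambda>x. nonlinearity p u x - nonlinearity p v x) \<le> 2 * p * (B + 0) powr (p - 1) * (D + 0)"
    by (rule tendsto_lowerbound) simp
  then show ?thesis by simp
qed

section \<open>Weakly singular integrals in time\<close>

lemma set_integrable_powr_near_0:
  fixes a c :: real
  assumes "a > - 1" "0 \<le> c"
  shows "set_integrable lborel {0..c} (\<lambda>x. x powr a)"
proof -
  have "(\<integral>\<^sup>+x. ennreal (indicator {0..c} x * x powr a) \<partial>lborel) = ennreal (c powr (a + 1) / (a + 1))"
    using nn_integral_has_integral_lebesgue[OF _ has_integral_powr_from_0[OF assms]] by simp
  then have "integrable lborel (\<lambda>x. indicator {0..c} x * x powr a)"
    by (intro integrableI_nonneg) auto
  then show ?thesis by (simp add: set_integrable_def)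
qed

lemma set_integrable_powr_at_infinity:
  fixes b :: real
  assumes "b > 1"
  shows "set_integrable lborel {1..} (\<lambda>x. x powr (- b))"
proof -
  have "(\<integral>\<^sup>+x. ennreal (indicator {1..} x * x powr (- b)) \<partial>lborel) = ennreal (-(1 powr (- b + 1)) / (- b + 1))"
    using nn_integral_has_integral_lebesgue[OF _ has_integral_powr_to_inf[of "- b" 1]] assms by simp
  then have "integrable lborel (\<lambda>x. indicator {1..} x * x powr (- b))"
    by (intro integrableI_nonneg) auto
  then show ?thesis by (simp add: set_integrable_def)
qed

lemma integrable_reflect:
  fixes f :: "real \<Rightarrow> real"
  shows "integrable lborel (\<lambda>s. f (t - s)) \<longleftrightarrow> integrable lborel f" "(LBINT s. f (t - s)) = (LBINT s. f s)"
proof -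
  show "integrable lborel (\<lambda>s. f (t - s)) \<longleftrightarrow> integrable lborel f"
    using lborel_integrable_real_affine_iff[of "-1" f t] by simp
  show "(LBINT s. f (t - s)) = (LBINT s. f s)"
    using lborel_integral_real_affine[of "-1" f t] by simp
qed

text \<open>If \<open>t-s\<close> exceeds \<open>1+s\<close>, then \<open>(t-s) powr a\<close> is comparable to \<open>(1+t) powr a\<close> and the second
  factor is integrable. Otherwise \<open>1+s\<close> is comparable to \<open>1+t\<close>; then \<open>(1+s) powr (-b)\<close> is split into
  the factors \<open>(1+s) powr a\<close> and \<open>(1+s) powr (-b-a)\<close>, the second of which is paired with
  \<open>(t-s) powr a\<close> to an integrable function of \<open>t-s\<close>, using \<open>-b-a < 0\<close>. Both cases are covered by a
  pointwise bound by \<open>(1+t) powr a\<close> times integrable functions of \<open>s\<close> and of \<open>t-s\<close>, whose integrals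
  do not depend on \<open>t\<close>.\<close>

lemma weakly_singular_integral:
  fixes a b :: real
  assumes a: "- 1 < a" and b: "1 < b"
  shows "\<exists>C>0. \<forall>t\<ge>0. set_integrable lborel {0..t} (\<lambda>s. (t - s) powr a * (1 + s) powr (- b)) \<and>
     (LBINT s:{0..t}. (t - s) powr a * (1 + s) powr (- b)) \<le> C * (1 + t) powr a"
proof -
  \<comment> \<open>integrable at \<open>0\<close> because of \<open>a > -1\<close> and at infinity because of \<open>b > 1\<close>\<close>
  define k where "k x = indicator {0..1} x * x powr a + indicator {1..} x * x powr (- b)" for x :: real
  define j where "j s = indicator {0..} s * (1 + s) powr (- b)" for s :: real
  have ki: "integrable lborel k"
    unfolding k_def using set_integrable_powr_near_0[OF a, of 1] set_integrable_powr_at_infinity[OF b]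
    by (intro Bochner_Integration.integrable_add) (auto simp: set_integrable_def)
  have ji: "integrable lborel j"
  proof -
    have "integrable lborel (\<lambda>s. indicator {1..} (1 + 1 * s) * (1 + 1 * s) powr (- b))"
      using lborel_integrable_real_affine_iff[of 1 "\<lambda>x. indicator {1..} x * x powr (- b)" 1] set_integrable_powr_at_infinity[OF b]
      by (simp add: set_integrable_def)
    moreover have "indicator {1..} (1 + 1 * s) = (indicator {0..} s :: real)" for s :: real by (simp add: indicator_def)
    ultimately show ?thesis by (simp add: j_def[abs_def])
  qed
  have k0: "0 \<le> k x" and j0: "0 \<le> j x" for x by (auto simp: k_def j_def)
  define C where "C = 2 powr \<bar>a\<bar> * ((LBINT s. j s) + (LBINT s. k s)) + 1"
  have "(LBINT s. j s) \<ge> 0" "(LBINT s. k s) \<ge> 0" using k0 j0 by (auto intro: integral_nonneg_AE)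
  then have C: "C > 0" unfolding C_def by (intro add_nonneg_pos mult_nonneg_nonneg) auto
  (* with x = t - s and y = 1 + s, so that x + y = 1 + t *)
  have key: "x powr a * y powr (- b) \<le> 2 powr \<bar>a\<bar> * (x + y) powr a * (y powr (- b) + k x)" if x: "0 \<le> x" and y: "1 \<le> y" for x y
  proof (cases "0 \<le> a")
    case True
    have "x powr a \<le> (x + y) powr a" using True x y by (intro powr_mono2) auto
    also have "\<dots> \<le> 2 powr \<bar>a\<bar> * (x + y) powr a" using ge_one_powr_ge_zero[of 2 "\<bar>a\<bar>"] by (simp add: mult_le_cancel_right1)
    finally have "x powr a * y powr (- b) \<le> 2 powr \<bar>a\<bar> * (x + y) powr a * y powr (- b)" by (rule mult_right_mono) simp
    also have "\<dots> \<le> 2 powr \<bar>a\<bar> * (x + y) powr a * (y powr (- b) + k x)" using k0 by (intro mult_left_mono) auto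
    finally show ?thesis .
  next
    case False
    then have an: "a < 0" by simp
    show ?thesis
    proof (cases "x = 0")
      case True
      then show ?thesis using k0[of 0] by (auto intro!: mult_nonneg_nonneg add_nonneg_nonneg)
    next
      case x0: False
      then have xp: "x > 0" using x by simp
      have two: "(2 * m) powr a * 2 powr \<bar>a\<bar> = m powr a" if "m > 0" for m
      proof -
        have "(2 * m) powr a * 2 powr \<bar>a\<bar> = m powr a * (2 powr a * 2 powr (- a))" using an by (simp add: powr_mult)
        then show ?thesis by (simp flip: powr_add)
      qed
      show ?thesis
      proof (cases "y \<le> x")
        case True
        have "(2 * x) powr a \<le> (x + y) powr a" using True an y by (intro powr_mono2') auto
        then have "x powr a \<le> 2 powr \<bar>a\<bar> * (x + y) powr a" using two[OF xp] by (metis mult.commute mult_right_mono powr_ge_zero)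
        then have "x powr a * y powr (- b) \<le> 2 powr \<bar>a\<bar> * (x + y) powr a * y powr (- b)" by (rule mult_right_mono) simp
        also have "\<dots> \<le> 2 powr \<bar>a\<bar> * (x + y) powr a * (y powr (- b) + k x)" using k0 by (intro mult_left_mono) auto
        finally show ?thesis .
      next
        case False
        have "(2 * y) powr a \<le> (x + y) powr a" using False an xp by (intro powr_mono2') auto
        then have 1: "y powr a \<le> 2 powr \<bar>a\<bar> * (x + y) powr a" using two[of y] y by (metis mult.commute mult_right_mono powr_ge_zero less_le_trans zero_less_one)
        have ab: "- b - a \<le> 0" using a b by simp
        have 2: "x powr a * y powr (- b - a) \<le> k x"
        proof (cases "x \<le> 1")
          case True
          have "y powr (- b - a) \<le> y powr 0" using y ab by (intro powr_mono) auto
          then have "x powr a * y powr (- b - a) \<le> x powr a * 1" using y by (intro mult_left_mono) auto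
          also have "\<dots> \<le> k x" using True xp by (simp add: k_def)
          finally show ?thesis .
        next
          case x1: False
          have "y powr (- b - a) \<le> x powr (- b - a)" using False xp ab by (intro powr_mono2') auto
          then have "x powr a * y powr (- b - a) \<le> x powr a * x powr (- b - a)" by (intro mult_left_mono) auto
          also have "\<dots> = x powr (- b)" by (simp flip: powr_add)
          also have "\<dots> \<le> k x" using x1 by (simp add: k_def)
          finally show ?thesis .
        qed
        have "x powr a * y powr (- b) = y powr a * (x powr a * y powr (- b - a))" by (simp add: mult.left_commute flip: powr_add)
        also have "\<dots> \<le> (2 powr \<bar>a\<bar> * (x + y) powr a) * (y powr (- b) + k x)"
          using 1 2 by (intro mult_mono) (auto intro: add_increasing)
        finally show ?thesis .
      qed
    qed
  qed
  have "set_integrable lborel {0..t} (\<lambda>s. (t - s) powr a * (1 + s) powr (- b)) \<and>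
     (LBINT s:{0..t}. (t - s) powr a * (1 + s) powr (- b)) \<le> C * (1 + t) powr a" if t: "t \<ge> 0" for t
  proof -
    let ?f = "\<lambda>s. indicator {0..t} s *\<^sub>R ((t - s) powr a * (1 + s) powr (- b))"
    let ?g = "\<lambda>s. 2 powr \<bar>a\<bar> * (1 + t) powr a * (j s + k (t - s))"
    have gi: "integrable lborel ?g" using ji ki integrable_reflect(1)[of k t] by simp
    have le: "?f s \<le> ?g s" for s
    proof (cases "0 \<le> s \<and> s \<le> t")
      case True
      then show ?thesis using key[of "t - s" "1 + s"] by (simp add: j_def add.commute)
    next
      case False
      then show ?thesis using k0[of "t - s"] j0[of s] by (auto intro!: mult_nonneg_nonneg add_nonneg_nonneg)
    qed
    have f0: "0 \<le> ?f s" for s by simp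
    have fi: "integrable lborel ?f"
      by (rule Bochner_Integration.integrable_bound[OF gi]) (use le f0 in \<open>auto intro!: AE_I2 order_trans[OF _ abs_ge_self]\<close>)
    have "(LBINT s. ?f s) \<le> (LBINT s. ?g s)" by (rule integral_mono[OF fi gi le])
    also have "\<dots> = 2 powr \<bar>a\<bar> * (1 + t) powr a * ((LBINT s. j s) + (LBINT s. k s))"
      using ji ki integrable_reflect[of k t] by simp
    also have "\<dots> \<le> C * (1 + t) powr a" by (simp add: C_def algebra_simps)
    finally show ?thesis using fi by (simp add: set_integrable_def set_lebesgue_integral_def)
  qed
  then show ?thesis using C by blast
qed

section \<open>Limits and curves in \<open>L\<^sup>q\<close>\<close>

text \<open>A series that converges absolutely in \<open>L\<^sup>1\<close> converges absolutely at almost every point. This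
  is how pointwise limits of Picard iterates, and of step functions, are obtained.\<close>

lemma AE_summable_of_L1_summable:
  fixes g :: "nat \<Rightarrow> real^'n \<Rightarrow> 'k::{real_normed_field,euclidean_space}"
  assumes g: "\<And>m. g m \<in> Lq_space 1" and s: "summable (\<lambda>m. Lq_norm 1 (g m))"
  shows "AE x in lborel. summable (\<lambda>m. norm (g m x))"
proof -
  have [measurable]: "g m \<in> borel_measurable borel" for m using g by measurable
  have "(\<integral>\<^sup>+x. (\<Sum>m. ennreal (norm (g m x))) \<partial>lborel) = (\<Sum>m. \<integral>\<^sup>+x. ennreal (norm (g m x)) \<partial>lborel)"
    by (rule nn_integral_suminf) measurable
  also have "\<dots> = (\<Sum>m. ennreal (Lq_norm 1 (g m)))"
    using Lq_nn_integral[OF g] by simp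
  also have "\<dots> = ennreal (\<Sum>m. Lq_norm 1 (g m))" using s by (intro suminf_ennreal2) auto
  finally have "(\<integral>\<^sup>+x. (\<Sum>m. ennreal (norm (g m x))) \<partial>lborel) \<noteq> \<infinity>" by simp
  then have "AE x in lborel. (\<Sum>m. ennreal (norm (g m x))) \<noteq> \<infinity>"
    by (intro nn_integral_noteq_infinite) measurable
  then show ?thesis
    by eventually_elim (auto intro!: summable_suminf_not_top)
qed

lemma Lq_fatou:
  assumes F: "\<And>m. F m \<in> Lq_space q" "\<And>m. Lq_norm q (F m) \<le> B" and q: "1 \<le> q"
    and [measurable]: "f \<in> borel_measurable borel" and lim: "AE x in lborel. (\<lambda>m. F m x) \<longlonglongrightarrow> f x"
  shows "f \<in> Lq_space q" "Lq_norm q f \<le> B"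
proof -
  have [measurable]: "F m \<in> borel_measurable borel" for m using F(1) by measurable
  have B: "0 \<le> B" using order_trans[OF Lq_norm_nonneg F(2)] .
  have "(\<integral>\<^sup>+x. ennreal (norm (f x) powr q) \<partial>lborel) = (\<integral>\<^sup>+x. liminf (\<lambda>m. ennreal (norm (F m x) powr q)) \<partial>lborel)"
  proof (rule nn_integral_cong_AE)
    show "AE x in lborel. ennreal (norm (f x) powr q) = liminf (\<lambda>m. ennreal (norm (F m x) powr q))"
      using lim
    proof eventually_elim
      case (elim x)
      have "(\<lambda>m. ennreal (norm (F m x) powr q)) \<longlonglongrightarrow> ennreal (norm (f x) powr q)"
        using q by (intro tendsto_ennrealI tendsto_powr2 tendsto_norm elim) auto
      then show ?case using lim_imp_Liminf[OF sequentially_bot] by metis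
    qed
  qed
  also have "\<dots> \<le> liminf (\<lambda>m. \<integral>\<^sup>+x. ennreal (norm (F m x) powr q) \<partial>lborel)"
    by (rule nn_integral_liminf) measurable
  also have "\<dots> \<le> ennreal (B powr q)"
  proof -
    have "(\<integral>\<^sup>+x. ennreal (norm (F m x) powr q) \<partial>lborel) \<le> ennreal (B powr q)" for m
      using Lq_nn_integral[OF F(1)] q F(2) by (simp add: ennreal_leI powr_mono2)
    then show ?thesis
      by (intro order_trans[OF Liminf_le_Limsup Limsup_bounded]) auto
  qed
  finally have le: "(\<integral>\<^sup>+x. ennreal (norm (f x) powr q) \<partial>lborel) \<le> ennreal (B powr q)" .
  show "f \<in> Lq_space q" "Lq_norm q f \<le> B" using q B by (intro Lq_boundI[OF _ _ _ le]; simp)+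
qed

text \<open>Curves are considered on \<open>[0, \<infinity>)\<close>, hence continuity at \<open>0\<close> is one-sided.\<close>

abbreviation Lq_continuous_at :: "real \<Rightarrow> (real \<Rightarrow> real^'n \<Rightarrow> 'k::{real_normed_field,euclidean_space}) \<Rightarrow> real \<Rightarrow> bool" where
  "Lq_continuous_at q u t \<equiv> ((\<lambda>s. Lq_norm q (\<lambda>x. u s x - u t x)) \<longlongrightarrow> 0) (at t within {0..})"

text \<open>Compactness of the time interval, applied to a sequence of pairs of times that would violate
  uniform continuity.\<close>

lemma L1_curve_uniformly_continuous:
  fixes u :: "real \<Rightarrow> real^'n \<Rightarrow> 'k::{real_normed_field,euclidean_space}"
  assumes u: "\<And>t. t \<ge> 0 \<Longrightarrow> u t \<in> Lq_space 1"
    and cont: "\<And>t. t \<ge> 0 \<Longrightarrow> Lq_continuous_at 1 u t"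
    and e: "e > 0"
  shows "\<exists>\<delta>>0. \<forall>s\<in>{0..T}. \<forall>t\<in>{0..T}. \<bar>s - t\<bar> < \<delta> \<longrightarrow> Lq_norm 1 (\<lambda>x. u s x - u t x) < e"
proof (rule ccontr)
  assume "\<not> ?thesis"
  then have "\<forall>i. \<exists>s t. s \<in> {0..T} \<and> t \<in> {0..T} \<and> \<bar>s - t\<bar> < inverse (real (Suc i)) \<and> e \<le> Lq_norm 1 (\<lambda>x. u s x - u t x)"
    by (metis inverse_positive_iff_positive linorder_not_less of_nat_0_less_iff zero_less_Suc)
  then obtain s t where st: "\<And>i. s i \<in> {0..T}" "\<And>i. t i \<in> {0..T}" "\<And>i. \<bar>s i - t i\<bar> < inverse (real (Suc i))" "\<And>i. e \<le> Lq_norm 1 (\<lambda>x. u (s i) x - u (t i) x)"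
    by metis
  have "compact {0..T}" by simp
  then obtain l r where l: "l \<in> {0..T}" "strict_mono r" "(s \<circ> r) \<longlonglongrightarrow> l"
    unfolding compact_def using st(1) by blast
  have sl: "(\<lambda>i. s (r i)) \<longlonglongrightarrow> l" using l(3) by (simp add: comp_def)
  have "(\<lambda>i. s (r i) - t (r i)) \<longlonglongrightarrow> 0"
  proof (rule Lim_null_comparison)
    show "\<forall>\<^sub>F i in sequentially. norm (s (r i) - t (r i)) \<le> inverse (real (Suc (r i)))"
      using st(3) by (auto intro!: always_eventually less_imp_le)
    show "(\<lambda>i. inverse (real (Suc (r i)))) \<longlonglongrightarrow> 0"
      using LIMSEQ_subseq_LIMSEQ[OF LIMSEQ_inverse_real_of_nat l(2)] by (simp add: comp_def)
  qed
  from tendsto_diff[OF sl this] have tl: "(\<lambda>i. t (r i)) \<longlonglongrightarrow> l" by simp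
  let ?d = "\<lambda>a. Lq_norm 1 (\<lambda>x. u a x - u l x)"
  have dl: "(\<lambda>i. ?d (a i)) \<longlonglongrightarrow> 0" if "a \<longlonglongrightarrow> l" "\<And>i. a i \<in> {0..T}" for a
  proof -
    have "(?d \<longlongrightarrow> ?d l) (at l within {0..})" using cont[of l] l by simp
    then have "continuous (at l within {0..}) ?d" by (simp add: continuous_within)
    then have "(\<lambda>i. ?d (a i)) \<longlonglongrightarrow> ?d l"
      using that by (intro continuous_within_tendsto_compose[of l "{0..}" ?d]) auto
    then show ?thesis by simp
  qed
  have "(\<lambda>i. ?d (s (r i)) + ?d (t (r i))) \<longlonglongrightarrow> 0 + 0"
    by (intro tendsto_add dl sl tl st)
  then have "\<forall>\<^sub>F i in sequentially. ?d (s (r i)) + ?d (t (r i)) < e" using order_tendstoD(2) e by fastforce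
  then obtain i where i: "?d (s (r i)) + ?d (t (r i)) < e" by (auto simp: eventually_sequentially)
  have "Lq_norm 1 (\<lambda>x. u (s (r i)) x - u (t (r i)) x) \<le> ?d (s (r i)) + Lq_norm 1 (\<lambda>x. u l x - u (t (r i)) x)"
    using st l by (intro Lq_norm_triangle u) auto
  also have "Lq_norm 1 (\<lambda>x. u l x - u (t (r i)) x) = ?d (t (r i))" by (rule Lq_norm_diff_commute)
  finally show False using i st(4)[of "r i"] by simp
qed

text \<open>A curve of equivalence classes need not be measurable as a function of two variables. By
  uniform continuity the curve is approximated by step functions in time, which are measurable in
  both variables, at a rate \<open>(1/2)^m\<close> on \<open>[0, m]\<close>; hence they converge for each time at almost every
  point, and their limit is the version.\<close>

lemma L1_curve_measurable_version:
  fixes u :: "real \<Rightarrow> real^'n \<Rightarrow> 'k::{real_normed_field,euclidean_space}"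
  assumes u: "\<And>t. t \<ge> 0 \<Longrightarrow> u t \<in> Lq_space 1"
    and cont: "\<And>t. t \<ge> 0 \<Longrightarrow> Lq_continuous_at 1 u t"
  shows "\<exists>u'. (\<lambda>(s, x). u' s x) \<in> borel_measurable (lborel \<Otimes>\<^sub>M lborel) \<and> (\<forall>s\<ge>0. AE x in lborel. u' s x = u s x)"
proof -
  have "\<exists>N::nat. N > 0 \<and> (\<forall>s\<in>{0..real m}. \<forall>t\<in>{0..real m}. \<bar>s - t\<bar> \<le> 1 / real N \<longrightarrow> Lq_norm 1 (\<lambda>x. u s x - u t x) < (1/2)^m)" for m
  proof -
    obtain \<delta> where d: "\<delta> > 0" "\<forall>s\<in>{0..real m}. \<forall>t\<in>{0..real m}. \<bar>s - t\<bar> < \<delta> \<longrightarrow> Lq_norm 1 (\<lambda>x. u s x - u t x) < (1/2)^m"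
      using L1_curve_uniformly_continuous[OF u cont, of "(1/2)^m" "real m"] by auto
    obtain N where "inverse (real (Suc N)) < \<delta>" using d(1) reals_Archimedean by blast
    then have "1 / real (Suc N) < \<delta>" by (simp only: inverse_eq_divide)
    then show ?thesis using d(2) by (intro exI[of _ "Suc N"] conjI ballI impI) (blast intro: le_less_trans zero_less_Suc)+
  qed
  then obtain N :: "nat \<Rightarrow> nat" where N: "\<And>m. N m > 0"
    "\<And>m s t. s \<in> {0..real m} \<Longrightarrow> t \<in> {0..real m} \<Longrightarrow> \<bar>s - t\<bar> \<le> 1 / real (N m) \<Longrightarrow> Lq_norm 1 (\<lambda>x. u s x - u t x) < (1/2)^m"
    by metis
  \<comment> \<open>rounding the time down to a multiple of \<open>1 / N m\<close>; the modulus keeps the grid in \<open>[0, \<infinity>)\<close>\<close>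
  define v where "v m s x = u (real_of_int \<lfloor>real (N m) * \<bar>s\<bar>\<rfloor> / real (N m)) x" for m s x
  have vm: "(\<lambda>p. v m (fst p) (snd p)) \<in> borel_measurable (lborel \<Otimes>\<^sub>M lborel)" for m
    unfolding v_def
  proof (rule measurable_compose_countable[where g = "\<lambda>p. nat \<lfloor>real (N m) * \<bar>fst p\<bar>\<rfloor>" and f = "\<lambda>i p. u (real i / real (N m)) (snd p)", THEN measurable_cong[THEN iffD1, rotated]])
    fix i :: nat
    have [measurable]: "u (real i / real (N m)) \<in> borel_measurable borel" using u[of "real i / real (N m)"] by (intro Lq_measurable[of _ 1]) auto
    show "(\<lambda>p. u (real i / real (N m)) (snd p)) \<in> borel_measurable (lborel \<Otimes>\<^sub>M lborel)" by measurable
  next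
    show "(\<lambda>p. nat \<lfloor>real (N m) * \<bar>fst p\<bar>\<rfloor>) \<in> lborel \<Otimes>\<^sub>M lborel \<rightarrow>\<^sub>M count_space UNIV" by measurable
  next
    fix p :: "real \<times> (real^'n)"
    have "real (nat \<lfloor>real (N m) * \<bar>fst p\<bar>\<rfloor>) = real_of_int \<lfloor>real (N m) * \<bar>fst p\<bar>\<rfloor>"
      by (simp add: of_nat_nat)
    then show "u (real (nat \<lfloor>real (N m) * \<bar>fst p\<bar>\<rfloor>) / real (N m)) (snd p) = u (real_of_int \<lfloor>real (N m) * \<bar>fst p\<bar>\<rfloor> / real (N m)) (snd p)" by simp
  qed
  have "AE x in lborel. (\<lambda>m. v m s x) \<longlonglongrightarrow> u s x" if s: "s \<ge> 0" for s
  proof -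
    obtain m0 :: nat where m0: "s \<le> real m0" using real_arch_simple by blast
    let ?g = "\<lambda>m x. v (m + m0) s x - u s x"
    have fl: "0 \<le> real_of_int \<lfloor>real (N m) * \<bar>s\<bar>\<rfloor> / real (N m)" "real_of_int \<lfloor>real (N m) * \<bar>s\<bar>\<rfloor> / real (N m) \<le> s"
        "\<bar>real_of_int \<lfloor>real (N m) * \<bar>s\<bar>\<rfloor> / real (N m) - s\<bar> \<le> 1 / real (N m)" for m
    proof -
      define k where "k = real_of_int \<lfloor>real (N m) * \<bar>s\<bar>\<rfloor>"
      have n: "real (N m) > 0" using N(1) by simp
      have k: "0 \<le> k" "k \<le> real (N m) * s" "real (N m) * s \<le> k + 1" using s unfolding k_def by (auto simp: le_floor_iff)
      show "0 \<le> real_of_int \<lfloor>real (N m) * \<bar>s\<bar>\<rfloor> / real (N m)" unfolding k_def[symmetric] using k n by simp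
      show l: "real_of_int \<lfloor>real (N m) * \<bar>s\<bar>\<rfloor> / real (N m) \<le> s" unfolding k_def[symmetric] using k n by (simp add: divide_le_eq mult.commute)
      have "s \<le> k / real (N m) + 1 / real (N m)" using k n by (simp add: add_divide_distrib[symmetric] le_divide_eq mult.commute)
      then show "\<bar>real_of_int \<lfloor>real (N m) * \<bar>s\<bar>\<rfloor> / real (N m) - s\<bar> \<le> 1 / real (N m)"
        using l unfolding k_def[symmetric] by linarith
    qed
    have gL: "?g m \<in> Lq_space 1" for m
      unfolding v_def by (intro Lq_diff(1) u s fl) simp
    have gb: "Lq_norm 1 (?g m) \<le> (1/2) ^ m" for m
    proof -
      have "Lq_norm 1 (?g m) < (1/2) ^ (m + m0)"
        unfolding v_def by (rule N(2)) (use fl[of "m + m0"] s m0 in auto)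
      also have "\<dots> \<le> (1/2) ^ m" by (intro power_decreasing) auto
      finally show ?thesis by simp
    qed
    have "summable (\<lambda>m. Lq_norm 1 (?g m))"
      by (rule summable_comparison_test'[of "\<lambda>m. (1/2)^m :: real" 0]) (use gb in \<open>auto intro: summable_geometric\<close>)
    from AE_summable_of_L1_summable[OF gL this] show ?thesis
    proof eventually_elim
      case (elim x)
      then have "(\<lambda>m. norm (?g m x)) \<longlonglongrightarrow> 0" by (rule summable_LIMSEQ_zero)
      then have "(\<lambda>m. v (m + m0) s x) \<longlonglongrightarrow> u s x" by (simp add: tendsto_norm_zero_iff LIM_zero_iff)
      then show ?case by (rule LIMSEQ_offset)
    qed
  qed
  then have conv: "s \<ge> 0 \<Longrightarrow> AE x in lborel. (\<lambda>m. v m s x) \<longlonglongrightarrow> u s x" for s .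
  have "AE x in lborel. lim (\<lambda>m. v m s x) = u s x" if "s \<ge> 0" for s
    using conv[OF that] by eventually_elim (rule limI)
  then have "\<forall>s\<ge>0. AE x in lborel. lim (\<lambda>m. v m s x) = u s x" by blast
  moreover have "(\<lambda>(s, x). lim (\<lambda>m. v m s x)) \<in> borel_measurable (lborel \<Otimes>\<^sub>M lborel)"
    unfolding split_beta' by (rule borel_measurable_lim_metric) (rule vm)
  ultimately show ?thesis by blast
qed

section \<open>Gamma integrals with complex parameter\<close>

text \<open>Cauchy's estimate turns a local bound on the integrand into a bound on its derivative, which
  allows differentiation under the integral.\<close>

lemma holomorphic_on_integral:
  fixes f :: "complex \<Rightarrow> 'a \<Rightarrow> complex"
  assumes U: "open U"
    and hol: "\<And>x. x \<in> space M \<Longrightarrow> (\<lambda>c. f c x) holomorphic_on U"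
    and meas: "\<And>c. c \<in> U \<Longrightarrow> f c \<in> borel_measurable M"
    and bound: "\<And>c. c \<in> U \<Longrightarrow> \<exists>r>0. \<exists>B. cball c r \<subseteq> U \<and> integrable M B \<and>
        (\<forall>c'\<in>cball c r. \<forall>x\<in>space M. norm (f c' x) \<le> B x)"
  shows "(\<lambda>c. \<integral>x. f c x \<partial>M) holomorphic_on U"
proof -
  have int: "integrable M (f c)" if cU: "c \<in> U" for c
  proof -
    obtain r B where "r > 0" "integrable M B" "\<forall>c'\<in>cball c r. \<forall>x\<in>space M. norm (f c' x) \<le> B x"
      using bound[OF cU] by blast
    then show ?thesis using meas[OF cU]
      by (intro Bochner_Integration.integrable_bound[of M B "f c"] AE_I2)
         (auto intro!: order_trans[OF _ abs_ge_self])
  qed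
  have "((\<lambda>c. \<integral>x. f c x \<partial>M) has_field_derivative (\<integral>x. deriv (\<lambda>c. f c x) c \<partial>M)) (at c)" if c: "c \<in> U" for c
  proof -
    obtain r B where r: "r > 0" and sub: "cball c r \<subseteq> U" and B: "integrable M B"
      and le: "\<And>c' x. c' \<in> cball c r \<Longrightarrow> x \<in> space M \<Longrightarrow> norm (f c' x) \<le> B x"
      using bound[OF c] by blast
    have der: "((\<lambda>c. f c x) has_field_derivative deriv (\<lambda>c. f c x) z) (at z)" if "x \<in> space M" "z \<in> U" for x z
      using holomorphic_derivI[OF hol[OF that(1)] U that(2)] .
    have dle: "norm (deriv (\<lambda>c. f c x) z) \<le> B x / (r/2)" if x: "x \<in> space M" and z: "z \<in> cball c (r/2)" for x z
    proof -
      have s: "cball z (r/2) \<subseteq> cball c r"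
      proof
        fix w assume "w \<in> cball z (r/2)"
        then show "w \<in> cball c r" using z dist_triangle[of c w z] by simp
      qed
      have "norm ((deriv ^^ 1) (\<lambda>c. f c x) z) \<le> fact 1 * B x / (r/2) ^ 1"
      proof (rule Cauchy_inequality)
        show "(\<lambda>c. f c x) holomorphic_on ball z (r/2)"
          by (rule holomorphic_on_subset[OF hol[OF x]]) (use s sub in force)
        show "continuous_on (cball z (r/2)) (\<lambda>c. f c x)"
          by (rule continuous_on_subset[OF holomorphic_on_imp_continuous_on[OF hol[OF x]]]) (use s sub in force)
        show "norm (f w x) \<le> B x" if "norm (z - w) = r/2" for w
          using s that x by (intro le) (auto simp: dist_norm subset_eq)
      qed (use r in auto)
      then show ?thesis by simp
    qed
    have diff: "norm (f (c + h) x - f c x) \<le> B x / (r/2) * norm h" if x: "x \<in> space M" and h: "norm h \<le> r/2" for x h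
    proof -
      have "norm (f (c + h) x - f c x) \<le> B x / (r/2) * norm (c + h - c)"
      proof (rule field_differentiable_bound[of "cball c (r/2)"])
        fix z assume z: "z \<in> cball c (r/2)"
        then have "z \<in> U" using sub r by (auto simp: subset_eq)
        then show "((\<lambda>c. f c x) has_field_derivative deriv (\<lambda>c. f c x) z) (at z within cball c (r/2))"
          using der[OF x] has_field_derivative_at_within by blast
        show "norm (deriv (\<lambda>c. f c x) z) \<le> B x / (r/2)" by (rule dle[OF x z])
      qed (use h r in \<open>auto simp: dist_norm\<close>)
      then show ?thesis by simp
    qed
    have seq: "(\<lambda>i. ((\<integral>x. f (c + h i) x \<partial>M) - (\<integral>x. f c x \<partial>M)) / h i) \<longlonglongrightarrow> (\<integral>x. deriv (\<lambda>c. f c x) c \<partial>M)"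
      if h0: "\<And>i. h i \<noteq> 0" and hlim: "h \<longlonglongrightarrow> 0" and hr: "\<And>i. norm (h i) \<le> r/2" for h
    proof -
      have cU: "c + h i \<in> U" for i using sub hr[of i] r by (auto simp: subset_eq dist_norm)
      have lim: "(\<lambda>i. (f (c + h i) x - f c x) / h i) \<longlonglongrightarrow> deriv (\<lambda>c. f c x) c" if "x \<in> space M" for x
      proof -
        have "((\<lambda>h. (f (c + h) x - f c x) / h) \<longlongrightarrow> deriv (\<lambda>c. f c x) c) (at 0)"
          using der[OF that c] by (simp add: DERIV_def)
        then show ?thesis using h0 hlim by (auto simp: tendsto_at_iff_sequentially comp_def)
      qed
      have m: "(\<lambda>x. (f (c + h i) x - f c x) / h i) \<in> borel_measurable M" for i
        using meas[OF c] meas[OF cU[of i]] by measurable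
      have "(\<lambda>i. \<integral>x. (f (c + h i) x - f c x) / h i \<partial>M) \<longlonglongrightarrow> (\<integral>x. deriv (\<lambda>c. f c x) c \<partial>M)"
      proof (rule integral_dominated_convergence[where w = "\<lambda>x. B x / (r/2)"])
        show "(\<lambda>x. deriv (\<lambda>c. f c x) c) \<in> borel_measurable M"
          by (rule borel_measurable_LIMSEQ_metric[OF m lim])
        show "AE x in M. norm ((f (c + h i) x - f c x) / h i) \<le> B x / (r/2)" for i
        proof (rule AE_I2)
          fix x assume "x \<in> space M"
          from diff[OF this hr[of i]] show "norm ((f (c + h i) x - f c x) / h i) \<le> B x / (r/2)"
            using h0[of i] by (simp add: norm_divide divide_le_eq)
        qed
      qed (use m lim B in auto)
      also have "(\<lambda>i. \<integral>x. (f (c + h i) x - f c x) / h i \<partial>M) = (\<lambda>i. ((\<integral>x. f (c + h i) x \<partial>M) - (\<integral>x. f c x \<partial>M)) / h i)"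
        using int[OF c] int[OF cU] by simp
      finally show ?thesis .
    qed
    have "((\<lambda>h. ((\<integral>x. f (c + h) x \<partial>M) - (\<integral>x. f c x \<partial>M)) / h) \<longlongrightarrow> (\<integral>x. deriv (\<lambda>c. f c x) c \<partial>M)) (at 0 within ball 0 (r/2))"
      unfolding tendsto_at_iff_sequentially using seq by (auto simp: comp_def less_imp_le)
    then have "((\<lambda>h. ((\<integral>x. f (c + h) x \<partial>M) - (\<integral>x. f c x \<partial>M)) / h) \<longlongrightarrow> (\<integral>x. deriv (\<lambda>c. f c x) c \<partial>M)) (at 0)"
      using r by (subst (asm) at_within_open) auto
    then show ?thesis by (simp add: DERIV_def)
  qed
  then show ?thesis by (meson field_differentiable_at_within field_differentiable_def holomorphic_onI)
qed

text \<open>Formulas with a complex parameter of positive real part are proved below for real parameters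
  and transferred by this identity theorem.\<close>

lemma right_half_plane_identity:
  assumes F: "F holomorphic_on {z. Re z > 0}" and G: "G holomorphic_on {z. Re z > 0}"
    and eq: "\<And>k. k > 0 \<Longrightarrow> F (complex_of_real k) = G (complex_of_real k)" and c: "Re c > 0"
  shows "F c = G c"
proof -
  have "1 islimpt (complex_of_real ` {0<..})"
    unfolding islimpt_approachable
  proof (intro allI impI)
    fix e :: real assume e: "e > 0"
    have "dist (complex_of_real (1 + e / 2)) 1 < e"
      using e by (simp add: dist_norm)
    moreover have "complex_of_real (1 + e / 2) \<noteq> 1"
      using e by (simp only: of_real_eq_1_iff)
    ultimately show "\<exists>x'\<in>complex_of_real ` {0<..}. x' \<noteq> 1 \<and> dist x' 1 < e"
      using e by (intro bexI[of _ "complex_of_real (1 + e / 2)"] conjI imageI) auto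
  qed
  note lim = this
  have "F c - G c = 0"
    by (rule analytic_continuation[of "\<lambda>z. F z - G z" "{z. Re z > 0}" "complex_of_real ` {0<..}" 1])
       (use lim F G eq c in \<open>auto intro!: holomorphic_intros open_halfspace_Re_gt convex_connected convex_halfspace_Re_gt\<close>)
  then show ?thesis by simp
qed

lemma Gamma_integral_scaled:
  fixes x k :: real
  assumes x: "x > 0" and k: "k > 0"
  shows "set_integrable lborel {0..} (\<lambda>s. s powr (x - 1) * exp (- k * s))"
    and "(LBINT s:{0..}. s powr (x - 1) * exp (- k * s)) = Gamma x * k powr (- x)"
proof -
  let ?f = "\<lambda>t. indicator {0..} t * t powr (x - 1) / exp t :: real"
  have n: "(\<integral>\<^sup>+t. ennreal (?f t) \<partial>lborel) = ennreal (Gamma x)"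
    using Gamma_conv_nn_integral_real[OF x] by simp
  have G: "Gamma x > 0" using x by (rule Gamma_real_pos)
  have hb: "has_bochner_integral lborel ?f (Gamma x)"
    by (rule has_bochner_integral_nn_integral[OF _ _ _ n]) (use G in \<open>auto simp: indicator_def\<close>)
  have "has_bochner_integral lborel (\<lambda>s. ?f (0 + k * s)) (Gamma x /\<^sub>R \<bar>k\<bar>)"
    using lborel_has_bochner_integral_real_affine_iff[of k ?f "Gamma x" 0] hb k by simp
  then have "has_bochner_integral lborel (\<lambda>s. k powr (1 - x) * ?f (0 + k * s)) (k powr (1 - x) * (Gamma x /\<^sub>R \<bar>k\<bar>))"
    by (rule has_bochner_integral_mult_right)
  also have "k powr (1 - x) * (Gamma x /\<^sub>R \<bar>k\<bar>) = Gamma x * k powr (- x)"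
    using k by (simp add: powr_diff powr_minus field_simps)
  also have "(\<lambda>s. k powr (1 - x) * ?f (0 + k * s)) = (\<lambda>s. indicator {0..} s *\<^sub>R (s powr (x - 1) * exp (- k * s)))"
  proof
    fix s
    show "k powr (1 - x) * ?f (0 + k * s) = indicator {0..} s *\<^sub>R (s powr (x - 1) * exp (- k * s))"
    proof (cases "s \<ge> 0")
      case True
      have "k powr (1 - x) * k powr (x - 1) = 1" using k by (simp flip: powr_add)
      then show ?thesis using True k by (simp add: powr_mult exp_minus field_simps)
    qed (use k in \<open>auto simp: indicator_def zero_le_mult_iff\<close>)
  qed
  finally show "set_integrable lborel {0..} (\<lambda>s. s powr (x - 1) * exp (- k * s))"
    "(LBINT s:{0..}. s powr (x - 1) * exp (- k * s)) = Gamma x * k powr (- x)"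
    by (auto simp: set_integrable_def set_lebesgue_integral_def has_bochner_integral_iff)
qed

lemma exp_decay_integrable:
  fixes k :: real
  assumes "k > 0"
  shows "set_integrable lborel {0..} (\<lambda>s. exp (- k * s))"
proof -
  have "integrable lborel (\<lambda>s. indicator {0..} s *\<^sub>R (s powr (1 - 1) * exp (- k * s)))"
    using Gamma_integral_scaled(1)[of 1 k] assms by (simp add: set_integrable_def)
  moreover have "AE s in lborel. s \<noteq> (0::real)" by (rule AE_lborel_singleton)
  then have "AE s in lborel. indicator {0..} s *\<^sub>R (s powr (1 - 1) * exp (- k * s)) = indicator {0..} s *\<^sub>R exp (- k * s)"
    by eventually_elim (auto simp: indicator_def)
  ultimately show ?thesis unfolding set_integrable_def by (subst (asm) integrable_cong_AE) auto
qed

lemma Gamma_integral_complex_scaled: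
  fixes x :: real
  assumes x: "x > 0" and c: "Re c > 0"
  shows "(LBINT s:{0..}. of_real (s powr (x - 1)) * exp (- c * of_real s)) = of_real (Gamma x) * c powr (- of_real x)"
proof -
  let ?f = "\<lambda>c (s::real). indicator {0..} s *\<^sub>R (complex_of_real (s powr (x - 1)) * exp (- c * complex_of_real s))"
  have "(\<lambda>c. LBINT s. ?f c s) holomorphic_on {z. Re z > 0}"
  proof (rule holomorphic_on_integral)
    show "open {z. Re z > 0}" by (rule open_halfspace_Re_gt)
    show "(\<lambda>c. ?f c s) holomorphic_on {z. 0 < Re z}" for s
      unfolding scaleR_conv_of_real by (intro holomorphic_intros)
    show "?f c \<in> borel_measurable lborel" for c by measurable
    fix c :: complex assume "c \<in> {z. 0 < Re z}"
    then have c: "Re c > 0" by simp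
    let ?B = "\<lambda>s. indicator {0..} s *\<^sub>R (s powr (x - 1) * exp (- (Re c / 2) * s))"
    have R: "Re c' \<ge> Re c / 2" if "c' \<in> cball c (Re c / 2)" for c'
      using that abs_Re_le_cmod[of "c - c'"] by (simp add: dist_norm)
    show "\<exists>r>0. \<exists>B. cball c r \<subseteq> {z. 0 < Re z} \<and> integrable lborel B \<and> (\<forall>c'\<in>cball c r. \<forall>s\<in>space lborel. norm (?f c' s) \<le> B s)"
    proof (intro exI[of _ "Re c / 2"] exI[of _ ?B] conjI ballI)
      show "cball c (Re c / 2) \<subseteq> {z. 0 < Re z}" using R c by force
      show "integrable lborel ?B" using Gamma_integral_scaled(1)[OF x, of "Re c / 2"] c by (simp add: set_integrable_def)
      fix c' s assume c': "c' \<in> cball c (Re c / 2)"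
      show "norm (?f c' s) \<le> ?B s"
        using mult_right_mono[OF R[OF c'], of s]
        by (auto simp: indicator_def norm_mult intro!: mult_left_mono)
    qed (use c in auto)
  qed
  moreover have "(\<lambda>c. complex_of_real (Gamma x) * c powr (- of_real x)) holomorphic_on {z. Re z > 0}"
    by (intro holomorphic_intros) (auto simp: complex_nonpos_Reals_iff)
  ultimately have "(LBINT s. ?f c s) = complex_of_real (Gamma x) * c powr (- of_real x)"
  proof (rule right_half_plane_identity)
    fix k :: real assume k: "k > 0"
    have "(LBINT s. ?f (of_real k) s) = (LBINT s. complex_of_real (indicator {0..} s *\<^sub>R (s powr (x - 1) * exp (- k * s))))"
      by (intro Bochner_Integration.integral_cong) (auto simp: indicator_def simp flip: exp_of_real)
    also have "\<dots> = complex_of_real (Gamma x * k powr (- x))"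
      using Gamma_integral_scaled(2)[OF x k] by (simp only: integral_complex_of_real set_lebesgue_integral_def)
    also have "\<dots> = complex_of_real (Gamma x) * of_real k powr (- of_real x)"
      using k by (simp flip: powr_of_real)
    finally show "(LBINT s. ?f (of_real k) s) = complex_of_real (Gamma x) * of_real k powr (- of_real x)" .
  qed (rule c)
  then show ?thesis by (simp add: set_lebesgue_integral_def)
qed

section \<open>Integrals along rays\<close>

text \<open>The second part is the fundamental theorem of calculus on the infinite ray: it expresses the
  integral by the limit of a primitive at infinity.\<close>

lemma ray_integral:
  fixes f :: "complex \<Rightarrow> complex" and R c C :: real and d :: complex
  assumes c: "c > 0"
    and cont: "continuous_on {0..} (\<lambda>s::real. f (of_real R + of_real s * d))"
    and bd: "\<And>s. s \<ge> 0 \<Longrightarrow> norm (f (of_real R + of_real s * d)) \<le> C * exp (- c * s)"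
  shows "set_integrable lborel {0..} (\<lambda>s. f (of_real R + of_real s * d))"
    and "(\<And>s. s \<ge> 0 \<Longrightarrow> (P has_field_derivative f (of_real R + of_real s * d)) (at (of_real R + of_real s * d))) \<Longrightarrow>
      ((\<lambda>T. P (of_real R + of_real T * d)) \<longlongrightarrow> P (of_real R) + (LBINT s:{0..}. d * f (of_real R + of_real s * d))) at_top"
proof -
  show i: "set_integrable lborel {0..} (\<lambda>s. f (of_real R + of_real s * d))"
  proof (rule set_integrable_bound)
    show "set_integrable lborel {0..} (\<lambda>s. C * exp (- c * s))"
      using exp_decay_integrable[OF c] by (rule set_integrable_mult_right)
    show "set_borel_measurable lborel {0..} (\<lambda>s. f (of_real R + of_real s * d))"
      using borel_measurable_continuous_on_indicator[OF _ cont] by (simp add: set_borel_measurable_def)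
    show "AE x in lborel. x \<in> {0..} \<longrightarrow> norm (f (of_real R + of_real x * d)) \<le> norm (C * exp (- c * x))"
      using bd by (auto intro!: AE_I2 order_trans[OF _ abs_ge_self])
  qed
  assume P: "\<And>s. s \<ge> 0 \<Longrightarrow> (P has_field_derivative f (of_real R + of_real s * d)) (at (of_real R + of_real s * d))"
  have "((\<lambda>T. LBINT s:{0..T}. d * f (of_real R + of_real s * d)) \<longlongrightarrow> (LBINT s:{0..}. d * f (of_real R + of_real s * d))) at_top"
    by (rule tendsto_set_lebesgue_integral_at_top) (use i in auto)
  then have "((\<lambda>T. P (of_real R) + (LBINT s:{0..T}. d * f (of_real R + of_real s * d))) \<longlongrightarrow> P (of_real R) + (LBINT s:{0..}. d * f (of_real R + of_real s * d))) at_top"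
    by (intro tendsto_intros)
  moreover have "\<forall>\<^sub>F T in at_top. P (of_real R) + (LBINT s:{0..T}. d * f (of_real R + of_real s * d)) = P (of_real R + of_real T * d)"
    using eventually_ge_at_top[of 0]
  proof eventually_elim
    case (elim T)
    have "(LBINT s. indicator {0..T} s *\<^sub>R (d * f (of_real R + of_real s * d)))
        = P (of_real R + of_real T * d) - P (of_real R + of_real 0 * d)"
    proof (rule integral_FTC_atLeastAtMost[OF elim])
      fix s assume "0 \<le> s" "s \<le> T"
      have "((\<lambda>s. of_real R + of_real s * d) has_vector_derivative d) (at s)"
        by (auto intro!: derivative_eq_intros)
      from field_vector_diff_chain_at[OF this P[OF \<open>0 \<le> s\<close>]]
      have "((\<lambda>s. P (of_real R + of_real s * d)) has_vector_derivative d * f (of_real R + of_real s * d)) (at s)"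
        by (simp add: o_def)
      then show "((\<lambda>s. P (of_real R + of_real s * d)) has_vector_derivative d * f (of_real R + of_real s * d)) (at s within {0..T})"
        by (rule has_vector_derivative_at_within)
    next
      show "continuous_on {0..T} (\<lambda>s. d * f (of_real R + of_real s * d))"
        by (intro continuous_intros continuous_on_subset[OF cont]) auto
    qed
    then show ?case unfolding set_lebesgue_integral_def by simp
  qed
  ultimately show "((\<lambda>T. P (of_real R + of_real T * d)) \<longlongrightarrow> P (of_real R) + (LBINT s:{0..}. d * f (of_real R + of_real s * d))) at_top"
    by (rule Lim_transform_eventually)
qed

text \<open>Two parallel rays that start on the real axis differ by the real segment between their
  starting points. On a convex domain of holomorphy the difference of the two ray integrals is thus
  the integral over this segment, which is real if the integrand is real there. Taking imaginary
  parts replaces the contour made of two conjugate rays, and the Cauchy theorem is needed only in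
  the form of a primitive on a convex set.\<close>

lemma ray_integral_shift:
  fixes f :: "complex \<Rightarrow> complex" and R1 R2 c C :: real and d :: complex
  assumes S: "open S" "convex S" "f holomorphic_on S" and c: "c > 0" and R: "R1 \<le> R2"
    and mem: "\<And>R s. R1 \<le> R \<Longrightarrow> R \<le> R2 \<Longrightarrow> s \<ge> 0 \<Longrightarrow> of_real R + of_real s * d \<in> S"
    and bd: "\<And>R s. R1 \<le> R \<Longrightarrow> R \<le> R2 \<Longrightarrow> s \<ge> 0 \<Longrightarrow> norm (f (of_real R + of_real s * d)) \<le> C * exp (- c * s)"
    and re: "\<And>R. R1 \<le> R \<Longrightarrow> R \<le> R2 \<Longrightarrow> Im (f (of_real R)) = 0"
  shows "Im (LBINT s:{0..}. d * f (of_real R1 + of_real s * d)) = Im (LBINT s:{0..}. d * f (of_real R2 + of_real s * d))"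
proof -
  have fc: "continuous_on S f" using S by (simp add: holomorphic_on_imp_continuous_on)
  have "of_real R1 + of_real 0 * d \<in> S" using mem[of R1 0] R by simp
  then have "starlike S" using S(2) convex_imp_starlike by blast
  have "\<exists>g. \<forall>x\<in>S. (g has_field_derivative f x) (at x)"
    by (rule holomorphic_starlike_primitive[of S f "{}"])
       (use S fc \<open>starlike S\<close> in \<open>auto simp: holomorphic_on_open field_differentiable_def\<close>)
  then obtain P where P: "\<And>x. x \<in> S \<Longrightarrow> (P has_field_derivative f x) (at x)" by blast
  define L where "L R = (LBINT s:{0..}. d * f (of_real R + of_real s * d))" for R :: real
  have lim: "((\<lambda>T. P (of_real R + of_real T * d)) \<longlongrightarrow> P (of_real R) + L R) at_top" if "R1 \<le> R" "R \<le> R2" for R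
    unfolding L_def
  proof (rule ray_integral(2)[OF c])
    show "continuous_on {0..} (\<lambda>s. f (complex_of_real R + complex_of_real s * d))"
      by (rule continuous_on_compose2[OF fc]) (use mem that in \<open>auto intro!: continuous_intros\<close>)
  qed (use bd P mem that in auto)
  have lim0: "((\<lambda>T. P (of_real R2 + of_real T * d) - P (of_real R1 + of_real T * d)) \<longlongrightarrow> 0) at_top"
  proof (rule Lim_null_comparison)
    show "\<forall>\<^sub>F T in at_top. norm (P (of_real R2 + of_real T * d) - P (of_real R1 + of_real T * d)) \<le> (C * exp (- c * T)) * (R2 - R1)"
      using eventually_ge_at_top[of 0]
    proof eventually_elim
      case (elim T)
      let ?A = "(\<lambda>R. complex_of_real R + of_real T * d) ` {R1..R2}"
      have cv: "convex ?A"
      proof -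
        have "?A = (\<lambda>z. z + of_real T * d) ` (complex_of_real ` {R1..R2})" by auto
        moreover have "convex (complex_of_real ` {R1..R2})"
          by (intro convex_linear_image) (auto intro: bounded_linear.linear bounded_linear_of_real)
        ultimately show ?thesis using convex_translation_eq[of "of_real T * d" "complex_of_real ` {R1..R2}"]
          by (simp add: add.commute image_image)
      qed
      have "norm (P (of_real R2 + of_real T * d) - P (of_real R1 + of_real T * d))
         \<le> (C * exp (- c * T)) * norm ((of_real R2 + of_real T * d) - (of_real R1 + of_real T * d))"
      proof (rule field_differentiable_bound[OF cv])
        fix z assume "z \<in> ?A"
        then obtain R where R: "R1 \<le> R" "R \<le> R2" "z = of_real R + of_real T * d" by auto
        show "(P has_field_derivative f z) (at z within ?A)"
          using P[OF mem[OF R(1,2) elim]] R by (auto intro: has_field_derivative_at_within)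
        show "norm (f z) \<le> C * exp (- c * T)" using bd R elim by auto
      qed (use R in auto)
      then show ?case using R by (simp flip: of_real_diff)
    qed
    have "((\<lambda>T. exp (- c * T)) \<longlongrightarrow> 0) at_top"
      using c by real_asymp
    then show "((\<lambda>T. (C * exp (- c * T)) * (R2 - R1)) \<longlongrightarrow> 0) at_top"
      by (intro tendsto_mult_left_zero tendsto_mult_right_zero)
  qed
  have lim1: "((\<lambda>T. P (of_real R2 + of_real T * d) - P (of_real R1 + of_real T * d)) \<longlongrightarrow> (P (of_real R2) + L R2) - (P (of_real R1) + L R1)) at_top"
    using R by (intro tendsto_diff lim) auto
  have eq: "(P (of_real R2) + L R2) - (P (of_real R1) + L R1) = 0"
    by (rule tendsto_unique[OF trivial_limit_at_top_linorder lim1 lim0])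
  have "\<exists>y. \<forall>x\<in>{R1..R2}. Im (P (of_real x)) = y"
  proof (rule has_field_derivative_zero_constant)
    fix x assume x: "x \<in> {R1..R2}"
    then have "(P has_field_derivative f (of_real x)) (at (of_real x))" using P mem[of x 0] by auto
    then have "((\<lambda>x. P (of_real x)) has_vector_derivative f (of_real x)) (at x within {R1..R2})"
      by (rule has_vector_derivative_real_field[THEN has_vector_derivative_at_within])
    then have "((\<lambda>x. Im (P (of_real x))) has_vector_derivative Im (f (of_real x))) (at x within {R1..R2})"
      by (rule bounded_linear.has_vector_derivative[OF bounded_linear_Im])
    then show "((\<lambda>x. Im (P (of_real x))) has_field_derivative 0) (at x within {R1..R2})"
      using re x by (simp add: has_real_derivative_iff_has_vector_derivative)
  qed simp
  then have "Im (P (of_real R1)) = Im (P (of_real R2))" using R by force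
  moreover have "Im ((P (of_real R2) + L R2) - (P (of_real R1) + L R1)) = 0" using eq by simp
  ultimately show ?thesis unfolding L_def[symmetric] by simp
qed

text \<open>The convex sector of the points \<open>z\<close> with \<open>\<theta>/2 - \<pi>/2 < Arg z < \<theta>\<close>. It contains all rays of
  direction \<open>\<theta>\<close> that start on the positive axis, and avoids the cut of the logarithm.\<close>

definition sector :: "real \<Rightarrow> complex set" where
  "sector \<theta> = {z. Im (cis (- \<theta>) * z) < 0 \<and> Im (cis ((pi - \<theta>) / 2) * z) > 0}"

lemma open_sector: "open (sector \<theta>)"
  unfolding sector_def by (intro open_Collect_conj open_Collect_less continuous_intros)

lemma convex_sector: "convex (sector \<theta>)"
proof -
  have lin: "linear (\<lambda>z. Im (a * z))" for a :: complex
    by (auto intro!: linearI simp: algebra_simps)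
  have "convex ((\<lambda>z. Im (cis (- \<theta>) * z)) -` {..<0})" "convex ((\<lambda>z. Im (cis ((pi - \<theta>) / 2) * z)) -` {0<..})"
    by (rule convex_linear_vimage[OF lin], simp)+
  then have "convex ((\<lambda>z. Im (cis (- \<theta>) * z)) -` {..<0} \<inter> (\<lambda>z. Im (cis ((pi - \<theta>) / 2) * z)) -` {0<..})"
    by (rule convex_Int)
  also have "\<dots> = sector \<theta>" by (auto simp: sector_def)
  finally show ?thesis .
qed

lemma Im_cis_mult: "Im (cis t * z) = cmod z * sin (Arg z + t)"
proof -
  have "cis t * z = of_real (cmod z) * cis (Arg z + t)"
    by (subst (1) rcis_cmod_Arg[symmetric, of z]) (simp add: rcis_def cis_mult add.commute mult_ac)
  then show ?thesis by simp
qed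

lemma sector_Arg:
  assumes t: "pi / 2 < \<theta>" "\<theta> < pi" and z: "z \<in> sector \<theta>"
  shows "z \<noteq> 0" "\<bar>Arg z\<bar> < \<theta>" "z \<notin> \<real>\<^sub>\<le>\<^sub>0"
proof -
  show z0: "z \<noteq> 0" using z by (auto simp: sector_def)
  then have m: "cmod z > 0" by simp
  have 1: "sin (Arg z + - \<theta>) < 0" using z m unfolding sector_def Im_cis_mult by (simp add: mult_less_0_iff)
  have 2: "sin (Arg z + (pi - \<theta>) / 2) > 0" using z m unfolding sector_def Im_cis_mult by (simp add: zero_less_mult_iff)
  have A: "- pi < Arg z" "Arg z \<le> pi" using Arg_bounded[of z] by auto
  show *: "\<bar>Arg z\<bar> < \<theta>"
  proof (rule ccontr)
    assume "\<not> \<bar>Arg z\<bar> < \<theta>"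
    then consider "Arg z \<ge> \<theta>" | "Arg z \<le> - \<theta>" by linarith
    then show False
    proof cases
      case 1
      then have "sin (Arg z + - \<theta>) \<ge> 0" using A t by (intro sin_ge_zero) auto
      then show ?thesis using \<open>sin (Arg z + - \<theta>) < 0\<close> by simp
    next
      case 2
      have "sin (- (Arg z + (pi - \<theta>) / 2)) \<ge> 0" using 2 A t by (intro sin_ge_zero) (auto simp: field_simps)
      then have "sin (Arg z + (pi - \<theta>) / 2) \<le> 0" by (simp only: sin_minus)
      then show ?thesis using \<open>sin (Arg z + (pi - \<theta>) / 2) > 0\<close> by simp
    qed
  qed
  show "z \<notin> \<real>\<^sub>\<le>\<^sub>0"
  proof
    assume "z \<in> \<real>\<^sub>\<le>\<^sub>0"
    then have "Arg z = pi" using z0 by (metis Arg_eq_pi complex_is_Real_iff complex_nonpos_Reals_iff complex_eq_iff order_le_less zero_complex.simps)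
    then show False using * t by simp
  qed
qed

text \<open>On a ray of obtuse angle the exponential decays, while the modulus is bounded below by its
  distance \<open>R sin \<theta>\<close> to the origin and grows at least linearly.\<close>

lemma ray_point:
  assumes t: "pi / 2 < \<theta>" "\<theta> < pi" and R: "0 \<le> R" "0 \<le> s" "0 < R + s"
  defines "z \<equiv> complex_of_real R + of_real s * cis \<theta>"
  shows "z \<noteq> 0" "0 \<le> Arg z" "Arg z \<le> \<theta>" "z \<notin> \<real>\<^sub>\<le>\<^sub>0" "R * sin \<theta> \<le> cmod z" "s * sin \<theta> \<le> cmod z"
    "R > 0 \<Longrightarrow> z \<in> sector \<theta>" "norm (exp z) = exp R * exp (- (- cos \<theta>) * s)" "cmod z \<le> R + s"
proof -
  have s0: "sin \<theta> > 0" using t by (intro sin_gt_zero) auto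
  have Iz: "Im z = s * sin \<theta>" by (simp add: z_def)
  have Ic: "Im (cis (- \<theta>) * z) = - R * sin \<theta>"
    by (simp add: z_def distrib_left cis_mult mult.left_commute[of _ "complex_of_real s"])
  show l1: "R * sin \<theta> \<le> cmod z"
    using abs_Im_le_cmod[of "cis (- \<theta>) * z"] Ic s0 R by (simp add: norm_mult abs_mult)
  show l2: "s * sin \<theta> \<le> cmod z" using abs_Im_le_cmod[of z] Iz by simp
  have "0 < (R + s) * sin \<theta>" using R s0 by simp
  then have "0 < R * sin \<theta> + s * sin \<theta>" by (simp add: distrib_right)
  then have "0 < cmod z" using l1 l2 by linarith
  then show z0: "z \<noteq> 0" by auto
  have "Im z \<ge> 0" using Iz R s0 by simp
  then show A0: "0 \<le> Arg z" using Arg_less_0[of z] by simp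
  have m: "cmod z > 0" using z0 by simp
  show A1: "Arg z \<le> \<theta>"
  proof (rule ccontr)
    assume "\<not> Arg z \<le> \<theta>"
    then have "0 < sin (Arg z + - \<theta>)" using Arg_bounded[of z] t by (intro sin_gt_zero) auto
    then have "0 < Im (cis (- \<theta>) * z)" unfolding Im_cis_mult using m by simp
    then show False unfolding Ic using mult_nonneg_nonneg[OF R(1) less_imp_le[OF s0]] by simp
  qed
  show "z \<notin> \<real>\<^sub>\<le>\<^sub>0"
  proof
    assume "z \<in> \<real>\<^sub>\<le>\<^sub>0"
    then have "Arg z = pi" using z0 by (metis Arg_eq_pi complex_is_Real_iff complex_nonpos_Reals_iff complex_eq_iff order_le_less zero_complex.simps)
    then show False using A1 t by simp
  qed
  show "z \<in> sector \<theta>" if "R > 0"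
  proof -
    have "0 < sin (Arg z + (pi - \<theta>) / 2)"
      using A0 A1 t by (intro sin_gt_zero) (auto simp: field_simps)
    then show ?thesis unfolding sector_def Im_cis_mult[of "(pi - \<theta>)/2"] mem_Collect_eq Ic using that s0 m by auto
  qed
  show "norm (exp z) = exp R * exp (- (- cos \<theta>) * s)" by (simp add: z_def exp_add flip: exp_add)
  show "cmod z \<le> R + s" unfolding z_def using R by (intro order_trans[OF norm_triangle_ineq]) (simp add: norm_mult)
qed

lemma cmod_powr_of_real: "z \<noteq> 0 \<Longrightarrow> cmod (z powr of_real x) = cmod z powr x"
  by (simp add: powr_def)

lemma Im_exp_powr_real: "0 < R \<Longrightarrow> Im (exp (complex_of_real R) * complex_of_real R powr of_real x) = 0"
  by (simp add: powr_of_real exp_of_real)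

lemma cos_neg_ray: "pi / 2 < \<theta> \<Longrightarrow> \<theta> < pi \<Longrightarrow> - cos \<theta> > 0"
  using cos_monotone_0_pi[of "pi/2" \<theta>] by simp

lemma exp_powr_bound:
  assumes t: "pi / 2 < \<theta>" "\<theta> < pi" and R: "0 < R" "0 \<le> s" and b: "0 \<le> b"
  defines "z \<equiv> complex_of_real R + of_real s * cis \<theta>"
  shows "norm (exp z * z powr of_real (- b)) \<le> exp R * (R * sin \<theta>) powr (- b) * exp (- (- cos \<theta>) * s)"
proof -
  have s0: "sin \<theta> > 0" using t by (intro sin_gt_zero) auto
  note p = ray_point[OF t, of R s, folded z_def]
  have "cmod z powr (- b) \<le> (R * sin \<theta>) powr (- b)"
    using p(5) R b s0 by (intro powr_mono2') auto
  moreover have z0: "z \<noteq> 0" using p(1) R by auto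
  have ez: "norm (exp z) = exp R * exp (- (- cos \<theta>) * s)" using p(8) R by auto
  have "norm (exp z * z powr of_real (- b)) = exp R * exp (- (- cos \<theta>) * s) * cmod z powr (- b)"
    unfolding norm_mult ez cmod_powr_of_real[OF z0] ..
  ultimately show ?thesis by (simp add: mult_left_mono mult_ac)
qed

section \<open>The Hankel integral\<close>

text \<open>Half of Hankel's contour: the ray of direction \<open>\<theta>\<close> from the point \<open>R\<close>. The other half is its
  mirror image, and the two together contribute \<open>2 \<i>\<close> times the imaginary part.\<close>

definition hankel :: "real \<Rightarrow> real \<Rightarrow> real \<Rightarrow> complex" where
  "hankel \<theta> b R = (LBINT s:{0..}. cis \<theta> *
     (exp (of_real R + of_real s * cis \<theta>) * (of_real R + of_real s * cis \<theta>) powr of_real (- b)))"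

lemma continuous_on_ray:
  assumes t: "pi / 2 < \<theta>" "\<theta> < pi" and R: "0 < R" and f: "f holomorphic_on sector \<theta>"
  shows "continuous_on {0..} (\<lambda>s::real. f (of_real R + of_real s * cis \<theta>))"
  by (rule continuous_on_compose2[OF holomorphic_on_imp_continuous_on[OF f]])
     (use ray_point(7)[OF t] R in \<open>auto intro!: continuous_intros\<close>)

lemma hankel_holomorphic:
  assumes t: "pi / 2 < \<theta>" "\<theta> < pi"
  shows "(\<lambda>z. exp z * z powr w) holomorphic_on sector \<theta>"
  using sector_Arg(3)[OF t] by (auto intro!: holomorphic_intros)

lemma hankel_integrable:
  assumes t: "pi / 2 < \<theta>" "\<theta> < pi" and R: "0 < R" and b: "0 \<le> b"
  shows "set_integrable lborel {0..} (\<lambda>s. exp (of_real R + of_real s * cis \<theta>) * (of_real R + of_real s * cis \<theta>) powr of_real (- b))"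
proof (rule ray_integral(1))
  show "- cos \<theta> > 0" by (rule cos_neg_ray[OF t])
  show "continuous_on {0..} (\<lambda>s. exp (complex_of_real R + of_real s * cis \<theta>) * (of_real R + of_real s * cis \<theta>) powr of_real (- b))"
    by (rule continuous_on_ray[OF t R hankel_holomorphic[OF t]])
next
  fix s :: real assume "0 \<le> s"
  then show "norm (exp (complex_of_real R + of_real s * cis \<theta>) * (of_real R + of_real s * cis \<theta>) powr of_real (- b))
      \<le> exp R * (R * sin \<theta>) powr (- b) * exp (- (- cos \<theta>) * s)"
    by (rule exp_powr_bound[OF t R _ b])
qed

text \<open>The integrand is real on the positive axis, hence the starting point of the ray does not
  influence the imaginary part.\<close>

lemma hankel_shift_le:
  assumes t: "pi / 2 < \<theta>" "\<theta> < pi" and R: "0 < R1" "R1 \<le> R2" and b: "0 \<le> b"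
  shows "Im (hankel \<theta> b R1) = Im (hankel \<theta> b R2)"
  unfolding hankel_def
proof (rule ray_integral_shift[where f = "\<lambda>z. exp z * z powr of_real (- b)"])
  show "open (sector \<theta>)" "convex (sector \<theta>)" by (rule open_sector convex_sector)+
  show "(\<lambda>z. exp z * z powr of_real (- b)) holomorphic_on sector \<theta>" by (rule hankel_holomorphic[OF t])
  show "- cos \<theta> > 0" by (rule cos_neg_ray[OF t])
  have s0: "sin \<theta> > 0" using t by (intro sin_gt_zero) auto
  fix R s :: real assume *: "R1 \<le> R" "R \<le> R2"
  show "Im (exp (of_real R) * complex_of_real R powr of_real (- b)) = 0"
    using * R by (intro Im_exp_powr_real) simp
  assume s: "0 \<le> s"
  show "complex_of_real R + of_real s * cis \<theta> \<in> sector \<theta>" using ray_point(7)[OF t, of R s] * R s by simp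
  have "norm (exp (complex_of_real R + of_real s * cis \<theta>) * (complex_of_real R + of_real s * cis \<theta>) powr of_real (- b))
     \<le> exp R * (R * sin \<theta>) powr (- b) * exp (- (- cos \<theta>) * s)"
    using * R s b by (intro exp_powr_bound[OF t]) auto
  also have "\<dots> \<le> exp R2 * (R1 * sin \<theta>) powr (- b) * exp (- (- cos \<theta>) * s)"
    using * R b s0 by (intro mult_right_mono mult_mono powr_mono2') auto
  finally show "norm (exp (complex_of_real R + of_real s * cis \<theta>) * (complex_of_real R + of_real s * cis \<theta>) powr of_real (- b))
     \<le> exp R2 * (R1 * sin \<theta>) powr (- b) * exp (- (- cos \<theta>) * s)" .
qed (rule R)

lemma hankel_shift:
  assumes t: "pi / 2 < \<theta>" "\<theta> < pi" and R: "0 < R1" "0 < R2" and b: "0 \<le> b"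
  shows "Im (hankel \<theta> b R1) = Im (hankel \<theta> b R2)"
proof (cases "R1 \<le> R2")
  case True
  show ?thesis by (rule hankel_shift_le[OF t R(1) True b])
next
  case False
  then have "R2 \<le> R1" by simp
  from hankel_shift_le[OF t R(2) this b] show ?thesis by (rule sym)
qed

text \<open>Integration by parts: \<open>exp z * z powr (-b)\<close> is real at the starting point and vanishes at
  infinity. The recursion has the form of the functional equation of \<open>1 / \<Gamma>\<close>.\<close>

lemma hankel_recursion:
  assumes t: "pi / 2 < \<theta>" "\<theta> < pi" and R: "0 < R" and b: "0 < b"
  shows "Im (hankel \<theta> b R) = b * Im (hankel \<theta> (b + 1) R)"
proof -
  let ?z = "\<lambda>s. complex_of_real R + of_real s * cis \<theta>"
  let ?P = "\<lambda>z::complex. exp z * z powr of_real (- b)"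
  let ?f = "\<lambda>z::complex. exp z * z powr of_real (- b) - of_real b * (exp z * z powr of_real (- (b + 1)))"
  have c: "- cos \<theta> > 0" by (rule cos_neg_ray[OF t])
  let ?C = "exp R * (R * sin \<theta>) powr (- b) + b * (exp R * (R * sin \<theta>) powr (- (b + 1)))"
  have i1: "set_integrable lborel {0..} (\<lambda>s. exp (?z s) * ?z s powr of_real (- b))"
    using hankel_integrable[OF t R, of b] b by simp
  have i2: "set_integrable lborel {0..} (\<lambda>s. exp (?z s) * ?z s powr of_real (- (b + 1)))"
    by (rule hankel_integrable[OF t R]) (use b in simp)
  have lim: "((\<lambda>T. ?P (of_real R + of_real T * cis \<theta>)) \<longlongrightarrow> ?P (of_real R) + (LBINT s:{0..}. cis \<theta> * ?f (?z s))) at_top"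
  proof (rule ray_integral(2)[OF c, of _ _ _ ?C])
    show "continuous_on {0..} (\<lambda>s. ?f (?z s))"
      using sector_Arg(3)[OF t] by (intro continuous_on_ray[OF t R]) (auto intro!: holomorphic_intros)
    fix s :: real assume s: "s \<ge> 0"
    have "norm (?f (?z s)) \<le> norm (exp (?z s) * ?z s powr of_real (- b)) + b * norm (exp (?z s) * ?z s powr of_real (- (b + 1)))"
      using b by (intro order_trans[OF norm_triangle_ineq4]) (simp add: norm_mult)
    also have "\<dots> \<le> exp R * (R * sin \<theta>) powr (- b) * exp (- (- cos \<theta>) * s) + b * (exp R * (R * sin \<theta>) powr (- (b + 1)) * exp (- (- cos \<theta>) * s))"
      using b R s by (intro add_mono mult_left_mono exp_powr_bound[OF t]) auto
    finally show "norm (?f (?z s)) \<le> ?C * exp (- (- cos \<theta>) * s)" by (simp add: algebra_simps)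
    have n: "?z s \<notin> \<real>\<^sub>\<le>\<^sub>0" using ray_point(4)[OF t, of R s] R s by simp
    have "(?P has_field_derivative (exp (?z s) * ?z s powr of_real (- b) + exp (?z s) * (of_real (- b) * ?z s powr (of_real (- b) - 1)))) (at (?z s))"
      using n by (auto intro!: derivative_eq_intros)
    moreover have "complex_of_real (- b) - 1 = of_real (- (b + 1))" by simp
    ultimately show "(?P has_field_derivative ?f (?z s)) (at (?z s))" by (simp only:) (simp add: algebra_simps)
  qed
  have "((\<lambda>T. ?P (of_real R + of_real T * cis \<theta>)) \<longlongrightarrow> 0) at_top"
  proof (rule Lim_null_comparison)
    show "\<forall>\<^sub>F T in at_top. norm (?P (of_real R + of_real T * cis \<theta>)) \<le> exp R * (R * sin \<theta>) powr (- b) * exp (- (- cos \<theta>) * T)"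
      using eventually_ge_at_top[of 0] by eventually_elim (use R b in \<open>intro exp_powr_bound[OF t]; simp\<close>)
    have "((\<lambda>T. exp (- (- cos \<theta>) * T)) \<longlongrightarrow> 0) at_top" using c by real_asymp
    then show "((\<lambda>T. exp R * (R * sin \<theta>) powr (- b) * exp (- (- cos \<theta>) * T)) \<longlongrightarrow> 0) at_top"
      by (rule tendsto_mult_right_zero)
  qed
  from tendsto_unique[OF trivial_limit_at_top_linorder lim this]
  have 1: "?P (of_real R) + (LBINT s:{0..}. cis \<theta> * ?f (?z s)) = 0" .
  have 2: "(LBINT s:{0..}. cis \<theta> * ?f (?z s)) = hankel \<theta> b R - of_real b * hankel \<theta> (b + 1) R"
  proof -
    have "(LBINT s:{0..}. cis \<theta> * ?f (?z s)) = (LBINT s:{0..}. cis \<theta> * (exp (?z s) * ?z s powr of_real (- b)) - of_real b * (cis \<theta> * (exp (?z s) * ?z s powr of_real (- (b + 1)))))"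
      by (simp add: algebra_simps)
    also have "\<dots> = (LBINT s:{0..}. cis \<theta> * (exp (?z s) * ?z s powr of_real (- b))) - (LBINT s:{0..}. of_real b * (cis \<theta> * (exp (?z s) * ?z s powr of_real (- (b + 1)))))"
      by (intro set_integral_diff set_integrable_mult_right i1 i2)
    finally show ?thesis by (simp add: hankel_def)
  qed
  have 3: "Im (?P (of_real R)) = 0"
    by (rule Im_exp_powr_real[OF R])
  have "Im (?P (of_real R) + (LBINT s:{0..}. cis \<theta> * ?f (?z s))) = 0" unfolding 1 by simp
  then have "Im (hankel \<theta> b R - of_real b * hankel \<theta> (b + 1) R) = 0"
    unfolding plus_complex.sel(2) 2 3 by (simp only: add_0)
  then show ?thesis by simp
qed

text \<open>For \<open>b < 1\<close> the singularity at the origin is integrable and the starting point can be moved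
  to \<open>0\<close>. There the integral is a Gamma integral on a rotated ray, and Euler's reflection formula
  gives the value.\<close>

lemma hankel_below_1:
  assumes t: "pi / 2 < \<theta>" "\<theta> < pi" and R: "0 < R" and b: "0 < b" "b < 1"
  shows "Im (hankel \<theta> b R) = pi * rGamma b"
proof -
  have s0: "sin \<theta> > 0" using t by (intro sin_gt_zero) auto
  have c: "- cos \<theta> > 0" by (rule cos_neg_ray[OF t])
  let ?R = "\<lambda>n. inverse (real (Suc n))"
  let ?z = "\<lambda>n s. complex_of_real (?R n) + of_real s * cis \<theta>"
  let ?g = "\<lambda>s. indicator {0..} s *\<^sub>R (cis \<theta> * cis (- b * \<theta>) * (of_real (s powr ((1 - b) - 1)) * exp (- (- cis \<theta>) * of_real s)))"
  have "(\<lambda>n. hankel \<theta> b (?R n)) \<longlonglongrightarrow> (LBINT s. ?g s)"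
    unfolding hankel_def set_lebesgue_integral_def
  proof (rule integral_dominated_convergence[where w = "\<lambda>s. exp 1 * sin \<theta> powr (- b) * (indicator {0..} s *\<^sub>R (s powr ((1 - b) - 1) * exp (- (- cos \<theta>) * s)))"])
    show "?g \<in> borel_measurable lborel" by measurable
    show "(\<lambda>s. indicator {0..} s *\<^sub>R (cis \<theta> * (exp (?z n s) * ?z n s powr of_real (- b)))) \<in> borel_measurable lborel" for n
      using set_integrable_mult_right[OF hankel_integrable[OF t, of "?R n" b], of "cis \<theta>"] b by (simp add: set_integrable_def)
    show "integrable lborel (\<lambda>s. exp 1 * sin \<theta> powr (- b) * (indicator {0..} s *\<^sub>R (s powr ((1 - b) - 1) * exp (- (- cos \<theta>) * s))))"
      using Gamma_integral_scaled(1)[of "1 - b" "- cos \<theta>"] b c by (intro integrable_mult_right) (simp add: set_integrable_def)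
    have ne: "AE s in lborel. s \<noteq> (0::real)" by (rule AE_lborel_singleton)
    show "AE s in lborel. (\<lambda>n. indicator {0..} s *\<^sub>R (cis \<theta> * (exp (?z n s) * ?z n s powr of_real (- b)))) \<longlonglongrightarrow> ?g s"
      using ne
    proof eventually_elim
      case (elim s)
      show ?case
      proof (cases "s > 0")
        case True
        have Rlim: "(\<lambda>n. complex_of_real (?R n)) \<longlonglongrightarrow> 0"
          using tendsto_of_real[OF LIMSEQ_inverse_real_of_nat, where 'a = complex] by simp
        have n: "0 + of_real s * cis \<theta> \<notin> \<real>\<^sub>\<le>\<^sub>0" using ray_point(4)[OF t, of 0 s] True by simp
        have "(\<lambda>n. exp (?z n s) * ?z n s powr of_real (- b)) \<longlonglongrightarrow> exp (0 + of_real s * cis \<theta>) * (0 + of_real s * cis \<theta>) powr of_real (- b)"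
          using n by (intro tendsto_intros Rlim) auto
        moreover have "(0 + of_real s * cis \<theta>) powr of_real (- b) = cis (- b * \<theta>) * of_real (s powr ((1 - b) - 1))"
        proof -
          have "Ln (of_real s * cis \<theta>) = of_real (ln s) + \<i> * of_real \<theta>"
          proof -
            have "of_real s * cis \<theta> = exp (of_real (ln s) + \<i> * of_real \<theta>)"
              using True by (simp add: exp_add cis_conv_exp exp_of_real)
            also have "Ln \<dots> = of_real (ln s) + \<i> * of_real \<theta>" using t by (intro Ln_exp) auto
            finally show ?thesis by simp
          qed
          then have "(of_real s * cis \<theta>) powr of_real (- b) = exp (of_real (- b * ln s) + \<i> * of_real (- b * \<theta>))"
            using True by (simp add: powr_def algebra_simps)
          also have "\<dots> = of_real (exp (- b * ln s)) * cis (- b * \<theta>)"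
            unfolding exp_add cis_conv_exp exp_of_real ..
          also have "exp (- b * ln s) = s powr (- b)"
            using True by (simp add: powr_def)
          finally show ?thesis by simp
        qed
        ultimately show ?thesis using True
          by (auto intro!: tendsto_eq_intros simp: algebra_simps)
      qed (use elim in \<open>auto simp: indicator_def\<close>)
    qed
    show "AE s in lborel. norm (indicator {0..} s *\<^sub>R (cis \<theta> * (exp (?z n s) * ?z n s powr of_real (- b))))
        \<le> exp 1 * sin \<theta> powr (- b) * (indicator {0..} s *\<^sub>R (s powr ((1 - b) - 1) * exp (- (- cos \<theta>) * s)))" for n
      using ne
    proof eventually_elim
      case (elim s)
      show ?case
      proof (cases "s > 0")
        case True
        define r where "r = ?R n"
        have R1: "0 < r" "r \<le> 1" by (auto simp: r_def field_simps)
        define z where "z = complex_of_real r + of_real s * cis \<theta>"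
        note p = ray_point[OF t, of r s, folded z_def]
        have z0: "z \<noteq> 0" and zs: "s * sin \<theta> \<le> cmod z" and ez: "norm (exp z) = exp r * exp (- (- cos \<theta>) * s)"
          using p(1,6,8) R1 True by auto
        have l1: "norm (z powr of_real (- b)) \<le> (s * sin \<theta>) powr (- b)"
          unfolding cmod_powr_of_real[OF z0] using zs True b s0 by (intro powr_mono2') auto
        have l2: "norm (exp z) \<le> exp 1 * exp (- (- cos \<theta>) * s)"
          unfolding ez using R1 by (intro mult_right_mono) auto
        have "norm (exp z * z powr of_real (- b)) \<le> (exp 1 * exp (- (- cos \<theta>) * s)) * (s * sin \<theta>) powr (- b)"
          unfolding norm_mult by (intro mult_mono l1 l2) auto
        then have "norm (cis \<theta> * (exp z * z powr of_real (- b))) \<le> exp 1 * sin \<theta> powr (- b) * (s powr ((1 - b) - 1) * exp (- (- cos \<theta>) * s))"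
          unfolding norm_mult[of "cis \<theta>"] by (simp add: powr_mult mult_ac)
        then show ?thesis using True unfolding z_def r_def by simp
      qed (use elim in \<open>auto simp: indicator_def\<close>)
    qed
  qed
  \<comment> \<open>the sequence is constant, hence equal to its limit\<close>
  then have "(\<lambda>n. Im (hankel \<theta> b (?R n))) \<longlonglongrightarrow> Im (LBINT s. ?g s)" by (rule tendsto_Im)
  moreover have "Im (hankel \<theta> b (?R n)) = Im (hankel \<theta> b R)" for n
    using b R by (intro hankel_shift[OF t]) auto
  ultimately have eq: "Im (hankel \<theta> b R) = Im (LBINT s. ?g s)"
    by (simp add: LIMSEQ_const_iff)
  have "(LBINT s. ?g s) = cis \<theta> * cis (- b * \<theta>) * (LBINT s:{0..}. of_real (s powr ((1 - b) - 1)) * exp (- (- cis \<theta>) * of_real s))"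
    unfolding set_lebesgue_integral_def by (subst integral_mult_right_zero[symmetric]) (simp add: mult_ac)
  also have "\<dots> = cis \<theta> * cis (- b * \<theta>) * (of_real (Gamma (1 - b)) * (- cis \<theta>) powr (- of_real (1 - b)))"
    by (subst Gamma_integral_complex_scaled) (use b c in auto)
  also have "(- cis \<theta>) powr (- of_real (1 - b)) = cis ((\<theta> - pi) * (b - 1))"
  proof -
    have "- cis \<theta> = cis (\<theta> - pi)" by (simp add: cis_divide[symmetric])
    then have e: "- cis \<theta> = exp (\<i> * of_real (\<theta> - pi))" by (simp only: cis_conv_exp)
    have "Ln (- cis \<theta>) = \<i> * of_real (\<theta> - pi)" unfolding e using t by (intro Ln_exp) auto
    then have "(- cis \<theta>) powr (- of_real (1 - b)) = exp (- of_real (1 - b) * (\<i> * of_real (\<theta> - pi)))" by (simp add: powr_def)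
    also have "- of_real (1 - b) * (\<i> * of_real (\<theta> - pi)) = \<i> * complex_of_real ((\<theta> - pi) * (b - 1))"
      by (simp add: algebra_simps)
    finally show ?thesis by (simp add: cis_conv_exp)
  qed
  also have "cis \<theta> * cis (- b * \<theta>) * (of_real (Gamma (1 - b)) * cis ((\<theta> - pi) * (b - 1))) = of_real (Gamma (1 - b)) * cis (pi - pi * b)"
  proof -
    have "cis \<theta> * cis (- b * \<theta>) * cis ((\<theta> - pi) * (b - 1)) = cis (pi - pi * b)"
      unfolding cis_mult by (rule arg_cong[of _ _ cis]) (simp add: algebra_simps)
    then show ?thesis by (simp only: mult.left_commute)
  qed
  finally have H: "Im (hankel \<theta> b R) = Gamma (1 - b) * sin (pi * b)" unfolding eq by simp
  have Rf: "rGamma b * rGamma (1 - b) = sin (pi * b) / pi"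
  proof -
    have "complex_of_real (rGamma b * rGamma (1 - b)) = of_real (sin (pi * b) / pi)"
    proof -
      have "rGamma (1 - complex_of_real b) = of_real (rGamma (1 - b))"
        unfolding rGamma_complex_of_real[symmetric] by simp
      moreover have "sin (complex_of_real pi * complex_of_real b) = of_real (sin (pi * b))"
        by (metis of_real_mult sin_of_real)
      ultimately show ?thesis
        using rGamma_reflection_complex[of "of_real b"] by (simp add: rGamma_complex_of_real)
    qed
    then show ?thesis by (simp only: of_real_eq_iff)
  qed
  have Gf: "Gamma (1 - b) * rGamma (1 - b) = 1"
  proof -
    have "Gamma (1 - b) \<noteq> 0" using Gamma_real_pos[of "1 - b"] b by force
    then show ?thesis by (simp add: rGamma_inverse_Gamma)
  qed
  have "sin (pi * b) = pi * (rGamma b * rGamma (1 - b))" unfolding Rf by simp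
  then have "Im (hankel \<theta> b R) = Gamma (1 - b) * (pi * (rGamma b * rGamma (1 - b)))"
    unfolding H by (rule arg_cong)
  also have "\<dots> = pi * rGamma b * (Gamma (1 - b) * rGamma (1 - b))"
    by (simp only: mult_ac)
  also have "\<dots> = pi * rGamma b" unfolding Gf by simp
  finally show ?thesis .
qed

text \<open>The recursion only connects exponents of equal fractional part, so the integers need a limit
  \<open>b \<rightarrow> 1\<close>.\<close>

lemma hankel_at_1:
  assumes t: "pi / 2 < \<theta>" "\<theta> < pi" and R: "0 < R"
  shows "Im (hankel \<theta> 1 R) = pi * rGamma 1"
proof -
  let ?z = "\<lambda>s. complex_of_real R + of_real s * cis \<theta>"
  let ?b = "\<lambda>n. 1 - inverse (real (Suc (Suc n)))"
  have s0: "sin \<theta> > 0" using t by (intro sin_gt_zero) auto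
  have blim: "?b \<longlonglongrightarrow> 1"
    using LIMSEQ_ignore_initial_segment[OF LIMSEQ_inverse_real_of_nat_add_minus[of 1], of 1] by simp
  have b01: "0 < ?b n" "?b n < 1" for n by (auto simp: field_simps)
  define m where "m = min 1 (R * sin \<theta>)"
  have m: "0 < m" "m \<le> 1" "m \<le> R * sin \<theta>" using R s0 by (auto simp: m_def)
  have "(\<lambda>n. hankel \<theta> (?b n) R) \<longlonglongrightarrow> hankel \<theta> 1 R"
    unfolding hankel_def set_lebesgue_integral_def
  proof (rule integral_dominated_convergence[where w = "\<lambda>s. exp R * m powr (- 1) * (indicator {0..} s *\<^sub>R exp (- (- cos \<theta>) * s))"])
    show "(\<lambda>s. indicator {0..} s *\<^sub>R (cis \<theta> * (exp (?z s) * ?z s powr of_real (- ?b n)))) \<in> borel_measurable lborel" for n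
      using set_integrable_mult_right[OF hankel_integrable[OF t R, of "?b n"], of "cis \<theta>"] b01[of n] by (simp add: set_integrable_def)
    show "(\<lambda>s. indicator {0..} s *\<^sub>R (cis \<theta> * (exp (?z s) * ?z s powr of_real (- 1)))) \<in> borel_measurable lborel"
      using set_integrable_mult_right[OF hankel_integrable[OF t R, of 1], of "cis \<theta>"] by (simp add: set_integrable_def)
    show "integrable lborel (\<lambda>s. exp R * m powr (- 1) * (indicator {0..} s *\<^sub>R exp (- (- cos \<theta>) * s)))"
      using exp_decay_integrable[OF cos_neg_ray[OF t]] by (intro integrable_mult_right) (simp add: set_integrable_def)
    show "AE s in lborel. (\<lambda>n. indicator {0..} s *\<^sub>R (cis \<theta> * (exp (?z s) * ?z s powr of_real (- ?b n)))) \<longlonglongrightarrow> indicator {0..} s *\<^sub>R (cis \<theta> * (exp (?z s) * ?z s powr of_real (- 1)))"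
    proof (rule AE_I2)
      fix s :: real
      show "(\<lambda>n. indicator {0..} s *\<^sub>R (cis \<theta> * (exp (?z s) * ?z s powr of_real (- ?b n)))) \<longlonglongrightarrow> indicator {0..} s *\<^sub>R (cis \<theta> * (exp (?z s) * ?z s powr of_real (- 1)))"
      proof (cases "s \<ge> 0")
        case True
        have n: "?z s \<noteq> 0" using ray_point(1)[OF t, of R s] R True by simp
        have "(\<lambda>n. ?z s powr of_real (- ?b n)) \<longlonglongrightarrow> ?z s powr of_real (- 1)"
        proof -
          have L: "(\<lambda>n. complex_of_real (- ?b n)) \<longlonglongrightarrow> of_real (- 1)"
            by (intro tendsto_of_real tendsto_minus blim)
          have "(\<lambda>i. exp (complex_of_real (- ?b i) * Ln (?z s))) \<longlonglongrightarrow> exp (of_real (- 1) * Ln (?z s))"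
            by (rule tendsto_exp[OF tendsto_mult[OF L tendsto_const]])
          then show ?thesis unfolding powr_def using n by (simp only: if_False)
        qed
        then have L2: "(\<lambda>n. ?z s powr of_real (- ?b n)) \<longlonglongrightarrow> ?z s powr of_real (- 1)" .
        show ?thesis
          by (rule tendsto_scaleR[OF tendsto_const tendsto_mult[OF tendsto_const tendsto_mult[OF tendsto_const L2]]])
      qed simp
    qed
    show "AE s in lborel. norm (indicator {0..} s *\<^sub>R (cis \<theta> * (exp (?z s) * ?z s powr of_real (- ?b n))))
      \<le> exp R * m powr (- 1) * (indicator {0..} s *\<^sub>R exp (- (- cos \<theta>) * s))" for n
    proof (rule AE_I2)
      fix s :: real
      show "norm (indicator {0..} s *\<^sub>R (cis \<theta> * (exp (?z s) * ?z s powr of_real (- ?b n))))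
        \<le> exp R * m powr (- 1) * (indicator {0..} s *\<^sub>R exp (- (- cos \<theta>) * s))"
      proof (cases "s \<ge> 0")
        case True
        have "norm (exp (?z s) * ?z s powr of_real (- ?b n)) \<le> exp R * (R * sin \<theta>) powr (- ?b n) * exp (- (- cos \<theta>) * s)"
          by (rule exp_powr_bound[OF t R True]) (use b01[of n] in simp)
        also have "(R * sin \<theta>) powr (- ?b n) \<le> m powr (- ?b n)"
          using m b01[of n] by (intro powr_mono2') auto
        also have "m powr (- ?b n) \<le> m powr (- 1)"
          using m b01[of n] by (intro powr_mono') auto
        finally have "norm (exp (?z s) * ?z s powr of_real (- ?b n)) \<le> exp R * m powr (- 1) * exp (- (- cos \<theta>) * s)"
          by (simp add: mult_left_mono mult_right_mono)
        then show ?thesis using True unfolding norm_scaleR norm_mult[of "cis \<theta>"] by simp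
      qed simp
    qed
  qed
  then have "(\<lambda>n. Im (hankel \<theta> (?b n) R)) \<longlonglongrightarrow> Im (hankel \<theta> 1 R)" by (rule tendsto_Im)
  moreover have "(\<lambda>n. Im (hankel \<theta> (?b n) R)) = (\<lambda>n. pi * rGamma (?b n))"
    using hankel_below_1[OF t R b01] by auto
  moreover have "(\<lambda>n. pi * rGamma (?b n)) \<longlonglongrightarrow> pi * rGamma 1"
    by (intro tendsto_intros isCont_tendsto_compose[OF isCont_rGamma blim]) auto
  ultimately show ?thesis using LIMSEQ_unique by simp
qed

text \<open>Hankel's formula. The exponents in \<open>(0, 1]\<close> are extended to all positive ones by the
  recursion.\<close>

lemma hankel_formula:
  assumes t: "pi / 2 < \<theta>" "\<theta> < pi" and R: "0 < R" and b: "0 < b"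
  shows "Im (hankel \<theta> b R) = pi / Gamma b"
proof -
  have *: "Im (hankel \<theta> b R) = pi * rGamma b" if "0 < b" "b \<le> real n + 1" for b n
    using that
  proof (induction n arbitrary: b)
    case 0
    then show ?case using hankel_below_1[OF t R, of b] hankel_at_1[OF t R] by (cases "b = 1") auto
  next
    case (Suc n)
    show ?case
    proof (cases "b \<le> 1")
      case True
      then show ?thesis using Suc.IH[of b] Suc.prems by simp
    next
      case False
      have "pi * rGamma (b - 1) = (b - 1) * Im (hankel \<theta> (b - 1 + 1) R)"
        using hankel_recursion[OF t R, of "b - 1"] Suc.IH[of "b - 1"] Suc.prems False by simp
      moreover have "rGamma (b - 1) = (b - 1) * rGamma b" using rGamma_plus1[of "b - 1"] by simp
      ultimately show ?thesis using False by simp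
    qed
  qed
  have "b \<le> real (nat \<lceil>b\<rceil>) + 1" using b by linarith
  from *[OF b this] show ?thesis by (simp add: rGamma_inverse_Gamma divide_inverse)
qed

section \<open>Contour integral and subordination formula for Mittag-Leffler functions\<close>

text \<open>On a ray that stays far from the origin, \<open>l * z powr (-a)\<close> has modulus less than one. The
  geometric series of \<open>1 / (z powr a + l)\<close> is integrated term by term, and Hankel's formula
  identifies each term with a term of the Mittag-Leffler series.\<close>

lemma mittag_leffler_large_radius:
  assumes t: "pi / 2 < \<theta>" "\<theta> < pi" and R: "0 < R" and a: "0 < a" and b: "0 < \<beta>" and l: "0 \<le> l" "l < (R * sin \<theta>) powr a"
  shows "Im (LBINT s:{0..}. cis \<theta> * (exp (of_real R + of_real s * cis \<theta>) * (of_real R + of_real s * cis \<theta>) powr of_real (a - \<beta>)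
        / ((of_real R + of_real s * cis \<theta>) powr of_real a + of_real l))) = pi * mittag_leffler a \<beta> (- l)"
proof -
  let ?z = "\<lambda>s. complex_of_real R + of_real s * cis \<theta>"
  have s0: "sin \<theta> > 0" using t by (intro sin_gt_zero) auto
  have c: "- cos \<theta> > 0" by (rule cos_neg_ray[OF t])
  define \<rho> where "\<rho> = l / (R * sin \<theta>) powr a"
  have r: "0 \<le> \<rho>" "\<rho> < 1" using l R s0 by (auto simp: \<rho>_def divide_less_eq)
  define T where "T k s = indicator {0..} s *\<^sub>R ((of_real (- l)) ^ k * (cis \<theta> * (exp (?z s) * ?z s powr of_real (- (a * real k + \<beta>)))))" for k s
  have bk: "0 < a * real k + \<beta>" for k using a b by (simp add: add_nonneg_pos)
  have Ti: "integrable lborel (T k)" for k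
    using set_integrable_mult_right[OF set_integrable_mult_right[OF hankel_integrable[OF t R, of "a * real k + \<beta>"], of "cis \<theta>"], of "of_real (- l) ^ k"] bk[of k]
    unfolding T_def set_integrable_def by simp
  have TI: "(LBINT s. T k s) = of_real ((- l) ^ k) * hankel \<theta> (a * real k + \<beta>) R" for k
  proof -
    have "(LBINT s. T k s) = (LBINT s:{0..}. of_real (- l) ^ k * (cis \<theta> * (exp (?z s) * ?z s powr of_real (- (a * real k + \<beta>)))))"
      by (simp only: T_def set_lebesgue_integral_def)
    also have "\<dots> = of_real (- l) ^ k * hankel \<theta> (a * real k + \<beta>) R"
      unfolding hankel_def by (rule set_integral_mult_right)
    finally show ?thesis by simp
  qed
  let ?B = "\<lambda>s. exp R * (R * sin \<theta>) powr (- \<beta>) * (indicator {0..} s *\<^sub>R exp (- (- cos \<theta>) * s))"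
  have Bi: "integrable lborel ?B"
    using exp_decay_integrable[OF c] by (intro integrable_mult_right) (simp add: set_integrable_def)
  have Tb: "norm (T k s) \<le> \<rho> ^ k * ?B s" for k s
  proof (cases "s \<ge> 0")
    case True
    have e: "(R * sin \<theta>) powr (- (a * real k + \<beta>)) = (1 / (R * sin \<theta>) powr a) ^ k * (R * sin \<theta>) powr (- \<beta>)"
    proof -
      have "(R * sin \<theta>) powr (- (a * real k + \<beta>)) = (R * sin \<theta>) powr (- a * real k) * (R * sin \<theta>) powr (- \<beta>)"
        by (simp add: powr_add[symmetric])
      also have "(R * sin \<theta>) powr (- a * real k) = ((R * sin \<theta>) powr (- a)) powr real k" by (simp only: powr_powr)
      also have "\<dots> = ((R * sin \<theta>) powr (- a)) ^ k" using R s0 by (intro powr_realpow) simp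
      finally show ?thesis by (simp add: powr_minus divide_inverse)
    qed
    have "norm (T k s) = l ^ k * norm (exp (?z s) * ?z s powr of_real (- (a * real k + \<beta>)))"
      using True l unfolding T_def norm_scaleR norm_mult[of "of_real (-l) ^ k"] norm_mult[of "cis \<theta>"] by (simp add: norm_power)
    also have "\<dots> \<le> l ^ k * (exp R * (R * sin \<theta>) powr (- (a * real k + \<beta>)) * exp (- (- cos \<theta>) * s))"
      using bk[of k] l by (intro mult_left_mono exp_powr_bound[OF t R True]) auto
    also have "\<dots> = \<rho> ^ k * ?B s" using True unfolding e \<rho>_def by (simp add: power_divide)
    finally show ?thesis .
  qed (simp add: T_def)
  have sumT: "summable (\<lambda>k. norm (T k s))" for s
    by (rule summable_comparison_test'[of "\<lambda>k. \<rho> ^ k * ?B s" 0])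
       (use Tb[of _ s] r in \<open>auto intro!: summable_mult2 summable_geometric\<close>)
  have sumI: "summable (\<lambda>k. LBINT s. norm (T k s))"
  proof (rule summable_comparison_test'[of "\<lambda>k. \<rho> ^ k * (LBINT s. ?B s)" 0])
    show "summable (\<lambda>k. \<rho> ^ k * (LBINT s. ?B s))" using r by (intro summable_mult2 summable_geometric) auto
    fix k
    have "(LBINT s. norm (T k s)) \<le> (LBINT s. \<rho> ^ k * ?B s)"
      by (intro integral_mono integrable_norm Ti integrable_mult_right Bi Tb)
    then show "norm (LBINT s. norm (T k s)) \<le> \<rho> ^ k * (LBINT s. ?B s)" by simp
  qed
  have "(\<lambda>k. LBINT s. T k s) sums (LBINT s. (\<Sum>k. T k s))"
    by (rule sums_integral[OF Ti _ sumI]) (use sumT in auto)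
  also have "(\<lambda>s. \<Sum>k. T k s) = (\<lambda>s. indicator {0..} s *\<^sub>R (cis \<theta> * (exp (?z s) * ?z s powr of_real (a - \<beta>)
        / (?z s powr of_real a + of_real l))))"
  proof
    fix s :: real
    show "(\<Sum>k. T k s) = indicator {0..} s *\<^sub>R (cis \<theta> * (exp (?z s) * ?z s powr of_real (a - \<beta>)
        / (?z s powr of_real a + of_real l)))"
    proof (cases "s \<ge> 0")
      case True
      define z where "z = ?z s"
      have z0: "z \<noteq> 0" and zR: "R * sin \<theta> \<le> cmod z" using ray_point(1,5)[OF t, of R s] R True by (auto simp: z_def)
      define x where "x = - of_real l * z powr of_real (- a)"
      have "norm x = l * cmod z powr (- a)" unfolding x_def norm_mult cmod_powr_of_real[OF z0] using l by simp
      also have "\<dots> \<le> l * (R * sin \<theta>) powr (- a)" using l zR R s0 a by (intro mult_left_mono powr_mono2') auto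
      also have "\<dots> = \<rho>" by (simp add: \<rho>_def powr_minus divide_inverse)
      finally have x1: "norm x < 1" using r by simp
      have pk: "z powr of_real (- (a * real k + \<beta>)) = z powr of_real (- \<beta>) * (z powr of_real (- a)) ^ k" for k
      proof -
        have "z powr of_real (- (a * real k + \<beta>)) = exp (of_real (- \<beta>) * Ln z + of_nat k * (of_real (- a) * Ln z))"
          using z0 by (simp add: powr_def algebra_simps)
        also have "\<dots> = z powr of_real (- \<beta>) * (z powr of_real (- a)) ^ k"
          using z0 unfolding exp_add exp_of_nat_mult by (simp add: powr_def)
        finally show ?thesis .
      qed
      have Tk: "T k s = cis \<theta> * (exp z * z powr of_real (- \<beta>)) * x ^ k" for k
      proof -
        have xk: "x ^ k = of_real (- l) ^ k * (z powr of_real (- a)) ^ k" by (simp only: x_def power_mult_distrib of_real_minus)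
        show ?thesis using True unfolding T_def z_def[symmetric] pk xk by (simp only: indicator_simps scaleR_one mult_ac atLeast_iff)
      qed
      have "(\<lambda>k. T k s) sums (cis \<theta> * (exp z * z powr of_real (- \<beta>)) * (1 / (1 - x)))"
        unfolding Tk by (intro sums_mult geometric_sums x1)
      then have "(\<Sum>k. T k s) = cis \<theta> * (exp z * z powr of_real (- \<beta>)) * (1 / (1 - x))" by (rule sums_unique[symmetric])
      also have "1 / (1 - x) = z powr of_real a / (z powr of_real a + of_real l)"
      proof -
        have za: "z powr of_real a \<noteq> 0" using z0 by simp
        have "z powr of_real a * (1 - x) = z powr of_real a + of_real l * (z powr of_real a * z powr of_real (- a))"
          by (simp add: x_def algebra_simps)
        also have "z powr of_real a * z powr of_real (- a) = 1" using z0 by (simp add: powr_minus)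
        finally have "z powr of_real a * (1 - x) = z powr of_real a + of_real l" by simp
        then have "z powr of_real a / (z powr of_real a + of_real l) = z powr of_real a / (z powr of_real a * (1 - x))" by simp
        then show ?thesis using za by simp
      qed
      also have "cis \<theta> * (exp z * z powr of_real (- \<beta>)) * (z powr of_real a / (z powr of_real a + of_real l))
         = cis \<theta> * (exp z * (z powr of_real (- \<beta>) * z powr of_real a) / (z powr of_real a + of_real l))"
        by (simp only: mult.assoc times_divide_eq_right times_divide_eq_left)
      also have "z powr of_real (- \<beta>) * z powr of_real a = z powr of_real (a - \<beta>)"
        by (simp add: powr_add[symmetric])
      finally show ?thesis using True by (simp add: z_def)
    qed (simp add: T_def)
  qed
  finally have "(\<lambda>k. of_real ((- l) ^ k) * hankel \<theta> (a * real k + \<beta>) R) sums (LBINT s:{0..}. cis \<theta> * (exp (?z s) * ?z s powr of_real (a - \<beta>)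
        / (?z s powr of_real a + of_real l)))"
    unfolding TI set_lebesgue_integral_def .
  then have "(\<lambda>k. Im (of_real ((- l) ^ k) * hankel \<theta> (a * real k + \<beta>) R)) sums Im (LBINT s:{0..}. cis \<theta> * (exp (?z s) * ?z s powr of_real (a - \<beta>)
        / (?z s powr of_real a + of_real l)))"
    by (rule sums_Im)
  also have "(\<lambda>k. Im (of_real ((- l) ^ k) * hankel \<theta> (a * real k + \<beta>) R)) = (\<lambda>k. pi * ((- l) ^ k / Gamma (a * real k + \<beta>)))"
    using hankel_formula[OF t R bk] by (simp del: of_real_power of_real_minus add: mult_ac)
  finally have S: "(\<lambda>k. pi * ((- l) ^ k / Gamma (a * real k + \<beta>))) sums Im (LBINT s:{0..}. cis \<theta> * (exp (?z s) * ?z s powr of_real (a - \<beta>)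
        / (?z s powr of_real a + of_real l)))" .
  then have "(\<lambda>k. (- l) ^ k / Gamma (a * real k + \<beta>)) sums (Im (LBINT s:{0..}. cis \<theta> * (exp (?z s) * ?z s powr of_real (a - \<beta>)
        / (?z s powr of_real a + of_real l))) / pi)"
    using sums_divide[OF S, of pi] by simp
  then show ?thesis unfolding mittag_leffler_def by (simp add: sums_iff)
qed

text \<open>The argument of \<open>z powr a\<close> lies in \<open>[0, a \<theta>]\<close>, and the rotation by half of the opening brings
  it into \<open>[- a \<theta> / 2, a \<theta> / 2]\<close>, inside the right half-plane.\<close>

lemma powr_rotated_lower_bound:
  assumes t: "0 < a" "a * \<theta> < pi" "\<bar>Arg z\<bar> \<le> \<theta>" and z: "z \<noteq> 0" "0 \<le> Arg z"
  shows "cmod z powr a * cos (a * \<theta> / 2) \<le> Re (cis (- (a * \<theta> / 2)) * z powr of_real a)"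
proof -
  have "cis (- (a * \<theta> / 2)) * z powr of_real a = exp (of_real (a * ln (cmod z)) + \<i> * of_real (a * Arg z - a * \<theta> / 2))"
  proof -
    have "Ln z = of_real (ln (cmod z)) + \<i> * of_real (Arg z)"
      using z Arg_eq_Im_Ln[of z] by (simp add: complex_eq_iff)
    then have "cis (- (a * \<theta> / 2)) * z powr of_real a = exp (\<i> * of_real (- (a * \<theta> / 2))) * exp (of_real a * (of_real (ln (cmod z)) + \<i> * of_real (Arg z)))"
      using z by (simp add: powr_def cis_conv_exp)
    then show ?thesis unfolding exp_add[symmetric] by (simp add: algebra_simps)
  qed
  then have "Re (cis (- (a * \<theta> / 2)) * z powr of_real a) = cmod z powr a * cos (a * Arg z - a * \<theta> / 2)"
    using z by (simp add: Re_exp powr_def)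
  moreover have "cos (a * \<theta> / 2) \<le> cos (\<bar>a * Arg z - a * \<theta> / 2\<bar>)"
  proof (rule cos_monotone_0_pi_le)
    have A: "0 \<le> a * Arg z" "a * Arg z \<le> a * \<theta>" using t z by auto
    then show "\<bar>a * Arg z - a * \<theta> / 2\<bar> \<le> a * \<theta> / 2" "a * \<theta> / 2 \<le> pi" using t pi_gt_zero by linarith+
  qed simp
  ultimately show ?thesis by (simp add: mult_left_mono)
qed

text \<open>Since \<open>a * \<theta> < \<pi>\<close>, the denominator has no zero in the sector, and the ray can be moved from a
  large starting point, which depends on \<open>l\<close>, to the fixed starting point \<open>1\<close>.\<close>

lemma mittag_leffler_contour:
  assumes a: "0 < a" and t: "pi / 2 < \<theta>" "\<theta> < pi" "a * \<theta> < pi" and b: "0 < \<beta>" and l: "0 \<le> l"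
  shows "Im (LBINT s:{0..}. cis \<theta> * (exp (1 + of_real s * cis \<theta>) * (1 + of_real s * cis \<theta>) powr of_real (a - \<beta>)
        / ((1 + of_real s * cis \<theta>) powr of_real a + of_real l))) = pi * mittag_leffler a \<beta> (- l)"
proof -
  have s0: "sin \<theta> > 0" using t by (intro sin_gt_zero) auto
  \<comment> \<open>so large that the geometric series converges on the ray from \<open>R\<close>\<close>
  define R where "R = max 1 ((l + 1) powr (1 / a) / sin \<theta>)"
  have R: "1 \<le> R" "0 < R" by (auto simp: R_def)
  have "(l + 1) powr (1 / a) \<le> R * sin \<theta>" using s0 by (auto simp: R_def max_def field_simps)
  then have "((l + 1) powr (1 / a)) powr a \<le> (R * sin \<theta>) powr a" using a by (intro powr_mono2) auto
  then have lR: "l < (R * sin \<theta>) powr a" using a l by (simp add: powr_powr)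
  let ?f = "\<lambda>z. exp z * z powr of_real (a - \<beta>) / (z powr of_real a + complex_of_real l)"
  have t': "0 < a * \<theta>" using a t pi_gt_zero by simp
  have nz: "z powr of_real a + complex_of_real l \<noteq> 0" if z: "z \<in> sector \<theta>" for z
  proof
    note S = sector_Arg[OF t(1,2) z]
    assume "z powr of_real a + complex_of_real l = 0"
    then have e: "z powr of_real a = - of_real l" by (simp add: eq_neg_iff_add_eq_0)
    have P: "z powr of_real a = of_real (cmod z powr a) * cis (a * Arg z)"
    proof -
      have "Ln z = of_real (ln (cmod z)) + \<i> * of_real (Arg z)"
        using S Arg_eq_Im_Ln[of z] by (simp add: complex_eq_iff)
      then have "z powr of_real a = exp (of_real (a * ln (cmod z)) + \<i> * of_real (a * Arg z))"
        using S by (simp add: powr_def algebra_simps)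
      also have "\<dots> = of_real (exp (a * ln (cmod z))) * cis (a * Arg z)"
        unfolding exp_add exp_of_real cis_conv_exp ..
      finally show ?thesis using S by (simp add: powr_def)
    qed
    have cz: "cmod z powr a > 0" using S by simp
    have "Im (z powr of_real a) = 0" "Re (z powr of_real a) \<le> 0" using e l by auto
    then have sc: "sin (a * Arg z) = 0" "cos (a * Arg z) \<le> 0"
      using cz unfolding P by (auto simp: mult_le_0_iff)
    have "\<bar>a * Arg z\<bar> < pi" using mult_strict_left_mono[OF S(2) a] t(3) a unfolding abs_mult by linarith
    then have "a * Arg z = 0" by (intro sin_eq_0_pi[OF _ _ sc(1)]) linarith+
    then have "cos (a * Arg z) = cos 0" by (rule arg_cong)
    then show False using sc(2) by (simp only: cos_zero)
  qed
  have "Im (LBINT s:{0..}. cis \<theta> * ?f (of_real 1 + of_real s * cis \<theta>)) = Im (LBINT s:{0..}. cis \<theta> * ?f (of_real R + of_real s * cis \<theta>))"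
  proof (rule ray_integral_shift[where f = ?f])
    show "open (sector \<theta>)" "convex (sector \<theta>)" by (rule open_sector convex_sector)+
    show "?f holomorphic_on sector \<theta>" using nz sector_Arg(3)[OF t(1,2)] by (auto intro!: holomorphic_intros)
    show "- cos \<theta> > 0" by (rule cos_neg_ray[OF t(1,2)])
    fix r s :: real assume r: "1 \<le> r" "r \<le> R"
    have "?f (of_real r) = of_real (exp r * r powr (a - \<beta>) / (r powr a + l))"
      using r powr_of_real[of r a] powr_of_real[of r "a - \<beta>"] by (simp add: exp_of_real)
    then show "Im (?f (of_real r)) = 0" by simp
    assume s: "0 \<le> s"
    define z where "z = complex_of_real r + of_real s * cis \<theta>"
    note p = ray_point[OF t(1,2), of r s, folded z_def]
    show "complex_of_real r + of_real s * cis \<theta> \<in> sector \<theta>" using p(7) r s by (simp add: z_def)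
    have z: "z \<noteq> 0" "0 \<le> Arg z" "\<bar>Arg z\<bar> \<le> \<theta>" using p(1,2,3) r s by auto
    have cp: "cos (a * \<theta> / 2) > 0" using t' t by (intro cos_gt_zero_pi) auto
    have cz: "cmod z powr a > 0" using z by simp
    have "cmod z powr a * cos (a * \<theta> / 2) \<le> Re (cis (- (a * \<theta> / 2)) * z powr of_real a)"
      by (rule powr_rotated_lower_bound[OF a t(3) z(3) z(1,2)])
    also have "\<dots> \<le> Re (cis (- (a * \<theta> / 2)) * (z powr of_real a + of_real l))"
      using l cp by (simp add: distrib_left)
    also have "\<dots> \<le> norm (cis (- (a * \<theta> / 2)) * (z powr of_real a + of_real l))" by (rule complex_Re_le_cmod)
    finally have lb: "cmod z powr a * cos (a * \<theta> / 2) \<le> norm (z powr of_real a + of_real l)" by (simp add: norm_mult)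
    have "norm (?f z) = norm (exp z) * cmod z powr (a - \<beta>) / norm (z powr of_real a + of_real l)"
      by (simp only: norm_mult norm_divide cmod_powr_of_real[OF z(1)])
    also have "\<dots> \<le> norm (exp z) * cmod z powr (a - \<beta>) / (cmod z powr a * cos (a * \<theta> / 2))"
    proof (rule divide_left_mono[OF lb])
      have pos: "0 < cmod z powr a * cos (a * \<theta> / 2)" by (rule mult_pos_pos[OF cz cp])
      then have "0 < norm (z powr of_real a + complex_of_real l)" using lb by linarith
      then show "0 < norm (z powr of_real a + of_real l) * (cmod z powr a * cos (a * \<theta> / 2))"
        using pos by (rule mult_pos_pos)
    qed simp
    also have "\<dots> = norm (exp z) * cmod z powr (- \<beta>) / cos (a * \<theta> / 2)"
      using z by (simp add: powr_diff powr_minus field_simps)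
    also have "norm (exp z) * cmod z powr (- \<beta>) = norm (exp z * z powr of_real (- \<beta>))"
      by (simp only: norm_mult cmod_powr_of_real[OF z(1)])
    also have "\<dots> \<le> exp r * (r * sin \<theta>) powr (- \<beta>) * exp (- (- cos \<theta>) * s)"
      unfolding z_def by (rule exp_powr_bound[OF t(1,2)]) (use r s b in auto)
    also have "\<dots> \<le> exp R * (1 * sin \<theta>) powr (- \<beta>) * exp (- (- cos \<theta>) * s)"
      using r b s0 by (intro mult_right_mono mult_mono powr_mono2') auto
    finally show "norm (?f (complex_of_real r + of_real s * cis \<theta>)) \<le> (exp R * (1 * sin \<theta>) powr (- \<beta>) / cos (a * \<theta> / 2)) * exp (- (- cos \<theta>) * s)"
      using cp by (simp add: z_def divide_right_mono)
  qed (rule R)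
  also have "\<dots> = pi * mittag_leffler a \<beta> (- l)"
    by (rule mittag_leffler_large_radius[OF t(1,2) R(2) a b l lR])
  finally show ?thesis by simp
qed

lemma integrable_product_bound:
  fixes F :: "'x \<times> 'y \<Rightarrow> 'b::{banach, second_countable_topology}" and A :: "'x \<Rightarrow> real" and B :: "'y \<Rightarrow> real"
  assumes "sigma_finite_measure M" "sigma_finite_measure N"
    and F: "F \<in> borel_measurable (M \<Otimes>\<^sub>M N)" and A: "integrable M A" and B: "integrable N B"
    and le: "\<And>x y. norm (F (x, y)) \<le> A x * B y"
  shows "integrable (M \<Otimes>\<^sub>M N) F"
proof -
  interpret M: sigma_finite_measure M by fact
  interpret N: sigma_finite_measure N by fact
  interpret pair_sigma_finite M N ..
  have "integrable (M \<Otimes>\<^sub>M N) (\<lambda>p. A (fst p) * B (snd p))"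
  proof (rule Fubini_integrable)
    show "(\<lambda>p. A (fst p) * B (snd p)) \<in> borel_measurable (M \<Otimes>\<^sub>M N)" using A B by measurable
  qed (use A B in \<open>auto simp: abs_mult\<close>)
  then show ?thesis
    by (rule Bochner_Integration.integrable_bound[OF _ F]) (use le in \<open>auto intro!: AE_I2 order_trans[OF _ abs_ge_self]\<close>)
qed

lemma exp_integral_complex:
  assumes c: "Re c > 0"
  shows "(LBINT s:{0..}. exp (- c * complex_of_real s)) = 1 / c"
proof -
  have "AE s in lborel. s \<noteq> (0::real)" by (rule AE_lborel_singleton)
  then have "(LBINT s. indicator {0..} s *\<^sub>R exp (- c * complex_of_real s))
     = (LBINT s. indicator {0..} s *\<^sub>R (of_real (s powr (1 - 1)) * exp (- c * complex_of_real s)))"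
    by (intro integral_cong_AE) (auto elim!: eventually_mono)
  also have "\<dots> = of_real (Gamma 1) * c powr (- of_real 1)"
    using Gamma_integral_complex_scaled[of 1 c] c by (simp add: set_lebesgue_integral_def)
  also have "\<dots> = 1 / c" using c by (simp add: powr_minus divide_inverse powr_to_1)
  finally show ?thesis by (simp add: set_lebesgue_integral_def)
qed

lemma square_exp_decay_integrable:
  fixes c :: real
  assumes c: "c > 0"
  shows "integrable lborel (\<lambda>s. indicator {0..} s * ((1 + s)\<^sup>2 * exp (- c * s)))"
proof -
  have "integrable lborel (\<lambda>s. indicator {0..} s *\<^sub>R (s powr (3 - 1) * exp (- c * s)) + 2 * (indicator {0..} s *\<^sub>R (s powr (2 - 1) * exp (- c * s))) + indicator {0..} s *\<^sub>R exp (- c * s))"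
    using Gamma_integral_scaled(1)[of 3 c] Gamma_integral_scaled(1)[of 2 c] exp_decay_integrable[of c] c
    by (intro Bochner_Integration.integrable_add integrable_mult_right) (auto simp: set_integrable_def)
  also have "(\<lambda>s. indicator {0..} s *\<^sub>R (s powr (3 - 1) * exp (- c * s)) + 2 * (indicator {0..} s *\<^sub>R (s powr (2 - 1) * exp (- c * s))) + indicator {0..} s *\<^sub>R exp (- c * s))
     = (\<lambda>s. indicator {0..} s * ((1 + s)\<^sup>2 * exp (- c * s)))"
    by (auto simp: fun_eq_iff indicator_def power2_eq_square algebra_simps)
  finally show ?thesis .
qed

text \<open>After rotation by \<open>\<omega>\<close>, the denominator \<open>z powr a + l\<close> has positive real part, uniformly on
  the ray; hence its reciprocal is the Laplace integral of \<open>\<omega> * exp (- r * \<omega> * (z powr a + l))\<close>.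
  Exchanging the integrals leaves \<open>l\<close> only in the factor \<open>exp (- \<omega> r l)\<close>. The uniform lower bound is
  the exponential decay rate of \<open>V\<close>. The condition \<open>\<beta> \<le> a\<close> prevents a negative power of \<open>z\<close>, so that
  a single polynomial bound suffices.\<close>

lemma mittag_leffler_subordination:
  assumes a: "1 < a" "a < 2" and b: "0 < \<beta>" "\<beta> \<le> a"
  shows "\<exists>V \<omega> K \<kappa>. cmod \<omega> = 1 \<and> Re \<omega> > 0 \<and> \<kappa> > 0 \<and> V \<in> borel_measurable borel \<and>
     (\<forall>r\<ge>0. cmod (V r) \<le> K * exp (- \<kappa> * r)) \<and>
     (\<forall>l\<ge>0. Im (LBINT r:{0..}. V r * exp (- \<omega> * of_real r * of_real l)) = mittag_leffler a \<beta> (- l))"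
proof -
  \<comment> \<open>any angle between \<open>\<pi>/2\<close>, for the decay of the exponential, and \<open>\<pi>/a\<close>, for the absence of zeros\<close>
  define \<theta> where "\<theta> = (pi / 2 + pi / a) / 2"
  have pa: "pi / 2 < pi / a" "pi / a < pi" using a pi_gt_zero by (auto simp: divide_simps)
  have gen: "pi / 2 < (pi / 2 + u) / 2" "u < pi \<Longrightarrow> (pi / 2 + u) / 2 < pi" if "pi / 2 < u" for u
    using that pi_gt_zero by (simp_all add: field_simps)
  have t1: "pi / 2 < \<theta>" and t2: "\<theta> < pi" unfolding \<theta>_def by (rule gen pa)+
  note t = t1 t2
  have at: "a * \<theta> < pi"
  proof -
    have "a * \<theta> = pi / 2 + a * pi / 4" using a by (simp add: \<theta>_def field_simps)
    then show ?thesis using mult_strict_right_mono[OF a(2) pi_gt_zero] by linarith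
  qed
  have at0: "0 < a * \<theta>" using a t pi_gt_zero by simp
  have s0: "sin \<theta> > 0" using t by (intro sin_gt_zero) auto
  have c: "- cos \<theta> > 0" by (rule cos_neg_ray[OF t])
  \<comment> \<open>turns the range of \<open>z powr a\<close> on the ray into a sector that is symmetric about the positive
    axis\<close>
  define \<omega> where "\<omega> = cis (- (a * \<theta> / 2))"
  have cp: "cos (a * \<theta> / 2) > 0" using at0 at by (intro cos_gt_zero_pi) auto
  have w: "cmod \<omega> = 1" "Re \<omega> > 0" "\<omega> \<noteq> 0" using cp by (auto simp: \<omega>_def)
  define \<kappa> where "\<kappa> = sin \<theta> powr a * cos (a * \<theta> / 2)"
  have k: "\<kappa> > 0" using s0 cp by (simp add: \<kappa>_def)
  \<comment> \<open>the modulus keeps \<open>z\<close> on the ray for all real \<open>s\<close>, which makes it continuous and nonzero on the whole line\<close>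
  define z where "z s = complex_of_real 1 + of_real \<bar>s\<bar> * cis \<theta>" for s :: real
  have zp: "z s \<noteq> 0" "0 \<le> Arg (z s)" "\<bar>Arg (z s)\<bar> \<le> \<theta>" "z s \<notin> \<real>\<^sub>\<le>\<^sub>0" "sin \<theta> \<le> cmod (z s)"
     "norm (exp (z s)) = exp 1 * exp (- (- cos \<theta>) * \<bar>s\<bar>)" "cmod (z s) \<le> 1 + \<bar>s\<bar>" for s
    using ray_point[OF t, of 1 "\<bar>s\<bar>"] unfolding z_def by auto
  have zc: "continuous_on UNIV z" unfolding z_def by (intro continuous_intros)
  have zm[measurable]: "z \<in> borel_measurable borel" by (rule borel_measurable_continuous_onI[OF zc])
  have zpm[measurable]: "(\<lambda>s. z s powr w) \<in> borel_measurable borel" for w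
  proof -
    have "(\<lambda>s. z s powr w) = (\<lambda>s. exp (w * Ln (z s)))" using zp(1) by (simp add: powr_def fun_eq_iff)
    moreover have "continuous_on UNIV (\<lambda>s. exp (w * Ln (z s)))" by (intro continuous_intros zc) (rule zp(4))
    ultimately show ?thesis by (simp add: borel_measurable_continuous_onI)
  qed
  define D where "D s = of_real (1 / pi) * (cis \<theta> * (exp (z s) * z s powr of_real (a - \<beta>))) * \<omega>" for s
  have Dm[measurable]: "D \<in> borel_measurable borel"
    unfolding D_def by (intro borel_measurable_times borel_measurable_const zpm measurable_compose[OF zm borel_measurable_exp])
  define W where "W s r = indicator {0..} s *\<^sub>R (D s * exp (- (\<omega> * z s powr of_real a) * of_real r))" for s r :: real
  define A where "A s = exp 1 / pi * (indicator {0..} s * ((1 + s)\<^sup>2 * exp (- (- cos \<theta>) * s)))" for s :: real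
  have Ai: "integrable lborel A" unfolding A_def by (intro integrable_mult_right square_exp_decay_integrable c)
  have lb: "\<kappa> \<le> Re (\<omega> * z s powr of_real a)" for s
  proof -
    have "\<kappa> \<le> cmod (z s) powr a * cos (a * \<theta> / 2)"
      unfolding \<kappa>_def using cp zp(5)[of s] s0 a by (intro mult_right_mono powr_mono2) auto
    also have "\<dots> \<le> Re (\<omega> * z s powr of_real a)" unfolding \<omega>_def
      by (rule powr_rotated_lower_bound) (use a at zp in auto)
    finally show ?thesis .
  qed
  have DA: "indicator {0..} s * cmod (D s) \<le> A s" for s
  proof (cases "s \<ge> 0")
    case True
    have "cmod (z s) powr (a - \<beta>) \<le> (1 + s) powr (a - \<beta>)"
      using zp(7)[of s] True b by (intro powr_mono2) auto
    also have "\<dots> \<le> (1 + s) powr 2" using True a b by (intro powr_mono) auto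
    also have "\<dots> = (1 + s)\<^sup>2" using True by simp
    finally have *: "cmod (z s) powr (a - \<beta>) \<le> (1 + s)\<^sup>2" .
    have "cmod (D s) = 1 / pi * (exp 1 * exp (- (- cos \<theta>) * s) * cmod (z s) powr (a - \<beta>))"
      using True w unfolding D_def norm_mult zp(6) cmod_powr_of_real[OF zp(1)] by (simp add: norm_divide)
    also have "\<dots> \<le> 1 / pi * (exp 1 * exp (- (- cos \<theta>) * s) * (1 + s)\<^sup>2)"
      using * by (intro mult_left_mono) auto
    finally show ?thesis using True by (simp add: A_def mult_ac)
  qed (simp add: A_def)
  have Wle: "cmod (W s r) \<le> A s * exp (- \<kappa> * r)" if r: "r \<ge> 0" for s r
  proof -
    have "cmod (exp (- (\<omega> * z s powr of_real a) * of_real r)) \<le> exp (- \<kappa> * r)"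
      using mult_right_mono[OF lb[of s] r] by simp
    then have "(indicator {0..} s * cmod (D s)) * cmod (exp (- (\<omega> * z s powr of_real a) * of_real r)) \<le> A s * exp (- \<kappa> * r)"
      using DA[of s] by (intro mult_mono) (auto simp: A_def)
    then show ?thesis by (simp add: W_def norm_mult mult_ac)
  qed
  have Wm[measurable]: "(\<lambda>p. W (fst p) (snd p)) \<in> borel_measurable (lborel \<Otimes>\<^sub>M lborel)"
    unfolding W_def by measurable
  have Wms: "(\<lambda>s. W s r) \<in> borel_measurable lborel" for r
    unfolding W_def by measurable
  define V where "V r = (LBINT s. W s r)" for r
  have Vm: "V \<in> borel_measurable borel"
  proof -
    have "(\<lambda>r. LBINT s. W s r) \<in> borel_measurable lborel"
      by (rule sigma_finite_measure.borel_measurable_lebesgue_integral[OF sigma_finite_lborel])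
         (use measurable_compose[OF measurable_pair_swap' Wm] in \<open>simp add: split_beta'\<close>)
    then show ?thesis by (simp add: V_def[abs_def])
  qed
  have Vle: "cmod (V r) \<le> (LBINT s. A s) * exp (- \<kappa> * r)" if r: "r \<ge> 0" for r
  proof -
    have i: "integrable lborel (\<lambda>s. A s * exp (- \<kappa> * r))" using Ai by simp
    have iW: "integrable lborel (\<lambda>s. W s r)"
      by (rule Bochner_Integration.integrable_bound[OF i Wms]) (use Wle[OF r] in \<open>auto intro!: AE_I2 order_trans[OF _ abs_ge_self]\<close>)
    have "cmod (V r) \<le> (LBINT s. cmod (W s r))" unfolding V_def by (rule integral_norm_bound)
    also have "\<dots> \<le> (LBINT s. A s * exp (- \<kappa> * r))"
      by (rule integral_mono[OF integrable_norm[OF iW] i Wle[OF r]])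
    finally have "cmod (V r) \<le> (LBINT s. A s * exp (- \<kappa> * r))" .
    then show ?thesis by simp
  qed
  have main: "Im (LBINT r:{0..}. V r * exp (- \<omega> * of_real r * of_real l)) = mittag_leffler a \<beta> (- l)" if l: "l \<ge> 0" for l
  proof -
    define F where "F s r = indicator {0..} r *\<^sub>R (W s r * exp (- \<omega> * of_real r * of_real l))" for s r :: real
    have Fle: "norm (F s r) \<le> A s * (indicator {0..} r *\<^sub>R exp (- \<kappa> * r))" for s r
    proof (cases "r \<ge> 0")
      case True
      have "cmod (exp (- \<omega> * of_real r * of_real l)) \<le> 1" using True l w by simp
      then have "cmod (W s r) * cmod (exp (- \<omega> * of_real r * of_real l)) \<le> A s * exp (- \<kappa> * r) * 1"
        using Wle[OF True, of s] by (intro mult_mono) (auto simp: A_def)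
      then show ?thesis using True by (simp add: F_def norm_mult)
    qed (simp add: F_def)
    have Fi: "integrable (lborel \<Otimes>\<^sub>M lborel) (case_prod F)"
    proof (rule integrable_product_bound[OF sigma_finite_lborel sigma_finite_lborel _ Ai])
      show "case_prod F \<in> borel_measurable (lborel \<Otimes>\<^sub>M lborel)"
        unfolding F_def split_beta' using Wm by measurable
      show "integrable lborel (\<lambda>r. indicator {0..} r *\<^sub>R exp (- \<kappa> * r))"
        using exp_decay_integrable[OF k] by (simp add: set_integrable_def)
    qed (use Fle in auto)
    have "(LBINT r:{0..}. V r * exp (- \<omega> * of_real r * of_real l)) = (LBINT r. (LBINT s. F s r))"
      unfolding set_lebesgue_integral_def
    proof (rule Bochner_Integration.integral_cong[OF refl])
      fix r :: real
      have "(LBINT s. F s r) = indicator {0..} r *\<^sub>R ((LBINT s. W s r) * exp (- \<omega> * of_real r * of_real l))"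
        unfolding F_def by (simp only: integral_scaleR_right integral_mult_left_zero)
      then show "indicator {0..} r *\<^sub>R (V r * exp (- \<omega> * of_real r * of_real l)) = (LBINT s. F s r)"
        by (simp add: V_def)
    qed
    also have "\<dots> = (LBINT s. (LBINT r. F s r))" by (rule lborel_pair.Fubini_integral[OF Fi])
    also have "\<dots> = (LBINT s. of_real (1 / pi) * (indicator {0..} s *\<^sub>R (cis \<theta> * (exp (1 + of_real s * cis \<theta>) * (1 + of_real s * cis \<theta>) powr of_real (a - \<beta>)
        / ((1 + of_real s * cis \<theta>) powr of_real a + of_real l)))))"
    proof (rule Bochner_Integration.integral_cong[OF refl])
      fix s :: real
      show "(LBINT r. F s r) = of_real (1 / pi) * (indicator {0..} s *\<^sub>R (cis \<theta> * (exp (1 + of_real s * cis \<theta>) * (1 + of_real s * cis \<theta>) powr of_real (a - \<beta>)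
        / ((1 + of_real s * cis \<theta>) powr of_real a + of_real l))))"
      proof (cases "s \<ge> 0")
        case True
        define \<zeta> where "\<zeta> = z s powr of_real a + of_real l"
        have ee: "exp (- (\<omega> * z s powr of_real a) * of_real r) * exp (- \<omega> * of_real r * of_real l) = exp (- (\<omega> * \<zeta>) * of_real r)" for r
          unfolding exp_add[symmetric] \<zeta>_def by (simp add: algebra_simps)
        have "(LBINT r. F s r) = (LBINT r. D s * (indicator {0..} r *\<^sub>R exp (- (\<omega> * \<zeta>) * of_real r)))"
          unfolding F_def W_def ee[symmetric] using True by (simp add: mult_ac)
        also have "\<dots> = D s * (LBINT r:{0..}. exp (- (\<omega> * \<zeta>) * of_real r))"
          unfolding set_lebesgue_integral_def by (rule integral_mult_right_zero)
        also have "(LBINT r:{0..}. exp (- (\<omega> * \<zeta>) * of_real r)) = 1 / (\<omega> * \<zeta>)"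
        proof (rule exp_integral_complex)
          have "Re (\<omega> * \<zeta>) = Re (\<omega> * z s powr of_real a) + Re \<omega> * l" by (simp add: \<zeta>_def distrib_left)
          then show "0 < Re (\<omega> * \<zeta>)" using lb[of s] k w l by (simp add: add_pos_nonneg)
        qed
        also have "D s * (1 / (\<omega> * \<zeta>)) = of_real (1 / pi) * (cis \<theta> * (exp (z s) * z s powr of_real (a - \<beta>) / \<zeta>))"
          using w by (simp add: D_def)
        finally show ?thesis using True by (simp add: \<zeta>_def z_def)
      qed (simp add: F_def W_def)
    qed
    also have "\<dots> = of_real (1 / pi) * (LBINT s:{0..}. cis \<theta> * (exp (1 + of_real s * cis \<theta>) * (1 + of_real s * cis \<theta>) powr of_real (a - \<beta>)
        / ((1 + of_real s * cis \<theta>) powr of_real a + of_real l)))"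
      unfolding set_lebesgue_integral_def by (rule integral_mult_right_zero)
    finally have "Im (LBINT r:{0..}. V r * exp (- \<omega> * of_real r * of_real l)) = 1 / pi * (pi * mittag_leffler a \<beta> (- l))"
      using mittag_leffler_contour[of a \<theta> \<beta> l] a t at b l by simp
    then show ?thesis by simp
  qed
  show ?thesis using w k Vm Vle main by blast
qed

section \<open>Fourier transforms of Gaussians\<close>

lemma cis_borel_measurable[measurable]: "cis \<in> borel_measurable borel"
  unfolding cis_conv_exp by (intro borel_measurable_continuous_onI continuous_intros)

lemma lborel_integral_prod:
  fixes f :: "'a::euclidean_space \<Rightarrow> real \<Rightarrow> complex"
  assumes f: "\<And>b. b \<in> Basis \<Longrightarrow> integrable lborel (f b)"
  shows "(LBINT x. (\<Prod>b\<in>Basis. f b (x \<bullet> b))) = (\<Prod>b\<in>Basis. LBINT t. f b t)"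
    and "integrable lborel (\<lambda>x::'a. \<Prod>b\<in>Basis. f b (x \<bullet> b))"
proof -
  have [measurable]: "f b \<in> borel_measurable borel" if "b \<in> Basis" for b using f[OF that] by auto
  interpret product_sigma_finite "\<lambda>b::'a. lborel :: real measure" ..
  have L: "(lborel :: 'a measure) = distr (Pi\<^sub>M Basis (\<lambda>b. lborel)) borel (\<lambda>f. \<Sum>b\<in>Basis. f b *\<^sub>R b)"
    using lborel_def[where 'a='a] by (simp add: lborel_eq_real)
  have c: "(\<Sum>b'\<in>Basis. g b' *\<^sub>R b') \<bullet> b = g b" if "b \<in> Basis" for g :: "'a \<Rightarrow> real" and b
    using that by (simp add: inner_sum_left_Basis)
  have m: "(\<lambda>f. \<Sum>b\<in>Basis. f b *\<^sub>R b) \<in> Pi\<^sub>M Basis (\<lambda>b. lborel) \<rightarrow>\<^sub>M (borel :: 'a measure)"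
    by measurable
  have fm: "(\<lambda>x. \<Prod>b\<in>Basis. f b (x \<bullet> b)) \<in> borel_measurable (borel :: 'a measure)"
    by measurable
  have e: "(\<Prod>b\<in>Basis. f b ((\<Sum>b'\<in>Basis. g b' *\<^sub>R b') \<bullet> b)) = (\<Prod>b\<in>Basis. f b (g b))" for g
    by (intro prod.cong refl) (simp add: c)
  show "(LBINT x. (\<Prod>b\<in>Basis. f b (x \<bullet> b))) = (\<Prod>b\<in>Basis. LBINT t. f b t)"
    unfolding L by (subst integral_distr[OF m fm]) (simp only: e product_integral_prod[OF finite_Basis f])
  show "integrable lborel (\<lambda>x::'a. \<Prod>b\<in>Basis. f b (x \<bullet> b))"
    unfolding L by (subst integrable_distr_eq[OF m fm]) (simp only: e product_integrable_prod[OF finite_Basis f])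
qed

lemma integrable_Cauchy_density: "integrable lborel (\<lambda>t::real. 1 / (1 + t\<^sup>2))"
proof -
  have "(\<lambda>t::real. 1 / (1 + t\<^sup>2)) = (\<lambda>t. inverse (1 + t\<^sup>2))" by (simp add: divide_inverse)
  moreover have "set_integrable lborel (einterval (-\<infinity>) \<infinity>) (\<lambda>t::real. inverse (1 + t\<^sup>2))"
    by (rule integrable_inverse_1_plus_square)
  ultimately show ?thesis by (simp add: set_integrable_def einterval_def)
qed

lemma integrable_prod_Cauchy: "integrable lborel (\<lambda>x::'a::euclidean_space. \<Prod>b\<in>Basis. 1 / (1 + (x \<bullet> b)\<^sup>2))"
proof -
  have "integrable lborel (\<lambda>x::'a. \<Prod>b\<in>Basis. complex_of_real (1 / (1 + (x \<bullet> b)\<^sup>2)))"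
    by (rule lborel_integral_prod(2)) (intro integrable_of_real integrable_Cauchy_density)
  then have "integrable lborel (\<lambda>x::'a. complex_of_real (\<Prod>b\<in>Basis. 1 / (1 + (x \<bullet> b)\<^sup>2)))"
    by (simp only: of_real_prod)
  then show ?thesis by (rule complex_of_real_integrable_eq[THEN iffD1])
qed

text \<open>The characteristic function of the standard normal distribution, rescaled.\<close>

lemma gaussian_fourier_1d:
  fixes k y :: real
  assumes k: "k > 0"
  shows "integrable lborel (\<lambda>t. of_real (exp (- k * t\<^sup>2)) * cis (y * t))"
    and "(LBINT t. of_real (exp (- k * t\<^sup>2)) * cis (y * t)) = of_real (sqrt (pi / k) * exp (- (y\<^sup>2 / (4 * k))))"
proof -
  let ?s = "sqrt (2 * k)"
  have s: "?s > 0" using k by simp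
  have s2: "?s\<^sup>2 = 2 * k" using k by simp
  let ?g = "\<lambda>t. std_normal_density t *\<^sub>R cis (y / ?s * t)"
  have gi: "integrable lborel ?g"
    by (rule Bochner_Integration.integrable_bound[OF integrable_normal_density[of 1 0]]) (auto simp: abs_of_nonneg)
  have "char std_normal_distribution (y / ?s) = (LBINT t. ?g t)"
    unfolding char_def by (subst integral_density) (auto simp: cis_conv_exp)
  then have gI: "(LBINT t. ?g t) = of_real (exp (- (y / ?s)\<^sup>2 / 2))"
    unfolding char_std_normal_distribution by simp
  have e: "?g (0 + ?s * t) = (1 / sqrt (2 * pi)) *\<^sub>R (of_real (exp (- k * t\<^sup>2)) * cis (y * t))" for t
    using s s2 by (simp add: std_normal_density_def power_mult_distrib scaleR_conv_of_real)
  have "integrable lborel (\<lambda>t. ?g (0 + ?s * t))"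
    using lborel_integrable_real_affine_iff[of ?s ?g 0] gi s by simp
  then have i1: "integrable lborel (\<lambda>t. (1 / sqrt (2 * pi)) *\<^sub>R (of_real (exp (- k * t\<^sup>2)) * cis (y * t)))" unfolding e .
  then have "integrable lborel (\<lambda>t. sqrt (2 * pi) *\<^sub>R ((1 / sqrt (2 * pi)) *\<^sub>R (of_real (exp (- k * t\<^sup>2)) * cis (y * t))))"
    by (rule integrable_scaleR_right)
  then show "integrable lborel (\<lambda>t. of_real (exp (- k * t\<^sup>2)) * cis (y * t))" by simp
  have "(LBINT t. ?g t) = \<bar>?s\<bar> *\<^sub>R (LBINT t. ?g (0 + ?s * t))"
    by (rule lborel_integral_real_affine) (use s in simp)
  also have "\<dots> = ?s *\<^sub>R ((1 / sqrt (2 * pi)) *\<^sub>R (LBINT t. of_real (exp (- k * t\<^sup>2)) * cis (y * t)))"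
    unfolding e using s by (simp only: integral_scaleR_right abs_of_pos)
  finally have "of_real (exp (- (y / ?s)\<^sup>2 / 2)) = (?s / sqrt (2 * pi)) *\<^sub>R (LBINT t. of_real (exp (- k * t\<^sup>2)) * cis (y * t))"
    unfolding gI by simp
  then have "(sqrt (2 * pi) / ?s) *\<^sub>R complex_of_real (exp (- (y / ?s)\<^sup>2 / 2)) = (LBINT t. of_real (exp (- k * t\<^sup>2)) * cis (y * t))"
    using s by simp
  moreover have "sqrt (2 * pi) / ?s = sqrt (pi / k)" by (simp add: real_sqrt_divide[symmetric])
  moreover have "(y / ?s)\<^sup>2 / 2 = y\<^sup>2 / (4 * k)" using s2 by (simp add: power_divide)
  ultimately show "(LBINT t. of_real (exp (- k * t\<^sup>2)) * cis (y * t)) = of_real (sqrt (pi / k) * exp (- (y\<^sup>2 / (4 * k))))"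
    by (simp add: scaleR_conv_of_real)
qed

lemma gaussian_fourier_real:
  fixes x :: "'a::euclidean_space"
  assumes k: "k > 0"
  shows "integrable lborel (\<lambda>\<xi>. of_real (exp (- k * (norm \<xi>)\<^sup>2)) * cis (x \<bullet> \<xi>))"
    and "(LBINT \<xi>. of_real (exp (- k * (norm \<xi>)\<^sup>2)) * cis (x \<bullet> \<xi>)) = of_real ((pi / k) powr (DIM('a) / 2) * exp (- ((norm x)\<^sup>2 / (4 * k))))"
proof -
  have n2: "(norm v)\<^sup>2 = (\<Sum>b\<in>Basis. (v \<bullet> b)\<^sup>2)" for v :: 'a
    unfolding power2_norm_eq_inner by (subst euclidean_inner) (simp add: power2_eq_square)
  have cs: "cis (\<Sum>b\<in>S. g b) = (\<Prod>b\<in>S. cis (g b))" if "finite S" for S :: "'a set" and g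
    using that by (induction S) (auto simp: cis_mult[symmetric])
  have e: "of_real (exp (- k * (norm \<xi>)\<^sup>2)) * cis (x \<bullet> \<xi>) = (\<Prod>b\<in>Basis. of_real (exp (- k * (\<xi> \<bullet> b)\<^sup>2)) * cis ((x \<bullet> b) * (\<xi> \<bullet> b)))" for \<xi> :: 'a
    unfolding n2 prod.distrib euclidean_inner[of x \<xi>] cs[OF finite_Basis] sum_distrib_left exp_sum[OF finite_Basis] of_real_prod ..
  show "integrable lborel (\<lambda>\<xi>. of_real (exp (- k * (norm \<xi>)\<^sup>2)) * cis (x \<bullet> \<xi>))"
    unfolding e by (rule lborel_integral_prod(2)) (rule gaussian_fourier_1d(1)[OF k])
  have "(LBINT \<xi>. of_real (exp (- k * (norm \<xi>)\<^sup>2)) * cis (x \<bullet> \<xi>)) = (\<Prod>b\<in>Basis. of_real (sqrt (pi / k) * exp (- ((x \<bullet> b)\<^sup>2 / (4 * k)))))"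
    unfolding e by (subst lborel_integral_prod(1)[OF gaussian_fourier_1d(1)[OF k]]) (simp only: gaussian_fourier_1d(2)[OF k])
  also have "\<dots> = of_real (sqrt (pi / k) ^ DIM('a) * exp (- ((norm x)\<^sup>2 / (4 * k))))"
    unfolding n2[of x] of_real_prod[symmetric] prod.distrib prod_constant sum_divide_distrib sum_negf[symmetric] exp_sum[OF finite_Basis] ..
  also have "sqrt (pi / k) ^ DIM('a) = (pi / k) powr (DIM('a) / 2)"
    using k by (simp add: powr_half_sqrt[symmetric] powr_realpow[symmetric] powr_powr)
  finally show "(LBINT \<xi>. of_real (exp (- k * (norm \<xi>)\<^sup>2)) * cis (x \<bullet> \<xi>)) = of_real ((pi / k) powr (DIM('a) / 2) * exp (- ((norm x)\<^sup>2 / (4 * k))))" .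
qed

lemma integrable_gaussian:
  assumes k: "k > 0"
  shows "integrable lborel (\<lambda>\<xi>::'a::euclidean_space. exp (- k * (norm \<xi>)\<^sup>2))"
    and "(LBINT \<xi>. exp (- k * (norm (\<xi>::'a))\<^sup>2)) = (pi / k) powr (DIM('a) / 2)"
proof -
  have "integrable lborel (\<lambda>\<xi>::'a. complex_of_real (exp (- k * (norm \<xi>)\<^sup>2)))"
    using gaussian_fourier_real(1)[OF k, of "0::'a"] by simp
  then show "integrable lborel (\<lambda>\<xi>::'a. exp (- k * (norm \<xi>)\<^sup>2))" by (rule complex_of_real_integrable_eq[THEN iffD1])
  have "complex_of_real (LBINT \<xi>. exp (- k * (norm (\<xi>::'a))\<^sup>2)) = of_real ((pi / k) powr (DIM('a) / 2))"
    using gaussian_fourier_real(2)[OF k, of "0::'a"] by (simp flip: integral_complex_of_real)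
  then show "(LBINT \<xi>. exp (- k * (norm (\<xi>::'a))\<^sup>2)) = (pi / k) powr (DIM('a) / 2)" by (simp only: of_real_eq_iff)
qed

text \<open>Both sides are holomorphic in \<open>c\<close>; this is where heat kernels of complex time come from.\<close>

lemma gaussian_fourier_complex:
  fixes x :: "'a::euclidean_space"
  assumes c: "Re c > 0"
  shows "(LBINT \<xi>. exp (- c * of_real ((norm \<xi>)\<^sup>2)) * cis (x \<bullet> \<xi>)) =
    of_real (pi powr (DIM('a) / 2)) * c powr (- of_real (DIM('a) / 2)) * exp (- (of_real ((norm x)\<^sup>2) / (4 * c)))"
proof (rule right_half_plane_identity[of "\<lambda>c. \<integral>\<xi>. exp (- c * of_real ((norm \<xi>)\<^sup>2)) * cis (x \<bullet> \<xi>) \<partial>lborel"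
      "\<lambda>c. of_real (pi powr (DIM('a) / 2)) * c powr (- of_real (DIM('a) / 2)) * exp (- (of_real ((norm x)\<^sup>2) / (4 * c)))", OF _ _ _ c])
  show "(\<lambda>c. of_real (pi powr (DIM('a) / 2)) * c powr (- of_real (DIM('a) / 2)) * exp (- (of_real ((norm x)\<^sup>2) / (4 * c)))) holomorphic_on {z. 0 < Re z}"
    by (intro holomorphic_intros) (auto simp: complex_nonpos_Reals_iff)
  show "(\<lambda>c. LBINT \<xi>. exp (- c * of_real ((norm \<xi>)\<^sup>2)) * cis (x \<bullet> \<xi>)) holomorphic_on {z. 0 < Re z}"
  proof (rule holomorphic_on_integral)
    show "open {z. Re z > 0}" by (rule open_halfspace_Re_gt)
    show "(\<lambda>c. exp (- c * of_real ((norm \<xi>)\<^sup>2)) * cis (x \<bullet> \<xi>)) holomorphic_on {z. 0 < Re z}" for \<xi>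
      by (intro holomorphic_intros)
    show "(\<lambda>\<xi>. exp (- c * of_real ((norm \<xi>)\<^sup>2)) * cis (x \<bullet> \<xi>)) \<in> borel_measurable lborel" for c
      by measurable
    fix c :: complex assume "c \<in> {z. 0 < Re z}"
    then have c: "Re c > 0" by simp
    let ?B = "\<lambda>\<xi>::'a. exp (- (Re c / 2) * (norm \<xi>)\<^sup>2)"
    have R: "Re c' \<ge> Re c / 2" if "c' \<in> cball c (Re c / 2)" for c'
      using that abs_Re_le_cmod[of "c - c'"] by (simp add: dist_norm)
    show "\<exists>r>0. \<exists>B. cball c r \<subseteq> {z. 0 < Re z} \<and> integrable lborel B \<and> (\<forall>c'\<in>cball c r. \<forall>\<xi>\<in>space lborel. norm (exp (- c' * of_real ((norm \<xi>)\<^sup>2)) * cis (x \<bullet> \<xi>)) \<le> B \<xi>)"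
    proof (intro exI[of _ "Re c / 2"] exI[of _ ?B] conjI ballI)
      show "cball c (Re c / 2) \<subseteq> {z. 0 < Re z}" using R c by force
      show "integrable lborel ?B" by (rule integrable_gaussian) (use c in simp)
      fix c' and \<xi> :: 'a assume c': "c' \<in> cball c (Re c / 2)"
      show "norm (exp (- c' * of_real ((norm \<xi>)\<^sup>2)) * cis (x \<bullet> \<xi>)) \<le> ?B \<xi>"
        using mult_right_mono[OF R[OF c'], of "(norm \<xi>)\<^sup>2"] by (simp add: norm_mult)
    qed (use c in auto)
  qed
  fix k :: real assume k: "k > 0"
  have "(LBINT \<xi>. exp (- of_real k * of_real ((norm \<xi>)\<^sup>2)) * cis (x \<bullet> \<xi>)) = (LBINT \<xi>. of_real (exp (- k * (norm \<xi>)\<^sup>2)) * cis (x \<bullet> \<xi>))"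
    by (simp add: exp_of_real flip: of_real_power of_real_mult of_real_minus)
  also have "\<dots> = of_real ((pi / k) powr (DIM('a) / 2) * exp (- ((norm x)\<^sup>2 / (4 * k))))"
    by (rule gaussian_fourier_real(2)[OF k])
  also have "(pi / k) powr (DIM('a) / 2) = pi powr (DIM('a) / 2) * k powr (- (DIM('a) / 2))"
    by (simp only: powr_divide powr_minus divide_inverse[of "pi powr _"])
  also have "of_real (pi powr (DIM('a) / 2) * k powr (- (DIM('a) / 2)) * exp (- ((norm x)\<^sup>2 / (4 * k)))) =
     of_real (pi powr (DIM('a) / 2)) * of_real k powr (- complex_of_real (DIM('a) / 2)) * exp (- (of_real ((norm x)\<^sup>2) / (4 * of_real k)))"
  proof -
    have "of_real (k powr (- (DIM('a) / 2))) = of_real k powr complex_of_real (- (DIM('a) / 2))"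
      using k by (intro powr_of_real[symmetric]) simp
    moreover have "complex_of_real (exp (- ((norm x)\<^sup>2 / (4 * k)))) = exp (- (of_real ((norm x)\<^sup>2) / (4 * of_real k)))"
      unfolding exp_of_real[symmetric] by simp
    ultimately show ?thesis unfolding of_real_mult by simp
  qed
  finally show "(LBINT \<xi>. exp (- of_real k * of_real ((norm \<xi>)\<^sup>2)) * cis (x \<bullet> \<xi>)) =
     of_real (pi powr (DIM('a) / 2)) * of_real k powr (- complex_of_real (DIM('a) / 2)) * exp (- (of_real ((norm x)\<^sup>2) / (4 * of_real k)))" .
qed

section \<open>Schwartz functions\<close>

lemma polynomial_growth:
  fixes P :: "'a::real_normed_vector \<Rightarrow> real"
  assumes "real_polynomial_function P"
  shows "\<exists>C N. 0 \<le> C \<and> (\<forall>x. \<bar>P x\<bar> \<le> C * (1 + norm x) ^ N)"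
  using assms
proof induction
  case (linear f)
  then obtain K where K: "\<And>x. norm (f x) \<le> norm x * K" "K > 0"
    using bounded_linear.pos_bounded by blast
  have "\<bar>f x\<bar> \<le> K * (1 + norm x) ^ 1" for x
    using K(1)[of x] K(2) by (simp add: algebra_simps)
  then show ?case using K(2) by (intro exI[of _ K] exI[of _ 1]) auto
next
  case (const c)
  show ?case by (rule exI[of _ "\<bar>c\<bar>"], rule exI[of _ 0]) auto
next
  case (add f g)
  then obtain C N C' N' where *: "0 \<le> C" "\<And>x. \<bar>f x\<bar> \<le> C * (1 + norm x) ^ N" "0 \<le> C'" "\<And>x. \<bar>g x\<bar> \<le> C' * (1 + norm x) ^ N'"
    by blast
  have "\<bar>f x + g x\<bar> \<le> (C + C') * (1 + norm x) ^ (N + N')" for x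
  proof -
    have "C * (1 + norm x) ^ N \<le> C * (1 + norm x) ^ (N + N')" "C' * (1 + norm x) ^ N' \<le> C' * (1 + norm x) ^ (N + N')"
      using * by (intro mult_left_mono power_increasing; simp)+
    then show ?thesis using *(2)[of x] *(4)[of x] by (simp add: distrib_right)
  qed
  then show ?case using * by (intro exI[of _ "C + C'"] exI[of _ "N + N'"]) auto
next
  case (mult f g)
  then obtain C N C' N' where *: "0 \<le> C" "\<And>x. \<bar>f x\<bar> \<le> C * (1 + norm x) ^ N" "0 \<le> C'" "\<And>x. \<bar>g x\<bar> \<le> C' * (1 + norm x) ^ N'"
    by blast
  have "\<bar>f x * g x\<bar> \<le> (C * C') * (1 + norm x) ^ (N + N')" for x
  proof -
    have "\<bar>f x\<bar> * \<bar>g x\<bar> \<le> (C * (1 + norm x) ^ N) * (C' * (1 + norm x) ^ N')"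
      by (intro mult_mono *) (use * in auto)
    then show ?thesis by (simp add: abs_mult power_add mult_ac)
  qed
  then show ?case using * by (intro exI[of _ "C * C'"] exI[of _ "N + N'"]) auto
qed

text \<open>The derivatives of a Gaussian are polynomials times the Gaussian. It suffices to know that
  the polynomial factors are stable under directional derivatives and multiplication, so an abstract
  class of polynomial functions is enough.\<close>

lemma polynomial_derivative:
  fixes P :: "'a::real_normed_vector \<Rightarrow> real"
  assumes "real_polynomial_function P"
  shows "\<exists>P'. (\<forall>x. (P has_derivative P' x) (at x)) \<and> (\<forall>b. real_polynomial_function (\<lambda>x. P' x b))"
  using assms
proof induction
  case (linear f)
  show ?case by (rule exI[of _ "\<lambda>x. f"]) (use linear in \<open>auto intro: bounded_linear_imp_has_derivative\<close>)
next
  case (const c)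
  show ?case by (rule exI[of _ "\<lambda>x h. 0"]) auto
next
  case (add f g)
  then obtain f' g' where *: "\<And>x. (f has_derivative f' x) (at x)" "\<And>b. real_polynomial_function (\<lambda>x. f' x b)"
    "\<And>x. (g has_derivative g' x) (at x)" "\<And>b. real_polynomial_function (\<lambda>x. g' x b)" by blast
  show ?case by (rule exI[of _ "\<lambda>x h. f' x h + g' x h"]) (use * in \<open>auto intro!: derivative_eq_intros\<close>)
next
  case (mult f g)
  then obtain f' g' where *: "\<And>x. (f has_derivative f' x) (at x)" "\<And>b. real_polynomial_function (\<lambda>x. f' x b)"
    "\<And>x. (g has_derivative g' x) (at x)" "\<And>b. real_polynomial_function (\<lambda>x. g' x b)" by blast
  show ?case
  proof (rule exI[of _ "\<lambda>x h. f x * g' x h + f' x h * g x"], intro conjI allI)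
    show "((\<lambda>x. f x * g x) has_derivative (\<lambda>h. f x * g' x h + f' x h * g x)) (at x)" for x
      by (rule has_derivative_mult[OF *(1) *(3)])
    show "real_polynomial_function (\<lambda>x. f x * g' x b + f' x b * g x)" for b
      by (intro real_polynomial_function.intros(3) real_polynomial_function.intros(4) *(2,4) mult.hyps)
  qed
qed

lemma gaussian_polynomial_bounded:
  fixes y :: "'a::real_normed_vector"
  assumes P: "real_polynomial_function P" and c: "c > 0"
  shows "bounded (range (\<lambda>x. norm x ^ k *\<^sub>R complex_of_real (P x * exp (- c * (norm (x - y))\<^sup>2))))"
proof -
  obtain C N where C: "0 \<le> C" "\<And>x. \<bar>P x\<bar> \<le> C * (1 + norm x) ^ N" using polynomial_growth[OF P] by blast
  define M where "M = k + N"
  have "norm (norm x ^ k *\<^sub>R complex_of_real (P x * exp (- c * (norm (x - y))\<^sup>2))) \<le> C * (1 + norm y) ^ M * exp ((real M)\<^sup>2 / (4 * c))" for x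
  proof -
    define t where "t = norm (x - y)"
    have t: "t \<ge> 0" by (simp add: t_def)
    have "norm x \<le> norm y + t" using norm_triangle_ineq[of y "x - y"] by (simp add: t_def)
    moreover have "norm y * t \<ge> 0" using t by simp
    ultimately have "1 + norm x \<le> (1 + norm y) * (1 + t)" unfolding distrib_left distrib_right by simp
    also have "\<dots> \<le> (1 + norm y) * exp t" using t by (intro mult_left_mono) auto
    finally have 1: "(1 + norm x) ^ M \<le> ((1 + norm y) * exp t) ^ M" by (intro power_mono) auto
    have "norm (norm x ^ k *\<^sub>R complex_of_real (P x * exp (- c * (norm (x - y))\<^sup>2))) = norm x ^ k * \<bar>P x\<bar> * exp (- c * t\<^sup>2)"
      by (simp add: t_def abs_mult norm_mult)
    also have "\<dots> \<le> (1 + norm x) ^ k * (C * (1 + norm x) ^ N) * exp (- c * t\<^sup>2)"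
      using C by (intro mult_right_mono mult_mono power_mono) auto
    also have "\<dots> = C * (1 + norm x) ^ M * exp (- c * t\<^sup>2)" by (simp add: M_def power_add)
    also have "\<dots> \<le> C * ((1 + norm y) * exp t) ^ M * exp (- c * t\<^sup>2)"
      using 1 C by (intro mult_right_mono mult_left_mono) auto
    also have "\<dots> = C * (1 + norm y) ^ M * exp (real M * t - c * t\<^sup>2)"
      by (simp add: power_mult_distrib exp_of_nat_mult exp_diff exp_minus divide_inverse)
    also have "exp (real M * t - c * t\<^sup>2) \<le> exp ((real M)\<^sup>2 / (4 * c))"
    proof -
      have "0 \<le> (2 * c * t - real M)\<^sup>2" by simp
      then have "4 * c * (real M * t - c * t\<^sup>2) \<le> (real M)\<^sup>2" by (simp add: power2_eq_square algebra_simps)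
      then show ?thesis using c by (simp add: field_simps)
    qed
    finally show ?thesis using C by (simp add: mult_left_mono)
  qed
  then show ?thesis by (auto simp: bounded_iff)
qed

lemma iter_partial_gaussian:
  fixes y :: "real^'n"
  assumes "set bs \<subseteq> Basis" "c > 0"
  shows "\<exists>P. real_polynomial_function P \<and> iter_partial bs (\<lambda>x. complex_of_real (exp (- c * (norm (x - y))\<^sup>2))) = (\<lambda>x. complex_of_real (P x * exp (- c * (norm (x - y))\<^sup>2)))
     \<and> (\<forall>x. iter_partial bs (\<lambda>x. complex_of_real (exp (- c * (norm (x - y))\<^sup>2))) differentiable (at x))"
  using assms(1)
proof (induction bs)
  have main: "\<exists>Q. real_polynomial_function Q \<and> (\<lambda>x. frechet_derivative (\<lambda>x. complex_of_real (P x * exp (- c * (norm (x - y))\<^sup>2))) (at x) b) = (\<lambda>x. complex_of_real (Q x * exp (- c * (norm (x - y))\<^sup>2)))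
      \<and> (\<forall>x. (\<lambda>x. complex_of_real (P x * exp (- c * (norm (x - y))\<^sup>2))) differentiable (at x))"
    if P: "real_polynomial_function P" for P b
  proof -
    obtain P' where P': "\<And>x. (P has_derivative P' x) (at x)" "\<And>b. real_polynomial_function (\<lambda>x. P' x b)"
      using polynomial_derivative[OF P] by blast
    have d: "((\<lambda>x. complex_of_real (P x * exp (- c * (norm (x - y))\<^sup>2))) has_derivative
        (\<lambda>h. complex_of_real ((P' x h - P x * (2 * c * ((x - y) \<bullet> h))) * exp (- c * (norm (x - y))\<^sup>2)))) (at x)" for x
    proof -
      have "((\<lambda>x. P x * exp (- c * ((x - y) \<bullet> (x - y)))) has_derivative
         (\<lambda>h. P x * (exp (- c * ((x - y) \<bullet> (x - y))) * (- c * ((x - y) \<bullet> h + h \<bullet> (x - y)))) + P' x h * exp (- c * ((x - y) \<bullet> (x - y))))) (at x)"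
        by (rule has_derivative_mult[OF P'(1)]) (auto intro!: derivative_eq_intros simp: algebra_simps)
      also have "(\<lambda>h. P x * (exp (- c * ((x - y) \<bullet> (x - y))) * (- c * ((x - y) \<bullet> h + h \<bullet> (x - y)))) + P' x h * exp (- c * ((x - y) \<bullet> (x - y))))
        = (\<lambda>h. (P' x h - P x * (2 * c * ((x - y) \<bullet> h))) * exp (- c * ((x - y) \<bullet> (x - y))))"
      proof
        have alg: "p * (e * (- k * (i + i))) + q * e = (q - p * (2 * k * i)) * e" for p e k i q :: real
          by (simp add: algebra_simps)
        show "P x * (exp (- c * ((x - y) \<bullet> (x - y))) * (- c * ((x - y) \<bullet> h + h \<bullet> (x - y)))) + P' x h * exp (- c * ((x - y) \<bullet> (x - y)))
          = (P' x h - P x * (2 * c * ((x - y) \<bullet> h))) * exp (- c * ((x - y) \<bullet> (x - y)))" for h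
          unfolding inner_commute[of h] by (rule alg)
      qed
      finally have "((\<lambda>x. P x * exp (- c * (norm (x - y))\<^sup>2)) has_derivative
          (\<lambda>h. (P' x h - P x * (2 * c * ((x - y) \<bullet> h))) * exp (- c * (norm (x - y))\<^sup>2))) (at x)"
        unfolding power2_norm_eq_inner .
      then show ?thesis by (rule has_derivative_of_real)
    qed
    let ?Q = "\<lambda>x. P' x b - P x * (2 * c * ((x - y) \<bullet> b))"
    have "bounded_linear (\<lambda>x::real^'n. x \<bullet> b)" by (rule bounded_linear_inner_left)
    then have "real_polynomial_function (\<lambda>x. 2 * c * (x \<bullet> b - y \<bullet> b))"
      by (intro real_polynomial_function.intros(4) real_polynomial_function_diff real_polynomial_function.intros(2) real_polynomial_function.intros(1))
    then have "real_polynomial_function ?Q"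
      unfolding inner_diff_left
      by (intro real_polynomial_function_diff P'(2) real_polynomial_function.intros(4)[OF P])
    moreover have "frechet_derivative (\<lambda>x. complex_of_real (P x * exp (- c * (norm (x - y))\<^sup>2))) (at x) b = complex_of_real (?Q x * exp (- c * (norm (x - y))\<^sup>2))" for x
      unfolding frechet_derivative_at[OF d, symmetric] ..
    ultimately show ?thesis using d by (intro exI[of _ ?Q]) (auto simp: differentiable_def)
  qed
  {
    case Nil
    have 1: "real_polynomial_function (\<lambda>x::real^'n. 1::real)" by (rule real_polynomial_function.intros(2))
    show ?case using main[OF 1] 1 by (intro exI[of _ "\<lambda>x. 1"]) (auto simp: iter_partial_def)
  next
    case (Cons b bs)
    then obtain P where P: "real_polynomial_function P" "iter_partial bs (\<lambda>x. complex_of_real (exp (- c * (norm (x - y))\<^sup>2))) = (\<lambda>x. complex_of_real (P x * exp (- c * (norm (x - y))\<^sup>2)))"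
      by auto
    obtain Q where Q: "real_polynomial_function Q" "(\<lambda>x. frechet_derivative (\<lambda>x. complex_of_real (P x * exp (- c * (norm (x - y))\<^sup>2))) (at x) b) = (\<lambda>x. complex_of_real (Q x * exp (- c * (norm (x - y))\<^sup>2)))"
      using main[OF P(1)] by blast
    have "iter_partial (b # bs) (\<lambda>x. complex_of_real (exp (- c * (norm (x - y))\<^sup>2))) = (\<lambda>x. complex_of_real (Q x * exp (- c * (norm (x - y))\<^sup>2)))"
      using P(2) Q(2) by (simp add: iter_partial_def)
    then show ?case using Q(1) main[OF Q(1)] by auto
  }
qed

lemma schwartz_gaussian:
  fixes y :: "real^'n"
  assumes "c > 0"
  shows "schwartz (\<lambda>x. complex_of_real (exp (- c * (norm (x - y))\<^sup>2)))"
  unfolding schwartz_def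
proof (intro allI impI conjI)
  fix bs :: "(real^'n) list" assume bs: "set bs \<subseteq> Basis"
  note P = iter_partial_gaussian[OF bs assms, of y]
  then show "iter_partial bs (\<lambda>x. complex_of_real (exp (- c * (norm (x - y))\<^sup>2))) differentiable (at x)" for x by blast
  obtain Q where Q: "real_polynomial_function Q"
    and eq: "iter_partial bs (\<lambda>x. complex_of_real (exp (- c * (norm (x - y))\<^sup>2))) = (\<lambda>x. complex_of_real (Q x * exp (- c * (norm (x - y))\<^sup>2)))"
    using P by blast
  show "bounded (range (\<lambda>x. norm x ^ k *\<^sub>R iter_partial bs (\<lambda>x. complex_of_real (exp (- c * (norm (x - y))\<^sup>2))) x))" for k
    unfolding eq by (rule gaussian_polynomial_bounded[OF Q assms])
qed

lemma schwartz_partial: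
  assumes "schwartz \<phi>" "b \<in> Basis"
  shows "schwartz (\<lambda>x. frechet_derivative \<phi> (at x) b)"
proof -
  have "iter_partial bs (\<lambda>x. frechet_derivative \<phi> (at x) b) = iter_partial (bs @ [b]) \<phi>" for bs
    by (simp add: iter_partial_def)
  then show ?thesis using assms unfolding schwartz_def by simp
qed

lemma schwartz_differentiable:
  assumes "schwartz \<phi>"
  shows "\<phi> differentiable (at x)"
proof -
  have "iter_partial [] \<phi> differentiable (at x)" using assms unfolding schwartz_def by simp
  then show ?thesis by (simp add: iter_partial_def)
qed

lemma schwartz_continuous: "schwartz \<phi> \<Longrightarrow> continuous_on S \<phi>"
  by (intro continuous_at_imp_continuous_on ballI differentiable_imp_continuous_within schwartz_differentiable)

lemma schwartz_measurable: "schwartz \<phi> \<Longrightarrow> \<phi> \<in> borel_measurable borel"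
  by (intro borel_measurable_continuous_onI schwartz_continuous)

lemma schwartz_decay:
  assumes "schwartz \<phi>"
  shows "\<exists>C\<ge>0. \<forall>x. norm x ^ k * cmod (\<phi> x) \<le> C"
proof -
  have "bounded (range (\<lambda>x. norm x ^ k *\<^sub>R iter_partial [] \<phi> x))" using assms unfolding schwartz_def by simp
  then obtain C where C: "\<And>x. norm (norm x ^ k *\<^sub>R \<phi> x) \<le> C" by (auto simp: bounded_iff iter_partial_def)
  then show ?thesis using order_trans[OF norm_ge_zero C] by (intro exI[of _ C]) auto
qed

text \<open>The product of one-dimensional weights is an integrable majorant by Fubini's theorem, which
  avoids polar coordinates.\<close>

lemma schwartz_prod_decay:
  fixes \<phi> :: "real^'n \<Rightarrow> complex"
  assumes "schwartz \<phi>"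
  shows "\<exists>C\<ge>0. \<forall>x. cmod (\<phi> x) \<le> C * (\<Prod>b\<in>Basis. 1 / (1 + (x \<bullet> b)\<^sup>2))"
proof -
  let ?n = "DIM(real^'n)"
  obtain C0 where C0: "0 \<le> C0" "\<And>x. norm x ^ 0 * cmod (\<phi> x) \<le> C0" using schwartz_decay[OF assms] by blast
  obtain C1 where C1: "0 \<le> C1" "\<And>x. norm x ^ (2 * ?n) * cmod (\<phi> x) \<le> C1" using schwartz_decay[OF assms] by blast
  define C where "C = 2 ^ ?n * (C0 + C1)"
  have "cmod (\<phi> x) \<le> C * (\<Prod>b\<in>Basis. 1 / (1 + (x \<bullet> b)\<^sup>2))" for x
  proof -
    have "(\<Prod>b\<in>Basis. 1 + (x \<bullet> b)\<^sup>2) \<le> (\<Prod>b\<in>(Basis :: (real^'n) set). 2 * max 1 ((norm x)\<^sup>2))"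
    proof (rule prod_mono, intro conjI)
      fix b :: "real^'n" assume "b \<in> Basis"
      then have "(x \<bullet> b)\<^sup>2 \<le> (norm x)\<^sup>2" using Basis_le_norm[of b x] by (intro abs_le_square_iff[THEN iffD1]) simp
      then show "1 + (x \<bullet> b)\<^sup>2 \<le> 2 * max 1 ((norm x)\<^sup>2)" by simp
    qed auto
    also have "\<dots> = (2 * max 1 ((norm x)\<^sup>2)) ^ ?n" by simp
    also have "\<dots> = 2 ^ ?n * max 1 ((norm x)\<^sup>2) ^ ?n" by (simp only: power_mult_distrib)
    also have "max 1 ((norm x)\<^sup>2) ^ ?n \<le> 1 + norm x ^ (2 * ?n)"
    proof (cases "(norm x)\<^sup>2 \<le> 1")
      case True
      then show ?thesis by (simp add: max_def)
    next
      case False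
      then show ?thesis by (simp add: max_def power_mult)
    qed
    finally have le: "(\<Prod>b\<in>Basis. 1 + (x \<bullet> b)\<^sup>2) \<le> 2 ^ ?n * (1 + norm x ^ (2 * ?n))" by simp
    have pos: "(\<Prod>b\<in>Basis. 1 + (x \<bullet> b)\<^sup>2) > 0" by (intro prod_pos) (auto intro: add_pos_nonneg)
    have "(\<Prod>b\<in>Basis. 1 + (x \<bullet> b)\<^sup>2) * cmod (\<phi> x) \<le> 2 ^ ?n * (1 + norm x ^ (2 * ?n)) * cmod (\<phi> x)"
      using le by (rule mult_right_mono) simp
    also have "\<dots> = 2 ^ ?n * (norm x ^ 0 * cmod (\<phi> x) + norm x ^ (2 * ?n) * cmod (\<phi> x))"
      by (simp add: algebra_simps)
    also have "\<dots> \<le> C" unfolding C_def using C0(2)[of x] C1(2)[of x] by (intro mult_left_mono add_mono) auto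
    finally have "cmod (\<phi> x) \<le> C / (\<Prod>b\<in>Basis. 1 + (x \<bullet> b)\<^sup>2)" using pos by (simp add: pos_le_divide_eq mult.commute)
    then show ?thesis by (simp add: prod_dividef)
  qed
  moreover have "0 \<le> C" using C0 C1 by (simp add: C_def)
  ultimately show ?thesis by blast
qed

lemma prod_decay_integrable:
  fixes f :: "'a::euclidean_space \<Rightarrow> complex"
  assumes "f \<in> borel_measurable borel" "\<And>x. cmod (f x) \<le> C * (\<Prod>b\<in>Basis. 1 / (1 + (x \<bullet> b)\<^sup>2))"
  shows "integrable lborel f"
  by (rule Bochner_Integration.integrable_bound[OF integrable_mult_right[OF integrable_prod_Cauchy, of C]])
     (use assms in \<open>auto intro!: AE_I2 order_trans[OF _ abs_ge_self]\<close>)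

lemma schwartz_integrable:
  assumes "schwartz \<phi>"
  shows "integrable lborel \<phi>"
  using schwartz_prod_decay[OF assms] prod_decay_integrable[OF schwartz_measurable[OF assms]] by blast

text \<open>By Fubini's theorem the integral of the derivative along \<open>b\<close> over all unit segments in
  direction \<open>b\<close> equals the integral of \<open>f (x + b) - f x\<close>, which vanishes by translation invariance.\<close>

lemma integral_directional_derivative:
  fixes f :: "real^'n \<Rightarrow> complex"
  assumes der: "\<And>x. (f has_derivative f' x) (at x)"
    and cont: "continuous_on UNIV (\<lambda>x. f' x b)"
    and int: "integrable lborel f" "integrable lborel (\<lambda>x. f' x b)"
  shows "(LBINT x. f' x b) = 0"
proof -
  let ?D = "\<lambda>x. f' x b"
  have fm[measurable]: "f \<in> borel_measurable borel" and Dm[measurable]: "?D \<in> borel_measurable borel"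
    using int by auto
  let ?G = "\<lambda>s x. indicator {0..1} s *\<^sub>R ?D (x + s *\<^sub>R b)"
  have tr: "integrable lborel (\<lambda>x. h (x + s *\<^sub>R b)) \<longleftrightarrow> integrable lborel h" "(LBINT x. h (x + s *\<^sub>R b)) = (LBINT x. h x)"
    if [measurable]: "h \<in> borel_measurable borel" for s and h :: "real^'n \<Rightarrow> 'z::{banach, second_countable_topology}"
  proof -
    have L: "lborel = distr lborel borel (\<lambda>x. s *\<^sub>R b + 1 *\<^sub>R x :: real^'n)"
      using lborel_affine[of 1 "s *\<^sub>R b"] by (simp add: density_1)
    show "integrable lborel (\<lambda>x. h (x + s *\<^sub>R b)) \<longleftrightarrow> integrable lborel h"
      by (subst (2) L, subst integrable_distr_eq) (auto simp: add.commute)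
    show "(LBINT x. h (x + s *\<^sub>R b)) = (LBINT x. h x)"
      by (subst (2) L, subst integral_distr) (auto simp: add.commute)
  qed
  have Gi: "integrable (lborel \<Otimes>\<^sub>M lborel) (case_prod ?G)"
  proof (rule lborel_pair.Fubini_integrable)
    show "case_prod ?G \<in> borel_measurable (lborel \<Otimes>\<^sub>M lborel)" by measurable
    have "(\<lambda>s. LBINT x. norm (case_prod ?G (s, x))) = (\<lambda>s. indicator {0..1} s * (LBINT x. norm (?D x)))"
      using tr(2)[of "\<lambda>x. norm (?D x)"] by (auto simp: fun_eq_iff indicator_def)
    moreover have "integrable lborel (\<lambda>s::real. indicator {0..1} s * (LBINT x. norm (?D x)))"
      by (intro integrable_mult_left integrable_real_indicator) auto
    ultimately show "integrable lborel (\<lambda>s. LBINT x. norm (case_prod ?G (s, x)))" by simp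
    show "AE s in lborel. integrable lborel (\<lambda>x. case_prod ?G (s, x))"
      using tr(1)[of ?D] int by (intro AE_I2) simp
  qed
  have ftc: "(LBINT s. ?G s x) = f (x + b) - f x" for x
  proof -
    have "(LBINT s. indicator {0..1} s *\<^sub>R ?D (x + s *\<^sub>R b)) = f (x + 1 *\<^sub>R b) - f (x + 0 *\<^sub>R b)"
    proof (rule integral_FTC_atLeastAtMost)
      fix s :: real
      have "((\<lambda>s. f (x + s *\<^sub>R b)) has_derivative (\<lambda>h. f' (x + s *\<^sub>R b) (h *\<^sub>R b))) (at s)"
        by (rule has_derivative_compose[OF _ der]) (auto intro!: derivative_eq_intros)
      moreover have "f' (x + s *\<^sub>R b) (h *\<^sub>R b) = h *\<^sub>R ?D (x + s *\<^sub>R b)" for h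
        using has_derivative_linear[OF der] by (rule linear_scale)
      ultimately show "((\<lambda>s. f (x + s *\<^sub>R b)) has_vector_derivative ?D (x + s *\<^sub>R b)) (at s within {0..1})"
        by (simp add: has_vector_derivative_def has_derivative_at_withinI)
      show "continuous_on {0..1} (\<lambda>s. ?D (x + s *\<^sub>R b))"
        by (rule continuous_on_compose2[OF cont]) (auto intro!: continuous_intros)
    qed simp
    then show ?thesis by simp
  qed
  have "(LBINT x. f (x + b) - f x) = (LBINT x. f (x + b)) - (LBINT x. f x)"
    using tr(1)[OF fm, of 1] int by (intro Bochner_Integration.integral_diff) auto
  then have "0 = (LBINT x. f (x + b) - f x)" using tr(2)[OF fm, of 1] by simp
  also have "\<dots> = (LBINT x. (LBINT s. ?G s x))" by (simp only: ftc)
  also have "\<dots> = (LBINT s. (LBINT x. ?G s x))" by (rule lborel_pair.Fubini_integral[OF Gi])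
  also have "\<dots> = (LBINT s. indicator {0..1::real} s *\<^sub>R (LBINT x. ?D x))"
    by (simp only: integral_scaleR_right tr(2)[OF Dm])
  also have "\<dots> = (LBINT x. ?D x)"
    by simp
  finally show ?thesis by simp
qed

lemma fourier_of_partial:
  fixes \<phi> :: "real^'n \<Rightarrow> complex"
  assumes \<phi>: "schwartz \<phi>" and b: "b \<in> Basis"
  shows "(LBINT x. cis (x \<bullet> \<xi>) * frechet_derivative \<phi> (at x) b) = - (\<i> * of_real (b \<bullet> \<xi>)) * (LBINT x. cis (x \<bullet> \<xi>) * \<phi> x)"
proof -
  let ?D = "\<lambda>x. frechet_derivative \<phi> (at x) b"
  have cm: "integrable lborel (\<lambda>x. cis (x \<bullet> \<xi>) * g x)" if g: "integrable lborel g" for g :: "real^'n \<Rightarrow> complex"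
  proof (rule Bochner_Integration.integrable_bound[OF g])
    have [measurable]: "g \<in> borel_measurable borel" using g by auto
    show "(\<lambda>x. cis (x \<bullet> \<xi>) * g x) \<in> borel_measurable lborel" by measurable
  qed (auto simp: norm_mult)
  have c1: "continuous_on UNIV (\<lambda>x::real^'n. cis (x \<bullet> \<xi>))" unfolding cis_conv_exp by (intro continuous_intros)
  note \<phi>i = schwartz_integrable[OF \<phi>] and Di = schwartz_integrable[OF schwartz_partial[OF \<phi> b]]
  have "(LBINT x. cis (x \<bullet> \<xi>) * ?D x + (\<i> * of_real (b \<bullet> \<xi>)) * (cis (x \<bullet> \<xi>) * \<phi> x)) = 0"
  proof (rule integral_directional_derivative[where f' = "\<lambda>x h. cis (x \<bullet> \<xi>) * frechet_derivative \<phi> (at x) h + (\<i> * of_real (h \<bullet> \<xi>)) * (cis (x \<bullet> \<xi>) * \<phi> x)" and f = "\<lambda>x. cis (x \<bullet> \<xi>) * \<phi> x"])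
    fix x
    have "((\<lambda>x. \<i> * complex_of_real (x \<bullet> \<xi>)) has_derivative (\<lambda>h. \<i> * complex_of_real (h \<bullet> \<xi>))) (at x)"
      by (intro bounded_linear_imp_has_derivative bounded_linear_const_mult bounded_linear_compose[OF bounded_linear_of_real] bounded_linear_inner_left)
    then have "((\<lambda>x. exp (\<i> * complex_of_real (x \<bullet> \<xi>))) has_derivative (\<lambda>h. exp (\<i> * complex_of_real (x \<bullet> \<xi>)) * (\<i> * complex_of_real (h \<bullet> \<xi>)))) (at x)"
      by (rule has_derivative_compose[OF _ DERIV_exp[unfolded has_field_derivative_def]])
    then have e: "((\<lambda>x. cis (x \<bullet> \<xi>)) has_derivative (\<lambda>h. cis (x \<bullet> \<xi>) * (\<i> * complex_of_real (h \<bullet> \<xi>)))) (at x)"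
      unfolding cis_conv_exp .
    have p: "(\<phi> has_derivative frechet_derivative \<phi> (at x)) (at x)"
      using schwartz_differentiable[OF \<phi>] frechet_derivative_works by blast
    show "((\<lambda>x. cis (x \<bullet> \<xi>) * \<phi> x) has_derivative (\<lambda>h. cis (x \<bullet> \<xi>) * frechet_derivative \<phi> (at x) h + (\<i> * of_real (h \<bullet> \<xi>)) * (cis (x \<bullet> \<xi>) * \<phi> x))) (at x)"
      using has_derivative_mult[OF e p] by (simp add: mult_ac)
  next
    show "continuous_on UNIV (\<lambda>x. cis (x \<bullet> \<xi>) * ?D x + (\<i> * of_real (b \<bullet> \<xi>)) * (cis (x \<bullet> \<xi>) * \<phi> x))"
      by (intro continuous_intros c1 schwartz_continuous \<phi> schwartz_partial b)
    show "integrable lborel (\<lambda>x. cis (x \<bullet> \<xi>) * \<phi> x)" by (rule cm[OF \<phi>i])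
    show "integrable lborel (\<lambda>x. cis (x \<bullet> \<xi>) * ?D x + (\<i> * of_real (b \<bullet> \<xi>)) * (cis (x \<bullet> \<xi>) * \<phi> x))"
      by (intro Bochner_Integration.integrable_add integrable_mult_right cm \<phi>i Di)
  qed
  moreover have "(LBINT x. cis (x \<bullet> \<xi>) * ?D x + (\<i> * of_real (b \<bullet> \<xi>)) * (cis (x \<bullet> \<xi>) * \<phi> x))
     = (LBINT x. cis (x \<bullet> \<xi>) * ?D x) + (\<i> * of_real (b \<bullet> \<xi>)) * (LBINT x. cis (x \<bullet> \<xi>) * \<phi> x)"
    by (subst Bochner_Integration.integral_add[OF cm[OF Di] integrable_mult_right[OF cm[OF \<phi>i]]]) simp
  ultimately show ?thesis by (simp add: eq_neg_iff_add_eq_0)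
qed

text \<open>Two derivatives in direction \<open>b\<close> produce the factor \<open>(\<xi> \<bullet> b)\<^sup>2\<close>; induction over the directions
  gives the integrable product weight.\<close>

lemma fourier_decay:
  fixes \<phi> :: "real^'n \<Rightarrow> complex"
  assumes "finite A" "A \<subseteq> Basis" "schwartz \<phi>"
  shows "\<exists>C\<ge>0. \<forall>\<xi>. (\<Prod>b\<in>A. 1 + (\<xi> \<bullet> b)\<^sup>2) * cmod (LBINT x. cis (x \<bullet> \<xi>) * \<phi> x) \<le> C"
  using assms
proof (induction A arbitrary: \<phi> rule: finite_induct)
  case empty
  have "cmod (LBINT x. cis (x \<bullet> \<xi>) * \<phi> x) \<le> (LBINT x. cmod (\<phi> x))" for \<xi>
    using integral_norm_bound[of lborel "\<lambda>x. cis (x \<bullet> \<xi>) * \<phi> x"] by (simp add: norm_mult)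
  then show ?case by (intro exI[of _ "\<integral>x. cmod (\<phi> x) \<partial>lborel"]) auto
next
  case (insert b A)
  have b: "b \<in> Basis" using insert by simp
  let ?J = "\<lambda>\<phi> \<xi>. \<integral>x. cis (x \<bullet> \<xi>) * \<phi> x \<partial>lborel"
  let ?\<psi> = "\<lambda>x. frechet_derivative (\<lambda>x. frechet_derivative \<phi> (at x) b) (at x) b"
  have s1: "schwartz (\<lambda>x. frechet_derivative \<phi> (at x) b)" and s2: "schwartz ?\<psi>"
    using schwartz_partial b insert.prems by blast+
  obtain C where C: "0 \<le> C" "\<And>\<xi>. (\<Prod>b\<in>A. 1 + (\<xi> \<bullet> b)\<^sup>2) * cmod (?J \<phi> \<xi>) \<le> C"
    using insert.IH[of \<phi>] insert.prems by auto
  obtain C' where C': "0 \<le> C'" "\<And>\<xi>. (\<Prod>b\<in>A. 1 + (\<xi> \<bullet> b)\<^sup>2) * cmod (?J ?\<psi> \<xi>) \<le> C'"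
    using insert.IH[OF _ s2] insert.prems by auto
  have "(\<Prod>b\<in>insert b A. 1 + (\<xi> \<bullet> b)\<^sup>2) * cmod (?J \<phi> \<xi>) \<le> C + C'" for \<xi>
  proof -
    have "?J ?\<psi> \<xi> = - of_real ((b \<bullet> \<xi>)\<^sup>2) * ?J \<phi> \<xi>"
      unfolding fourier_of_partial[OF s1 b] fourier_of_partial[OF insert.prems(2) b]
      by (simp add: power2_eq_square algebra_simps)
    then have n: "cmod (?J ?\<psi> \<xi>) = (\<xi> \<bullet> b)\<^sup>2 * cmod (?J \<phi> \<xi>)"
      by (simp add: norm_mult inner_commute norm_power)
    have "(\<Prod>b\<in>insert b A. 1 + (\<xi> \<bullet> b)\<^sup>2) * cmod (?J \<phi> \<xi>)
       = (\<Prod>b\<in>A. 1 + (\<xi> \<bullet> b)\<^sup>2) * cmod (?J \<phi> \<xi>) + (\<Prod>b\<in>A. 1 + (\<xi> \<bullet> b)\<^sup>2) * cmod (?J ?\<psi> \<xi>)"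
      unfolding n using insert.hyps by (simp add: algebra_simps)
    also have "\<dots> \<le> C + C'" by (intro add_mono C C')
    finally show ?thesis .
  qed
  then show ?case using C(1) C'(1) by (intro exI[of _ "C + C'"]) auto
qed

text \<open>Integrability of the transform is the only property of Fourier transforms of Schwartz
  functions that the tempered pairing with a bounded multiplier needs.\<close>

lemma schwartz_inverse_fourier_integrable:
  fixes \<phi> :: "real^'n \<Rightarrow> complex"
  assumes \<phi>: "schwartz \<phi>"
  shows "integrable lborel (inverse_fourier \<phi>)"
proof -
  have [measurable]: "\<phi> \<in> borel_measurable borel" by (rule schwartz_measurable[OF \<phi>])
  obtain C where C: "0 \<le> C" "\<And>\<xi>. (\<Prod>b\<in>Basis. 1 + (\<xi> \<bullet> b)\<^sup>2) * cmod (LBINT x. cis (x \<bullet> \<xi>) * \<phi> x) \<le> C"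
    using fourier_decay[OF finite_Basis subset_refl \<phi>] by auto
  have "integrable lborel (\<lambda>\<xi>. LBINT x. cis (\<xi> \<bullet> x) * \<phi> x)"
  proof (rule prod_decay_integrable)
    show "(\<lambda>\<xi>. LBINT x. cis (\<xi> \<bullet> x) * \<phi> x) \<in> borel_measurable borel"
      by measurable
    fix \<xi> :: "real^'n"
    have pos: "(\<Prod>b\<in>Basis. 1 + (\<xi> \<bullet> b)\<^sup>2) > 0" by (intro prod_pos) (auto intro: add_pos_nonneg)
    have "cmod (LBINT x. cis (x \<bullet> \<xi>) * \<phi> x) \<le> C / (\<Prod>b\<in>Basis. 1 + (\<xi> \<bullet> b)\<^sup>2)"
      using C(2)[of \<xi>] pos by (simp add: pos_le_divide_eq mult.commute)
    then show "cmod (LBINT x. cis (\<xi> \<bullet> x) * \<phi> x) \<le> C * (\<Prod>b\<in>Basis. 1 / (1 + (\<xi> \<bullet> b)\<^sup>2))"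
      by (simp add: prod_dividef inner_commute)
  qed
  then show ?thesis unfolding inverse_fourier_def[abs_def] by (rule integrable_scaleR_right)
qed

section \<open>The Mittag-Leffler kernel as a superposition of heat kernels\<close>

text \<open>The heat kernel at the complex time \<open>\<omega> * r\<close>, that is, the inverse Fourier transform of
  \<open>exp (- \<omega> r \<bar>\<xi>\<bar>\<^sup>2)\<close>. The power of the time is written as a product of powers of \<open>\<omega>\<close> and \<open>r\<close>, so
  that the branch of the complex power is fixed by \<open>\<omega>\<close> alone.\<close>

definition heat :: "complex \<Rightarrow> real \<Rightarrow> real^'n \<Rightarrow> complex" where
  "heat \<omega> r x = of_real (pi powr (real CARD('n) / 2) / (2 * pi) ^ CARD('n)) * \<omega> powr (- of_real (real CARD('n) / 2)) *
     of_real (r powr (- (real CARD('n) / 2))) * exp (- (of_real ((norm x)\<^sup>2) / (4 * (\<omega> * of_real r))))"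

lemma Ln_real_times: "r > 0 \<Longrightarrow> z \<noteq> 0 \<Longrightarrow> Ln (complex_of_real r * z) = of_real (ln r) + Ln z"
  by (simp add: Ln_times_of_real Ln_of_real)

lemma Re_inverse_pos: "Re \<omega> > 0 \<Longrightarrow> Re (1 / \<omega>) > 0"
  unfolding Re_divide by (auto intro!: divide_pos_pos add_pos_nonneg)

lemma Re_real_times: "Re (complex_of_real k * z) = k * Re z"
  by simp

lemma heat_inverse_fourier:
  fixes x :: "real^'n"
  assumes w: "Re \<omega> > 0" and r: "r > 0"
  shows "inverse_fourier (\<lambda>\<xi>. exp (- (\<omega> * of_real r) * of_real ((norm \<xi>)\<^sup>2))) x = heat \<omega> r x"
proof -
  let ?e = "- complex_of_real (real CARD('n) / 2)"
  have w0: "\<omega> \<noteq> 0" using w by auto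
  have F1: "(LBINT \<xi>. cis (x \<bullet> \<xi>) * exp (- (\<omega> * of_real r) * of_real ((norm \<xi>)\<^sup>2)))
     = of_real (pi powr (real CARD('n) / 2)) * (\<omega> * of_real r) powr ?e * exp (- (of_real ((norm x)\<^sup>2) / (4 * (\<omega> * of_real r))))"
    using gaussian_fourier_complex[of "\<omega> * of_real r" x] w r by (simp add: mult.commute)
  have F2: "(\<omega> * of_real r) powr ?e = \<omega> powr ?e * of_real (r powr (- (real CARD('n) / 2)))"
  proof -
    have "Ln (of_real r * \<omega>) = of_real (ln r) + Ln \<omega>" using r w0 by (rule Ln_real_times)
    then have "(\<omega> * of_real r) powr ?e = exp (?e * Ln \<omega> + of_real (- (real CARD('n) / 2) * ln r))"
    proof -
      assume L: "Ln (of_real r * \<omega>) = of_real (ln r) + Ln \<omega>"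
      have "(\<omega> * of_real r) powr ?e = exp (?e * (of_real (ln r) + Ln \<omega>))"
        using w0 r unfolding mult.commute[of \<omega>] powr_def L by simp
      also have "?e * (of_real (ln r) + Ln \<omega>) = ?e * Ln \<omega> + of_real (- (real CARD('n) / 2) * ln r)"
        by (simp add: distrib_left)
      finally show ?thesis .
    qed
    also have "\<dots> = \<omega> powr ?e * of_real (r powr (- (real CARD('n) / 2)))"
      using w0 r unfolding exp_add exp_of_real by (simp add: powr_def)
    finally show ?thesis .
  qed
  have rearrange: "(of_real A * (B * C) * D) /\<^sub>R X = of_real (A / X) * B * C * D" for A X :: real and B C D :: complex
    by (simp add: scaleR_conv_of_real divide_inverse)
  show ?thesis unfolding inverse_fourier_def heat_def F1 F2 by (rule rearrange)
qed

lemma heat_measurable[measurable (raw)]: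
  assumes [measurable]: "f \<in> borel_measurable M" "g \<in> borel_measurable M"
  shows "(\<lambda>p. heat \<omega> (f p) (g p)) \<in> borel_measurable M"
  unfolding heat_def by measurable

lemma cmod_heat:
  fixes x :: "real^'n"
  assumes r: "r > 0"
  shows "cmod (heat \<omega> r x) = (pi powr (real CARD('n) / 2) / (2 * pi) ^ CARD('n)) * cmod (\<omega> powr (- of_real (real CARD('n) / 2))) *
     r powr (- (real CARD('n) / 2)) * exp (- (Re (1 / \<omega>) / 4 / r) * (norm x)\<^sup>2)"
proof -
  have "complex_of_real ((norm x)\<^sup>2) / (4 * (\<omega> * of_real r)) = of_real ((norm x)\<^sup>2 / (4 * r)) * (1 / \<omega>)"
    using r by (simp add: field_simps)
  then have "Re (complex_of_real ((norm x)\<^sup>2) / (4 * (\<omega> * of_real r))) = (norm x)\<^sup>2 / (4 * r) * Re (1 / \<omega>)"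
    by (simp only: Re_real_times)
  then have "norm (exp (- (complex_of_real ((norm x)\<^sup>2) / (4 * (\<omega> * of_real r))))) = exp (- (Re (1 / \<omega>) / 4 / r) * (norm x)\<^sup>2)"
    unfolding norm_exp_eq_Re by (simp add: field_simps)
  then show ?thesis unfolding heat_def norm_mult by (simp only: norm_of_real) (simp add: abs_mult)
qed

text \<open>The modulus of the complex heat kernel is a real Gaussian, so its norm is the usual power of
  the time.\<close>

lemma heat_Lq:
  assumes w: "Re \<omega> > 0" and q: "1 \<le> q"
  shows "\<exists>C\<ge>0. \<forall>r>0. (heat \<omega> r :: real^'n \<Rightarrow> complex) \<in> Lq_space q \<and> Lq_norm q (heat \<omega> r :: real^'n \<Rightarrow> complex) = C * r powr (- (real CARD('n) / 2 * (1 - 1 / q)))"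
proof -
  define k where "k = Re (1 / \<omega>) / 4"
  have k: "k > 0" using Re_inverse_pos[OF w] unfolding k_def by simp
  define c where "c = (pi powr (real CARD('n) / 2) / (2 * pi) ^ CARD('n)) * cmod (\<omega> powr (- of_real (real CARD('n) / 2)))"
  have c: "c \<ge> 0" by (simp add: c_def)
  define h where "h = real CARD('n) / 2"
  define C where "C = c * (pi / (q * k)) powr (h / q)"
  have "(heat \<omega> r :: real^'n \<Rightarrow> complex) \<in> Lq_space q \<and> Lq_norm q (heat \<omega> r :: real^'n \<Rightarrow> complex) = C * r powr (- (real CARD('n) / 2 * (1 - 1 / q)))" if r: "r > 0" for r
  proof -
    have n: "cmod (heat \<omega> r (x :: real^'n)) powr q = (c * r powr (- h)) powr q * exp (- (q * k / r) * (norm x)\<^sup>2)" for x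
    proof -
      have "cmod (heat \<omega> r x) = (c * r powr (- h)) * exp (- (k / r) * (norm x)\<^sup>2)"
        unfolding cmod_heat[OF r] c_def k_def h_def by simp
      then have "cmod (heat \<omega> r x) powr q = (c * r powr (- h)) powr q * exp (- (k / r) * (norm x)\<^sup>2) powr q"
        by (simp only: powr_mult)
      also have "exp (- (k / r) * (norm x)\<^sup>2) powr q = exp (- (q * k / r) * (norm x)\<^sup>2)"
        by (simp add: powr_def)
      finally show ?thesis .
    qed
    have qk: "q * k / r > 0" using q k r by simp
    have i: "integrable lborel (\<lambda>x::real^'n. cmod (heat \<omega> r x) powr q)"
      unfolding n by (intro integrable_mult_right integrable_gaussian qk)
    have m: "heat \<omega> r \<in> borel_measurable borel" by measurable
    have "(LBINT x. cmod (heat \<omega> r (x::real^'n)) powr q) = (c * r powr (- h)) powr q * (pi / (q * k / r)) powr h"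
      unfolding n using integrable_gaussian(2)[OF qk, where 'a="real^'n"] by (simp add: h_def)
    then have "Lq_norm q (heat \<omega> r :: real^'n \<Rightarrow> complex) = ((c * r powr (- h)) powr q * (pi / (q * k / r)) powr h) powr (1 / q)"
      by (simp add: Lq_norm_def)
    also have "\<dots> = (c * r powr (- h)) powr (q * (1/q)) * (pi / (q * k / r)) powr (h / q)"
      by (simp only: powr_mult powr_powr) simp
    also have "\<dots> = (c * r powr (- h)) * ((pi / (q * k)) powr (h / q) * r powr (h / q))"
      using q c r by (simp flip: powr_mult)
    also have "\<dots> = C * (r powr (- h) * r powr (h / q))" by (simp add: C_def)
    also have "r powr (- h) * r powr (h / q) = r powr (- (real CARD('n) / 2 * (1 - 1 / q)))"
      unfolding powr_add[symmetric] h_def by (rule arg_cong[of _ _ "(powr) r"]) (simp add: field_simps)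
    finally show ?thesis using i m by (simp add: Lq_space_def)
  qed
  moreover have "C \<ge> 0" using c by (simp add: C_def)
  ultimately show ?thesis by blast
qed

lemma heat_integral:
  assumes w: "Re \<omega> > 0" and r: "r > 0"
  shows "(LBINT x. heat \<omega> r (x::real^'n)) = 1"
proof -
  let ?n = "real CARD('n)"
  let ?c = "1 / (4 * (\<omega> * of_real r))"
  have w0: "\<omega> \<noteq> 0" using w by auto
  have Rec: "Re ?c > 0"
  proof -
    have "?c = of_real (1 / (4 * r)) * (1 / \<omega>)" using r by (simp add: field_simps)
    then have "Re ?c = 1 / (4 * r) * Re (1 / \<omega>)" by (simp only: Re_real_times)
    also have "\<dots> > 0" using Re_inverse_pos[OF w] r by (intro mult_pos_pos) auto
    finally show ?thesis .
  qed
  have "(LBINT x. exp (- ?c * of_real ((norm (x::real^'n))\<^sup>2))) = of_real (pi powr (?n / 2)) * ?c powr (- of_real (?n / 2))"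
    using gaussian_fourier_complex[OF Rec, of "0::real^'n"] by simp
  moreover have "?c powr (- of_real (?n / 2)) = of_real ((4 * r) powr (?n / 2)) * \<omega> powr (of_real (?n / 2))"
  proof -
    have ci: "?c = inverse (of_real (4 * r) * \<omega>)" using r w0 by (simp add: field_simps)
    have "Re (of_real (4 * r) * \<omega>) > 0" unfolding Re_real_times using r w by simp
    then have "of_real (4 * r) * \<omega> \<notin> \<real>\<^sub>\<le>\<^sub>0" unfolding complex_nonpos_Reals_iff by linarith
    then have "Ln ?c = - Ln (of_real (4 * r) * \<omega>)" unfolding ci by (rule Ln_inverse)
    also have "Ln (of_real (4 * r) * \<omega>) = of_real (ln (4 * r)) + Ln \<omega>" using r w0 by (intro Ln_real_times) auto
    finally have L: "Ln ?c = - (of_real (ln (4 * r)) + Ln \<omega>)" .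
    have c0: "?c \<noteq> 0" using w0 r by simp
    have "?c powr (- of_real (?n / 2)) = exp (- of_real (?n / 2) * - (of_real (ln (4 * r)) + Ln \<omega>))"
      unfolding powr_def[of ?c] L using c0 by (simp only: if_False)
    also have "- complex_of_real (?n / 2) * - (of_real (ln (4 * r)) + Ln \<omega>) = of_real (?n / 2 * ln (4 * r)) + of_real (?n / 2) * Ln \<omega>"
      unfolding of_real_mult by (simp only: minus_mult_minus distrib_left)
    finally have "?c powr (- of_real (?n / 2)) = exp (of_real (?n / 2 * ln (4 * r)) + of_real (?n / 2) * Ln \<omega>)" .
    also have "\<dots> = of_real ((4 * r) powr (?n / 2)) * \<omega> powr (of_real (?n / 2))"
      using w0 r unfolding exp_add exp_of_real by (simp add: powr_def)
    finally show ?thesis .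
  qed
  moreover have "heat \<omega> r x = of_real (pi powr (?n / 2) / (2 * pi) ^ CARD('n)) * \<omega> powr (- of_real (?n / 2)) * of_real (r powr (- (?n / 2))) * exp (- ?c * of_real ((norm x)\<^sup>2))" for x :: "real^'n"
    by (simp add: heat_def)
  ultimately have "(LBINT x. heat \<omega> r (x::real^'n)) = of_real (pi powr (?n / 2) / (2 * pi) ^ CARD('n)) * \<omega> powr (- of_real (?n / 2)) * of_real (r powr (- (?n / 2))) *
       (of_real (pi powr (?n / 2)) * (of_real ((4 * r) powr (?n / 2)) * \<omega> powr (of_real (?n / 2))))"
    by simp
  also have "\<dots> = of_real (pi powr (?n / 2) / (2 * pi) ^ CARD('n) * r powr (- (?n / 2)) * (pi powr (?n / 2) * (4 * r) powr (?n / 2))) * (\<omega> powr (- of_real (?n / 2)) * \<omega> powr (of_real (?n / 2)))"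
    by simp
  also have "\<omega> powr (- of_real (?n / 2)) * \<omega> powr (of_real (?n / 2)) = 1"
    using w0 by (simp flip: powr_add)
  also have "pi powr (?n / 2) / (2 * pi) ^ CARD('n) * r powr (- (?n / 2)) * (pi powr (?n / 2) * (4 * r) powr (?n / 2)) = 1"
  proof -
    have "(2 * pi) ^ CARD('n) = ((2 * pi) powr 2) powr (?n / 2)" unfolding powr_powr using pi_gt_zero by (simp add: powr_realpow)
    also have "(2 * pi) powr 2 = 4 * (pi * pi)" using pi_gt_zero by (simp add: power2_eq_square)
    finally have "(2 * pi) ^ CARD('n) = 4 powr (?n / 2) * (pi powr (?n / 2) * pi powr (?n / 2))" by (simp only: powr_mult)
    then show ?thesis using r by (simp add: powr_mult powr_minus field_simps)
  qed
  finally show ?thesis by simp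
qed

text \<open>Fubini's theorem applied to the symmetric kernel \<open>cis (x \<bullet> \<xi>)\<close>.\<close>

lemma fourier_multiplication_formula:
  fixes g \<phi> :: "real^'n \<Rightarrow> complex"
  assumes g: "integrable lborel g" and \<phi>: "integrable lborel \<phi>"
  shows "(LBINT x. inverse_fourier g x * \<phi> x) = (LBINT \<xi>. g \<xi> * inverse_fourier \<phi> \<xi>)"
proof -
  have [measurable]: "g \<in> borel_measurable borel" "\<phi> \<in> borel_measurable borel" using g \<phi> by auto
  let ?F = "\<lambda>x \<xi>. cis (x \<bullet> \<xi>) * g \<xi> * \<phi> x"
  have i: "integrable (lborel \<Otimes>\<^sub>M lborel) (case_prod ?F)"
  proof (rule integrable_product_bound[OF sigma_finite_lborel sigma_finite_lborel _ integrable_norm[OF \<phi>] integrable_norm[OF g]])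
    show "case_prod ?F \<in> borel_measurable (lborel \<Otimes>\<^sub>M lborel)" by measurable
  qed (simp add: norm_mult)
  have "(LBINT x. inverse_fourier g x * \<phi> x) = (LBINT x. (1 / (2 * pi) ^ CARD('n)) *\<^sub>R (LBINT \<xi>. ?F x \<xi>))"
    unfolding inverse_fourier_def by (simp add: divide_inverse)
  also have "\<dots> = (1 / (2 * pi) ^ CARD('n)) *\<^sub>R (LBINT x. (LBINT \<xi>. ?F x \<xi>))" by (rule integral_scaleR_right)
  also have "(LBINT x. (LBINT \<xi>. ?F x \<xi>)) = (LBINT \<xi>. (LBINT x. ?F x \<xi>))"
    by (rule lborel_pair.Fubini_integral[OF i, symmetric])
  also have "(1 / (2 * pi) ^ CARD('n)) *\<^sub>R \<dots> = (LBINT \<xi>. (1 / (2 * pi) ^ CARD('n)) *\<^sub>R (LBINT x. ?F x \<xi>))"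
    by (rule integral_scaleR_right[symmetric])
  also have "\<dots> = (LBINT \<xi>. g \<xi> * inverse_fourier \<phi> \<xi>)"
  proof (rule Bochner_Integration.integral_cong[OF refl])
    fix \<xi>
    have "(LBINT x. ?F x \<xi>) = g \<xi> * (LBINT x. cis (\<xi> \<bullet> x) * \<phi> x)"
      by (subst integral_mult_right_zero[symmetric]) (simp add: mult_ac inner_commute)
    then show "(1 / (2 * pi) ^ CARD('n)) *\<^sub>R (LBINT x. ?F x \<xi>) = g \<xi> * inverse_fourier \<phi> \<xi>"
      by (simp add: inverse_fourier_def divide_inverse)
  qed
  finally show ?thesis .
qed

text \<open>Superpositions \<open>\<integral> V(r) exp (- \<omega> r l) dr\<close> with exponentially decaying density; \<open>symbol\<close> is the
  Fourier multiplier as a function of \<open>l = T \<bar>\<xi>\<bar>\<^sup>2\<close>, and \<open>kern\<close> its kernel.\<close>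

locale subordinator =
  fixes V :: "real \<Rightarrow> complex" and \<omega> :: complex and K \<kappa> :: real
  assumes V[measurable]: "V \<in> borel_measurable borel"
    and V_le: "\<And>r. r \<ge> 0 \<Longrightarrow> cmod (V r) \<le> K * exp (- \<kappa> * r)"
    and \<kappa>: "\<kappa> > 0" and \<omega>: "Re \<omega> > 0"
begin

definition kern :: "real \<Rightarrow> real^'n \<Rightarrow> complex" where
  "kern T x = (LBINT r:{0..}. V r * heat \<omega> (T * r) x)"

definition symbol :: "real \<Rightarrow> complex" where
  "symbol l = (LBINT r:{0..}. V r * exp (- \<omega> * of_real r * of_real l))"

lemma K_nonneg: "K \<ge> 0"
  using order_trans[OF norm_ge_zero V_le[of 0]] by simp

lemma V_integrable: "integrable lborel (\<lambda>r. indicator {0..} r * (K * exp (- \<kappa> * r)))"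
  using integrable_mult_right[OF exp_decay_integrable[OF \<kappa>, unfolded set_integrable_def], of K] by (simp add: mult_ac)

text \<open>The norm of the heat kernel has the singularity \<open>r powr (- n/2 (1 - 1/q))\<close> at \<open>r = 0\<close>, which
  is integrable by assumption; Minkowski's integral inequality does the rest.\<close>

lemma kern_Lq:
  assumes T: "T > 0" and q: "1 \<le> q" and d: "real CARD('n) / 2 * (1 - 1 / q) < 1"
  shows "(kern T :: real^'n \<Rightarrow> complex) \<in> Lq_space q"
proof -
  define d' where "d' = real CARD('n) / 2 * (1 - 1 / q)"
  obtain C where C: "C \<ge> 0" "\<And>r. r > 0 \<Longrightarrow> (heat \<omega> r :: real^'n \<Rightarrow> complex) \<in> Lq_space q \<and> Lq_norm q (heat \<omega> r :: real^'n \<Rightarrow> complex) = C * r powr (- d')"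
    using heat_Lq[OF \<omega> q, where 'n='n] unfolding d'_def by blast
  let ?F = "\<lambda>r (x::real^'n). indicator {0..} r *\<^sub>R (V r * heat \<omega> (T * r) x)"
  let ?w = "\<lambda>r. K * C * T powr (- d') * (indicator {0..} r *\<^sub>R (r powr ((1 - d') - 1) * exp (- \<kappa> * r)))"
  have "(\<lambda>x. LBINT r. ?F r x) \<in> Lq_space q"
  proof (rule Lq_minkowski(2)[OF sigma_finite_lborel q])
    show "(\<lambda>(r, x). ?F r x) \<in> borel_measurable (lborel \<Otimes>\<^sub>M lborel)" by measurable
    show "integrable lborel ?w"
      using Gamma_integral_scaled(1)[of "1 - d'" \<kappa>] d \<kappa> by (intro integrable_mult_right) (simp add: set_integrable_def d'_def)
    show "0 \<le> ?w r" for r using K_nonneg C by simp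
    have ne: "AE r in lborel. r \<noteq> (0::real)" by (rule AE_lborel_singleton)
    show "AE r in lborel. ?F r \<in> Lq_space q \<and> Lq_norm q (?F r) \<le> ?w r"
      using ne
    proof eventually_elim
      case (elim r)
      show ?case
      proof (cases "r > 0")
        case True
        have h: "(heat \<omega> (T * r) :: real^'n \<Rightarrow> complex) \<in> Lq_space q" "Lq_norm q (heat \<omega> (T * r) :: real^'n \<Rightarrow> complex) = C * (T * r) powr (- d')"
          using C(2)[of "T * r"] True T by auto
        have h1: "(\<lambda>x::real^'n. cmod (V r) *\<^sub>R heat \<omega> (T * r) x) \<in> Lq_space q"
           "Lq_norm q (\<lambda>x::real^'n. cmod (V r) *\<^sub>R heat \<omega> (T * r) x) = cmod (V r) * (C * (T * r) powr (- d'))"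
          using Lq_scaleR[OF h(1), of "cmod (V r)"] h(2) q by auto
        have e: "AE x in lborel. norm (?F r x) = norm (cmod (V r) *\<^sub>R heat \<omega> (T * r) x)" using True by (simp add: norm_mult)
        have "Lq_norm q (?F r) = cmod (V r) * (C * (T * r) powr (- d'))"
          using h1(2) Lq_norm_cong_AE[OF _ _ e, of q] by simp
        also have "\<dots> \<le> (K * exp (- \<kappa> * r)) * (C * (T * r) powr (- d'))"
          using C V_le[of r] True by (intro mult_right_mono) auto
        finally have "Lq_norm q (?F r) \<le> ?w r" using True T by (simp add: powr_mult mult_ac)
        moreover have "?F r \<in> Lq_space q" using h1(1) Lq_cong_AE[OF _ _ e, of q] by simp
        ultimately show ?thesis by simp
      qed (use elim in \<open>auto simp: indicator_def\<close>)
    qed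
  qed
  then show ?thesis by (simp add: kern_def[abs_def] set_lebesgue_integral_def)
qed

lemma kern_fubini:
  fixes \<psi> :: "real^'n \<Rightarrow> complex"
  assumes T: "T > 0" and \<psi>[measurable]: "\<psi> \<in> borel_measurable borel" and bd: "\<And>x. cmod (\<psi> x) \<le> B"
  shows "integrable lborel (\<lambda>x. kern T x * \<psi> x)"
    and "(LBINT x. kern T x * \<psi> x) = (LBINT r:{0..}. V r * (LBINT x. heat \<omega> (T * r) x * \<psi> x))"
proof -
  let ?F = "\<lambda>r (x::real^'n). indicator {0..} r *\<^sub>R (V r * heat \<omega> (T * r) x) * \<psi> x"
  obtain C where C: "C \<ge> 0" "\<And>r. r > 0 \<Longrightarrow> (heat \<omega> r :: real^'n \<Rightarrow> complex) \<in> Lq_space 1 \<and> Lq_norm 1 (heat \<omega> r :: real^'n \<Rightarrow> complex) = C"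
    using heat_Lq[OF \<omega> order_refl, where 'n='n] by auto
  have B: "B \<ge> 0" using order_trans[OF norm_ge_zero bd[of 0]] .
  have ne: "AE r in lborel. r \<noteq> (0::real)" by (rule AE_lborel_singleton)
  have Fm: "case_prod ?F \<in> borel_measurable (lborel \<Otimes>\<^sub>M lborel)" by measurable
  have est: "AE r in lborel. integrable lborel (?F r) \<and> (LBINT x. norm (?F r x)) \<le> C * B * (indicator {0..} r * (K * exp (- \<kappa> * r)))"
    using ne
  proof eventually_elim
    case (elim r)
    show ?case
    proof (cases "r > 0")
      case True
      have h: "integrable lborel (heat \<omega> (T * r) :: real^'n \<Rightarrow> complex)" "(LBINT x. norm (heat \<omega> (T * r) (x::real^'n))) = C"
        using C(2)[of "T * r"] True T by (auto simp: Lq1_iff Lq_norm_1)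
      have le: "norm (?F r x) \<le> (K * exp (- \<kappa> * r) * B) * norm (heat \<omega> (T * r) x)" for x
      proof -
        have "norm (?F r x) = cmod (V r) * cmod (\<psi> x) * norm (heat \<omega> (T * r) x)" using True by (simp add: norm_mult mult_ac)
        also have "\<dots> \<le> (K * exp (- \<kappa> * r) * B) * norm (heat \<omega> (T * r) x)"
          using V_le[of r] bd[of x] True K_nonneg by (intro mult_right_mono mult_mono) auto
        finally show ?thesis .
      qed
      have i1: "integrable lborel (\<lambda>x. (K * exp (- \<kappa> * r) * B) * norm (heat \<omega> (T * r) (x::real^'n)))"
        using h by (intro integrable_mult_right integrable_norm)
      have i2: "integrable lborel (?F r)"
        by (rule Bochner_Integration.integrable_bound[OF i1]) (use le in \<open>auto intro!: AE_I2 order_trans[OF _ abs_ge_self]\<close>)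
      have "(LBINT x. norm (?F r x)) \<le> (LBINT x. (K * exp (- \<kappa> * r) * B) * norm (heat \<omega> (T * r) (x::real^'n)))"
        by (rule integral_mono[OF integrable_norm[OF i2] i1 le])
      then show ?thesis using i2 h(2) True by (simp add: mult_ac)
    qed (use elim in \<open>auto simp: indicator_def\<close>)
  qed
  have i: "integrable (lborel \<Otimes>\<^sub>M lborel) (case_prod ?F)"
  proof (rule lborel_pair.Fubini_integrable[OF Fm])
    show "AE r in lborel. integrable lborel (\<lambda>x. case_prod ?F (r, x))" using est by eventually_elim simp
    show "integrable lborel (\<lambda>r. LBINT x. norm (case_prod ?F (r, x)))"
    proof (rule Bochner_Integration.integrable_bound)
      show "integrable lborel (\<lambda>r. C * B * (indicator {0..} r * (K * exp (- \<kappa> * r))))"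
        by (intro integrable_mult_right V_integrable)
      show "(\<lambda>r. LBINT x. norm (case_prod ?F (r, x))) \<in> borel_measurable lborel"
        by (rule sigma_finite_measure.borel_measurable_lebesgue_integral[OF sigma_finite_lborel]) measurable
      show "AE r in lborel. norm (LBINT x. norm (case_prod ?F (r, x))) \<le> norm (C * B * (indicator {0..} r * (K * exp (- \<kappa> * r))))"
        using est by eventually_elim (auto intro: order_trans[OF _ abs_ge_self])
    qed
  qed
  have e: "(\<lambda>x. LBINT r. ?F r x) = (\<lambda>x. kern T x * \<psi> x)"
    unfolding kern_def set_lebesgue_integral_def by (simp only: integral_mult_left_zero)
  show "integrable lborel (\<lambda>x. kern T x * \<psi> x)" using lborel_pair.integrable_snd[OF i] unfolding e .
  have "(LBINT x. kern T x * \<psi> x) = (LBINT r. (LBINT x. ?F r x))"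
    using lborel_pair.Fubini_integral[OF i] unfolding e .
  also have "\<dots> = (LBINT r:{0..}. V r * (LBINT x. heat \<omega> (T * r) x * \<psi> x))"
    unfolding set_lebesgue_integral_def by (simp add: mult.assoc)
  finally show "(LBINT x. kern T x * \<psi> x) = (LBINT r:{0..}. V r * (LBINT x. heat \<omega> (T * r) x * \<psi> x))" .
qed

lemma kern_integral: "(LBINT x. kern 1 (x::real^'n)) = symbol 0"
proof -
  have ne: "AE r in lborel. r \<noteq> (0::real)" by (rule AE_lborel_singleton)
  have "(LBINT x. kern 1 (x::real^'n)) = (LBINT r. indicator {0..} r *\<^sub>R (V r * (LBINT x. heat \<omega> r (x::real^'n))))"
    using kern_fubini(2)[of 1 "\<lambda>x::real^'n. 1" 1] by (simp add: set_lebesgue_integral_def)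
  also have "\<dots> = (LBINT r. indicator {0..} r *\<^sub>R V r)"
  proof (rule integral_cong_AE)
    show "AE r in lborel. indicator {0..} r *\<^sub>R (V r * (LBINT x. heat \<omega> r (x::real^'n))) = indicator {0..} r *\<^sub>R V r"
      using ne by eventually_elim (auto simp: indicator_def heat_integral[OF \<omega>])
  qed measurable
  finally show ?thesis by (simp add: symbol_def set_lebesgue_integral_def)
qed

lemma symbol_measurable[measurable]: "symbol \<in> borel_measurable borel"
proof -
  have "(\<lambda>l. LBINT r. indicator {0..} r *\<^sub>R (V r * exp (- \<omega> * of_real r * of_real l))) \<in> borel_measurable borel"
    by (rule sigma_finite_measure.borel_measurable_lebesgue_integral[OF sigma_finite_lborel]) measurable
  then show ?thesis by (simp add: symbol_def[abs_def] set_lebesgue_integral_def)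
qed

lemma symbol_integrand_le:
  assumes "l \<ge> 0"
  shows "norm (indicator {0..} r *\<^sub>R (V r * exp (- \<omega> * of_real r * of_real l))) \<le> indicator {0..} r * (K * exp (- \<kappa> * r))"
proof (cases "r \<ge> 0")
  case True
  have "cmod (exp (- \<omega> * of_real r * of_real l)) \<le> 1" using True assms \<omega> by simp
  then have "cmod (V r) * cmod (exp (- \<omega> * of_real r * of_real l)) \<le> K * exp (- \<kappa> * r) * 1"
    using V_le[OF True] K_nonneg by (intro mult_mono) auto
  then show ?thesis using True by (simp add: norm_mult)
qed simp

lemma symbol_bounded: "\<exists>B. \<forall>l\<ge>0. cmod (symbol l) \<le> B"
proof (intro exI allI impI)
  fix l :: real assume l: "l \<ge> 0"
  have i: "integrable lborel (\<lambda>r. indicator {0..} r *\<^sub>R (V r * exp (- \<omega> * of_real r * of_real l)))"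
    by (rule Bochner_Integration.integrable_bound[OF V_integrable])
       (use symbol_integrand_le[OF l] in \<open>auto intro!: AE_I2 order_trans[OF _ abs_ge_self]\<close>)
  have "cmod (symbol l) \<le> (LBINT r. norm (indicator {0..} r *\<^sub>R (V r * exp (- \<omega> * of_real r * of_real l))))"
    unfolding symbol_def set_lebesgue_integral_def by (rule integral_norm_bound)
  also have "\<dots> \<le> (LBINT r. indicator {0..} r * (K * exp (- \<kappa> * r)))"
    by (rule integral_mono[OF integrable_norm[OF i] V_integrable symbol_integrand_le[OF l]])
  finally show "cmod (symbol l) \<le> (LBINT r. indicator {0..} r * (K * exp (- \<kappa> * r)))" .
qed

text \<open>The multiplication formula holds for each heat kernel; it is integrated against \<open>V\<close>.\<close>

lemma kern_tempered:
  fixes \<phi> :: "real^'n \<Rightarrow> complex"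
  assumes T: "T > 0" and \<phi>: "schwartz \<phi>"
  shows "integrable lborel (\<lambda>x. kern T x * \<phi> x)"
    and "integrable lborel (\<lambda>\<xi>. symbol (T * (norm \<xi>)\<^sup>2) * inverse_fourier \<phi> \<xi>)"
    and "(LBINT x. kern T x * \<phi> x) = (LBINT \<xi>. symbol (T * (norm \<xi>)\<^sup>2) * inverse_fourier \<phi> \<xi>)"
proof -
  have \<phi>m[measurable]: "\<phi> \<in> borel_measurable borel" by (rule schwartz_measurable[OF \<phi>])
  have Ji: "integrable lborel (inverse_fourier \<phi>)" by (rule schwartz_inverse_fourier_integrable[OF \<phi>])
  then have Jm[measurable]: "inverse_fourier \<phi> \<in> borel_measurable borel" by auto
  obtain B where B: "\<And>x. cmod (\<phi> x) \<le> B" using schwartz_decay[OF \<phi>, of 0] by auto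
  note KF = kern_fubini[OF T \<phi>m B]
  show "integrable lborel (\<lambda>x. kern T x * \<phi> x)" by (rule KF(1))
  let ?F = "\<lambda>r \<xi>. indicator {0..} r *\<^sub>R (V r * exp (- \<omega> * of_real r * of_real (T * (norm \<xi>)\<^sup>2))) * inverse_fourier \<phi> \<xi>"
  have i: "integrable (lborel \<Otimes>\<^sub>M lborel) (case_prod ?F)"
  proof (rule integrable_product_bound[OF sigma_finite_lborel sigma_finite_lborel _ V_integrable integrable_norm[OF Ji]])
    show "case_prod ?F \<in> borel_measurable (lborel \<Otimes>\<^sub>M lborel)" by measurable
    show "norm (case_prod ?F (r, \<xi>)) \<le> indicator {0..} r * (K * exp (- \<kappa> * r)) * norm (inverse_fourier \<phi> \<xi>)" for r \<xi>
      using symbol_integrand_le[of "T * (norm \<xi>)\<^sup>2" r] T unfolding prod.case norm_mult by (intro mult_right_mono) auto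
  qed
  have e: "(\<lambda>\<xi>. LBINT r. ?F r \<xi>) = (\<lambda>\<xi>. symbol (T * (norm \<xi>)\<^sup>2) * inverse_fourier \<phi> \<xi>)"
    unfolding symbol_def set_lebesgue_integral_def by (simp only: integral_mult_left_zero)
  show "integrable lborel (\<lambda>\<xi>. symbol (T * (norm \<xi>)\<^sup>2) * inverse_fourier \<phi> \<xi>)" using lborel_pair.integrable_snd[OF i] unfolding e .
  have ne: "AE r in lborel. r \<noteq> (0::real)" by (rule AE_lborel_singleton)
  have "(LBINT x. kern T x * \<phi> x) = (LBINT r. indicator {0..} r *\<^sub>R (V r * (LBINT x. heat \<omega> (T * r) x * \<phi> x)))"
    using KF(2) by (simp add: set_lebesgue_integral_def)
  also have "\<dots> = (LBINT r. (LBINT \<xi>. ?F r \<xi>))"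
  proof (rule integral_cong_AE)
    show "AE r in lborel. indicator {0..} r *\<^sub>R (V r * (LBINT x. heat \<omega> (T * r) x * \<phi> x)) = (LBINT \<xi>. ?F r \<xi>)"
      using ne
    proof eventually_elim
      case (elim r)
      show ?case
      proof (cases "r > 0")
        case True
        let ?g = "\<lambda>\<xi>::real^'n. exp (- (\<omega> * of_real (T * r)) * of_real ((norm \<xi>)\<^sup>2))"
        have gi: "integrable lborel ?g"
        proof (rule Bochner_Integration.integrable_bound[OF integrable_gaussian(1)[of "Re \<omega> * (T * r)"]])
          show "0 < Re \<omega> * (T * r)" using \<omega> T True by simp
        qed auto
        have "(LBINT x. heat \<omega> (T * r) x * \<phi> x) = (LBINT x. inverse_fourier ?g x * \<phi> x)"
          by (simp only: heat_inverse_fourier[OF \<omega> mult_pos_pos[OF T True]])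
        also have "\<dots> = (LBINT \<xi>. ?g \<xi> * inverse_fourier \<phi> \<xi>)"
          by (rule fourier_multiplication_formula[OF gi schwartz_integrable[OF \<phi>]])
        finally have "V r * (LBINT x. heat \<omega> (T * r) x * \<phi> x) = (LBINT \<xi>. V r * (?g \<xi> * inverse_fourier \<phi> \<xi>))" by simp
        also have "\<dots> = (LBINT \<xi>. ?F r \<xi>)" using True by (simp add: mult_ac)
        finally show ?thesis using True by simp
      qed (use elim in \<open>auto simp: indicator_def\<close>)
    qed
  qed measurable
  also have "\<dots> = (LBINT \<xi>. (LBINT r. ?F r \<xi>))" by (rule lborel_pair.Fubini_integral[OF i, symmetric])
  finally show "(LBINT x. kern T x * \<phi> x) = (LBINT \<xi>. symbol (T * (norm \<xi>)\<^sup>2) * inverse_fourier \<phi> \<xi>)" unfolding e .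
qed

text \<open>The dilation in space of the heat kernels becomes the dilation of the superposition.\<close>

lemma kern_scaling:
  fixes x :: "real^'n"
  assumes T: "T > 0"
  shows "kern T x = of_real (T powr (- (real CARD('n) / 2))) * kern 1 (T powr (- 1 / 2) *\<^sub>R x)"
proof -
  have T2: "(T powr (- 1 / 2))\<^sup>2 = 1 / T"
  proof -
    have "(T powr (- 1 / 2))\<^sup>2 = T powr (- 1)" by (simp add: power2_eq_square flip: powr_add)
    also have "\<dots> = 1 / T" using T powr_minus_divide[of T 1] by simp
    finally show ?thesis .
  qed
  have ex: "complex_of_real ((norm x)\<^sup>2) / (4 * (\<omega> * of_real (T * r))) = of_real (1 / T * (norm x)\<^sup>2) / (4 * (\<omega> * of_real r))" for r
  proof -
    have "X / (4 * (\<omega> * (t * \<rho>))) = 1 / t * X / (4 * (\<omega> * \<rho>))" for X t \<rho> :: complex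
    proof -
      have "4 * (\<omega> * (t * \<rho>)) = t * (4 * (\<omega> * \<rho>))" by (simp only: mult.left_commute)
      then show ?thesis by simp
    qed
    then show ?thesis unfolding of_real_mult of_real_divide of_real_1 .
  qed
  have "heat \<omega> (T * r) x = of_real (T powr (- (real CARD('n) / 2))) * heat \<omega> r (T powr (- 1 / 2) *\<^sub>R x)" for r
    unfolding heat_def norm_scaleR power_mult_distrib power2_abs T2 ex
    unfolding powr_mult[of T r] of_real_mult[of "T powr _"] by (simp only: mult_ac)
  then have "kern T x = (LBINT r:{0..}. of_real (T powr (- (real CARD('n) / 2))) * (V r * heat \<omega> r (T powr (- 1 / 2) *\<^sub>R x)))"
    unfolding kern_def by (simp only: mult.left_commute)
  also have "\<dots> = of_real (T powr (- (real CARD('n) / 2))) * kern 1 (T powr (- 1 / 2) *\<^sub>R x)"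
    unfolding kern_def by (simp only: set_integral_mult_right mult_1)
  finally show ?thesis .
qed

end

lemma heat_cnj:
  assumes "Re \<omega> > 0"
  shows "heat (cnj \<omega>) r x = cnj (heat \<omega> r x)"
proof -
  have "cnj (\<omega> powr (- of_real (real CARD('a) / 2))) = cnj \<omega> powr cnj (- of_real (real CARD('a) / 2))"
    by (rule cnj_powr) (use assms in auto)
  then show ?thesis by (simp add: heat_def exp_cnj)
qed

text \<open>The Mittag-Leffler function is the imaginary part of a symbol. The imaginary part of the
  kernel corresponds to the imaginary part of the symbol, because the conjugate density with the
  conjugate \<open>\<omega>\<close> has the conjugate kernel and symbol. The integral of the profile is the value of the
  symbol at \<open>0\<close>.\<close>

lemma mittag_leffler_kernel:
  assumes a: "1 < a" "a < 2" and b: "0 < \<beta>" "\<beta> \<le> a"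
  shows "\<exists>g :: real^'n \<Rightarrow> real. g \<in> borel_measurable borel \<and>
    (\<forall>q\<ge>1. real CARD('n) / 2 * (1 - 1 / q) < 1 \<longrightarrow> g \<in> Lq_space q) \<and>
    (LBINT x. g x) = 1 / Gamma \<beta> \<and>
    (\<forall>t>0. has_tempered_inverse_fourier
       (\<lambda>\<xi>. complex_of_real (mittag_leffler a \<beta> (- (t powr a) * (norm \<xi>)\<^sup>2)))
       (\<lambda>x. complex_of_real (t powr (- (a / 2 * real CARD('n))) * g (t powr (- (a / 2)) *\<^sub>R x))))"
proof -
  obtain V \<omega> K \<kappa> where w: "Re \<omega> > 0" and k: "\<kappa> > 0" and V[measurable]: "V \<in> borel_measurable borel"
    and V_le: "\<And>r. r \<ge> 0 \<Longrightarrow> cmod (V r) \<le> K * exp (- \<kappa> * r)"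
    and S: "\<And>l. l \<ge> 0 \<Longrightarrow> Im (LBINT r:{0..}. V r * exp (- \<omega> * of_real r * of_real l)) = mittag_leffler a \<beta> (- l)"
    using mittag_leffler_subordination[OF a b] by blast
  interpret A: subordinator V \<omega> K \<kappa> by unfold_locales (use w k V V_le in auto)
  have Vc: "(\<lambda>r. cnj (V r)) \<in> borel_measurable borel"
    by (rule measurable_compose[OF V]) (intro borel_measurable_continuous_onI continuous_intros)
  interpret B: subordinator "\<lambda>r. cnj (V r)" "cnj \<omega>" K \<kappa> by unfold_locales (use w k Vc V_le in auto)
  have Bk: "B.kern T x = cnj (A.kern T x)" for T and x :: "real^'n"
    unfolding B.kern_def A.kern_def heat_cnj[OF w] set_lebesgue_integral_def Bochner_Integration.integral_cnj[symmetric] complex_cnj_scaleR complex_cnj_mult ..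
  have Bs: "B.symbol l = cnj (A.symbol l)" for l
    unfolding B.symbol_def A.symbol_def set_lebesgue_integral_def Bochner_Integration.integral_cnj[symmetric] by (simp add: exp_cnj)
  have Sy: "Im (A.symbol l) = mittag_leffler a \<beta> (- l)" if "l \<ge> 0" for l
    using S[OF that] by (simp add: A.symbol_def)
  have ImE: "complex_of_real (Im z) = (z - cnj z) * (1 / (2 * \<i>))" for z
    by (simp add: complex_eq_iff)
  define g where "g x = Im (A.kern 1 x)" for x :: "real^'n"
  have kL: "(A.kern 1 :: real^'n \<Rightarrow> complex) \<in> Lq_space q" if "1 \<le> q" "real CARD('n) / 2 * (1 - 1 / q) < 1" for q
    using A.kern_Lq[of 1 q] that by simp
  have km[measurable]: "(A.kern 1 :: real^'n \<Rightarrow> complex) \<in> borel_measurable borel"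
    using kL[of 1] by (intro Lq_measurable[of _ 1]) simp
  have gm[measurable]: "g \<in> borel_measurable borel" unfolding g_def by measurable
  have gL: "g \<in> Lq_space q" if "1 \<le> q" "real CARD('n) / 2 * (1 - 1 / q) < 1" for q
    by (rule Lq_mono(1)[OF gm _ kL[OF that]]) (use that in \<open>auto simp: g_def abs_Im_le_cmod\<close>)
  have gI: "(LBINT x. g x) = 1 / Gamma \<beta>"
  proof -
    have "integrable lborel (A.kern 1 :: real^'n \<Rightarrow> complex)" using kL[of 1] by (simp add: Lq1_iff)
    then have "(LBINT x. g x) = Im (A.symbol 0)" unfolding g_def A.kern_integral[symmetric, where 'n='n] by (rule integral_Im)
    also have "\<dots> = mittag_leffler a \<beta> 0" using Sy[of 0] by simp
    also have "\<dots> = 1 / Gamma \<beta>"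
      using powser_zero[of "\<lambda>k. 1 / Gamma (a * real k + \<beta>)"] by (simp add: mittag_leffler_def)
    finally show ?thesis .
  qed
  have ht: "has_tempered_inverse_fourier
       (\<lambda>\<xi>. complex_of_real (mittag_leffler a \<beta> (- (t powr a) * (norm \<xi>)\<^sup>2)))
       (\<lambda>x::real^'n. complex_of_real (t powr (- (a / 2 * real CARD('n))) * g (t powr (- (a / 2)) *\<^sub>R x)))" if t: "t > 0" for t
  proof -
    define T where "T = t powr a"
    have T: "T > 0" using t by (simp add: T_def)
    have gT: "complex_of_real (t powr (- (a / 2 * real CARD('n))) * g (t powr (- (a / 2)) *\<^sub>R x)) = of_real (Im (A.kern T x))" for x :: "real^'n"
    proof -
      have 1: "T powr (- (real CARD('n) / 2)) = t powr (- (a / 2 * real CARD('n)))"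
        unfolding T_def powr_powr by simp
      have 2: "T powr (- 1 / 2) = t powr (- (a / 2))"
        unfolding T_def powr_powr by simp
      have "Im (complex_of_real k * z) = k * Im z" for k z by simp
      then show ?thesis unfolding A.kern_scaling[OF T, of x] 1 2 g_def by (simp only:)
    qed
    have mT: "mittag_leffler a \<beta> (- (t powr a) * (norm \<xi>)\<^sup>2) = Im (A.symbol (T * (norm \<xi>)\<^sup>2))" for \<xi> :: "real^'n"
      using Sy[of "T * (norm \<xi>)\<^sup>2"] T by (simp add: T_def)
    have sm[measurable]: "(\<lambda>\<xi>::real^'n. A.symbol (T * (norm \<xi>)\<^sup>2)) \<in> borel_measurable borel" by measurable
    have kTm[measurable]: "(\<lambda>x::real^'n. A.kern T x) \<in> borel_measurable borel" unfolding A.kern_scaling[OF T] by measurable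
    show ?thesis unfolding has_tempered_inverse_fourier_def gT mT
    proof (intro conjI allI impI)
      show "(\<lambda>\<xi>::real^'n. complex_of_real (Im (A.symbol (T * (norm \<xi>)\<^sup>2)))) \<in> borel_measurable borel" by measurable
      show "(\<lambda>x::real^'n. complex_of_real (Im (A.kern T x))) \<in> borel_measurable borel" by measurable
      fix \<phi> :: "real^'n \<Rightarrow> complex" assume \<phi>: "schwartz \<phi>"
      have [measurable]: "\<phi> \<in> borel_measurable borel" by (rule schwartz_measurable[OF \<phi>])
      obtain M where M: "\<And>l. l \<ge> 0 \<Longrightarrow> cmod (A.symbol l) \<le> M" using A.symbol_bounded by blast
      show "integrable lborel (\<lambda>\<xi>. complex_of_real (Im (A.symbol (T * (norm \<xi>)\<^sup>2))) * \<phi> \<xi>)"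
      proof (rule Bochner_Integration.integrable_bound[OF integrable_mult_right[OF schwartz_integrable[OF \<phi>], of "of_real M"]])
        show "AE \<xi> in lborel. norm (complex_of_real (Im (A.symbol (T * (norm \<xi>)\<^sup>2))) * \<phi> \<xi>) \<le> norm (complex_of_real M * \<phi> \<xi>)"
          unfolding norm_mult norm_of_real using T
          by (intro AE_I2 mult_right_mono order_trans[OF abs_Im_le_cmod] order_trans[OF M abs_ge_self]) auto
      qed measurable
      note Ak = A.kern_tempered[OF T \<phi>] and Bk' = B.kern_tempered[OF T \<phi>]
      have eK: "complex_of_real (Im (A.kern T x)) * \<phi> x = (A.kern T x * \<phi> x - B.kern T x * \<phi> x) * (1 / (2 * \<i>))" for x
        unfolding ImE Bk by (simp add: algebra_simps)
      have eS: "complex_of_real (Im (A.symbol l)) * c = (A.symbol l * c - B.symbol l * c) * (1 / (2 * \<i>))" for l c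
        unfolding ImE Bs by (simp add: algebra_simps)
      show "integrable lborel (\<lambda>x. complex_of_real (Im (A.kern T x)) * \<phi> x)"
        unfolding eK by (intro integrable_mult_left Bochner_Integration.integrable_diff Ak(1) Bk'(1))
      have "(LBINT x. complex_of_real (Im (A.kern T x)) * \<phi> x) = ((LBINT x. A.kern T x * \<phi> x) - (LBINT x. B.kern T x * \<phi> x)) * (1 / (2 * \<i>))"
        unfolding eK integral_mult_left_zero by (subst Bochner_Integration.integral_diff[OF Ak(1) Bk'(1)]) simp
      also have "\<dots> = ((LBINT \<xi>. A.symbol (T * (norm \<xi>)\<^sup>2) * inverse_fourier \<phi> \<xi>) - (LBINT \<xi>. B.symbol (T * (norm \<xi>)\<^sup>2) * inverse_fourier \<phi> \<xi>)) * (1 / (2 * \<i>))"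
        unfolding Ak(3) Bk'(3) ..
      also have "\<dots> = (LBINT \<xi>. complex_of_real (Im (A.symbol (T * (norm \<xi>)\<^sup>2))) * inverse_fourier \<phi> \<xi>)"
        unfolding eS integral_mult_left_zero by (subst Bochner_Integration.integral_diff[OF Ak(2) Bk'(2)]) simp
      finally show "(LBINT x. complex_of_real (Im (A.kern T x)) * \<phi> x) = (LBINT \<xi>. complex_of_real (Im (A.symbol (T * (norm \<xi>)\<^sup>2))) * inverse_fourier \<phi> \<xi>)" .
    qed
  qed
  show ?thesis using gm gL gI ht by blast
qed

section \<open>Uniqueness of the inverse Fourier transform\<close>

text \<open>The hypothesis says that all mollifications of \<open>F\<close> by Gaussians vanish, and they converge to
  \<open>F\<close> in \<open>L\<^sup>1\<close>.\<close>

lemma orthogonal_to_gaussians_imp_zero: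
  fixes F :: "real^'n \<Rightarrow> real"
  assumes F: "integrable lborel F"
    and orth: "\<And>c y. c > 0 \<Longrightarrow> (LBINT x. exp (- c * (norm (x - y))\<^sup>2) * F x) = 0"
  shows "AE x in lborel. F x = 0"
proof -
  have [measurable]: "F \<in> borel_measurable borel" using F by auto
  let ?g = "\<lambda>y::real^'n. exp (- 1 * (norm y)\<^sup>2)"
  let ?A = "\<lambda>r x. \<integral>y. ?g y *\<^sub>R F (x - r *\<^sub>R y) \<partial>lborel"
  have FL: "F \<in> Lq_space 1" using F by (simp add: Lq1_iff)
  have gL: "?g \<in> Lq_space 1" using integrable_gaussian(1)[of 1, where 'a="real^'n"] by (simp add: Lq1_iff)
  have A0: "?A r x = 0" if r: "r > 0" for r x
  proof -
    let ?h = "\<lambda>z. exp (- (1 / r\<^sup>2) * (norm (z - x))\<^sup>2) * F z"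
    have "0 = (LBINT z. ?h z)" using orth[of "1 / r\<^sup>2" x] r by simp
    also have "\<dots> = \<bar>- r\<bar> ^ DIM(real^'n) *\<^sub>R (LBINT y. ?h (x + (- r) *\<^sub>R y))"
      by (rule integral_affine) (use r in auto)
    also have "(\<lambda>y. ?h (x + (- r) *\<^sub>R y)) = (\<lambda>y. ?g y *\<^sub>R F (x - r *\<^sub>R y))"
      using r by (simp add: fun_eq_iff power_mult_distrib)
    finally show ?thesis using r by simp
  qed
  have "((\<lambda>r. Lq_norm 1 (\<lambda>x. ?A r x - ?A 0 x)) \<longlongrightarrow> 0) (at 0)"
    by (rule dilated_average_continuous(1)[OF FL order_refl gL])
  then have "((\<lambda>r. Lq_norm 1 (\<lambda>x. ?A r x - ?A 0 x)) \<longlongrightarrow> 0) (at_right 0)"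
    by (rule filterlim_mono) (auto simp: at_le)
  moreover have "\<forall>\<^sub>F r in at_right 0. Lq_norm 1 (\<lambda>x. ?A r x - ?A 0 x) = Lq_norm 1 (?A 0)"
    using eventually_at_right_less[of 0] by eventually_elim (simp only: A0 diff_0 Lq_norm_def norm_minus_cancel)
  ultimately have "((\<lambda>r::real. Lq_norm 1 (?A 0)) \<longlongrightarrow> 0) (at_right 0)"
    by (rule Lim_transform_eventually)
  then have "Lq_norm 1 (?A 0) = 0"
    by (simp add: tendsto_const_iff)
  then have "AE x in lborel. ?A 0 x = 0"
    by (intro Lq_norm_zero_imp[of _ 1] dilated_average_continuous(3)[OF FL order_refl gL]) auto
  moreover have e0: "?A 0 x = pi powr (real CARD('n) / 2) * F x" for x
    using integrable_gaussian(2)[of 1, where 'a="real^'n"] by simp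
  ultimately show ?thesis by (simp only: e0 mult_eq_0_iff) simp
qed

text \<open>The difference of two representatives is annihilated by all Gaussians. It need not be
  integrable itself, but its product with one fixed Gaussian is; and a product of two Gaussians is
  again a Gaussian, so that this product is annihilated by all Gaussians as well.\<close>

lemma has_tempered_inverse_fourier_unique:
  fixes g h :: "real^'n \<Rightarrow> real"
  assumes g: "has_tempered_inverse_fourier m (\<lambda>x. complex_of_real (g x))"
    and h: "has_tempered_inverse_fourier m (\<lambda>x. complex_of_real (h x))"
  shows "AE x in lborel. g x = h x"
proof -
  have [measurable]: "g \<in> borel_measurable borel" "h \<in> borel_measurable borel"
    using g h by (auto simp: has_tempered_inverse_fourier_def borel_measurable_complex_iff)
  define f where "f x = g x - h x" for x
  have fm[measurable]: "f \<in> borel_measurable borel" unfolding f_def by measurable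
  have f: "integrable lborel (\<lambda>x. f x * exp (- c * (norm (x - y))\<^sup>2)) \<and> (LBINT x. f x * exp (- c * (norm (x - y))\<^sup>2)) = 0" if c: "c > 0" for c y
  proof -
    let ?\<phi> = "\<lambda>x. complex_of_real (exp (- c * (norm (x - y))\<^sup>2))"
    have s: "schwartz ?\<phi>" by (rule schwartz_gaussian[OF c])
    have gi: "integrable lborel (\<lambda>x. complex_of_real (g x) * ?\<phi> x)" "(LBINT x. complex_of_real (g x) * ?\<phi> x) = (LBINT \<xi>. m \<xi> * inverse_fourier ?\<phi> \<xi>)"
      using g s unfolding has_tempered_inverse_fourier_def by blast+
    have hi: "integrable lborel (\<lambda>x. complex_of_real (h x) * ?\<phi> x)" "(LBINT x. complex_of_real (h x) * ?\<phi> x) = (LBINT \<xi>. m \<xi> * inverse_fourier ?\<phi> \<xi>)"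
      using h s unfolding has_tempered_inverse_fourier_def by blast+
    have e: "complex_of_real (f x * exp (- c * (norm (x - y))\<^sup>2)) = complex_of_real (g x) * ?\<phi> x - complex_of_real (h x) * ?\<phi> x" for x
      by (simp add: f_def algebra_simps)
    have i: "integrable lborel (\<lambda>x. complex_of_real (f x * exp (- c * (norm (x - y))\<^sup>2)))"
      unfolding e by (rule Bochner_Integration.integrable_diff[OF gi(1) hi(1)])
    have "(LBINT x. complex_of_real (f x * exp (- c * (norm (x - y))\<^sup>2))) = 0"
      unfolding e Bochner_Integration.integral_diff[OF gi(1) hi(1)] gi(2) hi(2) by simp
    then have "complex_of_real (LBINT x. f x * exp (- c * (norm (x - y))\<^sup>2)) = 0"
      unfolding integral_complex_of_real .
    then have "(LBINT x. f x * exp (- c * (norm (x - y))\<^sup>2)) = 0" by (simp only: of_real_eq_0_iff)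
    then show ?thesis using complex_of_real_integrable_eq[THEN iffD1, OF i] by blast
  qed
  let ?F = "\<lambda>x. f x * exp (- 1 * (norm (x - 0))\<^sup>2)"
  have "AE x in lborel. ?F x = 0"
  proof (rule orthogonal_to_gaussians_imp_zero)
    show "integrable lborel ?F" using f[of 1 0] by simp
    fix c :: real and y :: "real^'n" assume c: "c > 0"
    \<comment> \<open>completing the square\<close>
    define y' where "y' = (c / (1 + c)) *\<^sub>R y"
    define k where "k = exp (- (c / (1 + c)) * (norm y)\<^sup>2)"
    have e: "exp (- c * (norm (x - y))\<^sup>2) * ?F x = k * (f x * exp (- (1 + c) * (norm (x - y'))\<^sup>2))" for x
    proof -
      have n: "(norm (x - v))\<^sup>2 = (norm x)\<^sup>2 - 2 * (x \<bullet> v) + (norm v)\<^sup>2" for v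
        by (simp add: power2_norm_eq_inner algebra_simps inner_commute)
      have "- c * (norm (x - y))\<^sup>2 + - 1 * (norm (x - 0))\<^sup>2 = - (c / (1 + c)) * (norm y)\<^sup>2 + - (1 + c) * (norm (x - y'))\<^sup>2"
      proof -
        have y1: "x \<bullet> y' = c / (1 + c) * (x \<bullet> y)" "(norm y')\<^sup>2 = (c / (1 + c))\<^sup>2 * (norm y)\<^sup>2"
          using c by (simp_all add: y'_def power_mult_distrib power_divide)
        have c1: "(1 + c) * (c / (1 + c)) = c" "(1 + c) * (c / (1 + c))\<^sup>2 = c * (c / (1 + c))" "c / (1 + c) + c * (c / (1 + c)) = c"
          using c by (simp_all add: power2_eq_square field_simps add_nonneg_eq_0_iff)
        have "(1 + c) * (norm (x - y'))\<^sup>2 = (1 + c) * (norm x)\<^sup>2 - 2 * (((1 + c) * (c / (1 + c))) * (x \<bullet> y)) + ((1 + c) * (c / (1 + c))\<^sup>2) * (norm y)\<^sup>2"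
          unfolding n y1 by (simp add: algebra_simps)
        also have "\<dots> = (1 + c) * (norm x)\<^sup>2 - 2 * (c * (x \<bullet> y)) + (c * (c / (1 + c))) * (norm y)\<^sup>2" unfolding c1 ..
        finally have 1: "(1 + c) * (norm (x - y'))\<^sup>2 + (c / (1 + c)) * (norm y)\<^sup>2 = (1 + c) * (norm x)\<^sup>2 - 2 * (c * (x \<bullet> y)) + (c / (1 + c) + c * (c / (1 + c))) * (norm y)\<^sup>2"
          by (simp add: algebra_simps)
        show ?thesis using 1 unfolding c1 n[of y] by (simp add: algebra_simps)
      qed
      then show ?thesis unfolding k_def by (simp only: mult.left_commute[of "exp _" "f x"] exp_add[symmetric])
    qed
    show "(LBINT x. exp (- c * (norm (x - y))\<^sup>2) * ?F x) = 0"
      unfolding e using f[of "1 + c" y'] c by simp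
  qed
  then show ?thesis by (simp add: f_def)
qed

section \<open>Measurable curves of functions\<close>

definition jointly_measurable :: "(real \<Rightarrow> real^'n \<Rightarrow> 'k::{real_normed_field,euclidean_space}) \<Rightarrow> bool" where
  "jointly_measurable f \<longleftrightarrow> (\<lambda>(s, x). f s x) \<in> borel_measurable (lborel \<Otimes>\<^sub>M lborel)"

lemma jointly_measurable_compose:
  assumes f: "jointly_measurable f" and a: "a \<in> borel_measurable M" and b: "b \<in> borel_measurable M"
  shows "(\<lambda>z. f (a z) (b z)) \<in> borel_measurable M"
proof -
  have "(\<lambda>z. (a z, b z)) \<in> M \<rightarrow>\<^sub>M lborel \<Otimes>\<^sub>M lborel" using a b by measurable
  from measurable_compose[OF this f[unfolded jointly_measurable_def]] show ?thesis by simp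
qed

lemma jointly_measurable_fst:
  assumes f: "jointly_measurable f"
  shows "f s \<in> borel_measurable borel"
  using jointly_measurable_compose[OF f, of "\<lambda>x. s" borel "\<lambda>x. x"] by simp

lemma jointly_measurableI:
  "(\<lambda>z. f (fst z) (snd z)) \<in> borel_measurable (lborel \<Otimes>\<^sub>M lborel) \<Longrightarrow> jointly_measurable f"
  by (simp add: jointly_measurable_def split_beta')

lemma jointly_measurable_diff:
  assumes "jointly_measurable f" "jointly_measurable g"
  shows "jointly_measurable (\<lambda>s x. f s x - g s x)"
  by (intro jointly_measurableI borel_measurable_diff jointly_measurable_compose[OF assms(1)] jointly_measurable_compose[OF assms(2)]) measurable

lemma jointly_measurable_reflect:
  assumes "jointly_measurable f"
  shows "jointly_measurable (\<lambda>s. f (t - s))"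
  by (intro jointly_measurableI jointly_measurable_compose[OF assms]) measurable

lemma jointly_measurable_nonlinearity:
  assumes "jointly_measurable f"
  shows "jointly_measurable (\<lambda>s. nonlinearity p (f s))"
proof (rule jointly_measurableI)
  have [measurable]: "(\<lambda>z. f (fst z) (snd z)) \<in> borel_measurable (lborel \<Otimes>\<^sub>M lborel)"
    by (rule jointly_measurable_compose[OF assms]) measurable
  show "(\<lambda>z. nonlinearity p (f (fst z)) (snd z)) \<in> borel_measurable (lborel \<Otimes>\<^sub>M lborel)"
    unfolding nonlinearity_def by measurable
qed

lemma Lq_curve_bounded:
  fixes u :: "real \<Rightarrow> real^'n \<Rightarrow> 'k::{real_normed_field,euclidean_space}"
  assumes q: "1 \<le> q" and u: "\<And>t. t \<ge> 0 \<Longrightarrow> u t \<in> Lq_space q"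
    and cont: "\<And>t. t \<ge> 0 \<Longrightarrow> Lq_continuous_at q u t"
  shows "\<exists>M. \<forall>s\<in>{0..T}. Lq_norm q (u s) \<le> M"
proof -
  have "continuous_on {0..} (\<lambda>s. Lq_norm q (u s))"
    unfolding continuous_on_def
  proof (intro ballI)
    fix t :: real assume "t \<in> {0..}"
    then have t: "t \<ge> 0" by simp
    have "((\<lambda>s. Lq_norm q (u s) - Lq_norm q (u t)) \<longlongrightarrow> 0) (at t within {0..})"
    proof (rule Lim_null_comparison[OF _ cont[OF t]])
      have "norm (Lq_norm q (u s) - Lq_norm q (u t)) \<le> Lq_norm q (\<lambda>x. u s x - u t x)" if s: "s \<ge> 0" for s
        using Lq_norm_le_diff[OF u[OF s] u[OF t] q] Lq_norm_le_diff[OF u[OF t] u[OF s] q] Lq_norm_diff_commute[of q "u s" "u t"]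
        by simp
      then show "\<forall>\<^sub>F s in at t within {0..}. norm (Lq_norm q (u s) - Lq_norm q (u t)) \<le> Lq_norm q (\<lambda>x. u s x - u t x)"
        by (simp add: eventually_at_filter)
    qed
    then show "((\<lambda>s. Lq_norm q (u s)) \<longlongrightarrow> Lq_norm q (u t)) (at t within {0..})" by (simp add: LIM_zero_iff)
  qed
  then have "continuous_on {0..T} (\<lambda>s. Lq_norm q (u s))" by (rule continuous_on_subset) auto
  then have "compact ((\<lambda>s. Lq_norm q (u s)) ` {0..T})" by (rule compact_continuous_image) simp
  from compact_imp_bounded[OF this] show ?thesis by (fastforce simp: bounded_real)
qed

lemma conv_diff:
  assumes "convolves_at k f x" "convolves_at k g x"
  shows "conv k (\<lambda>y. f y - g y) x = conv k f x - conv k g x"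
  using assms unfolding conv_def convolves_at_def by (simp add: scaleR_diff_right)

lemma conv_zero: "conv k (\<lambda>y. 0) x = 0"
  by (simp add: conv_def)

text \<open>The substitution \<open>r = t - s\<close>, which exchanges the two forms of a Volterra integral.\<close>

lemma reflect_set_integral:
  fixes b :: "real \<Rightarrow> real"
  shows "set_integrable lborel {0..t} (\<lambda>r. r powr c * b (t - r)) \<longleftrightarrow> set_integrable lborel {0..t} (\<lambda>s. (t - s) powr c * b s)"
    and "(LBINT r:{0..t}. r powr c * b (t - r)) = (LBINT s:{0..t}. (t - s) powr c * b s)"
proof -
  have e: "(\<lambda>r. indicator {0..t} r *\<^sub>R (r powr c * b (t - r))) = (\<lambda>r. (\<lambda>s. indicator {0..t} s *\<^sub>R ((t - s) powr c * b s)) (t - r))"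
    by (auto simp: fun_eq_iff indicator_def)
  show "set_integrable lborel {0..t} (\<lambda>r. r powr c * b (t - r)) \<longleftrightarrow> set_integrable lborel {0..t} (\<lambda>s. (t - s) powr c * b s)"
    unfolding set_integrable_def e by (rule integrable_reflect(1))
  show "(LBINT r:{0..t}. r powr c * b (t - r)) = (LBINT s:{0..t}. (t - s) powr c * b s)"
    unfolding set_lebesgue_integral_def e by (rule integrable_reflect(2))
qed

section \<open>The integral operator of the equation\<close>

text \<open>The properties of the two profiles on which the semilinear theory rests; \<open>g\<close> belongs to the
  initial value and \<open>h\<close> to the source. Supercriticality is the inequality \<open>p * rate p < -1\<close> for the
  rate defined below, and subcriticality is equivalent to \<open>rate p > -1\<close>.\<close>

locale evolution_kernels =
  fixes \<alpha> p :: real and g h :: "real^'n \<Rightarrow> real"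
  assumes \<alpha>: "0 < \<alpha>" and p: "1 < p"
    and supercritical: "1 < real CARD('n) / 2 * (1 + \<alpha>) * (p - 1) - \<alpha> * p"
    and subcritical: "real CARD('n) / 2 * (1 - 1 / p) < 1"
    and g1: "g \<in> Lq_space 1" and gp: "g \<in> Lq_space p"
    and h1: "h \<in> Lq_space 1" and hp: "h \<in> Lq_space p"
    and g_integral: "(LBINT x. g x) = 1"
begin

definition decay :: "real \<Rightarrow> real" where
  "decay q = real CARD('n) / 2 * (1 + \<alpha>) * (1 - 1 / q)"

definition rate :: "real \<Rightarrow> real" where
  "rate q = \<alpha> - decay q"

definition dil :: "(real^'n \<Rightarrow> real) \<Rightarrow> real \<Rightarrow> real^'n \<Rightarrow> real" where
  "dil k t x = t powr (- ((1 + \<alpha>) / 2 * real CARD('n))) * k (t powr (- ((1 + \<alpha>) / 2)) *\<^sub>R x)"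

lemma rate_1: "rate 1 = \<alpha>"
  by (simp add: rate_def decay_def)

lemma decay_nonneg: "1 \<le> q \<Longrightarrow> 0 \<le> decay q"
  using \<alpha> by (simp add: decay_def)

lemma rate_p: "- 1 < rate p"
proof -
  have "decay p = real CARD('n) / 2 * (1 - 1 / p) * (1 + \<alpha>)" by (simp add: decay_def)
  also have "\<dots> < 1 * (1 + \<alpha>)" using \<alpha> by (intro mult_strict_right_mono[OF subcritical]) simp
  finally show ?thesis by (simp add: rate_def)
qed

lemma rate_gt: "q = 1 \<or> q = p \<Longrightarrow> - 1 < rate q"
  using rate_p rate_1 \<alpha> by auto

lemma h_Lq: "q = 1 \<or> q = p \<Longrightarrow> h \<in> Lq_space q"
  using h1 hp by auto

lemma source_rate: "p * rate p < - 1"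
proof -
  have "p * rate p = \<alpha> * p - real CARD('n) / 2 * (1 + \<alpha>) * (p - 1)"
    using p by (simp add: rate_def decay_def field_simps)
  then show ?thesis using supercritical by simp
qed

lemma dil_Lq:
  assumes k: "k \<in> Lq_space q" and q: "1 \<le> q" and t: "t > 0"
  shows "dil k t \<in> Lq_space q" "Lq_norm q (dil k t) = t powr (- decay q) * Lq_norm q k"
proof -
  let ?c = "t powr (- ((1 + \<alpha>) / 2))"
  have q0: "q > 0" and c: "?c \<noteq> 0" using q t by auto
  note A = Lq_affine[OF k q0 c, of 0]
  note B = Lq_scaleR[OF A(1) q0, of "t powr (- ((1 + \<alpha>) / 2 * real CARD('n)))"]
  have e: "dil k t = (\<lambda>x. t powr (- ((1 + \<alpha>) / 2 * real CARD('n))) *\<^sub>R k (0 + ?c *\<^sub>R x))" by (simp add: dil_def fun_eq_iff)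
  show "dil k t \<in> Lq_space q" unfolding e by (rule B(1))
  have "Lq_norm q (dil k t) = t powr (- ((1 + \<alpha>) / 2 * real CARD('n))) * ((t powr (- ((1 + \<alpha>) / 2))) powr (- real CARD('n) / q)) * Lq_norm q k"
    unfolding e B(2) A(2) by simp
  also have "t powr (- ((1 + \<alpha>) / 2 * real CARD('n))) * ((t powr (- ((1 + \<alpha>) / 2))) powr (- real CARD('n) / q)) = t powr (- decay q)"
    unfolding powr_powr powr_add[symmetric] decay_def using q by (intro arg_cong[of _ _ "(powr) t"]) (simp add: field_simps)
  finally show "Lq_norm q (dil k t) = t powr (- decay q) * Lq_norm q k" .
qed

lemma dil_measurable[measurable (raw)]:
  assumes "k \<in> Lq_space q" and [measurable]: "a \<in> borel_measurable M" "b \<in> borel_measurable M"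
  shows "(\<lambda>z. dil k (a z) (b z)) \<in> borel_measurable M"
proof -
  have [measurable]: "k \<in> borel_measurable borel" using assms(1) by measurable
  show ?thesis unfolding dil_def by measurable
qed

lemma conv_dil_measurable:
  assumes f: "jointly_measurable f" and [measurable]: "a \<in> borel_measurable M" "b \<in> borel_measurable M" "c \<in> borel_measurable M"
  shows "(\<lambda>z. conv (dil h (a z)) (f (c z)) (b z)) \<in> borel_measurable M"
  unfolding conv_def
proof (rule sigma_finite_measure.borel_measurable_lebesgue_integral[OF sigma_finite_lborel])
  have [measurable]: "(\<lambda>z. f (c (fst z)) (snd z)) \<in> borel_measurable (M \<Otimes>\<^sub>M lborel)"
    by (rule jointly_measurable_compose[OF f]) measurable
  have [measurable]: "(\<lambda>z. dil h (a (fst z)) (b (fst z) - snd z)) \<in> borel_measurable (M \<Otimes>\<^sub>M lborel)"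
    by (rule dil_measurable[OF h1]) measurable
  show "(\<lambda>(z, y). dil h (a z) (b z - y) *\<^sub>R f (c z) y) \<in> borel_measurable (M \<Otimes>\<^sub>M lborel)"
    unfolding split_beta' by measurable
qed

text \<open>The integral operator in the time variable \<open>r = t - s\<close>. In this form the kernel does not
  depend on the final time, which is what makes continuity in time accessible.\<close>

definition delay :: "(real \<Rightarrow> real^'n \<Rightarrow> 'k::{real_normed_field,euclidean_space}) \<Rightarrow> real \<Rightarrow> real^'n \<Rightarrow> 'k" where
  "delay f T x = (LBINT r:{0..T}. r powr \<alpha> *\<^sub>R conv (dil h r) (f r) x)"

text \<open>By Young's inequality the integrand at \<open>r\<close> has \<open>L\<^sup>q\<close> norm at most \<open>r powr \<alpha> * r powr (- decay
  q) * \<parallel>h\<parallel>\<^sub>q * b r\<close>, and Minkowski's integral inequality sums these bounds.\<close>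

lemma delay_estimate:
  assumes q: "q = 1 \<or> q = p" and f: "jointly_measurable f"
    and fb: "\<And>r. 0 < r \<Longrightarrow> r < T \<Longrightarrow> f r \<in> Lq_space 1 \<and> Lq_norm 1 (f r) \<le> b r"
    and b0: "\<And>r. 0 \<le> b r" and bi: "set_integrable lborel {0..T} (\<lambda>r. r powr rate q * b r)"
  shows "AE x in lborel. set_integrable lborel {0..T} (\<lambda>r. r powr \<alpha> *\<^sub>R conv (dil h r) (f r) x)"
    and "delay f T \<in> Lq_space q"
    and "Lq_norm q (delay f T) \<le> Lq_norm q h * (LBINT r:{0..T}. r powr rate q * b r)"
proof -
  have q1: "1 \<le> q" using q p by auto
  let ?F = "\<lambda>r x. indicator {0..T} r *\<^sub>R (r powr \<alpha> *\<^sub>R conv (dil h r) (f r) x)"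
  let ?w = "\<lambda>r. Lq_norm q h * (indicator {0..T} r *\<^sub>R (r powr rate q * b r))"
  have F: "(\<lambda>(r, x). ?F r x) \<in> borel_measurable (lborel \<Otimes>\<^sub>M lborel)"
  proof -
    have [measurable]: "(\<lambda>z. conv (dil h (fst z)) (f (fst z)) (snd z)) \<in> borel_measurable (lborel \<Otimes>\<^sub>M lborel)"
      by (rule conv_dil_measurable[OF f]) measurable
    show ?thesis unfolding split_beta' by measurable
  qed
  have w: "integrable lborel ?w" using bi by (intro integrable_mult_right) (simp add: set_integrable_def)
  have w0: "0 \<le> ?w r" for r using b0 by (simp add: indicator_def)
  have ne: "AE r in lborel. r \<noteq> 0 \<and> r \<noteq> T" using AE_lborel_singleton[of 0] AE_lborel_singleton[of T] by eventually_elim simp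
  have bd: "AE r in lborel. ?F r \<in> Lq_space q \<and> Lq_norm q (?F r) \<le> ?w r"
    using ne
  proof eventually_elim
    case (elim r)
    show ?case
    proof (cases "0 < r \<and> r < T")
      case True
      then have fr: "f r \<in> Lq_space 1" "Lq_norm 1 (f r) \<le> b r" and r: "r > 0" using fb by auto
      note d = dil_Lq[OF h_Lq[OF q] q1 r]
      note C = conv_Lq_L1[OF d(1) fr(1) q1]
      note S = Lq_scaleR[OF C(2), of "r powr \<alpha>"]
      have q0: "q > 0" using q1 by simp
      have "Lq_norm q (\<lambda>x. r powr \<alpha> *\<^sub>R conv (dil h r) (f r) x) = r powr \<alpha> * Lq_norm q (conv (dil h r) (f r))"
        using S(2)[OF q0] by simp
      also have "\<dots> \<le> r powr \<alpha> * (r powr (- decay q) * Lq_norm q h * b r)"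
        using C(3) d(2) fr(2) by (intro mult_left_mono order_trans[OF C(3)]) (auto intro!: mult_left_mono)
      also have "\<dots> = Lq_norm q h * (r powr rate q * b r)" using r by (simp add: rate_def powr_diff powr_minus divide_inverse)
      finally show ?thesis using True S(1)[OF q0] by simp
    next
      case False
      then have "indicator {0..T} r = (0::real)" using elim by (auto simp: indicator_def)
      then show ?thesis using w0[of r] by simp
    qed
  qed
  note M = Lq_minkowski[OF sigma_finite_lborel q1 F w w0 bd]
  show "AE x in lborel. set_integrable lborel {0..T} (\<lambda>r. r powr \<alpha> *\<^sub>R conv (dil h r) (f r) x)"
    using M(1) by (simp add: set_integrable_def)
  show "delay f T \<in> Lq_space q" using M(2) by (simp add: delay_def[abs_def] set_lebesgue_integral_def)
  show "Lq_norm q (delay f T) \<le> Lq_norm q h * (LBINT r:{0..T}. r powr rate q * b r)"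
    using M(3) by (simp add: delay_def[abs_def] set_lebesgue_integral_def)
qed

lemma delay_convolves:
  assumes f: "jointly_measurable f" and fb: "\<And>r. 0 < r \<Longrightarrow> r < T \<Longrightarrow> f r \<in> Lq_space 1"
  shows "AE x in lborel. AE r in lborel. 0 < r \<and> r < T \<longrightarrow> convolves_at (dil h r) (f r) x"
proof -
  have "AE r in lborel. AE x in lborel. 0 < r \<and> r < T \<longrightarrow> convolves_at (dil h r) (f r) x"
  proof (rule AE_I2)
    fix r :: real
    show "AE x in lborel. 0 < r \<and> r < T \<longrightarrow> convolves_at (dil h r) (f r) x"
    proof (cases "0 < r \<and> r < T")
      case True
      then show ?thesis using conv_Lq_L1(1)[OF dil_Lq(1)[OF h1] fb] by simp
    next
      case False
      then show ?thesis by (intro AE_I2) blast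
    qed
  qed
  moreover have "{z \<in> space (lborel \<Otimes>\<^sub>M lborel). 0 < fst z \<and> fst z < T \<longrightarrow> convolves_at (dil h (fst z)) (f (fst z)) (snd z)} \<in> sets (lborel \<Otimes>\<^sub>M lborel)"
  proof -
    have [measurable]: "(\<lambda>z. f (fst (fst z)) (snd z)) \<in> borel_measurable ((lborel \<Otimes>\<^sub>M lborel) \<Otimes>\<^sub>M lborel)"
      by (rule jointly_measurable_compose[OF f]) measurable
    have [measurable]: "(\<lambda>z. dil h (fst (fst z)) (snd (fst z) - snd z)) \<in> borel_measurable ((lborel \<Otimes>\<^sub>M lborel) \<Otimes>\<^sub>M lborel)"
      by (rule dil_measurable[OF h1]) measurable
    have [measurable]: "Measurable.pred (lborel \<Otimes>\<^sub>M lborel) (\<lambda>z. integrable lborel (\<lambda>y. dil h (fst z) (snd z - y) *\<^sub>R f (fst z) y))"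
      by (rule sigma_finite_measure.borel_measurable_lebesgue_integrable[OF sigma_finite_lborel]) (simp only: split_beta', measurable)
    show ?thesis unfolding convolves_at_def by measurable
  qed
  ultimately show ?thesis by (subst lborel_pair.AE_commute[symmetric]) auto
qed

lemma delay_diff:
  fixes f1 f2 :: "real \<Rightarrow> real^'n \<Rightarrow> 'k::{real_normed_field,euclidean_space}"
  assumes f: "jointly_measurable f1" "jointly_measurable f2"
    and fb: "\<And>r. 0 < r \<Longrightarrow> r < T \<Longrightarrow> f1 r \<in> Lq_space 1 \<and> Lq_norm 1 (f1 r) \<le> b r"
      "\<And>r. 0 < r \<Longrightarrow> r < T \<Longrightarrow> f2 r \<in> Lq_space 1 \<and> Lq_norm 1 (f2 r) \<le> b r"
    and b0: "\<And>r. 0 \<le> b r" and bi: "set_integrable lborel {0..T} (\<lambda>r. r powr rate 1 * b r)"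
  shows "AE x in lborel. delay f1 T x - delay f2 T x = delay (\<lambda>r y. f1 r y - f2 r y) T x"
proof -
  note E1 = delay_estimate(1)[of 1, OF _ f(1) fb(1) b0 bi] and E2 = delay_estimate(1)[of 1, OF _ f(2) fb(2) b0 bi]
  have "AE x in lborel. set_integrable lborel {0..T} (\<lambda>r. r powr \<alpha> *\<^sub>R conv (dil h r) (f1 r) x)" by (rule E1) auto
  moreover have "AE x in lborel. set_integrable lborel {0..T} (\<lambda>r. r powr \<alpha> *\<^sub>R conv (dil h r) (f2 r) x)" by (rule E2) auto
  moreover have "AE x in lborel. AE r in lborel. 0 < r \<and> r < T \<longrightarrow> convolves_at (dil h r) (f1 r) x"
    by (rule delay_convolves[OF f(1)]) (use fb in auto)
  moreover have "AE x in lborel. AE r in lborel. 0 < r \<and> r < T \<longrightarrow> convolves_at (dil h r) (f2 r) x"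
    by (rule delay_convolves[OF f(2)]) (use fb in auto)
  ultimately show ?thesis
  proof eventually_elim
    case (elim x)
    have ne: "AE r in lborel. r \<noteq> 0 \<and> r \<noteq> T" using AE_lborel_singleton[of 0] AE_lborel_singleton[of T] by eventually_elim simp
    have m: "(\<lambda>r. conv (dil h r) (k r) x) \<in> borel_measurable lborel" if "jointly_measurable k" for k :: "real \<Rightarrow> real^'n \<Rightarrow> 'k"
      by (rule conv_dil_measurable[OF that]) measurable
    note [measurable] = m[OF f(1)] m[OF f(2)] m[OF jointly_measurable_diff[OF f]]
    have "delay f1 T x - delay f2 T x = (LBINT r:{0..T}. r powr \<alpha> *\<^sub>R conv (dil h r) (f1 r) x - r powr \<alpha> *\<^sub>R conv (dil h r) (f2 r) x)"
      unfolding delay_def using elim(1,2) by (rule set_integral_diff(2)[symmetric])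
    also have "\<dots> = delay (\<lambda>r y. f1 r y - f2 r y) T x"
      unfolding delay_def set_lebesgue_integral_def
    proof (rule integral_cong_AE)
      show "AE r in lborel. indicator {0..T} r *\<^sub>R (r powr \<alpha> *\<^sub>R conv (dil h r) (f1 r) x - r powr \<alpha> *\<^sub>R conv (dil h r) (f2 r) x) =
          indicator {0..T} r *\<^sub>R (r powr \<alpha> *\<^sub>R conv (dil h r) (\<lambda>y. f1 r y - f2 r y) x)"
        using ne elim(3,4)
      proof eventually_elim
        case (elim r)
        show ?case
        proof (cases "0 < r \<and> r < T")
          case True
          then show ?thesis using elim conv_diff[of "dil h r" "f1 r" x "f2 r"] by (simp add: scaleR_diff_right)
        next
          case False
          then have "indicator {0..T} r = (0::real)" using elim by (auto simp: indicator_def)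
          then show ?thesis by simp
        qed
      qed
    qed measurable
    finally show ?case .
  qed
qed

definition duhamel :: "(real \<Rightarrow> real^'n \<Rightarrow> 'k::{real_normed_field,euclidean_space}) \<Rightarrow> real \<Rightarrow> real^'n \<Rightarrow> 'k" where
  "duhamel f t x = (LBINT s:{0..t}. (t - s) powr \<alpha> *\<^sub>R conv (dil h (t - s)) (f s) x)"

lemma duhamel_delay: "duhamel f t x = delay (\<lambda>r. f (t - r)) t x"
proof -
  have "duhamel f t x = \<bar>-1\<bar> *\<^sub>R (LBINT r. indicator {0..t} (t + - 1 * r) *\<^sub>R ((t - (t + - 1 * r)) powr \<alpha> *\<^sub>R conv (dil h (t - (t + - 1 * r))) (f (t + - 1 * r)) x))"
    unfolding duhamel_def set_lebesgue_integral_def by (rule lborel_integral_real_affine) simp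
  also have "\<dots> = (LBINT r. indicator {0..t} r *\<^sub>R (r powr \<alpha> *\<^sub>R conv (dil h r) (f (t - r)) x))"
    by (simp add: indicator_def conj_commute)
  finally show ?thesis by (simp add: delay_def set_lebesgue_integral_def)
qed

lemma duhamel_integrable_reflect:
  "set_integrable lborel {0..t} (\<lambda>s. (t - s) powr \<alpha> *\<^sub>R conv (dil h (t - s)) (f s) x) \<longleftrightarrow>
   set_integrable lborel {0..t} (\<lambda>r. r powr \<alpha> *\<^sub>R conv (dil h r) (f (t - r)) x)"
proof -
  have "integrable lborel (\<lambda>r. indicator {0..t} (t + - 1 * r) *\<^sub>R ((t - (t + - 1 * r)) powr \<alpha> *\<^sub>R conv (dil h (t - (t + - 1 * r))) (f (t + - 1 * r)) x))
     \<longleftrightarrow> integrable lborel (\<lambda>s. indicator {0..t} s *\<^sub>R ((t - s) powr \<alpha> *\<^sub>R conv (dil h (t - s)) (f s) x))"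
    by (rule lborel_integrable_real_affine_iff) simp
  moreover have "(\<lambda>r. indicator {0..t} (t + - 1 * r) *\<^sub>R ((t - (t + - 1 * r)) powr \<alpha> *\<^sub>R conv (dil h (t - (t + - 1 * r))) (f (t + - 1 * r)) x))
     = (\<lambda>r. indicator {0..t} r *\<^sub>R (r powr \<alpha> *\<^sub>R conv (dil h r) (f (t - r)) x))"
    by (auto simp: fun_eq_iff indicator_def)
  ultimately show ?thesis by (simp add: set_integrable_def)
qed

lemma duhamel_estimate:
  assumes q: "q = 1 \<or> q = p" and f: "jointly_measurable f"
    and fb: "\<And>s. 0 < s \<Longrightarrow> s < t \<Longrightarrow> f s \<in> Lq_space 1 \<and> Lq_norm 1 (f s) \<le> b s"
    and b0: "\<And>s. 0 \<le> b s" and bi: "set_integrable lborel {0..t} (\<lambda>s. (t - s) powr rate q * b s)"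
  shows "AE x in lborel. set_integrable lborel {0..t} (\<lambda>s. (t - s) powr \<alpha> *\<^sub>R conv (dil h (t - s)) (f s) x)"
    and "duhamel f t \<in> Lq_space q"
    and "Lq_norm q (duhamel f t) \<le> Lq_norm q h * (LBINT s:{0..t}. (t - s) powr rate q * b s)"
proof -
  have fr: "f (t - r) \<in> Lq_space 1 \<and> Lq_norm 1 (f (t - r)) \<le> b (t - r)" if "0 < r" "r < t" for r using fb[of "t - r"] that by simp
  note E = delay_estimate[where b = "\<lambda>r. b (t - r)" and T = t, OF q jointly_measurable_reflect[OF f] fr b0, unfolded reflect_set_integral, OF _ _ bi]
  show "AE x in lborel. set_integrable lborel {0..t} (\<lambda>s. (t - s) powr \<alpha> *\<^sub>R conv (dil h (t - s)) (f s) x)"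
    unfolding duhamel_integrable_reflect by (rule E(1))
  have d: "duhamel f t = delay (\<lambda>r. f (t - r)) t" by (simp add: fun_eq_iff duhamel_delay)
  show "duhamel f t \<in> Lq_space q" unfolding d by (rule E(2))
  show "Lq_norm q (duhamel f t) \<le> Lq_norm q h * (LBINT s:{0..t}. (t - s) powr rate q * b s)" unfolding d by (rule E(3))
qed

lemma duhamel_diff:
  assumes f: "jointly_measurable f1" "jointly_measurable f2"
    and fb: "\<And>s. 0 < s \<Longrightarrow> s < t \<Longrightarrow> f1 s \<in> Lq_space 1 \<and> Lq_norm 1 (f1 s) \<le> b s"
      "\<And>s. 0 < s \<Longrightarrow> s < t \<Longrightarrow> f2 s \<in> Lq_space 1 \<and> Lq_norm 1 (f2 s) \<le> b s"
    and b0: "\<And>s. 0 \<le> b s" and bi: "set_integrable lborel {0..t} (\<lambda>s. (t - s) powr rate 1 * b s)"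
  shows "AE x in lborel. duhamel f1 t x - duhamel f2 t x = duhamel (\<lambda>s y. f1 s y - f2 s y) t x"
  unfolding duhamel_delay
  by (rule delay_diff[where b = "\<lambda>r. b (t - r)"])
     (use fb b0 bi in \<open>auto simp: reflect_set_integral intro: jointly_measurable_reflect f\<close>)

lemma duhamel_convolves:
  assumes f: "jointly_measurable f" and fb: "\<And>s. 0 < s \<Longrightarrow> s < t \<Longrightarrow> f s \<in> Lq_space 1"
  shows "AE x in lborel. AE s in lborel. 0 < s \<and> s < t \<longrightarrow> convolves_at (dil h (t - s)) (f s) x"
proof -
  have "AE x in lborel. AE r in lborel. 0 < r \<and> r < t \<longrightarrow> convolves_at (dil h r) (f (t - r)) x"
    by (rule delay_convolves[OF jointly_measurable_reflect[OF f]]) (use fb in auto)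
  then show ?thesis
  proof eventually_elim
    case (elim x)
    let ?Q = "\<lambda>r. 0 < r \<and> r < t \<longrightarrow> convolves_at (dil h r) (f (t - r)) x"
    have d: "(lborel :: real measure) = distr lborel borel (\<lambda>s. t - s)"
      using lborel_real_affine[of "-1" t] by (simp add: density_1)
    have "AE s in lborel. ?Q (t - s)"
    proof (rule AE_distrD[of "\<lambda>s. t - s" lborel borel ?Q])
      show "AE r in distr lborel borel (\<lambda>s. t - s). ?Q r" unfolding d[symmetric] by (rule elim)
    qed simp
    then show ?case by eventually_elim auto
  qed
qed

text \<open>In the delay form, a change of the final time only changes the source, by a translation in
  time. The difference of two values is thus estimated by the \<open>L\<^sup>1\<close> modulus of continuity of the
  source, and dominated convergence applies because \<open>r powr rate q\<close> is integrable at \<open>0\<close>.\<close>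

lemma duhamel_continuous:
  assumes q: "q = 1 \<or> q = p" and f: "jointly_measurable f" and fL: "\<And>s. s \<ge> 0 \<Longrightarrow> f s \<in> Lq_space 1"
    and cont: "\<And>t. t \<ge> 0 \<Longrightarrow> Lq_continuous_at 1 f t"
    and t: "t \<ge> 0"
  shows "((\<lambda>\<tau>. Lq_norm q (\<lambda>x. duhamel f \<tau> x - duhamel f t x)) \<longlongrightarrow> 0) (at t within {0..})"
proof -
  have q1: "1 \<le> q" using q p by auto
  define T where "T = t + 1"
  obtain M' where M': "\<And>s. s \<in> {0..T} \<Longrightarrow> Lq_norm 1 (f s) \<le> M'"
    using Lq_curve_bounded[OF order_refl fL cont, of T] by blast
  define M where "M = max 0 M'"
  have M: "0 \<le> M" "\<And>s. s \<in> {0..T} \<Longrightarrow> Lq_norm 1 (f s) \<le> M" using M' unfolding M_def by (force intro: max.coboundedI2)+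
  (* extension by zero to negative times, so that the range of integration does not move *)
  define z where "z s x = (if s < 0 then 0 else f s x)" for s x
  have zm: "jointly_measurable z"
  proof (rule jointly_measurableI)
    have [measurable]: "(\<lambda>w. f (fst w) (snd w)) \<in> borel_measurable (lborel \<Otimes>\<^sub>M lborel)"
      by (rule jointly_measurable_compose[OF f]) measurable
    show "(\<lambda>w. z (fst w) (snd w)) \<in> borel_measurable (lborel \<Otimes>\<^sub>M lborel)" unfolding z_def by measurable
  qed
  have zL: "z s \<in> Lq_space 1" for s using fL[of s] by (cases "s < 0") (simp_all add: z_def[abs_def])
  have zM: "Lq_norm 1 (z s) \<le> M" if "s \<le> T" for s using M that by (cases "s < 0") (simp_all add: z_def[abs_def])
  have zd: "duhamel f \<tau> x = delay (\<lambda>r. z (\<tau> - r)) T x" if "0 \<le> \<tau>" "\<tau> \<le> T" for \<tau> x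
  proof -
    have "indicator {0..\<tau>} r *\<^sub>R (r powr \<alpha> *\<^sub>R conv (dil h r) (f (\<tau> - r)) x) = indicator {0..T} r *\<^sub>R (r powr \<alpha> *\<^sub>R conv (dil h r) (z (\<tau> - r)) x)" for r
    proof (cases "r \<le> \<tau>")
      case True
      then have "z (\<tau> - r) = f (\<tau> - r)" by (simp add: z_def fun_eq_iff)
      then show ?thesis using True that by (simp add: indicator_def)
    next
      case False
      then have "z (\<tau> - r) = (\<lambda>y. 0)" by (simp add: z_def fun_eq_iff)
      then show ?thesis using False by (simp add: conv_zero indicator_def)
    qed
    then show ?thesis unfolding duhamel_delay delay_def set_lebesgue_integral_def by simp
  qed
  define w where "w \<tau> r = Lq_norm 1 (\<lambda>x. z (\<tau> - r) x - z (t - r) x)" for \<tau> r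
  have wL: "(\<lambda>x. z (\<tau> - r) x - z (t - r) x) \<in> Lq_space 1" for \<tau> r by (rule Lq_diff(1)[OF zL zL order_refl])
  have wM: "w \<tau> r \<le> 2 * M" if "0 \<le> r" "\<tau> \<le> T" for \<tau> r
    using Lq_diff(2)[OF zL zL order_refl, of "\<tau> - r" "t - r"] zM[of "\<tau> - r"] zM[of "t - r"] that by (simp add: w_def T_def)
  have w0: "0 \<le> w \<tau> r" for \<tau> r by (simp add: w_def)
  have wm[measurable]: "w \<tau> \<in> borel_measurable borel" for \<tau>
  proof -
    have "(\<lambda>r. LBINT x. norm (z (\<tau> - r) x - z (t - r) x)) \<in> borel_measurable lborel"
    proof (rule sigma_finite_measure.borel_measurable_lebesgue_integral[OF sigma_finite_lborel])
      have [measurable]: "(\<lambda>v. z (c - fst v) (snd v)) \<in> borel_measurable (lborel \<Otimes>\<^sub>M lborel)" for c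
        by (rule jointly_measurable_compose[OF zm]) measurable
      show "(\<lambda>(r, x). norm (z (\<tau> - r) x - z (t - r) x)) \<in> borel_measurable (lborel \<Otimes>\<^sub>M lborel)" unfolding split_beta' by measurable
    qed
    then show ?thesis by (simp add: w_def[abs_def] Lq_norm_1)
  qed
  have pw: "set_integrable lborel {0..T} (\<lambda>r. r powr rate c * K)" if "c = 1 \<or> c = p" for c K
    using set_integrable_powr_near_0[OF rate_gt[OF that], of T] t by (intro set_integrable_mult_left) (simp add: T_def)
  have wi: "set_integrable lborel {0..T} (\<lambda>r. r powr rate q * w \<tau> r)" if "\<tau> \<le> T" for \<tau>
  proof (rule set_integrable_bound[OF pw[OF q, of "2 * M"]])
    show "set_borel_measurable lborel {0..T} (\<lambda>r. r powr rate q * w \<tau> r)" unfolding set_borel_measurable_def by measurable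
    show "AE r in lborel. r \<in> {0..T} \<longrightarrow> norm (r powr rate q * w \<tau> r) \<le> norm (r powr rate q * (2 * M))"
      using wM[OF _ that] w0 M by (intro AE_I2) (auto simp: abs_mult intro!: mult_left_mono)
  qed
  have est: "Lq_norm q (\<lambda>x. duhamel f \<tau> x - duhamel f t x) \<le> Lq_norm q h * (LBINT r:{0..T}. r powr rate q * w \<tau> r)"
    if \<tau>: "0 \<le> \<tau>" "\<tau> \<le> T" for \<tau>
  proof -
    let ?A = "\<lambda>c r. z (c - r)"
    have tT: "t \<le> T" by (simp add: T_def)
    have jr: "jointly_measurable (?A c)" for c by (rule jointly_measurable_reflect[OF zm])
    have bA: "?A c r \<in> Lq_space 1 \<and> Lq_norm 1 (?A c r) \<le> M" if "c \<le> T" "0 < r" for c r using zL zM[of "c - r"] that by simp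
    have L: "duhamel f c \<in> Lq_space q" if "0 \<le> c" "c \<le> T" for c
    proof -
      have "duhamel f c = delay (?A c) T" using zd[OF that] by (simp add: fun_eq_iff)
      also have "\<dots> \<in> Lq_space q" by (rule delay_estimate(2)[OF q jr, of T c "\<lambda>_. M"]) (use bA that M pw[OF q] in auto)
      finally show ?thesis .
    qed
    have ae: "AE x in lborel. duhamel f \<tau> x - duhamel f t x = delay (\<lambda>r y. z (\<tau> - r) y - z (t - r) y) T x"
      using delay_diff[OF jr jr, of T \<tau> "\<lambda>_. M" t] bA \<tau> tT M pw[of 1 M] zd[OF \<tau>] zd[OF t tT] by simp
    have E: "delay (\<lambda>r y. z (\<tau> - r) y - z (t - r) y) T \<in> Lq_space q"
      "Lq_norm q (delay (\<lambda>r y. z (\<tau> - r) y - z (t - r) y) T) \<le> Lq_norm q h * (LBINT r:{0..T}. r powr rate q * w \<tau> r)"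
      using delay_estimate(2,3)[OF q jointly_measurable_diff[OF jr jr], of T \<tau> t "w \<tau>"] wL w0 wi[OF \<tau>(2)] by (simp_all add: w_def)
    have [measurable]: "duhamel f \<tau> \<in> borel_measurable borel" "duhamel f t \<in> borel_measurable borel"
       "delay (\<lambda>r y. z (\<tau> - r) y - z (t - r) y) T \<in> borel_measurable borel"
      using L[OF \<tau>] L[OF t tT] E(1) by (auto intro: Lq_measurable)
    have "Lq_norm q (\<lambda>x. duhamel f \<tau> x - duhamel f t x) = Lq_norm q (delay (\<lambda>r y. z (\<tau> - r) y - z (t - r) y) T)"
      by (rule Lq_norm_cong_AE) (use ae in \<open>auto elim: eventually_mono\<close>)
    then show ?thesis using E(2) by simp
  qed
  have zc: "((\<lambda>\<tau>. w \<tau> r) \<longlongrightarrow> 0) (at t within {0..})" if r: "r \<noteq> t" for r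
  proof (cases "r < t")
    case True
    have "((\<lambda>s. Lq_norm 1 (\<lambda>x. f s x - f (t - r) x)) \<longlongrightarrow> 0) (at (t - r))"
      using cont[of "t - r"] True at_within_interior[of "t - r" "{0..}"] by simp
    then have "((\<lambda>\<tau>. Lq_norm 1 (\<lambda>x. f (\<tau> - r) x - f (t - r) x)) \<longlongrightarrow> 0) (at t)"
      using LIM_offset[of "\<lambda>s. Lq_norm 1 (\<lambda>x. f s x - f (t - r) x)" 0 "t - r" "- r"] by simp
    then have "((\<lambda>\<tau>. Lq_norm 1 (\<lambda>x. f (\<tau> - r) x - f (t - r) x)) \<longlongrightarrow> 0) (at t within {0..})"
      by (rule tendsto_within_subset[of _ _ _ UNIV, simplified])
    moreover have "\<forall>\<^sub>F \<tau> in at t within {0..}. r < \<tau>"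
      using True by (intro order_tendstoD(1)[OF tendsto_ident_at])
    then have "\<forall>\<^sub>F \<tau> in at t within {0..}. Lq_norm 1 (\<lambda>x. f (\<tau> - r) x - f (t - r) x) = w \<tau> r"
      by eventually_elim (use True in \<open>simp add: w_def z_def\<close>)
    ultimately show ?thesis by (rule Lim_transform_eventually)
  next
    case False
    then have "r > t" using r by simp
    then have "\<forall>\<^sub>F \<tau> in at t within {0..}. \<tau> < r"
      by (intro order_tendstoD(2)[OF tendsto_ident_at])
    then have "\<forall>\<^sub>F \<tau> in at t within {0..}. w \<tau> r = 0"
      by eventually_elim (use \<open>r > t\<close> in \<open>simp add: w_def z_def\<close>)
    then show ?thesis by (rule tendsto_eventually)
  qed
  have "((\<lambda>\<tau>. Lq_norm q h * (LBINT r:{0..T}. r powr rate q * w \<tau> r)) \<longlongrightarrow> 0) (at t within {0..T})"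
  proof (rule tendsto_mult_right_zero, rule tendsto_at_iff_sequentially[THEN iffD2], intro allI impI, goal_cases)
    case (1 X)
    have X: "X i \<le> T" "X i \<in> {0..}" "X i \<noteq> t" for i using 1(1) by auto
    have Xt: "filterlim X (at t within {0..}) sequentially" using X 1(2) by (auto simp: filterlim_at)
    have "(\<lambda>i. LBINT r. indicator {0..T} r *\<^sub>R (r powr rate q * w (X i) r)) \<longlonglongrightarrow> (\<integral>r. 0 \<partial>(lborel :: real measure))"
    proof (rule integral_dominated_convergence[where w = "\<lambda>r. indicator {0..T} r *\<^sub>R (r powr rate q * (2 * M))"])
      show "integrable lborel (\<lambda>r. indicator {0..T} r *\<^sub>R (r powr rate q * (2 * M)))"
        using pw[OF q, of "2 * M"] by (simp add: set_integrable_def)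
      show "AE r in lborel. (\<lambda>i. indicator {0..T} r *\<^sub>R (r powr rate q * w (X i) r)) \<longlonglongrightarrow> 0"
        using AE_lborel_singleton[of t]
      proof eventually_elim
        case (elim r)
        then have "(\<lambda>i. w (X i) r) \<longlonglongrightarrow> 0" using filterlim_compose[OF zc Xt] by simp
        then show ?case by (auto intro!: tendsto_eq_intros)
      qed
      show "AE r in lborel. norm (indicator {0..T} r *\<^sub>R (r powr rate q * w (X i) r)) \<le> indicator {0..T} r *\<^sub>R (r powr rate q * (2 * M))" for i
        using wM[OF _ X(1)] w0 by (intro AE_I2) (auto simp: indicator_def abs_mult intro!: mult_left_mono)
    qed measurable
    then show ?case by (simp add: comp_def set_lebesgue_integral_def)
  qed
  then have "((\<lambda>\<tau>. Lq_norm q (\<lambda>x. duhamel f \<tau> x - duhamel f t x)) \<longlongrightarrow> 0) (at t within {0..T})"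
    by (rule Lim_null_comparison[rotated]) (use est in \<open>auto simp: eventually_at_filter\<close>)
  moreover have "at t within {0..T} = at t within {0..}"
  proof (rule at_within_nhd[of t "{..<T}"])
    show "t \<in> {..<T}" by (simp add: T_def)
  qed auto
  ultimately show ?thesis by simp
qed

section \<open>The free evolution\<close>

text \<open>The convolution with the dilated profile, written as an average of dilated translates of the
  data. At \<open>t = 0\<close> this expression still makes sense and gives \<open>u0\<close>, because the profile has
  integral one; the continuity at \<open>t = 0\<close> is therefore no special case.\<close>

definition free :: "(real^'n \<Rightarrow> 'k::{real_normed_field,euclidean_space}) \<Rightarrow> real \<Rightarrow> real^'n \<Rightarrow> 'k" where
  "free u0 t x = (LBINT y. g y *\<^sub>R u0 (x - t powr ((1 + \<alpha>) / 2) *\<^sub>R y))"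

lemma free_conv:
  fixes u0 :: "real^'n \<Rightarrow> 'k::{real_normed_field,euclidean_space}"
  assumes t: "t > 0" and u0: "u0 \<in> Lq_space 1"
  shows "conv (dil g t) u0 x = free u0 t x"
proof -
  let ?c = "t powr ((1 + \<alpha>) / 2)"
  have [measurable]: "u0 \<in> borel_measurable borel" using u0 by measurable
  have [measurable]: "(\<lambda>y. dil g t (x - y)) \<in> borel_measurable borel" by (rule dil_measurable[OF g1]) measurable
  have "conv (dil g t) u0 x = \<bar>- ?c\<bar> ^ DIM(real^'n) *\<^sub>R (LBINT y. dil g t (x - (x + (- ?c) *\<^sub>R y)) *\<^sub>R u0 (x + (- ?c) *\<^sub>R y))"
    unfolding conv_def by (rule integral_affine) (use t in auto)
  also have "\<dots> = (LBINT y. \<bar>- ?c\<bar> ^ DIM(real^'n) *\<^sub>R (dil g t (x - (x + (- ?c) *\<^sub>R y)) *\<^sub>R u0 (x + (- ?c) *\<^sub>R y)))"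
    by (rule integral_scaleR_right[symmetric])
  also have "\<dots> = free u0 t x"
    unfolding free_def
  proof (rule Bochner_Integration.integral_cong[OF refl])
    fix y :: "real^'n"
    have "\<bar>- ?c\<bar> ^ DIM(real^'n) * t powr (- ((1 + \<alpha>) / 2 * real CARD('n))) = 1"
    proof -
      have "\<bar>- ?c\<bar> ^ DIM(real^'n) = ?c powr real CARD('n)" using t by (simp add: powr_realpow)
      then show ?thesis using t by (simp add: powr_powr flip: powr_add)
    qed
    moreover have "t powr (- ((1 + \<alpha>) / 2)) *\<^sub>R (?c *\<^sub>R y) = y"
      unfolding scaleR_scaleR powr_add[symmetric] using t by simp
    ultimately show "\<bar>- ?c\<bar> ^ DIM(real^'n) *\<^sub>R (dil g t (x - (x + (- ?c) *\<^sub>R y)) *\<^sub>R u0 (x + (- ?c) *\<^sub>R y)) = g y *\<^sub>R u0 (x - ?c *\<^sub>R y)"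
      by (simp add: dil_def mult.assoc[symmetric])
  qed
  finally show ?thesis .
qed

lemma free_Lq:
  assumes u0: "u0 \<in> Lq_space q" and q: "1 \<le> q"
  shows "free u0 t \<in> Lq_space q" "Lq_norm q (free u0 t) \<le> Lq_norm 1 g * Lq_norm q u0"
  using dilated_average_continuous(3,4)[OF u0 q g1] by (simp_all add: free_def[abs_def])

lemma free_continuous:
  assumes u0: "u0 \<in> Lq_space q" and q: "1 \<le> q" and t: "t \<ge> 0"
  shows "((\<lambda>\<tau>. Lq_norm q (\<lambda>x. free u0 \<tau> x - free u0 t x)) \<longlongrightarrow> 0) (at t within {0..})"
proof -
  let ?G = "\<lambda>r x. \<integral>y. g y *\<^sub>R u0 (x - r *\<^sub>R y) \<partial>lborel"
  let ?s = "t powr ((1 + \<alpha>) / 2)"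
  let ?\<Phi> = "\<lambda>r. Lq_norm q (\<lambda>x. ?G r x - ?G ?s x)"
  have "(?\<Phi> \<longlongrightarrow> 0) (at ?s)" by (rule dilated_average_continuous(1)[OF u0 q g1])
  then have c: "isCont ?\<Phi> ?s" by (simp add: isCont_def)
  have "((\<lambda>\<tau>. \<tau> powr ((1 + \<alpha>) / 2)) \<longlongrightarrow> ?s) (at t within {0..})"
    using \<alpha> t by (intro tendsto_powr2 tendsto_ident_at tendsto_const) (auto simp: eventually_at_filter)
  from isCont_tendsto_compose[OF c this] show ?thesis by (simp add: free_def)
qed

lemma free_0:
  shows "free u0 0 x = u0 x"
  using g_integral g1 by (simp add: free_def Lq1_iff)

text \<open>The decay in \<open>L\<^sup>p\<close> of \<open>L\<^sup>1\<close> data; the bound by \<open>\<parallel>u0\<parallel>\<^sub>p\<close> in \<open>free_Lq\<close> takes over for small times.\<close>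

lemma free_smoothing:
  assumes u0: "u0 \<in> Lq_space 1" and t: "t > 0"
  shows "Lq_norm p (free u0 t) \<le> t powr (- decay p) * Lq_norm p g * Lq_norm 1 u0"
proof -
  have p1: "1 \<le> p" using p by simp
  note d = dil_Lq[OF gp p1 t]
  have "free u0 t = conv (dil g t) u0" using free_conv[OF t u0] by (simp add: fun_eq_iff)
  then show ?thesis using conv_Lq_L1(3)[OF d(1) u0 p1] d(2) by simp
qed

lemma free_convolves:
  assumes u0: "u0 \<in> Lq_space 1" and t: "t > 0"
  shows "AE x in lborel. convolves_at (dil g t) u0 x"
  by (rule conv_Lq_L1(1)[OF dil_Lq(1)[OF g1 order_refl t] u0 order_refl])

lemma free_jointly_measurable:
  assumes u0: "u0 \<in> Lq_space 1"
  shows "jointly_measurable (free u0)"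
proof (rule jointly_measurableI)
  have [measurable]: "u0 \<in> borel_measurable borel" "g \<in> borel_measurable borel" using u0 g1 by measurable
  show "(\<lambda>z. free u0 (fst z) (snd z)) \<in> borel_measurable (lborel \<Otimes>\<^sub>M lborel)"
    unfolding free_def
    by (rule sigma_finite_measure.borel_measurable_lebesgue_integral[OF sigma_finite_lborel]) measurable
qed

lemma duhamel_jointly_measurable:
  assumes f: "jointly_measurable f"
  shows "jointly_measurable (duhamel f)"
proof (rule jointly_measurableI)
  have e: "duhamel f t x = (LBINT s. (if 0 \<le> s \<and> s \<le> t then (t - s) powr \<alpha> *\<^sub>R conv (dil h (t - s)) (f s) x else 0))" for t x
    unfolding duhamel_def set_lebesgue_integral_def by (intro Bochner_Integration.integral_cong) (auto simp: indicator_def)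
  show "(\<lambda>z. duhamel f (fst z) (snd z)) \<in> borel_measurable (lborel \<Otimes>\<^sub>M lborel)"
    unfolding e
  proof (rule sigma_finite_measure.borel_measurable_lebesgue_integral[OF sigma_finite_lborel])
    have C: "(\<lambda>w. conv (dil h (fst (fst w) - snd w)) (f (snd w)) (snd (fst w))) \<in> borel_measurable ((lborel \<Otimes>\<^sub>M lborel) \<Otimes>\<^sub>M lborel)"
      by (rule conv_dil_measurable[OF f]) measurable
    show "(\<lambda>(z, s). if 0 \<le> s \<and> s \<le> fst z then (fst z - s) powr \<alpha> *\<^sub>R conv (dil h (fst z - s)) (f s) (snd z) else 0) \<in> borel_measurable ((lborel \<Otimes>\<^sub>M lborel) \<Otimes>\<^sub>M lborel)"
      unfolding split_beta' by (intro measurable_If borel_measurable_scaleR C) measurable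
  qed
qed

section \<open>Weighted estimates\<close>

text \<open>The ball of radius \<open>B\<close> of the space in which the equation is solved.\<close>

definition weighted :: "real \<Rightarrow> (real \<Rightarrow> real^'n \<Rightarrow> 'k::{real_normed_field,euclidean_space}) \<Rightarrow> bool" where
  "weighted B u \<longleftrightarrow> jointly_measurable u \<and>
     (\<forall>q\<in>{1, p}. \<forall>t\<ge>0. u t \<in> Lq_space q \<and> Lq_norm q (u t) \<le> B * (1 + t) powr rate q)"

lemma weightedD:
  assumes "weighted B u" and "q = 1 \<or> q = p"
  shows "jointly_measurable u" "t \<ge> 0 \<Longrightarrow> u t \<in> Lq_space q" "t \<ge> 0 \<Longrightarrow> Lq_norm q (u t) \<le> B * (1 + t) powr rate q"
  using assms unfolding weighted_def by blast+

lemma weighted_mono: "weighted B u \<Longrightarrow> B \<le> B' \<Longrightarrow> weighted B' u"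
  unfolding weighted_def by (meson mult_right_mono order_trans powr_ge_zero)

lemma weighted_add:
  assumes "weighted A u" "weighted B v"
  shows "weighted (A + B) (\<lambda>t x. u t x + v t x)"
  unfolding weighted_def
proof (intro conjI ballI allI impI)
  have jm: "jointly_measurable u" "jointly_measurable v" using assms by (simp_all add: weighted_def)
  show "jointly_measurable (\<lambda>t x. u t x + v t x)"
    by (intro jointly_measurableI borel_measurable_add jointly_measurable_compose[OF jm(1)] jointly_measurable_compose[OF jm(2)]) measurable
next
  fix q t :: real assume q: "q \<in> {1, p}" and t: "t \<ge> 0"
  then have q1: "1 \<le> q" and q': "q = 1 \<or> q = p" using p by auto
  note L = Lq_add[OF weightedD(2)[OF assms(1) q' t] weightedD(2)[OF assms(2) q' t] q1]
  show "(\<lambda>x. u t x + v t x) \<in> Lq_space q" by (rule L(1))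
  show "Lq_norm q (\<lambda>x. u t x + v t x) \<le> (A + B) * (1 + t) powr rate q"
    using L(2) weightedD(3)[OF assms(1) q' t] weightedD(3)[OF assms(2) q' t] by (simp add: distrib_right)
qed

definition free_const :: real where
  "free_const = 1 + Lq_norm 1 g + 2 powr decay p * (Lq_norm 1 g + Lq_norm p g)"

lemma free_const_pos: "0 < free_const"
  by (simp add: free_const_def add_pos_nonneg)

lemma L1_Lp_norm_ge: "Lq_norm 1 f \<le> L1_Lp_norm p f" "Lq_norm p f \<le> L1_Lp_norm p f" "0 \<le> L1_Lp_norm p f"
  by (simp_all add: L1_Lp_norm_def)

text \<open>For \<open>t \<ge> 1\<close> the smoothing estimate gives the decay, for \<open>t \<le> 1\<close> the boundedness of the
  evolution does. The free evolution decays by the factor \<open>(1+t) powr \<alpha>\<close> faster than the weight,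
  which is dictated by the integral operator.\<close>

lemma free_weighted:
  assumes u0: "u0 \<in> L1_Lp_space p"
  shows "weighted (free_const * L1_Lp_norm p u0) (free u0)"
  unfolding weighted_def
proof (intro conjI ballI allI impI)
  have u1: "u0 \<in> Lq_space 1" and up: "u0 \<in> Lq_space p" using u0 by (auto simp: L1_Lp_space_def)
  show "jointly_measurable (free u0)" by (rule free_jointly_measurable[OF u1])
  fix q t :: real assume q: "q \<in> {1, p}" and t: "t \<ge> 0"
  have p1: "1 \<le> p" using p by simp
  show "free u0 t \<in> Lq_space q" using q free_Lq(1)[OF u1 order_refl] free_Lq(1)[OF up p1] by auto
  let ?e = "L1_Lp_norm p u0"
  have ge1: "1 \<le> (1 + t) powr \<alpha>" using \<alpha> t by (simp add: ge_one_powr_ge_zero)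
  have d: "0 \<le> decay p" by (rule decay_nonneg[OF p1])
  have "Lq_norm 1 (free u0 t) \<le> free_const * ?e * (1 + t) powr rate 1"
  proof -
    have "Lq_norm 1 (free u0 t) \<le> Lq_norm 1 g * Lq_norm 1 u0" by (rule free_Lq(2)[OF u1 order_refl])
    also have "\<dots> \<le> free_const * ?e" by (intro mult_mono L1_Lp_norm_ge) (simp_all add: free_const_def less_imp_le[OF free_const_pos])
    also have "\<dots> \<le> free_const * ?e * (1 + t) powr rate 1"
      using mult_left_mono[OF ge1, of "free_const * ?e"] free_const_pos L1_Lp_norm_ge(3)[of u0] by (simp add: rate_1)
    finally show ?thesis .
  qed
  moreover have "Lq_norm p (free u0 t) \<le> free_const * ?e * (1 + t) powr rate p"
  proof -
    have "Lq_norm p (free u0 t) \<le> 2 powr decay p * (Lq_norm 1 g + Lq_norm p g) * ?e * (1 + t) powr (- decay p)"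
    proof (cases "t \<le> 1")
      case True
      have "2 powr (- decay p) \<le> (1 + t) powr (- decay p)" using True t d by (intro powr_mono2') auto
      then have "2 powr decay p * 2 powr (- decay p) \<le> 2 powr decay p * (1 + t) powr (- decay p)" by (rule mult_left_mono) simp
      then have one: "1 \<le> 2 powr decay p * (1 + t) powr (- decay p)" by (simp add: powr_add[symmetric])
      have "Lq_norm p (free u0 t) \<le> Lq_norm 1 g * Lq_norm p u0" by (rule free_Lq(2)[OF up p1])
      also have "\<dots> \<le> (Lq_norm 1 g + Lq_norm p g) * ?e" by (intro mult_mono L1_Lp_norm_ge) simp_all
      also have "\<dots> \<le> (Lq_norm 1 g + Lq_norm p g) * ?e * (2 powr decay p * (1 + t) powr (- decay p))"
        using mult_left_mono[OF one, of "(Lq_norm 1 g + Lq_norm p g) * ?e"] L1_Lp_norm_ge(3)[of u0] by simp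
      finally show ?thesis by (simp only: mult_ac)
    next
      case False
      have "(2 * t) powr (- decay p) \<le> (1 + t) powr (- decay p)" using False d by (intro powr_mono2') auto
      then have "2 powr decay p * (2 powr (- decay p) * t powr (- decay p)) \<le> 2 powr decay p * (1 + t) powr (- decay p)"
        using False by (intro mult_left_mono) (simp_all add: powr_mult)
      then have tb: "t powr (- decay p) \<le> 2 powr decay p * (1 + t) powr (- decay p)"
        by (simp add: powr_add[symmetric] mult.assoc[symmetric])
      have "Lq_norm p (free u0 t) \<le> t powr (- decay p) * Lq_norm p g * Lq_norm 1 u0"
        by (rule free_smoothing[OF u1]) (use False in simp)
      also have "\<dots> \<le> (2 powr decay p * (1 + t) powr (- decay p)) * (Lq_norm 1 g + Lq_norm p g) * ?e"
        by (intro mult_mono L1_Lp_norm_ge tb) (auto simp: L1_Lp_norm_def)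
      finally show ?thesis by (simp only: mult_ac)
    qed
    also have "\<dots> \<le> free_const * ?e * (1 + t) powr rate p"
    proof (intro mult_mono)
      show "2 powr decay p * (Lq_norm 1 g + Lq_norm p g) \<le> free_const" by (simp add: free_const_def)
      show "(1 + t) powr - decay p \<le> (1 + t) powr rate p" using t \<alpha> by (intro powr_mono) (auto simp: rate_def)
    qed (use L1_Lp_norm_ge(3)[of u0] free_const_pos in auto)
    finally show ?thesis .
  qed
  ultimately show "Lq_norm q (free u0 t) \<le> free_const * ?e * (1 + t) powr rate q" using q by auto
qed

text \<open>The constant \<open>K\<close> is independent of the source and of the time; this is the place where both
  conditions on \<open>p\<close> enter.\<close>

lemma duhamel_weighted:
  "\<exists>K>0. \<forall>A\<ge>0. \<forall>f :: real \<Rightarrow> real^'n \<Rightarrow> 'k::{real_normed_field,euclidean_space}. jointly_measurable f \<longrightarrow>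
     (\<forall>s\<ge>0. f s \<in> Lq_space 1 \<and> Lq_norm 1 (f s) \<le> A * (1 + s) powr (p * rate p)) \<longrightarrow> weighted (K * A) (duhamel f)"
proof -
  have b: "1 < - (p * rate p)" using source_rate by simp
  obtain C1 where C1: "C1 > 0" and C1': "\<And>t. t \<ge> 0 \<Longrightarrow> set_integrable lborel {0..t} (\<lambda>s. (t - s) powr rate 1 * (1 + s) powr (p * rate p)) \<and>
     (LBINT s:{0..t}. (t - s) powr rate 1 * (1 + s) powr (p * rate p)) \<le> C1 * (1 + t) powr rate 1"
    using weakly_singular_integral[OF rate_gt[of 1] b] by auto
  obtain Cp where Cp: "Cp > 0" and Cp': "\<And>t. t \<ge> 0 \<Longrightarrow> set_integrable lborel {0..t} (\<lambda>s. (t - s) powr rate p * (1 + s) powr (p * rate p)) \<and>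
     (LBINT s:{0..t}. (t - s) powr rate p * (1 + s) powr (p * rate p)) \<le> Cp * (1 + t) powr rate p"
    using weakly_singular_integral[OF rate_gt[of p] b] by auto
  define K where "K = 1 + Lq_norm 1 h * C1 + Lq_norm p h * Cp"
  have n0: "0 \<le> Lq_norm 1 h * C1" "0 \<le> Lq_norm p h * Cp" using C1 Cp by (auto intro: mult_nonneg_nonneg)
  have K: "K > 0" using n0 by (simp add: K_def)
  have main: "weighted (K * A) (duhamel f)"
    if A: "A \<ge> 0" and jm: "jointly_measurable f" and fb: "\<And>s. s \<ge> 0 \<Longrightarrow> f s \<in> Lq_space 1 \<and> Lq_norm 1 (f s) \<le> A * (1 + s) powr (p * rate p)"
    for A and f :: "real \<Rightarrow> real^'n \<Rightarrow> 'k"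
  proof -
    have est: "duhamel f t \<in> Lq_space q \<and> Lq_norm q (duhamel f t) \<le> K * A * (1 + t) powr rate q"
      if q: "q = 1 \<or> q = p" and t: "t \<ge> 0" and CK: "Lq_norm q h * C \<le> K"
       and C: "set_integrable lborel {0..t} (\<lambda>s. (t - s) powr rate q * (1 + s) powr (p * rate p)) \<and>
     (LBINT s:{0..t}. (t - s) powr rate q * (1 + s) powr (p * rate p)) \<le> C * (1 + t) powr rate q" for q t C
    proof -
      let ?b = "\<lambda>s. A * (1 + s) powr (p * rate p)"
      have e: "(\<lambda>s. (t - s) powr rate q * ?b s) = (\<lambda>s. A * ((t - s) powr rate q * (1 + s) powr (p * rate p)))" by (simp add: fun_eq_iff)
      have bi: "set_integrable lborel {0..t} (\<lambda>s. (t - s) powr rate q * ?b s)"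
        unfolding e using C by (intro set_integrable_mult_right) auto
      note E = duhamel_estimate(2,3)[where b = ?b, OF q jm fb _ bi]
      have "Lq_norm q (duhamel f t) \<le> Lq_norm q h * (LBINT s:{0..t}. (t - s) powr rate q * ?b s)"
        by (rule E(2)) (use A in auto)
      also have "(LBINT s:{0..t}. (t - s) powr rate q * ?b s) = A * (LBINT s:{0..t}. (t - s) powr rate q * (1 + s) powr (p * rate p))"
        unfolding e by (rule set_integral_mult_right)
      also have "Lq_norm q h * \<dots> \<le> Lq_norm q h * (A * (C * (1 + t) powr rate q))"
        using C A by (intro mult_left_mono) auto
      also have "\<dots> = (Lq_norm q h * C) * (A * (1 + t) powr rate q)" by (simp only: mult_ac)
      also have "\<dots> \<le> K * (A * (1 + t) powr rate q)" using A CK by (intro mult_right_mono) auto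
      finally have "Lq_norm q (duhamel f t) \<le> K * A * (1 + t) powr rate q" by (simp only: mult_ac)
      moreover have "duhamel f t \<in> Lq_space q" by (rule E(1)) (use A in auto)
      ultimately show ?thesis by blast
    qed
    have "duhamel f t \<in> Lq_space 1 \<and> Lq_norm 1 (duhamel f t) \<le> K * A * (1 + t) powr rate 1" if "t \<ge> 0" for t
      by (rule est[OF _ that _ C1'[OF that]]) (use n0 in \<open>auto simp: K_def\<close>)
    moreover have "duhamel f t \<in> Lq_space p \<and> Lq_norm p (duhamel f t) \<le> K * A * (1 + t) powr rate p" if "t \<ge> 0" for t
      by (rule est[OF _ that _ Cp'[OF that]]) (use n0 in \<open>auto simp: K_def\<close>)
    ultimately show ?thesis unfolding weighted_def using duhamel_jointly_measurable[OF jm] by auto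
  qed
  show ?thesis
  proof (intro exI[of _ K] conjI allI impI K)
    fix A :: real and f :: "real \<Rightarrow> real^'n \<Rightarrow> 'k"
    assume "0 \<le> A" "jointly_measurable f" "\<forall>s\<ge>0. f s \<in> Lq_space 1 \<and> Lq_norm 1 (f s) \<le> A * (1 + s) powr (p * rate p)"
    then show "weighted (K * A) (duhamel f)" by (intro main) auto
  qed
qed

lemma weighted_source:
  assumes u: "weighted B u" and B: "0 \<le> B" and s: "0 \<le> s"
  shows "nonlinearity p (u s) \<in> Lq_space 1" "Lq_norm 1 (nonlinearity p (u s)) \<le> B powr p * (1 + s) powr (p * rate p)"
proof -
  note L = weightedD(2,3)[OF u disjI2[OF refl] s]
  have p0: "0 < p" using p by simp
  note N = nonlinearity_L1[OF L(1) p0]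
  show "nonlinearity p (u s) \<in> Lq_space 1" by (rule N(1))
  have "Lq_norm p (u s) powr p \<le> (B * (1 + s) powr rate p) powr p" using L(2) p0 by (intro powr_mono2) auto
  also have "\<dots> = B powr p * (1 + s) powr (p * rate p)" using B by (simp add: powr_mult powr_powr mult.commute)
  finally show "Lq_norm 1 (nonlinearity p (u s)) \<le> B powr p * (1 + s) powr (p * rate p)" by (simp add: N(2))
qed

text \<open>The nonlinearity multiplies decay rates by \<open>p\<close>; the factor \<open>B powr (p-1)\<close> is what smallness
  of the data makes small.\<close>

lemma weighted_source_diff:
  assumes u: "weighted B u" and v: "weighted B v" and d: "weighted D (\<lambda>t x. u t x - v t x)" and B: "0 \<le> B" and s: "0 \<le> s"
  shows "Lq_norm 1 (\<lambda>x. nonlinearity p (u s) x - nonlinearity p (v s) x) \<le> 2 * p * B powr (p - 1) * D * (1 + s) powr (p * rate p)"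
proof -
  have q: "p = 1 \<or> p = p" by simp
  have "Lq_norm 1 (\<lambda>x. nonlinearity p (u s) x - nonlinearity p (v s) x)
     \<le> 2 * p * (B * (1 + s) powr rate p) powr (p - 1) * (D * (1 + s) powr rate p)"
    by (rule nonlinearity_diff_L1[OF weightedD(2)[OF u q s] weightedD(2)[OF v q s] p
        weightedD(3)[OF u q s] weightedD(3)[OF v q s] weightedD(3)[OF d q s]])
  also have "(B * (1 + s) powr rate p) powr (p - 1) = B powr (p - 1) * (1 + s) powr (rate p * (p - 1))"
    using B by (simp add: powr_mult powr_powr)
  also have "2 * p * (B powr (p - 1) * (1 + s) powr (rate p * (p - 1))) * (D * (1 + s) powr rate p)
     = 2 * p * B powr (p - 1) * D * ((1 + s) powr (rate p * (p - 1)) * (1 + s) powr rate p)" by (simp only: mult_ac)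
  also have "(1 + s) powr (rate p * (p - 1)) * (1 + s) powr rate p = (1 + s) powr (p * rate p)"
    unfolding powr_add[symmetric] by (simp add: algebra_simps)
  finally show ?thesis .
qed

definition curve_continuous :: "(real \<Rightarrow> real^'n \<Rightarrow> 'k::{real_normed_field,euclidean_space}) \<Rightarrow> bool" where
  "curve_continuous u \<longleftrightarrow>
     (\<forall>q\<in>{1, p}. \<forall>t\<ge>0. Lq_continuous_at q u t)"

text \<open>Continuity in time is inherited by the source from the Lipschitz bound, since a continuous
  curve is bounded near each time.\<close>

lemma nonlinearity_continuous:
  fixes u :: "real \<Rightarrow> real^'n \<Rightarrow> 'k::{real_normed_field,euclidean_space}"
  assumes u: "\<And>t. t \<ge> 0 \<Longrightarrow> u t \<in> Lq_space p"
    and cont: "\<And>t. t \<ge> 0 \<Longrightarrow> Lq_continuous_at p u t" and t: "t \<ge> 0"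
  shows "((\<lambda>s. Lq_norm 1 (\<lambda>x. nonlinearity p (u s) x - nonlinearity p (u t) x)) \<longlongrightarrow> 0) (at t within {0..})"
proof -
  have p1: "1 \<le> p" using p by simp
  obtain M where M: "\<forall>s\<in>{0..t+1}. Lq_norm p (u s) \<le> M" using Lq_curve_bounded[OF p1 u cont] by blast
  have lim: "((\<lambda>s. 2 * p * M powr (p - 1) * Lq_norm p (\<lambda>x. u s x - u t x)) \<longlongrightarrow> 0) (at t within {0..})"
    using tendsto_mult_left[OF cont[OF t], of "2 * p * M powr (p - 1)"] by simp
  have "\<forall>\<^sub>F s in at t within {0..}. s < t + 1" by (intro order_tendstoD(2)[OF tendsto_ident_at]) simp
  moreover have "\<forall>\<^sub>F s in at t within {0..}. 0 \<le> s" by (simp add: eventually_at_filter)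
  ultimately have "\<forall>\<^sub>F s in at t within {0..}. norm (Lq_norm 1 (\<lambda>x. nonlinearity p (u s) x - nonlinearity p (u t) x)) \<le> 2 * p * M powr (p - 1) * Lq_norm p (\<lambda>x. u s x - u t x)"
  proof eventually_elim
    case (elim s)
    show ?case using nonlinearity_diff_L1[OF u[OF elim(2)] u[OF t] p, of M] M elim t by simp
  qed
  from Lim_null_comparison[OF this lim] show ?thesis .
qed

text \<open>The right-hand side of the integral equation.\<close>

definition mild :: "(real^'n \<Rightarrow> 'k::{real_normed_field,euclidean_space}) \<Rightarrow> (real \<Rightarrow> real^'n \<Rightarrow> 'k) \<Rightarrow> real \<Rightarrow> real^'n \<Rightarrow> 'k" where
  "mild u0 u t x = free u0 t x + duhamel (\<lambda>s. nonlinearity p (u s)) t x"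

lemma mild_continuous:
  assumes u0: "u0 \<in> L1_Lp_space p" and jm: "jointly_measurable u" and u: "\<And>t. t \<ge> 0 \<Longrightarrow> u t \<in> Lq_space p"
    and L: "\<And>q t. q = 1 \<or> q = p \<Longrightarrow> t \<ge> 0 \<Longrightarrow> duhamel (\<lambda>s. nonlinearity p (u s)) t \<in> Lq_space q"
    and cont: "curve_continuous u"
  shows "curve_continuous (mild u0 u)"
  unfolding curve_continuous_def
proof (intro ballI allI impI)
  fix q t :: real assume "q \<in> {1, p}" and t: "t \<ge> 0"
  then have q: "q = 1 \<or> q = p" and q1: "1 \<le> q" using p by auto
  have u0q: "u0 \<in> Lq_space q" using u0 q by (auto simp: L1_Lp_space_def)
  let ?f = "\<lambda>s. nonlinearity p (u s)"
  have c: "Lq_continuous_at p u t" if "t \<ge> 0" for t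
    using cont that by (simp add: curve_continuous_def)
  have d: "((\<lambda>s. Lq_norm q (\<lambda>x. duhamel ?f s x - duhamel ?f t x)) \<longlongrightarrow> 0) (at t within {0..})"
    by (rule duhamel_continuous[OF q jointly_measurable_nonlinearity[OF jm] _ _ t])
       (use nonlinearity_L1(1)[OF u] p nonlinearity_continuous[OF u c] in auto)
  have lim: "((\<lambda>s. Lq_norm q (\<lambda>x. free u0 s x - free u0 t x) + Lq_norm q (\<lambda>x. duhamel ?f s x - duhamel ?f t x)) \<longlongrightarrow> 0) (at t within {0..})"
    using tendsto_add[OF free_continuous[OF u0q q1 t] d] by simp
  have le: "norm (Lq_norm q (\<lambda>x. mild u0 u s x - mild u0 u t x)) \<le> Lq_norm q (\<lambda>x. free u0 s x - free u0 t x) + Lq_norm q (\<lambda>x. duhamel ?f s x - duhamel ?f t x)"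
    if s: "s \<ge> 0" for s
  proof -
    have e: "(\<lambda>x. mild u0 u s x - mild u0 u t x) = (\<lambda>x. (free u0 s x - free u0 t x) + (duhamel ?f s x - duhamel ?f t x))"
      by (simp add: mild_def fun_eq_iff)
    show ?thesis unfolding e
      using Lq_add(2)[OF Lq_diff(1)[OF free_Lq(1)[OF u0q q1] free_Lq(1)[OF u0q q1] q1] Lq_diff(1)[OF L[OF q s] L[OF q t] q1] q1] by simp
  qed
  show "((\<lambda>s. Lq_norm q (\<lambda>x. mild u0 u s x - mild u0 u t x)) \<longlongrightarrow> 0) (at t within {0..})"
    by (rule Lim_null_comparison[OF _ lim]) (use le in \<open>auto simp: eventually_at_filter\<close>)
qed

section \<open>The Picard iteration\<close>

lemma source_weight_integrable:
  assumes q: "q = 1 \<or> q = p" and t: "0 \<le> t"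
  shows "set_integrable lborel {0..t} (\<lambda>s. (t - s) powr rate q * (A * (1 + s) powr (p * rate p)))"
proof -
  have b: "1 < - (p * rate p)" using source_rate by simp
  have "set_integrable lborel {0..t} (\<lambda>s. (t - s) powr rate q * (1 + s) powr (p * rate p))"
    using weakly_singular_integral[OF rate_gt[OF q] b] t by auto
  then have "set_integrable lborel {0..t} (\<lambda>s. A * ((t - s) powr rate q * (1 + s) powr (p * rate p)))"
    by (intro set_integrable_mult_right) auto
  then show ?thesis by (simp only: mult.left_commute)
qed

lemma source_L1:
  assumes "weighted B u" "0 \<le> B"
  shows "\<forall>s\<ge>0. nonlinearity p (u s) \<in> Lq_space 1 \<and> Lq_norm 1 (nonlinearity p (u s)) \<le> B powr p * (1 + s) powr (p * rate p)"
  using weighted_source[OF assms] by blast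

lemma source_diff_duhamel:
  assumes u: "weighted B u" and v: "weighted B v" and B: "0 \<le> B" and t: "0 \<le> t"
  shows "AE x in lborel. duhamel (\<lambda>s. nonlinearity p (u s)) t x - duhamel (\<lambda>s. nonlinearity p (v s)) t x =
    duhamel (\<lambda>s y. nonlinearity p (u s) y - nonlinearity p (v s) y) t x"
proof (rule duhamel_diff[where b = "\<lambda>s. B powr p * (1 + s) powr (p * rate p)"])
  show "jointly_measurable (\<lambda>s. nonlinearity p (u s))" "jointly_measurable (\<lambda>s. nonlinearity p (v s))"
    using u v by (auto intro: jointly_measurable_nonlinearity simp: weighted_def)
  show "nonlinearity p (u s) \<in> Lq_space 1 \<and> Lq_norm 1 (nonlinearity p (u s)) \<le> B powr p * (1 + s) powr (p * rate p)" if "0 < s" "s < t" for s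
    using source_L1[OF u B] that by simp
  show "nonlinearity p (v s) \<in> Lq_space 1 \<and> Lq_norm 1 (nonlinearity p (v s)) \<le> B powr p * (1 + s) powr (p * rate p)" if "0 < s" "s < t" for s
    using source_L1[OF v B] that by simp
  show "set_integrable lborel {0..t} (\<lambda>s. (t - s) powr rate 1 * (B powr p * (1 + s) powr (p * rate p)))"
    by (rule source_weight_integrable[OF disjI1[OF refl] t])
qed simp

text \<open>One constant serves for the size of the integral operator and for its Lipschitz constant.\<close>

lemma duhamel_contraction:
  "\<exists>K>0. \<forall>(u :: real \<Rightarrow> real^'n \<Rightarrow> 'k::{real_normed_field,euclidean_space}) v B D. 0 \<le> B \<longrightarrow> 0 \<le> D \<longrightarrow> weighted B u \<longrightarrow>
     weighted (K * B powr p) (duhamel (\<lambda>s. nonlinearity p (u s))) \<and>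
     (weighted B v \<longrightarrow> weighted D (\<lambda>t x. u t x - v t x) \<longrightarrow>
      weighted (2 * p * K * B powr (p - 1) * D) (\<lambda>t x. duhamel (\<lambda>s. nonlinearity p (u s)) t x - duhamel (\<lambda>s. nonlinearity p (v s)) t x))"
proof -
  obtain K where K: "K > 0" and K': "\<And>A f :: real \<Rightarrow> real^'n \<Rightarrow> 'k. A \<ge> 0 \<Longrightarrow> jointly_measurable f \<Longrightarrow>
     (\<forall>s\<ge>0. f s \<in> Lq_space 1 \<and> Lq_norm 1 (f s) \<le> A * (1 + s) powr (p * rate p)) \<Longrightarrow> weighted (K * A) (duhamel f)"
    using duhamel_weighted by metis
  show ?thesis
  proof (intro exI[of _ K] conjI allI impI K)
    fix u v :: "real \<Rightarrow> real^'n \<Rightarrow> 'k" and B D :: real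
    assume B: "0 \<le> B" and D: "0 \<le> D" and u: "weighted B u"
    have jm: "jointly_measurable (\<lambda>s. nonlinearity p (w s))" if "weighted B w" for w :: "real \<Rightarrow> real^'n \<Rightarrow> 'k"
      using that by (auto intro: jointly_measurable_nonlinearity simp: weighted_def)
    have W: "weighted (K * B powr p) (duhamel (\<lambda>s. nonlinearity p (w s)))" if "weighted B w" for w :: "real \<Rightarrow> real^'n \<Rightarrow> 'k"
      by (rule K'[OF _ jm[OF that] source_L1[OF that B]]) simp
    show "weighted (K * B powr p) (duhamel (\<lambda>s. nonlinearity p (u s)))" by (rule W[OF u])
    assume v: "weighted B v" and d: "weighted D (\<lambda>t x. u t x - v t x)"
    let ?N = "\<lambda>s y. nonlinearity p (u s) y - nonlinearity p (v s) y"
    have "weighted (K * (2 * p * B powr (p - 1) * D)) (duhamel ?N)"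
    proof (rule K'[OF _ jointly_measurable_diff[OF jm[OF u] jm[OF v]]])
      show "0 \<le> 2 * p * B powr (p - 1) * D" using p D by simp
      show "\<forall>s\<ge>0. ?N s \<in> Lq_space 1 \<and> Lq_norm 1 (?N s) \<le> 2 * p * B powr (p - 1) * D * (1 + s) powr (p * rate p)"
        using weighted_source_diff[OF u v d B] Lq_diff(1)[OF weighted_source(1)[OF u B] weighted_source(1)[OF v B] order_refl] by blast
    qed
    then have N: "weighted (2 * p * K * B powr (p - 1) * D) (duhamel ?N)" by (simp only: mult_ac)
    show "weighted (2 * p * K * B powr (p - 1) * D) (\<lambda>t x. duhamel (\<lambda>s. nonlinearity p (u s)) t x - duhamel (\<lambda>s. nonlinearity p (v s)) t x)"
      unfolding weighted_def
    proof (intro conjI ballI allI impI)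
      show "jointly_measurable (\<lambda>t x. duhamel (\<lambda>s. nonlinearity p (u s)) t x - duhamel (\<lambda>s. nonlinearity p (v s)) t x)"
        by (intro jointly_measurable_diff duhamel_jointly_measurable jm u v)
      fix q t :: real assume q: "q \<in> {1, p}" and t: "t \<ge> 0"
      then have q': "q = 1 \<or> q = p" and q1: "1 \<le> q" using p by auto
      note Lu = weightedD(2)[OF W[OF u] q' t] and Lv = weightedD(2)[OF W[OF v] q' t]
      note LN = weightedD(2,3)[OF N q' t]
      show L: "(\<lambda>x. duhamel (\<lambda>s. nonlinearity p (u s)) t x - duhamel (\<lambda>s. nonlinearity p (v s)) t x) \<in> Lq_space q"
        by (rule Lq_diff(1)[OF Lu Lv q1])
      have "Lq_norm q (\<lambda>x. duhamel (\<lambda>s. nonlinearity p (u s)) t x - duhamel (\<lambda>s. nonlinearity p (v s)) t x) = Lq_norm q (duhamel ?N t)"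
        using source_diff_duhamel[OF u v B t]
        by (intro Lq_norm_cong_AE[OF Lq_measurable[OF L] Lq_measurable[OF LN(1)]]) (auto elim: eventually_mono)
      then show "Lq_norm q (\<lambda>x. duhamel (\<lambda>s. nonlinearity p (u s)) t x - duhamel (\<lambda>s. nonlinearity p (v s)) t x)
         \<le> 2 * p * K * B powr (p - 1) * D * (1 + t) powr rate q" using LN(2) by simp
    qed
  qed
qed

text \<open>The convergence is locally uniform in time, since the weights are continuous.\<close>

lemma curve_continuous_limit:
  assumes W: "\<And>k. weighted A (W k)" and c: "\<And>k. curve_continuous (W k)"
    and u: "weighted A' u" and d: "\<And>k::nat. weighted (B * (1/2) ^ k) (\<lambda>t x. u t x - W k t x)"
  shows "curve_continuous u"
  unfolding curve_continuous_def
proof (intro ballI allI impI)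
  fix q t :: real assume q0: "q \<in> {1, p}" and t: "t \<ge> 0"
  then have q: "q = 1 \<or> q = p" and q1: "1 \<le> q" using p by auto
  show "Lq_continuous_at q u t"
  proof (rule tendstoI)
    fix e :: real assume e: "e > 0"
    have "(\<lambda>k. B * (1/2) ^ k * (1 + t) powr rate q) \<longlonglongrightarrow> B * 0 * (1 + t) powr rate q"
      by (intro tendsto_intros LIMSEQ_power_zero) auto
    then have "\<forall>\<^sub>F k in sequentially. B * (1/2) ^ k * (1 + t) powr rate q < e / 3"
      using e by (intro order_tendstoD(2)) auto
    then obtain k where k: "B * (1/2) ^ k * (1 + t) powr rate q < e / 3" by (auto simp: eventually_sequentially)
    have "((\<lambda>s. B * (1/2) ^ k * (1 + s) powr rate q) \<longlongrightarrow> B * (1/2) ^ k * (1 + t) powr rate q) (at t within {0..})"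
      using t by (intro tendsto_intros) auto
    then have "\<forall>\<^sub>F s in at t within {0..}. B * (1/2) ^ k * (1 + s) powr rate q < e / 3"
      using k by (rule order_tendstoD(2))
    moreover have "((\<lambda>s. Lq_norm q (\<lambda>x. W k s x - W k t x)) \<longlongrightarrow> 0) (at t within {0..})"
      using c[of k] q0 t by (auto simp: curve_continuous_def)
    then have "\<forall>\<^sub>F s in at t within {0..}. Lq_norm q (\<lambda>x. W k s x - W k t x) < e / 3"
      using e by (intro order_tendstoD(2)) auto
    moreover have "\<forall>\<^sub>F s in at t within {0..}. 0 \<le> s" by (simp add: eventually_at_filter)
    ultimately show "\<forall>\<^sub>F s in at t within {0..}. dist (Lq_norm q (\<lambda>x. u s x - u t x)) 0 < e"
    proof eventually_elim
      case (elim s)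
      note us = weightedD(2)[OF u q elim(3)] and ut = weightedD(2)[OF u q t]
      note Ws = weightedD(2)[OF W[of k] q elim(3)] and Wt = weightedD(2)[OF W[of k] q t]
      have "Lq_norm q (\<lambda>x. u s x - u t x) \<le> Lq_norm q (\<lambda>x. u s x - W k s x) + (Lq_norm q (\<lambda>x. W k s x - W k t x) + Lq_norm q (\<lambda>x. W k t x - u t x))"
        using Lq_norm_triangle[OF us Ws ut q1] Lq_norm_triangle[OF Ws Wt ut q1] by linarith
      also have "\<dots> < e / 3 + (e / 3 + e / 3)"
      proof (intro add_strict_mono)
        show "Lq_norm q (\<lambda>x. u s x - W k s x) < e / 3" using weightedD(3)[OF d q elim(3), of k] elim(1) by simp
        show "Lq_norm q (\<lambda>x. W k t x - u t x) < e / 3" using weightedD(3)[OF d q t, of k] k by (subst Lq_norm_diff_commute) simp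
      qed (rule elim(2))
      finally show ?case by simp
    qed
  qed
qed

text \<open>A limit of curves of functions is constructed pointwise, so that it is again measurable in
  both variables; Fatou's lemma transfers the bounds to it.\<close>

lemma weighted_limit:
  fixes W :: "nat \<Rightarrow> real \<Rightarrow> real^'n \<Rightarrow> 'k::{real_normed_field,euclidean_space}"
  assumes B: "0 \<le> B" and W: "\<And>k. weighted B (W k)" and d: "\<And>k. weighted (B * (1/2) ^ k) (\<lambda>t x. W (Suc k) t x - W k t x)"
  shows "\<exists>u. weighted B u \<and> (\<forall>k. weighted (2 * B * (1/2) ^ k) (\<lambda>t x. u t x - W k t x))"
proof -
  define u where "u t x = lim (\<lambda>k. W k t x)" for t x
  have ujm: "jointly_measurable u"
  proof (rule jointly_measurableI)
    have m: "jointly_measurable (W k)" for k using W by (simp add: weighted_def)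
    show "(\<lambda>z. u (fst z) (snd z)) \<in> borel_measurable (lborel \<Otimes>\<^sub>M lborel)"
      unfolding u_def by (intro borel_measurable_lim_metric jointly_measurable_compose[OF m]) measurable
  qed
  have lim: "AE x in lborel. (\<lambda>k. W k t x) \<longlonglongrightarrow> u t x" if t: "t \<ge> 0" for t
  proof -
    let ?g = "\<lambda>k x. W (Suc k) t x - W k t x"
    have gL: "?g k \<in> Lq_space 1" "Lq_norm 1 (?g k) \<le> B * (1/2) ^ k * (1 + t) powr rate 1" for k
      using weightedD(2,3)[OF d[of k] disjI1[OF refl] t] by auto
    have "summable (\<lambda>k. B * (1/2) ^ k * (1 + t) powr rate 1)"
      by (intro summable_mult summable_mult2 summable_geometric) simp
    then have "summable (\<lambda>k. Lq_norm 1 (?g k))"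
      by (rule summable_comparison_test'[where N = 0]) (use gL in auto)
    from AE_summable_of_L1_summable[OF gL(1) this] show ?thesis
    proof eventually_elim
      case (elim x)
      then have "summable (\<lambda>k. ?g k x)" by (rule summable_norm_cancel)
      then have "convergent (\<lambda>k. \<Sum>i<k. ?g i x)" by (simp add: summable_iff_convergent)
      then have "convergent (\<lambda>k. W k t x - W 0 t x)" by (simp only: sum_lessThan_telescope[of "\<lambda>k. W k t x"])
      then have "convergent (\<lambda>k. W k t x)" using convergent_diff_const_right_iff by blast
      then show ?case by (simp add: u_def convergent_LIMSEQ_iff)
    qed
  qed
  have um: "u t \<in> borel_measurable borel" for t by (rule jointly_measurable_fst[OF ujm])
  have tele: "Lq_norm q (\<lambda>x. W (m + k) t x - W k t x) \<le> 2 * B * (1/2) ^ k * (1 - (1/2) ^ m) * (1 + t) powr rate q"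
    if q: "q = 1 \<or> q = p" and t: "t \<ge> 0" for q t m k
  proof (induction m)
    case 0
    then show ?case by simp
  next
    case (Suc m)
    have q1: "1 \<le> q" using q p by auto
    note L = weightedD(2)[OF W q t]
    have "Lq_norm q (\<lambda>x. W (Suc m + k) t x - W k t x) \<le> Lq_norm q (\<lambda>x. W (Suc (m + k)) t x - W (m + k) t x) + Lq_norm q (\<lambda>x. W (m + k) t x - W k t x)"
      using Lq_norm_triangle[OF L[of "Suc (m + k)"] L[of "m + k"] L[of k] q1] by simp
    also have "\<dots> \<le> B * (1/2) ^ (m + k) * (1 + t) powr rate q + 2 * B * (1/2) ^ k * (1 - (1/2) ^ m) * (1 + t) powr rate q"
      by (intro add_mono Suc weightedD(3)[OF d q t])
    also have "\<dots> = 2 * B * (1/2) ^ k * (1 - (1/2) ^ Suc m) * (1 + t) powr rate q"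
      by (simp add: power_add algebra_simps)
    finally show ?case .
  qed
  have ub: "u t \<in> Lq_space q \<and> Lq_norm q (u t) \<le> B * (1 + t) powr rate q" if q: "q = 1 \<or> q = p" and t: "t \<ge> 0" for q t
  proof -
    have q1: "1 \<le> q" using q p by auto
    show ?thesis using Lq_fatou[OF weightedD(2)[OF W q t] weightedD(3)[OF W q t] q1 um lim[OF t]] by blast
  qed
  have db: "(\<lambda>x. u t x - W k t x) \<in> Lq_space q \<and> Lq_norm q (\<lambda>x. u t x - W k t x) \<le> 2 * B * (1/2) ^ k * (1 + t) powr rate q"
    if q: "q = 1 \<or> q = p" and t: "t \<ge> 0" for q t k
  proof -
    have q1: "1 \<le> q" using q p by auto
    note L = weightedD(2)[OF W q t]
    have l: "AE x in lborel. (\<lambda>m. W (m + k) t x - W k t x) \<longlonglongrightarrow> u t x - W k t x"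
      using lim[OF t] by eventually_elim (intro tendsto_diff tendsto_const LIMSEQ_ignore_initial_segment)
    have b: "Lq_norm q (\<lambda>x. W (m + k) t x - W k t x) \<le> 2 * B * (1/2) ^ k * (1 + t) powr rate q" for m
    proof -
      have "2 * B * (1/2) ^ k * (1 - (1/2) ^ m) * (1 + t) powr rate q \<le> 2 * B * (1/2) ^ k * 1 * (1 + t) powr rate q"
        using B by (intro mult_right_mono mult_left_mono) auto
      then show ?thesis using tele[OF q t, of m k] by simp
    qed
    have m: "(\<lambda>x. u t x - W k t x) \<in> borel_measurable borel" using um Lq_measurable[OF L] by measurable
    show ?thesis using Lq_fatou[OF Lq_diff(1)[OF L L q1] b q1 m l] by blast
  qed
  have "weighted B u" unfolding weighted_def using ujm ub by auto
  moreover have "weighted (2 * B * (1/2) ^ k) (\<lambda>t x. u t x - W k t x)" for k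
    unfolding weighted_def using jointly_measurable_diff[OF ujm] W[of k] db by (auto simp: weighted_def)
  ultimately show ?thesis by blast
qed

lemma mild_diff: "mild u0 u t x - mild u0 v t x = duhamel (\<lambda>s. nonlinearity p (u s)) t x - duhamel (\<lambda>s. nonlinearity p (v s)) t x"
  by (simp add: mild_def)

text \<open>The ball has twice the radius of the free evolution. For small data the Lipschitz constant of
  the integral operator on it is at most one half, which makes the ball invariant and the iteration,
  started at \<open>0\<close>, geometrically convergent.\<close>

lemma small_data_fixed_point:
  "\<exists>\<epsilon>>0. \<forall>u0 :: real^'n \<Rightarrow> 'k::{real_normed_field,euclidean_space}. u0 \<in> L1_Lp_space p \<longrightarrow> L1_Lp_norm p u0 \<le> \<epsilon> \<longrightarrow>
     (\<exists>u. weighted (2 * free_const * L1_Lp_norm p u0) u \<and> curve_continuous u \<and> (\<forall>t\<ge>0. AE x in lborel. u t x = mild u0 u t x))"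
proof -
  obtain K where K: "K > 0" and K': "\<forall>(u :: real \<Rightarrow> real^'n \<Rightarrow> 'k) v B D. 0 \<le> B \<longrightarrow> 0 \<le> D \<longrightarrow> weighted B u \<longrightarrow>
     weighted (K * B powr p) (duhamel (\<lambda>s. nonlinearity p (u s))) \<and>
     (weighted B v \<longrightarrow> weighted D (\<lambda>t x. u t x - v t x) \<longrightarrow>
      weighted (2 * p * K * B powr (p - 1) * D) (\<lambda>t x. duhamel (\<lambda>s. nonlinearity p (u s)) t x - duhamel (\<lambda>s. nonlinearity p (v s)) t x))"
    using duhamel_contraction[where 'k = 'k] by (elim exE conjE) (rule that)
  have K1: "weighted (K * B powr p) (duhamel (\<lambda>s. nonlinearity p (u s)))"
    if "0 \<le> B" "weighted B u" for u :: "real \<Rightarrow> real^'n \<Rightarrow> 'k" and B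
    by (rule K'[rule_format, THEN conjunct1, OF that(1) order_refl that(2)])
  have K2: "weighted (2 * p * K * B powr (p - 1) * D) (\<lambda>t x. duhamel (\<lambda>s. nonlinearity p (u s)) t x - duhamel (\<lambda>s. nonlinearity p (v s)) t x)"
    if "0 \<le> B" "0 \<le> D" "weighted B u" "weighted B v" "weighted D (\<lambda>t x. u t x - v t x)" for u v :: "real \<Rightarrow> real^'n \<Rightarrow> 'k" and B D
    by (rule K'[rule_format, THEN conjunct2, rule_format, OF that])
  \<comment> \<open>chosen so that \<open>2 * p * K * B powr (p - 1) \<le> 1 / 2\<close> for the radius \<open>B = 2 * free_const * \<epsilon>\<close>\<close>
  define \<epsilon> where "\<epsilon> = (1 / (4 * p * K)) powr (1 / (p - 1)) / (2 * free_const)"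
  have \<epsilon>: "\<epsilon> > 0" using K p free_const_pos by (simp add: \<epsilon>_def)
  show ?thesis
  proof (intro exI[of _ \<epsilon>] conjI allI impI \<epsilon>)
    fix u0 :: "real^'n \<Rightarrow> 'k" assume u0: "u0 \<in> L1_Lp_space p" and small: "L1_Lp_norm p u0 \<le> \<epsilon>"
    define B where "B = 2 * free_const * L1_Lp_norm p u0"
    have B: "0 \<le> B" using free_const_pos L1_Lp_norm_ge(3)[of u0] by (simp add: B_def)
    have "B \<le> (1 / (4 * p * K)) powr (1 / (p - 1))"
      using mult_left_mono[OF small, of "2 * free_const"] free_const_pos by (simp add: B_def \<epsilon>_def)
    then have "B powr (p - 1) \<le> ((1 / (4 * p * K)) powr (1 / (p - 1))) powr (p - 1)" using B p by (intro powr_mono2) auto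
    also have "\<dots> = 1 / (4 * p * K)" using p K by (simp add: powr_powr)
    finally have Bp: "B powr (p - 1) * (4 * p * K) \<le> 1" using p K by (simp add: le_divide_eq)
    have half: "2 * p * K * B powr (p - 1) * D \<le> D / 2" if "0 \<le> D" for D
      using mult_right_mono[OF Bp that] by (simp add: algebra_simps)
    have self: "K * B powr p \<le> B / 2"
    proof -
      have "K * B powr p = K * B powr (p - 1) * B" using B by (simp add: powr_diff)
      also have "\<dots> \<le> 2 * p * K * B powr (p - 1) * B" using p K B by (intro mult_right_mono) auto
      also have "\<dots> \<le> B / 2" by (rule half[OF B])
      finally show ?thesis .
    qed
    define W where "W k = (mild u0 ^^ k) (\<lambda>t x. 0)" for k
    have W0: "W 0 = (\<lambda>t x. 0)" and WS: "W (Suc k) = mild u0 (W k)" for k by (simp_all add: W_def)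
    have zw: "weighted D (\<lambda>t x. 0 :: 'k)" if "0 \<le> D" for D
      using that by (simp add: weighted_def jointly_measurable_def)
    have mw: "weighted B (mild u0 u)" if "weighted B u" for u
    proof -
      have "weighted (free_const * L1_Lp_norm p u0 + K * B powr p) (mild u0 u)"
        using weighted_add[OF free_weighted[OF u0] K1[OF B that]] by (simp add: mild_def[abs_def])
      then show ?thesis by (rule weighted_mono) (use self in \<open>simp add: B_def mult.commute\<close>)
    qed
    have W: "weighted B (W k)" for k
    proof (induction k)
      case 0
      then show ?case using zw[OF B] by (simp only: W0)
    next
      case (Suc k)
      then show ?case unfolding WS by (rule mw)
    qed
    have md: "weighted (D / 2) (\<lambda>t x. mild u0 u t x - mild u0 v t x)"
      if "0 \<le> D" "weighted B u" "weighted B v" "weighted D (\<lambda>t x. u t x - v t x)" for D u v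
      unfolding mild_diff by (rule weighted_mono[OF K2[OF B that] half[OF that(1)]])
    have d: "weighted (B * (1/2) ^ k) (\<lambda>t x. W (Suc k) t x - W k t x)" for k
    proof (induction k)
      case 0
      then show ?case using W[of "Suc 0"] by (simp add: W0)
    next
      case (Suc k)
      have "weighted (B * (1/2) ^ k / 2) (\<lambda>t x. W (Suc (Suc k)) t x - W (Suc k) t x)"
        unfolding WS[of "Suc k"] by (subst (2) WS) (rule md[OF _ W W Suc], use B in simp)
      then show ?case by simp
    qed
    obtain u where u: "weighted B u" and ud: "\<And>k. weighted (2 * B * (1/2) ^ k) (\<lambda>t x. u t x - W k t x)"
      using weighted_limit[OF B W d] by blast
    have Wc: "curve_continuous (W k)" for k
    proof (induction k)
      case 0
      then show ?case by (simp add: W0 curve_continuous_def)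
    next
      case (Suc k)
      show ?case unfolding WS
        by (rule mild_continuous[OF u0 _ _ _ Suc])
           (use W[of k] K1[OF B W[of k]] in \<open>auto simp: weighted_def\<close>)
    qed
    have uc: "curve_continuous u" by (rule curve_continuous_limit[OF W Wc u ud])
    have "AE x in lborel. u t x = mild u0 u t x" if t: "t \<ge> 0" for t
    proof -
      have q: "(1::real) = 1 \<or> 1 = p" by simp
      note uL = weightedD(2)[OF u q t] and mL = weightedD(2)[OF mw[OF u] q t] and WL = weightedD(2)[OF W q t]
      have le: "Lq_norm 1 (\<lambda>x. u t x - mild u0 u t x) \<le> 2 * B * (1/2) ^ k * (1 + t) powr rate 1" for k
      proof -
        have a: "Lq_norm 1 (\<lambda>x. u t x - W (Suc k) t x) \<le> 2 * B * (1/2) ^ Suc k * (1 + t) powr rate 1"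
          by (rule weightedD(3)[OF ud q t])
        have "0 \<le> 2 * B * (1/2) ^ k" using B by simp
        from weightedD(3)[OF md[OF this u W ud] q t]
        have b: "Lq_norm 1 (\<lambda>x. W (Suc k) t x - mild u0 u t x) \<le> 2 * B * (1/2) ^ k / 2 * (1 + t) powr rate 1"
          unfolding WS by (subst Lq_norm_diff_commute)
        show ?thesis using Lq_norm_triangle[OF uL WL mL order_refl, of "Suc k"] a b by simp
      qed
      have "(\<lambda>k. 2 * B * (1/2) ^ k * (1 + t) powr rate 1) \<longlonglongrightarrow> 2 * B * 0 * (1 + t) powr rate 1"
        by (intro tendsto_intros LIMSEQ_power_zero) auto
      then have "Lq_norm 1 (\<lambda>x. u t x - mild u0 u t x) \<le> 2 * B * 0 * (1 + t) powr rate 1"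
        by (rule LIMSEQ_le_const) (use le in blast)
      then have "Lq_norm 1 (\<lambda>x. u t x - mild u0 u t x) = 0" using Lq_norm_nonneg[of 1 "\<lambda>x. u t x - mild u0 u t x"] by simp
      from Lq_norm_zero_imp[OF Lq_diff(1)[OF uL mL order_refl] _ this] show ?thesis by (auto elim: eventually_mono)
    qed
    with u uc show "\<exists>u. weighted (2 * free_const * L1_Lp_norm p u0) u \<and> curve_continuous u \<and> (\<forall>t\<ge>0. AE x in lborel. u t x = mild u0 u t x)"
      unfolding B_def by blast
  qed
qed

text \<open>Only \<open>L\<^sup>1\<close> and \<open>L\<^sup>p\<close> are controlled by the iteration; the exponents between them follow by
  interpolation.\<close>

lemma weighted_bound:
  fixes u :: "real \<Rightarrow> real^'n \<Rightarrow> 'k::{real_normed_field,euclidean_space}"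
  assumes u: "weighted B u" and B: "0 \<le> B" and q: "1 \<le> q" "q \<le> p" and t: "t \<ge> 0"
  shows "Lq_norm q (u t) \<le> B * (1 + t) powr rate q"
proof -
  have T: "0 < 1 + t" using t by simp
  note L1 = weightedD(2,3)[OF u disjI1[OF refl] t] and Lp = weightedD(2,3)[OF u disjI2[OF refl] t]
  show ?thesis
    using Lq_interpolation_decay[OF L1(1) Lp(1) p q T B, of \<alpha> "real CARD('n) / 2 * (1 + \<alpha>)"] L1(2) Lp(2)
    by (simp add: rate_def decay_def)
qed

end

section \<open>Uniqueness\<close>

text \<open>After reflection this is a part of a Gamma integral. Its value tends to \<open>0\<close> as \<open>\<Lambda>\<close> grows,
  relative to the weight \<open>exp (\<Lambda> t)\<close>.\<close>

lemma exp_weighted_singular_integral: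
  fixes a \<Lambda> t :: real
  assumes a: "- 1 < a" and L: "0 < \<Lambda>" and t: "0 \<le> t"
  shows "set_integrable lborel {0..t} (\<lambda>s. (t - s) powr a * exp (\<Lambda> * s))"
    and "(LBINT s:{0..t}. (t - s) powr a * exp (\<Lambda> * s)) \<le> Gamma (a + 1) * \<Lambda> powr (- (a + 1)) * exp (\<Lambda> * t)"
proof -
  have a1: "0 < a + 1" using a by simp
  note G = Gamma_integral_scaled[OF a1 L, simplified]
  have G1: "set_integrable lborel {0..t} (\<lambda>r. r powr a * exp (- (\<Lambda> * r)))"
    by (rule set_integrable_subset[OF G(1)]) auto
  have e: "(\<lambda>r. exp (\<Lambda> * t) * (r powr a * exp (- (\<Lambda> * r)))) = (\<lambda>r. r powr a * exp (\<Lambda> * (t - r)))"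
    by (simp add: fun_eq_iff exp_add[symmetric] right_diff_distrib exp_diff exp_minus field_simps)
  have i: "set_integrable lborel {0..t} (\<lambda>r. r powr a * exp (\<Lambda> * (t - r)))"
    unfolding e[symmetric] by (intro set_integrable_mult_right G1)
  note R = reflect_set_integral[of t a "\<lambda>s. exp (\<Lambda> * s)"]
  show "set_integrable lborel {0..t} (\<lambda>s. (t - s) powr a * exp (\<Lambda> * s))" using i R(1) by simp
  have "(LBINT s:{0..t}. (t - s) powr a * exp (\<Lambda> * s)) = (LBINT r:{0..t}. r powr a * exp (\<Lambda> * (t - r)))"
    by (rule R(2)[symmetric])
  also have "\<dots> = exp (\<Lambda> * t) * (LBINT r:{0..t}. r powr a * exp (- (\<Lambda> * r)))"
    unfolding e[symmetric] by (rule set_integral_mult_right)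
  also have "\<dots> \<le> exp (\<Lambda> * t) * (LBINT r:{0..}. r powr a * exp (- (\<Lambda> * r)))"
  proof (rule mult_left_mono)
    show "(LBINT r:{0..t}. r powr a * exp (- (\<Lambda> * r))) \<le> (LBINT r:{0..}. r powr a * exp (- (\<Lambda> * r)))"
      unfolding set_lebesgue_integral_def
      by (rule integral_mono) (use G1 G(1) in \<open>auto simp: set_integrable_def indicator_def\<close>)
  qed simp
  also have "\<dots> = Gamma (a + 1) * \<Lambda> powr (- (a + 1)) * exp (\<Lambda> * t)" using G(2) by simp
  finally show "(LBINT s:{0..t}. (t - s) powr a * exp (\<Lambda> * s)) \<le> Gamma (a + 1) * \<Lambda> powr (- (a + 1)) * exp (\<Lambda> * t)" .
qed

context evolution_kernels
begin

text \<open>With the weight \<open>exp (- \<Lambda> t)\<close> and \<open>\<Lambda>\<close> large the integral operator is a contraction on a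
  bounded interval, so repeated use of the equation improves the trivial bound for the difference by
  a factor one half each time. The induction carries an explicit bound for the difference as a
  function of time, which is then the bound for the source.\<close>

lemma mild_unique:
  assumes jm: "jointly_measurable u" "jointly_measurable v"
    and L: "\<And>t. t \<ge> 0 \<Longrightarrow> u t \<in> Lq_space p" "\<And>t. t \<ge> 0 \<Longrightarrow> v t \<in> Lq_space p"
    and c: "\<And>t. t \<ge> 0 \<Longrightarrow> Lq_continuous_at p u t"
      "\<And>t. t \<ge> 0 \<Longrightarrow> Lq_continuous_at p v t"
    and mild: "\<And>t. t > 0 \<Longrightarrow> AE x in lborel. u t x = mild u0 u t x" "\<And>t. t > 0 \<Longrightarrow> AE x in lborel. v t x = mild u0 v t x"
    and t: "t > 0"
  shows "AE x in lborel. u t x = v t x"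
proof -
  have p1: "1 \<le> p" and p0: "0 < p" using p by auto
  obtain Mu where Mu: "\<forall>s\<in>{0..t}. Lq_norm p (u s) \<le> Mu" using Lq_curve_bounded[OF p1 L(1) c(1)] by blast
  obtain Mv where Mv: "\<forall>s\<in>{0..t}. Lq_norm p (v s) \<le> Mv" using Lq_curve_bounded[OF p1 L(2) c(2)] by blast
  define M where "M = \<bar>Mu\<bar> + \<bar>Mv\<bar>"
  have M0: "0 \<le> M" by (simp add: M_def)
  have M: "Lq_norm p (u s) \<le> M" "Lq_norm p (v s) \<le> M" if "0 \<le> s" "s \<le> t" for s
    using bspec[OF Mu, of s] bspec[OF Mv, of s] that unfolding M_def by auto
  define a where "a = rate p"
  have a: "- 1 < a" using rate_p by (simp add: a_def)
  define H where "H = Lq_norm p h * (2 * p * M powr (p - 1)) * Gamma (a + 1)"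
  have H: "0 \<le> H" using p0 a unfolding H_def by (intro mult_nonneg_nonneg) (auto intro: less_imp_le Gamma_real_pos)
  obtain \<Lambda> where Lm: "\<Lambda> > 0" and half: "H * \<Lambda> powr (- (a + 1)) \<le> 1 / 2"
  proof
    \<comment> \<open>solves \<open>\<Lambda> powr (- (a + 1)) = 1 / (2 * H + 1)\<close>\<close>
    let ?L = "(2 * H + 1) powr (1 / (a + 1))"
    show "0 < ?L" using H by simp
    have "?L powr (- (a + 1)) = (2 * H + 1) powr (-1)" unfolding powr_powr using a by (intro arg_cong[where f = "\<lambda>z. (2 * H + 1) powr z"]) (simp add: field_simps)
    also have "\<dots> = 1 / (2 * H + 1)" using H by (simp add: powr_minus divide_inverse)
    finally have X: "?L powr (- (a + 1)) = 1 / (2 * H + 1)" .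
    show "H * ?L powr (- (a + 1)) \<le> 1 / 2" unfolding X using H by (simp add: divide_simps)
  qed
  note Nm = jointly_measurable_nonlinearity[OF jm(1), of p] jointly_measurable_nonlinearity[OF jm(2), of p]
  have N1: "nonlinearity p (u s) \<in> Lq_space 1" "nonlinearity p (v s) \<in> Lq_space 1" if "0 \<le> s" for s
    using nonlinearity_L1(1)[OF L(1)[OF that] p0] nonlinearity_L1(1)[OF L(2)[OF that] p0] by auto
  let ?N = "\<lambda>s y. nonlinearity p (u s) y - nonlinearity p (v s) y"
  (* one pass through the integral equation halves the bound in the exponentially weighted norm *)
  have bound: "Lq_norm p (\<lambda>x. u \<tau> x - v \<tau> x) \<le> 2 * M * exp (\<Lambda> * \<tau>) * (1/2) ^ k" if "0 < \<tau>" "\<tau> \<le> t" for \<tau> k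
    using that
  proof (induction k arbitrary: \<tau>)
    case 0
    have "Lq_norm p (\<lambda>x. u \<tau> x - v \<tau> x) \<le> 2 * M"
      using Lq_diff(2)[OF L(1) L(2) p1, of \<tau> \<tau>] M[of \<tau>] 0 by simp
    also have "\<dots> \<le> 2 * M * exp (\<Lambda> * \<tau>)" using M0 Lm 0 mult_left_mono[of 1 "exp (\<Lambda> * \<tau>)" "2 * M"] by simp
    finally show ?case by simp
  next
    case (Suc k)
    have \<tau>: "0 \<le> \<tau>" using Suc.prems by simp
    have u\<tau>: "u \<tau> \<in> Lq_space p" "v \<tau> \<in> Lq_space p" using L \<tau> by auto
    let ?A = "2 * p * M powr (p - 1) * (2 * M * (1/2) ^ k)"
    let ?b = "\<lambda>s. ?A * exp (\<Lambda> * s)"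
    have A: "0 \<le> ?A" using p0 M0 by simp
    have e: "(\<lambda>s. (\<tau> - s) powr c * (C * f s)) = (\<lambda>s. C * ((\<tau> - s) powr c * f s))" for c C :: real and f :: "real \<Rightarrow> real"
      by (simp add: fun_eq_iff)
    have bi: "set_integrable lborel {0..\<tau>} (\<lambda>s. (\<tau> - s) powr rate p * ?b s)"
      unfolding e by (intro set_integrable_mult_right exp_weighted_singular_integral(1) rate_p Lm \<tau>)
    have fb: "?N s \<in> Lq_space 1 \<and> Lq_norm 1 (?N s) \<le> ?b s" if s: "0 < s" "s < \<tau>" for s
    proof
      have s': "0 \<le> s" "s \<le> t" using s Suc.prems by auto
      show "?N s \<in> Lq_space 1" by (rule Lq_diff(1)[OF N1[OF s'(1)] order_refl])
      have "Lq_norm 1 (?N s) \<le> 2 * p * M powr (p - 1) * (2 * M * exp (\<Lambda> * s) * (1/2) ^ k)"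
        by (rule nonlinearity_diff_L1[OF L(1)[OF s'(1)] L(2)[OF s'(1)] p M(1)[OF s'] M(2)[OF s'] Suc.IH[OF s(1) s'(2)]])
      then show "Lq_norm 1 (?N s) \<le> ?b s" by (simp only: mult_ac)
    qed
    note E = duhamel_estimate(2,3)[where b = ?b, OF disjI2[OF refl] jointly_measurable_diff[OF Nm] fb _ bi]
    have EL: "duhamel ?N \<tau> \<in> Lq_space p" by (rule E(1)) (use A in auto)
    have d: "AE x in lborel. duhamel (\<lambda>s. nonlinearity p (u s)) \<tau> x - duhamel (\<lambda>s. nonlinearity p (v s)) \<tau> x = duhamel ?N \<tau> x"
    proof (rule duhamel_diff[OF Nm, where b = "\<lambda>s. M powr p"])
      show "nonlinearity p (u s) \<in> Lq_space 1 \<and> Lq_norm 1 (nonlinearity p (u s)) \<le> M powr p" if "0 < s" "s < \<tau>" for s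
        using N1[of s] nonlinearity_L1(2)[OF L(1) p0, of s] M(1)[of s] that Suc.prems p0 by (auto intro!: powr_mono2)
      show "nonlinearity p (v s) \<in> Lq_space 1 \<and> Lq_norm 1 (nonlinearity p (v s)) \<le> M powr p" if "0 < s" "s < \<tau>" for s
        using N1[of s] nonlinearity_L1(2)[OF L(2) p0, of s] M(2)[of s] that Suc.prems p0 by (auto intro!: powr_mono2)
      have "set_integrable lborel {0..\<tau>} (\<lambda>r. r powr rate 1 * M powr p)"
        using set_integrable_powr_near_0[OF rate_gt[of 1] \<tau>] by (intro set_integrable_mult_left) auto
      then show "set_integrable lborel {0..\<tau>} (\<lambda>s. (\<tau> - s) powr rate 1 * M powr p)"
        using reflect_set_integral(1)[of \<tau> "rate 1" "\<lambda>_. M powr p"] by simp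
    qed simp
    have "AE x in lborel. u \<tau> x - v \<tau> x = duhamel ?N \<tau> x"
      using d mild(1)[OF Suc.prems(1)] mild(2)[OF Suc.prems(1)] by eventually_elim (simp add: mild_def)
    then have "Lq_norm p (\<lambda>x. u \<tau> x - v \<tau> x) = Lq_norm p (duhamel ?N \<tau>)"
      by (intro Lq_norm_cong_AE[OF Lq_measurable[OF Lq_diff(1)[OF u\<tau> p1]] Lq_measurable[OF EL]]) (auto elim: eventually_mono)
    also have "\<dots> \<le> Lq_norm p h * (LBINT s:{0..\<tau>}. (\<tau> - s) powr rate p * ?b s)" by (rule E(2)) (use A in auto)
    also have "(LBINT s:{0..\<tau>}. (\<tau> - s) powr rate p * ?b s) = ?A * (LBINT s:{0..\<tau>}. (\<tau> - s) powr a * exp (\<Lambda> * s))"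
      unfolding e a_def by (rule set_integral_mult_right)
    also have "Lq_norm p h * \<dots> \<le> Lq_norm p h * (?A * (Gamma (a + 1) * \<Lambda> powr (- (a + 1)) * exp (\<Lambda> * \<tau>)))"
      using A by (intro mult_left_mono exp_weighted_singular_integral(2) a Lm \<tau>) auto
    also have "\<dots> = H * \<Lambda> powr (- (a + 1)) * (2 * M * exp (\<Lambda> * \<tau>) * (1/2) ^ k)" unfolding H_def by (simp only: mult_ac)
    also have "\<dots> \<le> 1 / 2 * (2 * M * exp (\<Lambda> * \<tau>) * (1/2) ^ k)" using half M0 by (intro mult_right_mono) auto
    finally show ?case by simp
  qed
  have "(\<lambda>k. 2 * M * exp (\<Lambda> * t) * (1/2) ^ k) \<longlonglongrightarrow> 2 * M * exp (\<Lambda> * t) * 0"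
    by (intro tendsto_intros LIMSEQ_power_zero) auto
  then have "Lq_norm p (\<lambda>x. u t x - v t x) \<le> 2 * M * exp (\<Lambda> * t) * 0"
    by (rule LIMSEQ_le_const) (use bound t in auto)
  then have "Lq_norm p (\<lambda>x. u t x - v t x) = 0" using Lq_norm_nonneg[of p "\<lambda>x. u t x - v t x"] by simp
  from Lq_norm_zero_imp[OF Lq_diff(1)[OF L p1] p0 this] show ?thesis using t by (auto elim: eventually_mono)
qed

end

section \<open>From profiles to the kernels of the equation\<close>

text \<open>Reflection and translation preserve null sets, so the convolution has the same value at every
  point, not only at almost every point.\<close>

lemma convolution_cong:
  assumes [measurable]: "k \<in> borel_measurable borel" "k' \<in> borel_measurable borel" "f \<in> borel_measurable borel" "f' \<in> borel_measurable borel"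
    and k: "AE z in lborel. k z = k' z" and f: "AE y in lborel. f y = f' y"
  shows "convolves_at k f x \<longleftrightarrow> convolves_at k' f' x" "conv k f x = conv k' f' x"
proof -
  have "(\<integral>\<^sup>+z. indicator {z. k z \<noteq> k' z} z \<partial>lborel) = 0"
    using k by (subst nn_integral_0_iff_AE) (auto elim: eventually_mono)
  then have "(\<integral>\<^sup>+y. indicator {z. k z \<noteq> k' z} (x + (-1) *\<^sub>R y) \<partial>lborel) = (0::ennreal)"
    using nn_integral_affine[of "indicator {z. k z \<noteq> k' z}" "-1" x] by simp
  then have "AE y in lborel. k (x - y) = k' (x - y)"
    by (subst (asm) nn_integral_0_iff_AE) (auto elim!: eventually_mono simp: indicator_def split: if_splits)
  then have ae: "AE y in lborel. k (x - y) *\<^sub>R f y = k' (x - y) *\<^sub>R f' y" using f by eventually_elim simp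
  show "convolves_at k f x \<longleftrightarrow> convolves_at k' f' x"
    unfolding convolves_at_def by (rule integrable_cong_AE[OF _ _ ae]) measurable
  show "conv k f x = conv k' f' x"
    unfolding conv_def by (rule integral_cong_AE[OF _ _ ae]) measurable
qed

text \<open>The representative chosen in \<open>G_kernel\<close> agrees with every known one almost everywhere.\<close>

lemma G_kernel_AE:
  fixes k :: "real^'n \<Rightarrow> real"
  assumes "has_tempered_inverse_fourier
    (\<lambda>\<xi>. complex_of_real (mittag_leffler (1 + \<alpha>) \<beta> (- (t powr (1 + \<alpha>)) * (norm \<xi>)\<^sup>2))) (\<lambda>x. complex_of_real (k x))"
  shows "(G_kernel \<alpha> \<beta> t :: real^'n \<Rightarrow> real) \<in> borel_measurable borel" "AE x in lborel. G_kernel \<alpha> \<beta> t x = k x"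
proof -
  have G: "has_tempered_inverse_fourier
    (\<lambda>\<xi>. complex_of_real (mittag_leffler (1 + \<alpha>) \<beta> (- (t powr (1 + \<alpha>)) * (norm \<xi>)\<^sup>2))) (\<lambda>x::real^'n. complex_of_real (G_kernel \<alpha> \<beta> t x))"
    unfolding G_kernel_def
    by (rule someI[where P = "\<lambda>g. has_tempered_inverse_fourier
      (\<lambda>\<xi>. complex_of_real (mittag_leffler (1 + \<alpha>) \<beta> (- (t powr (1 + \<alpha>)) * (norm \<xi>)\<^sup>2))) (\<lambda>x. complex_of_real (g x))"])
      (rule assms)
  then show "(G_kernel \<alpha> \<beta> t :: real^'n \<Rightarrow> real) \<in> borel_measurable borel"
    by (auto simp: has_tempered_inverse_fourier_def borel_measurable_complex_iff)
  show "AE x in lborel. G_kernel \<alpha> \<beta> t x = k x" by (rule has_tempered_inverse_fourier_unique[OF G assms])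
qed

locale mittag_leffler_evolution = evolution_kernels \<alpha> p g h
  for \<alpha> p :: real and g h :: "real^'n \<Rightarrow> real" +
  assumes g_kernel: "\<And>t. t > 0 \<Longrightarrow> has_tempered_inverse_fourier
     (\<lambda>\<xi>. complex_of_real (mittag_leffler (1 + \<alpha>) 1 (- (t powr (1 + \<alpha>)) * (norm \<xi>)\<^sup>2))) (\<lambda>x. complex_of_real (dil g t x))"
    and h_kernel: "\<And>t. t > 0 \<Longrightarrow> has_tempered_inverse_fourier
     (\<lambda>\<xi>. complex_of_real (mittag_leffler (1 + \<alpha>) (1 + \<alpha>) (- (t powr (1 + \<alpha>)) * (norm \<xi>)\<^sup>2))) (\<lambda>x. complex_of_real (dil h t x))"
begin

lemma dil_borel: "dil g t \<in> borel_measurable borel" "dil h t \<in> borel_measurable borel"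
  using dil_measurable[OF g1, of "\<lambda>z. t" borel "\<lambda>z. z"] dil_measurable[OF h1, of "\<lambda>z. t" borel "\<lambda>z. z"] by simp_all

lemma free_G_kernel:
  assumes u0: "u0 \<in> Lq_space 1" and t: "t > 0"
  shows "convolves_at (G_kernel \<alpha> 1 t) u0 x \<longleftrightarrow> convolves_at (dil g t) u0 x" "conv (G_kernel \<alpha> 1 t) u0 x = free u0 t x"
  using convolution_cong[OF G_kernel_AE(1)[OF g_kernel[OF t]] dil_borel(1) Lq_measurable[OF u0] Lq_measurable[OF u0] G_kernel_AE(2)[OF g_kernel[OF t]]]
  by (simp_all add: free_conv[OF t u0])

lemma source_G_kernel:
  assumes f: "f \<in> borel_measurable borel" "f' \<in> borel_measurable borel" "AE x in lborel. f x = f' x" and t: "t > 0"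
  shows "convolves_at (G_kernel \<alpha> (1 + \<alpha>) t) f x \<longleftrightarrow> convolves_at (dil h t) f' x" "conv (G_kernel \<alpha> (1 + \<alpha>) t) f x = conv (dil h t) f' x"
  using convolution_cong[OF G_kernel_AE(1)[OF h_kernel[OF t]] dil_borel(2) f(1,2) G_kernel_AE(2)[OF h_kernel[OF t]] f(3)] by auto

text \<open>At \<open>s = t\<close> the kernel has no meaning, but the factor \<open>(t - s) powr \<alpha>\<close> vanishes there.\<close>

lemma duhamel_integrand_eq:
  fixes u u' :: "real \<Rightarrow> real^'n \<Rightarrow> 'k::{real_normed_field,euclidean_space}"
  assumes u: "\<And>s. s \<ge> 0 \<Longrightarrow> u s \<in> borel_measurable borel" "\<And>s. s \<ge> 0 \<Longrightarrow> u' s \<in> borel_measurable borel"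
    and ae: "\<And>s. s \<ge> 0 \<Longrightarrow> AE x in lborel. u s x = u' s x" and s: "s \<in> {0..t}"
  shows "duhamel_integrand \<alpha> p u t x s = (t - s) powr \<alpha> *\<^sub>R conv (dil h (t - s)) (nonlinearity p (u' s)) x"
proof (cases "s = t")
  case True
  then show ?thesis using \<alpha> by (simp add: duhamel_integrand_def)
next
  case False
  have [measurable]: "u s \<in> borel_measurable borel" "u' s \<in> borel_measurable borel" using u s by auto
  have m: "nonlinearity p (u s) \<in> borel_measurable borel" "nonlinearity p (u' s) \<in> borel_measurable borel"
    unfolding nonlinearity_def[abs_def] by measurable
  have "AE x in lborel. nonlinearity p (u s) x = nonlinearity p (u' s) x"
    using ae[of s] s by (auto simp: nonlinearity_def elim!: eventually_mono)
  from source_G_kernel(2)[OF m this] False s show ?thesis by (simp add: duhamel_integrand_def)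
qed

lemma duhamel_integral_eq:
  fixes u u' :: "real \<Rightarrow> real^'n \<Rightarrow> 'k::{real_normed_field,euclidean_space}"
  assumes u: "\<And>s. s \<ge> 0 \<Longrightarrow> u s \<in> borel_measurable borel" "\<And>s. s \<ge> 0 \<Longrightarrow> u' s \<in> borel_measurable borel"
    and ae: "\<And>s. s \<ge> 0 \<Longrightarrow> AE x in lborel. u s x = u' s x"
  shows "set_integrable lborel {0..t} (duhamel_integrand \<alpha> p u t x) \<longleftrightarrow>
      set_integrable lborel {0..t} (\<lambda>s. (t - s) powr \<alpha> *\<^sub>R conv (dil h (t - s)) (nonlinearity p (u' s)) x)"
    and "(LBINT s:{0..t}. duhamel_integrand \<alpha> p u t x s) = duhamel (\<lambda>s. nonlinearity p (u' s)) t x"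
proof -
  have e: "indicator {0..t} s *\<^sub>R duhamel_integrand \<alpha> p u t x s =
      indicator {0..t} s *\<^sub>R ((t - s) powr \<alpha> *\<^sub>R conv (dil h (t - s)) (nonlinearity p (u' s)) x)" for s
    using duhamel_integrand_eq[of u u' s t x, OF assms] by (cases "s \<in> {0..t}") auto
  show "set_integrable lborel {0..t} (duhamel_integrand \<alpha> p u t x) \<longleftrightarrow>
      set_integrable lborel {0..t} (\<lambda>s. (t - s) powr \<alpha> *\<^sub>R conv (dil h (t - s)) (nonlinearity p (u' s)) x)"
    unfolding set_integrable_def e ..
  show "(LBINT s:{0..t}. duhamel_integrand \<alpha> p u t x s) = duhamel (\<lambda>s. nonlinearity p (u' s)) t x"
    unfolding duhamel_def set_lebesgue_integral_def e ..
qed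

lemma L1_Lp_curve_iff:
  "(\<forall>t\<ge>0. ((\<lambda>s. L1_Lp_norm p (\<lambda>x. u s x - u t x)) \<longlongrightarrow> 0) (at t within {0..})) \<longleftrightarrow> curve_continuous u"
proof -
  have "((\<lambda>s. L1_Lp_norm p (\<lambda>x. u s x - u t x)) \<longlongrightarrow> 0) (at t within {0..}) \<longleftrightarrow>
     Lq_continuous_at 1 u t \<and> Lq_continuous_at p u t" for t
  proof
    assume *: "((\<lambda>s. L1_Lp_norm p (\<lambda>x. u s x - u t x)) \<longlongrightarrow> 0) (at t within {0..})"
    show "Lq_continuous_at 1 u t \<and> Lq_continuous_at p u t"
      by (intro conjI Lim_null_comparison[OF always_eventually *]) (auto simp: L1_Lp_norm_def)
  next
    assume "Lq_continuous_at 1 u t \<and> Lq_continuous_at p u t"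
    then show "((\<lambda>s. L1_Lp_norm p (\<lambda>x. u s x - u t x)) \<longlongrightarrow> 0) (at t within {0..})"
      unfolding L1_Lp_norm_def using tendsto_add by fastforce
  qed
  then show ?thesis unfolding curve_continuous_def by auto
qed

text \<open>All convergence requirements in the definition of a solution follow from the weighted bounds.\<close>

lemma fixed_point_global_solution:
  fixes u :: "real \<Rightarrow> real^'n \<Rightarrow> 'k::{real_normed_field,euclidean_space}"
  assumes u0: "u0 \<in> L1_Lp_space p" and B: "0 \<le> B" and u: "weighted B u" "curve_continuous u"
    and fp: "\<And>t. t \<ge> 0 \<Longrightarrow> AE x in lborel. u t x = mild u0 u t x"
  shows "global_solution \<alpha> p u0 u"
  unfolding global_solution_def L1_Lp_curve_iff
proof (intro conjI allI impI u(2))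
  have u1: "u0 \<in> Lq_space 1" using u0 by (simp add: L1_Lp_space_def)
  have m: "u s \<in> borel_measurable borel" for s by (rule jointly_measurable_fst[OF weightedD(1)[OF u(1) disjI1[OF refl]]])
  have nm: "nonlinearity p (u s) \<in> borel_measurable borel" for s
    using m[of s] unfolding nonlinearity_def[abs_def] by measurable
  note Nm = jointly_measurable_nonlinearity[OF weightedD(1)[OF u(1) disjI1[OF refl]], of p]
  show "u t \<in> L1_Lp_space p" if "t \<ge> 0" for t
    using weightedD(2)[OF u(1) _ that] by (simp add: L1_Lp_space_def)
  have "duhamel f 0 x = 0" for f :: "real \<Rightarrow> real^'n \<Rightarrow> 'k" and x
  proof -
    have "(\<lambda>s. indicator {0..0} s *\<^sub>R ((0 - s) powr \<alpha> *\<^sub>R conv (dil h (0 - s)) (f s) x)) = (\<lambda>s::real. 0)"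
      by (auto simp: fun_eq_iff indicator_def)
    then show ?thesis unfolding duhamel_def set_lebesgue_integral_def by simp
  qed
  then show "AE x in lborel. u 0 x = u0 x" using fp[OF order_refl] by (auto simp: mild_def free_0 elim!: eventually_mono)
  fix t :: real assume t: "t > 0"
  note src = source_L1[OF u(1) B, rule_format]
  have bi: "set_integrable lborel {0..t} (\<lambda>s. (t - s) powr rate 1 * (B powr p * (1 + s) powr (p * rate p)))"
    using source_weight_integrable[of 1 t "B powr p"] t by simp
  have "AE x in lborel. set_integrable lborel {0..t} (\<lambda>s. (t - s) powr \<alpha> *\<^sub>R conv (dil h (t - s)) (nonlinearity p (u s)) x)"
    by (rule duhamel_estimate(1)[OF disjI1[OF refl] Nm _ _ bi]) (use src in auto)
  moreover have "AE x in lborel. AE s in lborel. 0 < s \<and> s < t \<longrightarrow> convolves_at (dil h (t - s)) (nonlinearity p (u s)) x"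
    by (rule duhamel_convolves[OF Nm]) (use src in auto)
  moreover have "AE x in lborel. convolves_at (dil g t) u0 x" by (rule free_convolves[OF u1 t])
  ultimately show "AE x in lborel.
        convolves_at (G_kernel \<alpha> 1 t) u0 x \<and>
        (AE s in lborel. 0 < s \<and> s < t \<longrightarrow> convolves_at (G_kernel \<alpha> (1 + \<alpha>) (t - s)) (nonlinearity p (u s)) x) \<and>
        set_integrable lborel {0..t} (duhamel_integrand \<alpha> p u t x) \<and>
        u t x = conv (G_kernel \<alpha> 1 t) u0 x + (LBINT s:{0..t}. duhamel_integrand \<alpha> p u t x s)"
    using fp[OF less_imp_le[OF t]]
  proof eventually_elim
    case (elim x)
    have "AE s in lborel. 0 < s \<and> s < t \<longrightarrow> convolves_at (G_kernel \<alpha> (1 + \<alpha>) (t - s)) (nonlinearity p (u s)) x"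
      using elim(2) by eventually_elim (use source_G_kernel(1)[OF nm nm AE_I2[OF refl]] in auto)
    moreover have "set_integrable lborel {0..t} (duhamel_integrand \<alpha> p u t x)"
      "(LBINT s:{0..t}. duhamel_integrand \<alpha> p u t x s) = duhamel (\<lambda>s. nonlinearity p (u s)) t x"
      using duhamel_integral_eq[of u u t x, OF m m] elim(1) by auto
    ultimately show ?case using elim(3,4) free_G_kernel[OF u1 t, of x] by (simp add: mild_def)
  qed
qed

text \<open>Both solutions are replaced by versions that are measurable in \<open>(t, x)\<close>; these satisfy the
  same equation, since it does not see null sets at fixed times.\<close>

lemma global_solution_unique:
  fixes u v :: "real \<Rightarrow> real^'n \<Rightarrow> 'k::{real_normed_field,euclidean_space}"
  assumes u0: "u0 \<in> L1_Lp_space p" and u: "global_solution \<alpha> p u0 u" and v: "global_solution \<alpha> p u0 v" and t: "t \<ge> 0"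
  shows "AE x in lborel. v t x = u t x"
proof -
  have u1: "u0 \<in> Lq_space 1" using u0 by (simp add: L1_Lp_space_def)
  have version: "\<exists>w'. jointly_measurable w' \<and> (\<forall>s\<ge>0. AE x in lborel. w' s x = w s x) \<and> (\<forall>s\<ge>0. w' s \<in> Lq_space p) \<and>
      (\<forall>t\<ge>0. Lq_continuous_at p w' t) \<and> (\<forall>t>0. AE x in lborel. w' t x = mild u0 w' t x)"
    if w: "global_solution \<alpha> p u0 w" for w :: "real \<Rightarrow> real^'n \<Rightarrow> 'k"
  proof -
    have wL: "w s \<in> Lq_space 1" "w s \<in> Lq_space p" if "s \<ge> 0" for s
      using w that by (auto simp: global_solution_def L1_Lp_space_def)
    have cc: "curve_continuous w" using w unfolding global_solution_def L1_Lp_curve_iff by blast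
    have wc: "Lq_continuous_at q w t" if "q = 1 \<or> q = p" "t \<ge> 0" for q t
      using cc that by (auto simp: curve_continuous_def)
    have eq: "AE x in lborel. w t x = conv (G_kernel \<alpha> 1 t) u0 x + (LBINT s:{0..t}. duhamel_integrand \<alpha> p w t x s)" if "t > 0" for t
      using w that unfolding global_solution_def by (auto elim: eventually_mono)
    obtain w' where w': "jointly_measurable w'" and ae: "\<And>s. s \<ge> 0 \<Longrightarrow> AE x in lborel. w' s x = w s x"
      using L1_curve_measurable_version[OF wL(1) wc[OF disjI1[OF refl]]] unfolding jointly_measurable_def by blast
    have m: "w s \<in> borel_measurable borel" if "s \<ge> 0" for s by (rule Lq_measurable[OF wL(1)[OF that]])
    have m': "w' s \<in> borel_measurable borel" for s by (rule jointly_measurable_fst[OF w'])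
    have ae': "AE x in lborel. w s x = w' s x" if "s \<ge> 0" for s using ae[OF that] by (auto elim: eventually_mono)
    have L': "w' s \<in> Lq_space p" if "s \<ge> 0" for s
    proof -
      have "AE x in lborel. norm (w s x) = norm (w' s x)" using ae'[OF that] by eventually_elim simp
      from Lq_cong_AE[OF m[OF that] m' this] show ?thesis using wL(2)[OF that] by blast
    qed
    have n: "Lq_norm p (\<lambda>x. w' s x - w' t x) = Lq_norm p (\<lambda>x. w s x - w t x)" if "s \<ge> 0" "t \<ge> 0" for s t
    proof (rule Lq_norm_cong_AE)
      show "AE x in lborel. norm (w' s x - w' t x) = norm (w s x - w t x)" using ae[OF that(1)] ae[OF that(2)] by eventually_elim simp
    qed (use m m' that in measurable)
    have c': "Lq_continuous_at p w' t" if t: "t \<ge> 0" for t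
    proof (rule Lim_transform_eventually[OF wc[OF disjI2[OF refl] t]])
      show "\<forall>\<^sub>F s in at t within {0..}. Lq_norm p (\<lambda>x. w s x - w t x) = Lq_norm p (\<lambda>x. w' s x - w' t x)"
        using n t by (simp add: eventually_at_filter)
    qed
    have "AE x in lborel. w' t x = mild u0 w' t x" if t: "t > 0" for t
      using ae[OF less_imp_le[OF t]] eq[OF t]
    proof eventually_elim
      case (elim x)
      then show ?case using duhamel_integral_eq(2)[of w w' t x, OF m m' ae'] free_G_kernel(2)[OF u1 t, of x] by (simp add: mild_def)
    qed
    then show ?thesis using w' ae L' c' by blast
  qed
  obtain u' where u': "jointly_measurable u'" "\<And>s. s \<ge> 0 \<Longrightarrow> AE x in lborel. u' s x = u s x" "\<And>s. s \<ge> 0 \<Longrightarrow> u' s \<in> Lq_space p"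
      "\<And>t. t \<ge> 0 \<Longrightarrow> Lq_continuous_at p u' t" "\<And>t. t > 0 \<Longrightarrow> AE x in lborel. u' t x = mild u0 u' t x"
    using version[OF u] by blast
  obtain v' where v': "jointly_measurable v'" "\<And>s. s \<ge> 0 \<Longrightarrow> AE x in lborel. v' s x = v s x" "\<And>s. s \<ge> 0 \<Longrightarrow> v' s \<in> Lq_space p"
      "\<And>t. t \<ge> 0 \<Longrightarrow> Lq_continuous_at p v' t" "\<And>t. t > 0 \<Longrightarrow> AE x in lborel. v' t x = mild u0 v' t x"
    using version[OF v] by blast
  show ?thesis
  proof (cases "t = 0")
    case True
    have "AE x in lborel. u 0 x = u0 x" "AE x in lborel. v 0 x = u0 x" using u v unfolding global_solution_def by blast+
    then show ?thesis unfolding True by eventually_elim simp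
  next
    case False
    then have "AE x in lborel. u' t x = v' t x"
      using mild_unique[OF u'(1) v'(1) u'(3) v'(3) u'(4) v'(4) u'(5) v'(5)] t by simp
    then show ?thesis using u'(2)[OF t] v'(2)[OF t] by eventually_elim simp
  qed
qed

end

text \<open>The lower bound on \<open>p\<close> is equivalent to \<open>(p-1) * (n/2 (1+\<alpha>) - \<alpha>) > 1 + \<alpha>\<close>, which is
  supercriticality. For \<open>n \<le> 2\<close> subcriticality holds for every \<open>p\<close>, as \<open>1 - 1/p < 1\<close>.\<close>

lemma exponent_range:
  fixes \<alpha> p :: real
  assumes a: "0 < \<alpha>" "\<alpha> < 1" and n: "1 \<le> (n::nat)"
    and lower: "p > 1 + 2 / (real n - 2 + 2 / (1 + \<alpha>))"
    and upper: "n \<ge> 3 \<Longrightarrow> p < 1 + 2 / (real n - 2)"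
  shows "1 < p" "1 < real n / 2 * (1 + \<alpha>) * (p - 1) - \<alpha> * p" "real n / 2 * (1 - 1 / p) < 1"
proof -
  define d where "d = real n - 2 + 2 / (1 + \<alpha>)"
  have "1 < 2 / (1 + \<alpha>)" using a by (simp add: less_divide_eq)
  then have d: "d > 0" using n by (simp add: d_def)
  show p: "1 < p" using lower d by (simp add: d_def[symmetric]) (smt (verit) divide_pos_pos)
  have "2 < (p - 1) * d" using lower d by (simp add: d_def[symmetric] divide_less_eq less_diff_eq) (simp add: field_simps)
  then have "2 * ((1 + \<alpha>) / 2) < (p - 1) * d * ((1 + \<alpha>) / 2)" using a by (intro mult_strict_right_mono) auto
  moreover have "d * ((1 + \<alpha>) / 2) = real n / 2 * (1 + \<alpha>) - \<alpha>" using a by (simp add: d_def field_simps)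
  ultimately have "1 + \<alpha> < (p - 1) * (real n / 2 * (1 + \<alpha>) - \<alpha>)" by (simp only: mult.assoc) simp
  then show "1 < real n / 2 * (1 + \<alpha>) * (p - 1) - \<alpha> * p" by (simp add: algebra_simps)
  show "real n / 2 * (1 - 1 / p) < 1"
  proof (cases "n \<ge> 3")
    case True
    then have "(p - 1) * (real n - 2) < 2" using upper by (simp add: less_divide_eq)  (simp add: field_simps)
    then show ?thesis using p by (simp add: field_simps)
  next
    case False
    then have "real n \<le> 2" by simp
    then have "real n / 2 * (1 - 1 / p) \<le> 1 * (1 - 1 / p)" using p by (intro mult_right_mono) auto
    also have "\<dots> < 1" using p by simp
    finally show ?thesis .
  qed
qed

theorem theorem3:
  fixes \<alpha> p :: real
  assumes "0 < \<alpha>" and "\<alpha> < 1"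
    and "p > 1 + 2 / (real CARD('n::finite) - 2 + 2 / (1 + \<alpha>))"
    and "CARD('n) \<ge> 3 \<Longrightarrow> p < 1 + 2 / (real CARD('n) - 2)"
  shows "\<exists>\<epsilon>>0. \<exists>C>0.
    \<forall>u0 :: real^'n \<Rightarrow> 'k::{real_normed_field,euclidean_space}.
      u0 \<in> L1_Lp_space p \<longrightarrow> L1_Lp_norm p u0 \<le> \<epsilon> \<longrightarrow>
      (\<exists>u. global_solution \<alpha> p u0 u \<and>
           (\<forall>v. global_solution \<alpha> p u0 v \<longrightarrow> (\<forall>t\<ge>0. AE x in lborel. v t x = u t x)) \<and>
           (\<forall>q\<in>{1..p}. \<forall>t\<ge>0.
              Lq_norm q (u t) \<le>
                C * (1 + t) powr (\<alpha> - real CARD('n) / 2 * (1 + \<alpha>) * (1 - 1 / q)) * L1_Lp_norm p u0))"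
proof -
  have n: "1 \<le> CARD('n)" by (simp add: Suc_leI)
  note E = exponent_range[OF assms(1,2) n assms(3,4)]
  have a: "1 < 1 + \<alpha>" "1 + \<alpha> < 2" "(0::real) < 1" "1 \<le> 1 + \<alpha>" "0 < 1 + \<alpha>" using assms by auto
  obtain g :: "real^'n \<Rightarrow> real" where g: "\<And>q. q \<ge> 1 \<Longrightarrow> real CARD('n) / 2 * (1 - 1 / q) < 1 \<Longrightarrow> g \<in> Lq_space q"
      "(LBINT x. g x) = 1 / Gamma 1" and gk: "\<And>t. t > 0 \<Longrightarrow> has_tempered_inverse_fourier
       (\<lambda>\<xi>. complex_of_real (mittag_leffler (1 + \<alpha>) 1 (- (t powr (1 + \<alpha>)) * (norm \<xi>)\<^sup>2)))
       (\<lambda>x. complex_of_real (t powr (- ((1 + \<alpha>) / 2 * real CARD('n))) * g (t powr (- ((1 + \<alpha>) / 2)) *\<^sub>R x)))"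
    using mittag_leffler_kernel[OF a(1,2,3,4)] by blast
  obtain h :: "real^'n \<Rightarrow> real" where h: "\<And>q. q \<ge> 1 \<Longrightarrow> real CARD('n) / 2 * (1 - 1 / q) < 1 \<Longrightarrow> h \<in> Lq_space q"
      and hk: "\<And>t. t > 0 \<Longrightarrow> has_tempered_inverse_fourier
       (\<lambda>\<xi>. complex_of_real (mittag_leffler (1 + \<alpha>) (1 + \<alpha>) (- (t powr (1 + \<alpha>)) * (norm \<xi>)\<^sup>2)))
       (\<lambda>x. complex_of_real (t powr (- ((1 + \<alpha>) / 2 * real CARD('n))) * h (t powr (- ((1 + \<alpha>) / 2)) *\<^sub>R x)))"
    using mittag_leffler_kernel[OF a(1,2,5) order_refl] by blast
  interpret evolution_kernels \<alpha> p g h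
    using assms(1) E g h by unfold_locales auto
  interpret mittag_leffler_evolution \<alpha> p g h
    by unfold_locales (use gk hk in \<open>simp_all add: dil_def[abs_def]\<close>)
  obtain \<epsilon> where \<epsilon>: "\<epsilon> > 0" and sol: "\<forall>u0 :: real^'n \<Rightarrow> 'k. u0 \<in> L1_Lp_space p \<longrightarrow> L1_Lp_norm p u0 \<le> \<epsilon> \<longrightarrow>
     (\<exists>u. weighted (2 * free_const * L1_Lp_norm p u0) u \<and> curve_continuous u \<and> (\<forall>t\<ge>0. AE x in lborel. u t x = mild u0 u t x))"
    using small_data_fixed_point[where 'k = 'k] by (elim exE conjE) (rule that)
  show ?thesis
  proof (rule exI[of _ \<epsilon>], intro conjI \<epsilon>, rule exI[of _ "2 * free_const"], intro conjI allI impI)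
    show "0 < 2 * free_const" using free_const_pos by simp
    fix u0 :: "real^'n \<Rightarrow> 'k" assume u0: "u0 \<in> L1_Lp_space p" and small: "L1_Lp_norm p u0 \<le> \<epsilon>"
    let ?B = "2 * free_const * L1_Lp_norm p u0"
    have B: "0 \<le> ?B" using free_const_pos L1_Lp_norm_ge(3)[of u0] by simp
    obtain u where u: "weighted ?B u" "curve_continuous u" "\<And>t. t \<ge> 0 \<Longrightarrow> AE x in lborel. u t x = mild u0 u t x"
      using sol u0 small by blast
    have gs: "global_solution \<alpha> p u0 u" by (rule fixed_point_global_solution[OF u0 B u])
    show "\<exists>u. global_solution \<alpha> p u0 u \<and>
           (\<forall>v. global_solution \<alpha> p u0 v \<longrightarrow> (\<forall>t\<ge>0. AE x in lborel. v t x = u t x)) \<and>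
           (\<forall>q\<in>{1..p}. \<forall>t\<ge>0.
              Lq_norm q (u t) \<le>
                2 * free_const * (1 + t) powr (\<alpha> - real CARD('n) / 2 * (1 + \<alpha>) * (1 - 1 / q)) * L1_Lp_norm p u0)"
    proof (intro exI[of _ u] conjI ballI allI impI gs)
      show "AE x in lborel. v t x = u t x" if "global_solution \<alpha> p u0 v" "0 \<le> t" for v t
        by (rule global_solution_unique[OF u0 gs that])
      fix q t :: real assume "q \<in> {1..p}" "0 \<le> t"
      then have "Lq_norm q (u t) \<le> ?B * (1 + t) powr rate q" by (intro weighted_bound[OF u(1) B]) auto
      then show "Lq_norm q (u t) \<le> 2 * free_const * (1 + t) powr (\<alpha> - real CARD('n) / 2 * (1 + \<alpha>) * (1 - 1 / q)) * L1_Lp_norm p u0"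
        unfolding rate_def decay_def by (simp only: mult_ac)
    qed
  qed
qed

end
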